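(* Let $Q=(0,1)\times(0,T]$ with $T=1$. Let the data $b,f,g_L,g_R,\phi,\beta$ satisfy the standing assumptions listed in the context. Let $y$ be the solution of problem (Y) of the context, let $Y$ be the solution of the finite difference scheme (D) of the context on the tensor-product Shishkin mesh $\bar Q^{N,M}$, and let $\bar Y$ be the bilinear interpolant of $Y$ from the values at the grid points of $\bar Q^{N,M}$ to the domain $\bar Q$. Then there is a constant $C$, depending on the data but independent of $\varepsilon$, $N$ and $M$, such that $$\|y-\bar Y\|_{\bar Q}:=\sup_{(x,t)\in\bar Q}|y(x,t)-\bar Y(x,t)|\le C\left(N^{-2}\max\{\ln^2 N,\ \ln M\}+M^{-1}\ln^2 M\right).$$
   Context: Function spaces. $C^{n+\gamma}(\bar Q)$ ($\gamma>0$) is the set of functions $z$ such that $\partial^{i+j}z/\partial x^i\partial t^j$ is Hölder continuous of degree $\gamma$ on $\bar Q$ for all $0\le i+2j\le n$. Standing assumptions. $0<\varepsilon\le 1$ is the singular perturbation parameter. $f,b\in C^{4+\gamma}(\bar Q)$, $g_L,g_R\in C^2[0,T]$, $\phi\in C^4[0,1]$. $b(x,t)>\beta>0$ on $\bar Q$ for a constant $\beta$, and $b_x(0,0)=0$. $\phi(0^+)\ne g_L(0)$ and $\phi(1^-)=g_R(0)$. At $(1,0)$ the following compatibility conditions hold for the values of $\varepsilon$ considered: $$\varepsilon(g_R'(0)-\phi''(1))+b(1,0)g_R(0)=f(1,0),$$ $$\varepsilon(g_R''(0)-\phi''''(1))+b(1,0)(g_R'(0)+\phi''(1))+b_t(1,0)g_R(0)+2b_x(1,0)\phi'(1)+b_{xx}(1,0)\phi(1)=(f_t+f_{xx})(1,0).$$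 Continuous problem. $Lz:=\varepsilon(z_t-z_{xx})+b(x,t)z$. The underlying problem is $Lu=f$ in $Q$, $u(0,t)=g_L(t)$, $u(1,t)=g_R(t)$ for $t\ge0$, $u(x,0)=\phi(x)$ for $0<x<1$. Put $A_0:=g_L(0)-\phi(0^+)$ and $$z_0(x,t):=e^{-b(0,0)t/\varepsilon}\,\mathrm{erfc}\!\left(\frac{x}{2\sqrt t}\right),\qquad \mathrm{erfc}(z)=\frac{2}{\sqrt\pi}\int_z^\infty e^{-s^2}ds,$$ with $z_0(x,0)=0$ for $x>0$. The function $y=u-A_0z_0$ is continuous on $\bar Q$ and solves problem (Y): $$Ly=f-A_0\,(b(x,t)-b(0,0))\,z_0(x,t)\ \text{ in }Q,$$ $$y(0,t)=g_L(t)-A_0e^{-b(0,0)t/\varepsilon},\quad y(1,t)=g_R(t)-A_0z_0(1,t)\ (t\ge0),\quad y(x,0)=\phi(x)\ (0<x<1).$$ Mesh. $\bar Q^{N,M}=\omega_x^N\times\omega_t^M$, with $N$ divisible by 4 and $M$ even. The space mesh $\omega_x^N=\{x_i\}_{i=0}^N$ is piecewise uniform on $[0,\sigma]\cup[\sigma,1-\sigma]\cup[1-\sigma,1]$ with $N/4,N/2,N/4$ mesh intervals respectively, where $\sigma=\min\{0.25,\,2\sqrt{\varepsilon/\beta}\,\ln N\}$. The time mesh $\omega_t^M=\{t_j\}_{j=0}^M$ is piecewise uniform on $[0,\tau]\cup[\tau,1]$ with $M/2$ mesh intervals in each part, where $\tau=\min\{0.5,\,(\varepsilon/\beta)\ln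 M\}$. $Q^{N,M}:=\bar Q^{N,M}\cap Q$ and $\partial Q^{N,M}:=\bar Q^{N,M}\setminus Q^{N,M}$. Scheme (D). With $h_i=x_i-x_{i-1}$, $\hbar_i=(h_{i+1}+h_i)/2$, $k_j=t_j-t_{j-1}$, $D_x^-Y(x_i,t_j)=(Y(x_i,t_j)-Y(x_{i-1},t_j))/h_i$, $D_x^+Y(x_i,t_j)=D_x^-Y(x_{i+1},t_j)$, $D_t^-Y(x_i,t_j)=(Y(x_i,t_j)-Y(x_i,t_{j-1}))/k_j$, $\delta_x^2Y(x_i,t_j)=(D_x^+-D_x^-)Y(x_i,t_j)/\hbar_i$: $$(\varepsilon D_t^--\varepsilon\delta_x^2+b(x_i,t_j))Y(x_i,t_j)=\big(f-A_0(b-b(0,0))z_0\big)(x_i,t_j),\quad (x_i,t_j)\in Q^{N,M},$$ $$Y(x_i,t_j)=y(x_i,t_j),\quad (x_i,t_j)\in\partial Q^{N,M}.$$ *)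

theory Defs
  imports "HOL-Analysis.Analysis"
begin

definition Q :: "(real \<times> real) set" where
  "Q = {0<..<1} \<times> {0<..1}"

definition Qbar :: "(real \<times> real) set" where
  "Qbar = {0..1} \<times> {0..1}"

text \<open>Derivatives are taken within the closed unit interval, hence they are one-sided
  at its endpoints and depend only on the values of the function on the interval.\<close>

definition D :: "(real \<Rightarrow> real) \<Rightarrow> real \<Rightarrow> real" where
  "D g s = vector_derivative g (at s within {0..1})"

definition Dx :: "(real \<Rightarrow> real \<Rightarrow> real) \<Rightarrow> real \<Rightarrow> real \<Rightarrow> real" where
  "Dx z x t = D (\<lambda>s. z s t) x"

definition Dt :: "(real \<Rightarrow> real \<Rightarrow> real) \<Rightarrow> real \<Rightarrow> real \<Rightarrow> real" where
  "Dt z x t = D (\<lambda>s. z x s) t"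

definition x_differentiable :: "(real \<Rightarrow> real \<Rightarrow> real) \<Rightarrow> real \<Rightarrow> real \<Rightarrow> bool" where
  "x_differentiable z x t \<longleftrightarrow> (\<lambda>s. z s t) differentiable (at x within {0..1})"

definition t_differentiable :: "(real \<Rightarrow> real \<Rightarrow> real) \<Rightarrow> real \<Rightarrow> real \<Rightarrow> bool" where
  "t_differentiable z x t \<longleftrightarrow> (\<lambda>s. z x s) differentiable (at t within {0..1})"

definition C_class :: "nat \<Rightarrow> (real \<Rightarrow> real) \<Rightarrow> bool" where
  "C_class n g \<longleftrightarrow>
     (\<forall>i<n. \<forall>s\<in>{0..1}. (D ^^ i) g differentiable (at s within {0..1})) \<and>
     continuous_on {0..1} ((D ^^ n) g)"

text \<open>Hoelder continuity is understood, as is usual for parabolic problems (and in accordance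
  with the weighting i + 2j of the orders of differentiation below), with respect to the
  parabolic metric. On the bounded set \<open>Qbar\<close> every function that is Hoelder continuous
  with respect to the Euclidean metric is also Hoelder continuous in this sense.\<close>

definition holder_continuous :: "real \<Rightarrow> (real \<Rightarrow> real \<Rightarrow> real) \<Rightarrow> bool" where
  "holder_continuous \<gamma> z \<longleftrightarrow>
     (\<exists>K. \<forall>(x, t)\<in>Qbar. \<forall>(x', t')\<in>Qbar.
        \<bar>z x t - z x' t'\<bar> \<le> K * sqrt ((x - x')\<^sup>2 + \<bar>t - t'\<bar>) powr \<gamma>)"

definition pderiv_xt :: "nat \<Rightarrow> nat \<Rightarrow> (real \<Rightarrow> real \<Rightarrow> real) \<Rightarrow> real \<Rightarrow> real \<Rightarrow> real" where
  "pderiv_xt i j z = (Dx ^^ i) ((Dt ^^ j) z)"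

text \<open>The first two conjuncts say that the derivatives in the third one exist: those of order
  (0, j + 1) as t-derivatives and those of order (i + 1, j) as x-derivatives of
  derivatives of lower order.\<close>

definition holder_class :: "nat \<Rightarrow> real \<Rightarrow> (real \<Rightarrow> real \<Rightarrow> real) \<Rightarrow> bool" where
  "holder_class n \<gamma> z \<longleftrightarrow>
     (\<forall>j. 2 * (j + 1) \<le> n \<longrightarrow> (\<forall>(x, t)\<in>Qbar. t_differentiable (pderiv_xt 0 j z) x t)) \<and>
     (\<forall>i j. (i + 1) + 2 * j \<le> n \<longrightarrow> (\<forall>(x, t)\<in>Qbar. x_differentiable (pderiv_xt i j z) x t)) \<and>
     (\<forall>i j. i + 2 * j \<le> n \<longrightarrow> holder_continuous \<gamma> (pderiv_xt i j z))"

definition erfc :: "real \<Rightarrow> real" where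
  "erfc z = 2 / sqrt pi * (LBINT s:{z..}. exp (- s\<^sup>2))"

text \<open>The argument \<open>b0\<close> stands for b(0,0). The value at the corner (0,0) is never used.\<close>

definition z0 :: "real \<Rightarrow> real \<Rightarrow> real \<Rightarrow> real \<Rightarrow> real" where
  "z0 \<epsilon> b0 x t = (if t = 0 then 0 else exp (- b0 * t / \<epsilon>) * erfc (x / (2 * sqrt t)))"

definition compatible ::
  "real \<Rightarrow> (real \<Rightarrow> real \<Rightarrow> real) \<Rightarrow> (real \<Rightarrow> real \<Rightarrow> real) \<Rightarrow> (real \<Rightarrow> real) \<Rightarrow> (real \<Rightarrow> real) \<Rightarrow> bool"
where
  "compatible \<epsilon> f b gR \<phi> \<longleftrightarrow>
     \<epsilon> * (D gR 0 - (D ^^ 2) \<phi> 1) + b 1 0 * gR 0 = f 1 0 \<and>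
     \<epsilon> * ((D ^^ 2) gR 0 - (D ^^ 4) \<phi> 1) + b 1 0 * (D gR 0 + (D ^^ 2) \<phi> 1)
       + Dt b 1 0 * gR 0 + 2 * Dx b 1 0 * D \<phi> 1 + Dx (Dx b) 1 0 * \<phi> 1
     = Dt f 1 0 + Dx (Dx f) 1 0"

text \<open>For \<open>\<phi>\<close> continuous on the closed interval, its one-sided limit at 0 is
  \<open>\<phi> 0\<close>.\<close>

definition A0 :: "(real \<Rightarrow> real) \<Rightarrow> (real \<Rightarrow> real) \<Rightarrow> real" where
  "A0 gL \<phi> = gL 0 - \<phi> 0"

definition L :: "real \<Rightarrow> (real \<Rightarrow> real \<Rightarrow> real) \<Rightarrow> (real \<Rightarrow> real \<Rightarrow> real) \<Rightarrow> real \<Rightarrow> real \<Rightarrow> real" where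
  "L \<epsilon> b z x t = \<epsilon> * (Dt z x t - Dx (Dx z) x t) + b x t * z x t"

definition rhs ::
  "real \<Rightarrow> (real \<Rightarrow> real \<Rightarrow> real) \<Rightarrow> (real \<Rightarrow> real \<Rightarrow> real) \<Rightarrow> (real \<Rightarrow> real) \<Rightarrow> (real \<Rightarrow> real)
    \<Rightarrow> real \<Rightarrow> real \<Rightarrow> real"
where
  "rhs \<epsilon> f b gL \<phi> x t = f x t - A0 gL \<phi> * (b x t - b 0 0) * z0 \<epsilon> (b 0 0) x t"

definition solves_Y ::
  "real \<Rightarrow> (real \<Rightarrow> real \<Rightarrow> real) \<Rightarrow> (real \<Rightarrow> real \<Rightarrow> real) \<Rightarrow> (real \<Rightarrow> real) \<Rightarrow> (real \<Rightarrow> real)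
    \<Rightarrow> (real \<Rightarrow> real) \<Rightarrow> (real \<Rightarrow> real \<Rightarrow> real) \<Rightarrow> bool"
where
  "solves_Y \<epsilon> f b gL gR \<phi> y \<longleftrightarrow>
     continuous_on Qbar (\<lambda>(x, t). y x t) \<and>
     (\<forall>(x, t)\<in>Q. t_differentiable y x t \<and> x_differentiable y x t \<and> x_differentiable (Dx y) x t \<and>
        L \<epsilon> b y x t = rhs \<epsilon> f b gL \<phi> x t) \<and>
     (\<forall>t\<in>{0..1}. y 0 t = gL t - A0 gL \<phi> * exp (- b 0 0 * t / \<epsilon>)) \<and>
     (\<forall>t\<in>{0..1}. y 1 t = gR t - A0 gL \<phi> * z0 \<epsilon> (b 0 0) 1 t) \<and>
     (\<forall>x\<in>{0<..<1}. y x 0 = \<phi> x)"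

definition sigma :: "real \<Rightarrow> real \<Rightarrow> nat \<Rightarrow> real" where
  "sigma \<epsilon> \<beta> N = min (1 / 4) (2 * sqrt (\<epsilon> / \<beta>) * ln (real N))"

definition tau :: "real \<Rightarrow> real \<Rightarrow> nat \<Rightarrow> real" where
  "tau \<epsilon> \<beta> M = min (1 / 2) (\<epsilon> / \<beta> * ln (real M))"

definition xmesh :: "real \<Rightarrow> real \<Rightarrow> nat \<Rightarrow> nat \<Rightarrow> real" where
  "xmesh \<epsilon> \<beta> N i =
     (let s = sigma \<epsilon> \<beta> N; n = real N; k = real i in
      if k \<le> n / 4 then s * k / (n / 4)
      else if k \<le> 3 * n / 4 then s + (1 - 2 * s) * (k - n / 4) / (n / 2)
      else 1 - s + s * (k - 3 * n / 4) / (n / 4))"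

definition tmesh :: "real \<Rightarrow> real \<Rightarrow> nat \<Rightarrow> nat \<Rightarrow> real" where
  "tmesh \<epsilon> \<beta> M j =
     (let s = tau \<epsilon> \<beta> M; m = real M; k = real j in
      if k \<le> m / 2 then s * k / (m / 2)
      else s + (1 - s) * (k - m / 2) / (m / 2))"

text \<open>Grid functions are indexed by mesh indices: \<open>V i j\<close> is the value at the
  mesh point with abscissa \<open>p i\<close> and time level \<open>q j\<close>. The forward difference
  in space at index i is the backward difference at index i + 1.\<close>

definition backward_diff :: "(nat \<Rightarrow> real) \<Rightarrow> (nat \<Rightarrow> real) \<Rightarrow> nat \<Rightarrow> real" where
  "backward_diff p v i = (v i - v (i - 1)) / (p i - p (i - 1))"

definition second_diff :: "(nat \<Rightarrow> real) \<Rightarrow> (nat \<Rightarrow> real) \<Rightarrow> nat \<Rightarrow> real" where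
  "second_diff p v i =
     (backward_diff p v (i + 1) - backward_diff p v i)
       / (((p (i + 1) - p i) + (p i - p (i - 1))) / 2)"

definition discrete_L ::
  "real \<Rightarrow> (real \<Rightarrow> real \<Rightarrow> real) \<Rightarrow> (nat \<Rightarrow> real) \<Rightarrow> (nat \<Rightarrow> real) \<Rightarrow> (nat \<Rightarrow> nat \<Rightarrow> real)
    \<Rightarrow> nat \<Rightarrow> nat \<Rightarrow> real"
where
  "discrete_L \<epsilon> b p q V i j =
     \<epsilon> * backward_diff q (\<lambda>l. V i l) j - \<epsilon> * second_diff p (\<lambda>k. V k j) i + b (p i) (q j) * V i j"

definition solves_D ::
  "real \<Rightarrow> (real \<Rightarrow> real \<Rightarrow> real) \<Rightarrow> (real \<Rightarrow> real \<Rightarrow> real) \<Rightarrow> (real \<Rightarrow> real) \<Rightarrow> (real \<Rightarrow> real)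
    \<Rightarrow> real \<Rightarrow> nat \<Rightarrow> nat \<Rightarrow> (real \<Rightarrow> real \<Rightarrow> real) \<Rightarrow> (nat \<Rightarrow> nat \<Rightarrow> real) \<Rightarrow> bool"
where
  "solves_D \<epsilon> f b gL \<phi> \<beta> N M y Y \<longleftrightarrow>
     (let p = xmesh \<epsilon> \<beta> N; q = tmesh \<epsilon> \<beta> M in
      \<forall>i\<le>N. \<forall>j\<le>M.
        if (p i, q j) \<in> Q
        then discrete_L \<epsilon> b p q Y i j = rhs \<epsilon> f b gL \<phi> (p i) (q j)
        else Y i j = y (p i) (q j))"

text \<open>The piecewise linear hat function of the node \<open>p i\<close> on the mesh
  \<open>p 0 < \<dots> < p n\<close>. The tensor-product sum below is bilinear on every mesh rectangle
  and takes the value \<open>V i j\<close> at the mesh points.\<close>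

definition hat :: "(nat \<Rightarrow> real) \<Rightarrow> nat \<Rightarrow> nat \<Rightarrow> real \<Rightarrow> real" where
  "hat p n i s =
     (if 0 < i \<and> p (i - 1) \<le> s \<and> s \<le> p i then (s - p (i - 1)) / (p i - p (i - 1))
      else if i < n \<and> p i \<le> s \<and> s \<le> p (i + 1) then (p (i + 1) - s) / (p (i + 1) - p i)
      else 0)"

definition bilinear_interpolant ::
  "(nat \<Rightarrow> real) \<Rightarrow> nat \<Rightarrow> (nat \<Rightarrow> real) \<Rightarrow> nat \<Rightarrow> (nat \<Rightarrow> nat \<Rightarrow> real) \<Rightarrow> real \<Rightarrow> real \<Rightarrow> real"
where
  "bilinear_interpolant p N q M V x t =
     (\<Sum>i\<le>N. \<Sum>j\<le>M. V i j * hat p N i x * hat q M j t)"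

end

theory Submission
  imports Defs "HOL-Probability.Distributions"
begin

text \<open>Throughout \<open>e\<close> and \<open>be\<close> stand for \<open>\<epsilon>\<close> and \<open>\<beta>\<close>. The solution is split as \<open>y = W + p + q\<close>, where \<open>p = (\<phi> - f / b)(x, 0) exp (- b(x, 0) t / e)\<close> is
 the initial layer and \<open>q = J exp (- b(0, 0) t / e) Z\<close>, with \<open>Z\<close> the first iterated integral in time of
 \<open>erfc (x / (2 sqrt t))\<close>, carries the corner singularity that remains in \<open>y\<close>. The maximum principle
 applied to first and second differences in time of \<open>W\<close> (not to derivatives, whose existence would have to be
 proved) bounds them in terms of the boundary layer function and of \<open>exp (- be t / e)\<close>; the differential equation
 turns differences in time into derivatives in space. With
 \<open>A = ln\<^sup>2 N / N\<^sup>2 + ln M / M\<close> the truncation error of the scheme is of order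
 \<open>A (1 + e / (t + x\<^sup>2))\<close>, plus \<open>A e N / sigma\<close> at the two transition points, and the discrete maximum
 principle with the barriers \<open>1\<close>, \<open>t / (t + x\<^sup>2 / 12)\<close> and the trapezoid \<open>theta\<close> makes the error at the
 nodes of order \<open>A\<close>. The same estimates bound the interpolation error.\<close>

text \<open>As \<open>b\<close> exceeds \<open>\<beta>\<close> strictly on a compact set, it exceeds
  it by some \<open>\<delta> > 0\<close>. The layer barriers are annihilated by the operator with
  reaction coefficient \<open>\<beta>\<close>, so this excess is what lets them dominate a source;
  it also lets the exponentials in the solution absorb every power of \<open>t / \<epsilon>\<close>.
  After the splitting, \<open>W\<close> starts from \<open>f / b\<close> with time derivative
  \<open>\<phi>''\<close>. Second differences in time are of order \<open>k^2\<close> down to the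
  corners only if the boundary values start with the same slope: at \<open>(1, 0)\<close> this is
  the first compatibility condition, at \<open>(0, 0)\<close> it determines \<open>J\<close>, which
  therefore grows like \<open>1 / \<epsilon>\<close>. Since \<open>b_x(0, 0) = 0\<close>, the factor
  \<open>b - b(0, 0)\<close> is of order \<open>t + x^2\<close>, and the corner functions leave in
  the equation for \<open>W\<close> a source whose second time derivative is singular only like
  \<open>1 / (t + x^2)\<close>, which a bounded barrier can still absorb. Finally, the fourth space
  derivative behind the truncation error is replaced by second differences of
  \<open>\<epsilon> W_xx\<close>, a limit of functions built from difference quotients in
  time.\<close>

abbreviation "Icc \<equiv> {0..1::real}"
abbreviation "Ioc \<equiv> {0<..1::real}"
abbreviation "Ioo \<equiv> {0<..<1::real}"

abbreviation "dif2 g k (t::real) \<equiv> g (t + 2 * k) - 2 * g (t + k) + (g t :: real)"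

abbreviation unif :: "(real => real => real => bool) => bool" where
 "unif P \<equiv> \<forall>e x t. 0 < e --> e <= 1 --> 0 <= x --> x <= 1 --> 0 < t --> t <= 1 --> P e x t"

section \<open>The maximum principle\<close>

text \<open>The time derivative is taken from the left: it then makes sense up to the final time, is
  compatible with shifts in time, and is what a minimum at time \<open>t\<close> controls.\<close>

definition heat_deriv ::
 "real => (real => real => real) => (real => real => real) => (real => real => real)
  => (real => real => real) => bool" where
 "heat_deriv T u ux uxx ut \<longleftrightarrow> (\<forall>x\<in>Ioo. \<forall>t\<in>{0<..T}.
  DERIV (%s. u s t) x :> ux x t \<and>
  DERIV (%s. ux s t) x :> uxx x t \<and>
  ((%s. u x s) has_real_derivative ut x t) (at_left t))"

definition solves ::
 "real => real => (real => real => real) => (real => real => real) => (real => real => real) => bool" where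
 "solves T e b u F \<longleftrightarrow> (\<exists>ux uxx ut. heat_deriv T u ux uxx ut \<and>
  (\<forall>x\<in>Ioo. \<forall>t\<in>{0<..T}. e * (ut x t - uxx x t) + b x t * u x t = F x t))"

lemma solvesI:
 assumes "heat_deriv T u ux uxx ut"
  and "!!x t. x \<in> Ioo ==> t \<in> {0<..T} ==> e * (ut x t - uxx x t) + b x t * u x t = F x t"
 shows "solves T e b u F"
 using assms unfolding solves_def by blast

lemma heat_deriv_add:
 assumes "heat_deriv T u ux uxx ut" "heat_deriv T v vx vxx vt"
 shows "heat_deriv T (%x t. u x t + v x t) (%x t. ux x t + vx x t) (%x t. uxx x t + vxx x t)
  (%x t. ut x t + vt x t)"
 using assms unfolding heat_deriv_def by (auto intro!: derivative_intros)

lemma heat_deriv_cmult: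
 assumes "heat_deriv T u ux uxx ut"
 shows "heat_deriv T (%x t. c * u x t) (%x t. c * ux x t) (%x t. c * uxx x t) (%x t. c * ut x t)"
 using assms unfolding heat_deriv_def by (auto intro!: DERIV_cmult)

lemma heat_deriv_diff:
 assumes "heat_deriv T u ux uxx ut" "heat_deriv T v vx vxx vt"
 shows "heat_deriv T (%x t. u x t - v x t) (%x t. ux x t - vx x t) (%x t. uxx x t - vxx x t)
  (%x t. ut x t - vt x t)"
 using assms unfolding heat_deriv_def by (auto intro!: derivative_intros)

lemma heat_deriv_subset: "heat_deriv T u ux uxx ut ==> T' <= T ==> heat_deriv T' u ux uxx ut"
 unfolding heat_deriv_def by auto

lemma heat_deriv_shift:
 assumes "heat_deriv T u ux uxx ut" "0 <= \<eta>"
 shows "heat_deriv (T - \<eta>) (%x t. u x (t + \<eta>)) (%x t. ux x (t + \<eta>)) (%x t. uxx x (t + \<eta>))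
  (%x t. ut x (t + \<eta>))"
 unfolding heat_deriv_def
proof (intro ballI conjI)
 fix x t :: real
 assume x: "x \<in> Ioo" and t: "t \<in> {0<..T - \<eta>}"
 hence t': "t + \<eta> \<in> {0<..T}" using assms by auto
 from assms(1) x t' have *: "DERIV (%s. u s (t+\<eta>)) x :> ux x (t+\<eta>)"
  "DERIV (%s. ux s (t+\<eta>)) x :> uxx x (t+\<eta>)"
  "((%s. u x s) has_real_derivative ut x (t+\<eta>)) (at_left (t+\<eta>))"
  unfolding heat_deriv_def by auto
 show "DERIV (%s. u s (t+\<eta>)) x :> ux x (t+\<eta>)"
  "DERIV (%s. ux s (t+\<eta>)) x :> uxx x (t+\<eta>)" by fact+
 have "((%s. u x s) has_real_derivative ut x (t+\<eta>)) (at (t+\<eta>) within ((%s. s + \<eta>) ` {..<t}))"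
  by (rule has_field_derivative_subset[OF *(3)]) auto
 hence "((%s. u x s) \<circ> (%s. s + \<eta>) has_real_derivative ut x (t+\<eta>) * 1) (at_left t)"
  by (rule DERIV_image_chain) (auto intro!: derivative_eq_intros)
 thus "((%s. u x (s + \<eta>)) has_real_derivative ut x (t+\<eta>)) (at_left t)"
  by (simp add: o_def)
qed

lemma solves_add:
 "solves T e b u F ==> solves T e b v G ==> solves T e b (%x t. u x t + v x t) (%x t. F x t + G x t)"
 unfolding solves_def
 by (elim exE conjE, rule exI, rule exI, rule exI, rule conjI, erule (1) heat_deriv_add)
  (simp add: algebra_simps)

lemma solves_diff:
 "solves T e b u F ==> solves T e b v G ==> solves T e b (%x t. u x t - v x t) (%x t. F x t - G x t)"
 unfolding solves_def
 by (elim exE conjE, rule exI, rule exI, rule exI, rule conjI, erule (1) heat_deriv_diff)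
  (simp add: algebra_simps)

lemma solves_cmult:
 assumes "solves T e b u F" shows "solves T e b (%x t. c * u x t) (%x t. c * F x t)"
proof -
 from assms obtain ux uxx ut where h: "heat_deriv T u ux uxx ut"
  and eq: "!!x t. x\<in>Ioo ==> t\<in>{0<..T} ==> e * (ut x t - uxx x t) + b x t * u x t = F x t"
  unfolding solves_def by blast
 show ?thesis
  by (rule solvesI[OF heat_deriv_cmult[OF h]], subst eq[symmetric]) (auto simp: algebra_simps)
qed

lemma solves_subset: "solves T e b u F ==> T' <= T ==> solves T' e b u F"
 unfolding solves_def using heat_deriv_subset by fastforce

text \<open>The second derivative is known at \<open>x\<close> only, so the argument uses the sign
  of \<open>f'\<close> to the right of \<open>x\<close> instead of a Taylor expansion.\<close>

lemma second_deriv_nonneg_at_min: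
 fixes f f' :: "real => real"
 assumes "!!s. s \<in> {a<..<c} ==> DERIV f s :> f' s"
  and "DERIV f' x :> d2" "x \<in> {a<..<c}"
  and min: "!!s. s \<in> {a<..<c} ==> f x <= f s"
 shows "0 <= d2"
proof (rule ccontr)
 assume "\<not> 0 <= d2"
 define r where "r = min (x - a) (c - x)"
 have r: "r > 0" using assms(3) by (auto simp: r_def)
 have "f' x = 0"
  by (rule DERIV_local_min[OF assms(1)[OF assms(3)] r]) (auto intro!: min simp: r_def abs_if split: if_splits)
 from DERIV_neg_dec_right[OF assms(2)] \<open>\<not> 0 <= d2\<close> obtain d where
  d: "d > 0" "!!h. 0 < h ==> h < d ==> f' (x + h) < f' x" by auto
 define h where "h = min (d/2) (r/2)"
 have h: "0 < h" "h < d" "h < r" using d r by (auto simp: h_def)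
 have "\<exists>z. x < z \<and> z < x + h \<and> f (x + h) - f x = ((x+h) - x) * f' z"
  by (rule MVT2) (use h assms(3) in \<open>auto intro!: assms(1) simp: r_def\<close>)
 then obtain z where z: "x < z" "z < x + h" "f (x+h) - f x = h * f' z" by auto
 have "f' z < 0" using d(2)[of "z - x"] z h \<open>f' x = 0\<close> by auto
 hence "f (x+h) < f x" using z h by (smt (verit) mult_pos_neg)
 moreover have "f x <= f (x+h)" using min[of "x+h"] h assms(3) by (auto simp: r_def)
 ultimately show False by simp
qed

lemma left_deriv_nonpos_at_min:
 fixes f :: "real => real"
 assumes "(f has_real_derivative d2) (at_left t)" "a < t" "!!s. a < s ==> s < t ==> f t <= f s"
 shows "d2 <= 0"
proof -
 have "((%y. (f y - f t) / (y - t)) \<longlongrightarrow> d2) (at_left t)"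
  using assms(1) by (simp add: has_field_derivative_iff)
 moreover have "eventually (%y. (f y - f t) / (y - t) <= 0) (at_left t)"
  unfolding eventually_at_left_field using assms(2,3)
  by (intro exI[of _ a]) (auto intro!: divide_nonneg_neg)
 ultimately show ?thesis by (rule tendsto_upperbound) simp
qed

text \<open>The initial condition is a uniform lower bound for small times because \<open>u\<close>
  may be discontinuous at \<open>t = 0\<close>; the minimum is therefore sought at times from
  \<open>d / 2\<close> on. As \<open>b\<close> is strictly positive, a negative minimum contradicts
  the sign of the equation directly.\<close>

lemma minimum_principle:
 assumes eps: "e > 0" and b: "!!x t. x \<in> Ioo ==> t \<in> {0<..T} ==> 0 < b x t"
  and sol: "solves T e b u F" and F: "!!x t. x \<in> Ioo ==> t \<in> {0<..T} ==> 0 <= F x t"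
  and cont: "continuous_on (Icc \<times> {0<..T}) (%(x,t). u x t)"
  and bd: "!!t. t \<in> {0<..T} ==> 0 <= u 0 t" "!!t. t \<in> {0<..T} ==> 0 <= u 1 t"
  and init: "!!ee. ee > 0 ==> \<exists>d>0. \<forall>x\<in>Icc. \<forall>t\<in>{0<..T}. t < d --> - ee <= u x t"
  and x: "x \<in> Icc" and t: "t \<in> {0<..T}"
 shows "0 <= u x t"
proof (rule ccontr)
 assume neg: "\<not> 0 <= u x t"
 define m where "m = - u x t"
 have m: "m > 0" using neg by (simp add: m_def)
 from init[of "m/2"] m obtain d where d: "d > 0"
  "!!x t. x \<in> Icc ==> t \<in> {0<..T} ==> t < d ==> - (m/2) <= u x t" by auto
 have td: "d <= t" using d(2)[OF x t] m by (auto simp: m_def not_less[symmetric])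
 have "compact ({0..1::real} \<times> {d/2..T})" by (intro compact_Times compact_Icc)
 moreover have "(x,t) \<in> Icc \<times> {d/2..T}" using x t td d by auto
 moreover have "continuous_on (Icc \<times> {d/2..T}) (%(x,t). u x t)"
  by (rule continuous_on_subset[OF cont]) (use d in auto)
 ultimately obtain q where q: "q \<in> Icc \<times> {d/2..T}"
  "!!p. p \<in> Icc \<times> {d/2..T} ==> (%(x,t). u x t) q <= (%(x,t). u x t) p"
  using continuous_attains_inf[of "Icc \<times> {d/2..T}" "%(x,t). u x t"] by (metis empty_iff)
 obtain x1 t1 where q': "q = (x1,t1)" by (cases q)
 have mn: "!!y s. y \<in> Icc ==> s \<in> {d/2..T} ==> u x1 t1 <= u y s"
  using q(2) q' by fastforce
 have "u x1 t1 <= - m" using mn[OF x, of t] t td d by (auto simp: m_def)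
 \<comment> \<open>Before time \<open>d\<close> the values stay above \<open>- m\<close>. So the
   minimum lies beyond the left end of the time interval, and a left derivative can be taken
   there.\<close>
 have t1: "t1 >= d" using d(2)[of x1 t1] q q' m \<open>u x1 t1 <= - m\<close> d(1) by force
 have t1': "t1 \<in> {0<..T}" using t1 d q q' by auto
 have x1: "x1 \<in> Ioo"
  using q q' bd[OF t1'] \<open>u x1 t1 <= - m\<close> m by (cases "x1 = 0 \<or> x1 = 1") auto
 from sol obtain ux uxx ut where h: "heat_deriv T u ux uxx ut"
  and eq: "e * (ut x1 t1 - uxx x1 t1) + b x1 t1 * u x1 t1 = F x1 t1"
  unfolding solves_def using x1 t1' by blast
 have dx: "!!s. s \<in> Ioo ==> DERIV (%s. u s t1) s :> ux s t1"
  and dxx: "DERIV (%s. ux s t1) x1 :> uxx x1 t1"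
  and dt: "((%s. u x1 s) has_real_derivative ut x1 t1) (at_left t1)"
  using h x1 t1' unfolding heat_deriv_def by auto
 have "0 <= uxx x1 t1"
  by (rule second_deriv_nonneg_at_min[OF dx dxx x1]) (use mn q q' in auto)
 moreover have "ut x1 t1 <= 0"
  by (rule left_deriv_nonpos_at_min[OF dt, of "d/2"]) (use mn t1 d x1 q q' in auto)
 ultimately have "e * (ut x1 t1 - uxx x1 t1) <= 0" using eps by (simp add: mult_nonneg_nonpos)
 moreover have "b x1 t1 * u x1 t1 < 0" using b[OF x1 t1'] m \<open>u x1 t1 <= - m\<close> by (simp add: mult_pos_neg)
 ultimately show False using eq F[OF x1 t1'] by linarith
qed

text \<open>The majorant \<open>W\<close> may be discontinuous at \<open>t = 0\<close>; there only its
 continuous minorant \<open>W0\<close> is used.\<close>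

lemma comparison_principle:
 assumes eps: "e > 0" and b: "!!x t. x \<in> Ioo ==> t \<in> {0<..T} ==> 0 < b x t"
  and w: "solves T e b w F" and W: "solves T e b W G"
  and F: "!!x t. x \<in> Ioo ==> t \<in> {0<..T} ==> abs (F x t) <= G x t"
  and cw: "continuous_on (Icc \<times> {0..T}) (%(x,t). w x t)"
  and cW: "continuous_on (Icc \<times> {0<..T}) (%(x,t). W x t)"
  and cW0: "continuous_on (Icc \<times> {0..T}) (%(x,t). W0 x t)"
  and W0: "!!x t. x \<in> Icc ==> t \<in> {0<..T} ==> W0 x t <= W x t"
  and init: "!!x. x \<in> Icc ==> abs (w x 0) <= W0 x 0"
  and bd: "!!t. t \<in> {0<..T} ==> abs (w 0 t) <= W 0 t" "!!t. t \<in> {0<..T} ==> abs (w 1 t) <= W 1 t"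
  and x: "x \<in> Icc" and t: "t \<in> {0<..T}"
 shows "abs (w x t) <= W x t"
proof -
 have key: "0 <= W x t - k * w x t" if k: "k = 1 \<or> k = -1" for k
 proof (rule minimum_principle[OF eps b _ _ _ _ _ _ x t, where u="%x t. W x t - k * w x t" and F="%x t. G x t - k * F x t"])
  show "solves T e b (%x t. W x t - k * w x t) (%x t. G x t - k * F x t)"
   by (rule solves_diff[OF W solves_cmult[OF w]])
  show "0 <= G x t - k * F x t" if "x \<in> Ioo" "t \<in> {0<..T}" for x t
   using F[OF that] k by auto
  have cw': "continuous_on (Icc \<times> {0<..T}) (%(x,t). w x t)"
   by (rule continuous_on_subset[OF cw]) auto
  show "continuous_on (Icc \<times> {0<..T}) (%(x,t). W x t - k * w x t)"
   using continuous_on_diff[OF cW continuous_on_mult_left[OF cw', of k]]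
   by (simp add: case_prod_unfold)
  show "0 <= W 0 t - k * w 0 t" "0 <= W 1 t - k * w 1 t" if "t \<in> {0<..T}" for t
   using bd[OF that] k by auto
  fix ee :: real assume ee: "ee > 0"
  have "compact ({0..1::real} \<times> {0..T})" by (intro compact_Times compact_Icc)
  moreover have "continuous_on (Icc \<times> {0..T}) (%(x,t). W0 x t - k * w x t)"
   using continuous_on_diff[OF cW0 continuous_on_mult_left[OF cw, of k]]
   by (simp add: case_prod_unfold)
  ultimately have "uniformly_continuous_on (Icc \<times> {0..T}) (%(x,t). W0 x t - k * w x t)"
   using compact_uniformly_continuous by blast
  then obtain d where d: "d > 0" and dd: "\<forall>p\<in>Icc \<times> {0..T}. \<forall>p'\<in>Icc \<times> {0..T}.
    dist p' p < d --> dist ((%(x,t). W0 x t - k * w x t) p') ((%(x,t). W0 x t - k * w x t) p) < ee"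
   using ee unfolding uniformly_continuous_on_def by meson
  show "\<exists>d>0. \<forall>x\<in>Icc. \<forall>t\<in>{0<..T}. t < d --> - ee <= W x t - k * w x t"
  proof (intro exI[of _ d] conjI ballI impI)
   fix x t :: real assume xt: "x \<in> Icc" "t \<in> {0<..T}" "t < d"
   have "dist (x,t) (x,0) < d" using xt by (simp add: dist_Pair_Pair)
   hence "dist (W0 x t - k * w x t) (W0 x 0 - k * w x 0) < ee"
    using dd[rule_format, of "(x,0)" "(x,t)"] xt by auto
   moreover have "0 <= W0 x 0 - k * w x 0" using init[of x] k xt by auto
   ultimately show "- ee <= W x t - k * w x t" using W0[of x t] xt by (auto simp: dist_real_def)
  qed (use d in auto)
 qed
 from key[of 1] key[of "-1"] show ?thesis by auto
qed

section \<open>Derivatives, differences and interpolation\<close>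

lemma MVT_open:
 fixes f :: "real => real"
 assumes "a < c" "continuous_on {a..c} f"
  and "!!x. a < x ==> x < c ==> DERIV f x :> f' x"
 obtains z where "a < z" "z < c" "f c - f a = (c - a) * f' z"
proof -
 from MVT[OF assms(1,2)] assms(3) obtain l z where z: "a < z" "z < c"
  "DERIV f z :> l" "f c - f a = (c - a) * l"
  by (auto simp: real_differentiable_def) 
 hence "l = f' z" using assms(3) DERIV_unique by blast
 with z that show ?thesis by blast
qed

lemma DERIV_continuous_on_Icc:
 assumes "!!x. x \<in> {a..c} ==> DERIV f x :> f' x"
 shows "continuous_on {a..c} f"
 by (rule continuous_at_imp_continuous_on) (use assms DERIV_isCont in blast)

lemma abs_diff_le_deriv:
 fixes f :: "real => real"
 assumes "a <= c" "continuous_on {a..c} f"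
  and "!!x. a < x ==> x < c ==> DERIV f x :> f' x"
  and "!!x. a < x ==> x < c ==> abs (f' x) <= K"
 shows "abs (f c - f a) <= K * (c - a)"
proof (cases "a = c")
 case False
 hence "a < c" using assms by simp
 then obtain z where "a < z" "z < c" "f c - f a = (c - a) * f' z"
  using MVT_open[OF _ assms(2,3)] by blast
 thus ?thesis using assms(4)[of z] \<open>a < c\<close> by (simp add: abs_mult mult.commute mult_left_mono)
qed simp

text \<open>The mean value theorem is applied to the first difference \<open>h\<close> and then to
  \<open>g1\<close>. Only continuity is asked for at the end points, so intervals starting at
  \<open>t = 0\<close> are allowed.\<close>

lemma second_difference_le:
 fixes g :: "real => real"
 assumes "0 <= p" "continuous_on {a..a+2*p} g"
  and g1: "!!s. a < s ==> s < a + 2*p ==> DERIV g s :> g1 s"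
  and g2: "!!s. a < s ==> s < a + 2*p ==> DERIV g1 s :> g2 s"
  and K: "!!s. a < s ==> s < a + 2*p ==> abs (g2 s) <= K"
 shows "abs (g (a+2*p) - 2 * g (a+p) + g a) <= K * p^2"
proof (cases "p = 0")
 case False
 hence p: "p > 0" using assms by simp
 define h where "h = (%s. g (s + p) - g s)"
 have "abs (h (a+p) - h a) <= (K * p) * (a + p - a)"
 proof (rule abs_diff_le_deriv[where f'="%s. g1 (s+p) - g1 s"])
  have c1: "continuous_on {a..a+p} (%s. g (s+p))"
   by (rule continuous_on_compose2[OF assms(2)]) (use p in \<open>auto intro!: continuous_intros\<close>)
  have c2: "continuous_on {a..a+p} g" by (rule continuous_on_subset[OF assms(2)]) (use p in auto)
  show "continuous_on {a..a+p} h" unfolding h_def using c1 c2 by (intro continuous_intros)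
  fix s assume s: "a < s" "s < a + p"
  have "DERIV (%s. g (s + p)) s :> g1 (s+p)"
   using g1[of "s+p"] s p by (simp add: DERIV_shift)
  thus "DERIV h s :> g1 (s + p) - g1 s"
   unfolding h_def using g1[of s] s p by (auto intro!: derivative_intros)
  have "abs (g1 (s+p) - g1 s) <= K * (s + p - s)"
   by (rule abs_diff_le_deriv[where f'=g2], use p in simp, rule DERIV_continuous_on_Icc[where f'=g2])
    (use s p g2 K in auto)
  thus "abs (g1 (s+p) - g1 s) <= K * p" by simp
 qed (use p in auto)
 thus ?thesis by (simp add: h_def power2_eq_square algebra_simps)
qed simp

text \<open>The remainder \<open>r\<close> vanishes with its derivative at \<open>0\<close>, and its
  second derivative is the second difference of \<open>w\<close>. Thus second differences of
  \<open>w\<close> take the place of a fourth derivative of \<open>g\<close>.\<close>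

lemma second_difference_error:
 fixes g w :: "real => real"
 assumes h: "0 < h" and cont: "continuous_on {x-h..x+h} g"
  and g1: "!!y. y \<in> {x-h<..<x+h} ==> DERIV g y :> g1 y"
  and w: "!!y. y \<in> {x-h<..<x+h} ==> DERIV g1 y :> w y"
  and K: "!!s. 0 < s ==> s < h ==> abs (w (x+s) - 2 * w x + w (x-s)) <= K * s^2"
 shows "abs (g (x+h) - 2 * g x + g (x-h) - h^2 * w x) <= K * h^4"
proof -
 define r where "r = (%s. g (x+s) + g (x-s) - s^2 * w x)"
 define r1 where "r1 = (%s. g1 (x+s) - g1 (x-s) - 2 * s * w x)"
 have K0: "0 <= K" using K[of "h/2"] h
  by (smt (verit) field_sum_of_halves half_gt_zero mult_less_0_iff zero_less_power)
 have d1: "DERIV r s :> r1 s" if "-h < s" "s < h" for s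
  unfolding r_def r1_def using that
  by (auto intro!: derivative_eq_intros DERIV_chain2[OF g1])
 have d2: "DERIV r1 s :> w (x+s) - 2 * w x + w (x-s)" if "-h < s" "s < h" for s
  unfolding r1_def using that
  by (auto intro!: derivative_eq_intros DERIV_chain2[OF w])
 have b1: "abs (r1 s) <= K * h^3" if s: "0 < s" "s < h" for s
 proof -
  have "abs (r1 s - r1 0) <= (K * s^2) * (s - 0)"
  proof (rule abs_diff_le_deriv[OF _ DERIV_continuous_on_Icc[OF d2] d2])
   fix y assume "0 < y" "y < s"
   hence "K * y^2 <= K * s^2" using K0 s by (intro mult_left_mono power_mono) auto
   thus "abs (w (x + y) - 2 * w x + w (x - y)) <= K * s^2"
    using K[of y] \<open>0 < y\<close> \<open>y < s\<close> s by force
  qed (use s in auto)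
  moreover have "K * s^2 * (s - 0) = K * s^3" by (simp add: power2_eq_square power3_eq_cube)
  moreover have "K * s^3 <= K * h^3" using s K0 by (intro mult_left_mono power_mono) auto
  ultimately show ?thesis by (simp add: r1_def power2_eq_square power3_eq_cube)
 qed
 have "abs (r h - r 0) <= (K * h^3) * (h - 0)"
 proof (rule abs_diff_le_deriv)
  have "continuous_on {0..h} (%s. g (x+s))" "continuous_on {0..h} (%s. g (x-s))"
   by (rule continuous_on_compose2[OF cont], use h in \<open>auto intro!: continuous_intros\<close>)+
  thus "continuous_on {0..h} r" unfolding r_def by (intro continuous_intros)
  show "!!s. 0 < s ==> s < h ==> DERIV r s :> r1 s" using d1 h by auto
 qed (use b1 h in auto)
 thus ?thesis by (simp add: r_def algebra_simps power4_eq_xxxx power3_eq_cube)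
qed

text \<open>Quadratic polynomials are treated exactly even on unequal steps, so the error consists
  of the two Taylor remainders divided by their own steps; only the oscillation of \<open>w\<close>
  enters.\<close>

lemma second_diff_consistency:
 fixes g w :: "real => real"
 assumes h: "0 < h" "0 < h'" and cont: "continuous_on {x-h..x+h'} g"
  and g1: "!!y. y \<in> {x-h<..<x+h'} ==> DERIV g y :> g1 y"
  and w: "!!y. y \<in> {x-h<..<x+h'} ==> DERIV g1 y :> w y"
  and K: "!!y. y \<in> {x-h<..<x+h'} ==> abs (w y - w x) <= K"
 shows "abs (((g (x+h') - g x) / h' - (g x - g (x-h)) / h) / ((h' + h) / 2) - w x) <= 2 * K"
proof -
 define r where "r = (%y. g y - g x - g1 x * (y-x) - w x * (y-x)^2 / 2)"
 define r1 where "r1 = (%y. g1 y - g1 x - w x * (y-x))"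
 have K0: "0 <= K" using K[of x] h by simp
 have d1: "DERIV r y :> r1 y" if "x-h < y" "y < x+h'" for y
  unfolding r_def r1_def using that g1[of y]
  by (auto intro!: derivative_eq_intros simp: field_simps)
 have d2: "DERIV r1 y :> w y - w x" if "x-h < y" "y < x+h'" for y
  unfolding r1_def using that w[of y] by (auto intro!: derivative_eq_intros)
 have cr: "continuous_on {x-h..x+h'} r" unfolding r_def by (intro continuous_intros cont) auto
 have b1: "abs (r1 y) <= K * abs (y - x)" if y: "x-h < y" "y < x+h'" for y
 proof (cases "x <= y")
  case True
  have "abs (r1 y - r1 x) <= K * (y - x)"
   by (rule abs_diff_le_deriv[OF _ DERIV_continuous_on_Icc[OF d2] d2]) (use True y h K in auto)
  thus ?thesis using True by (simp add: r1_def)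
 next
  case False
  have "abs (r1 x - r1 y) <= K * (x - y)"
   by (rule abs_diff_le_deriv[OF _ DERIV_continuous_on_Icc[OF d2] d2]) (use False y h K in auto)
  thus ?thesis using False by (simp add: r1_def)
 qed
 have "abs (r (x+h') - r x) <= (K * h') * (x + h' - x)"
 proof (rule abs_diff_le_deriv[OF _ _ d1])
  show "continuous_on {x..x+h'} r" by (rule continuous_on_subset[OF cr]) (use h in auto)
  fix y assume y: "x < y" "y < x + h'"
  thus "abs (r1 y) <= K * h'" using b1[of y] h K0
   by (smt (verit) mult_left_mono)
 qed (use h in auto)
 hence R: "abs (r (x+h') / h') <= K * h'"
  using h by (simp add: r_def abs_mult divide_simps)
 have "abs (r x - r (x-h)) <= (K * h) * (x - (x - h))"
 proof (rule abs_diff_le_deriv[OF _ _ d1])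
  show "continuous_on {x-h..x} r" by (rule continuous_on_subset[OF cr]) (use h in auto)
  fix y assume y: "x - h < y" "y < x"
  thus "abs (r1 y) <= K * h" using b1[of y] h K0
   by (smt (verit) mult_left_mono)
 qed (use h in auto)
 hence L: "abs (r (x-h) / h) <= K * h"
  using h by (simp add: r_def abs_mult divide_simps)
 have "((g (x+h') - g x) / h' - (g x - g (x-h)) / h) / ((h' + h) / 2) - w x =
   (r (x+h') / h' + r (x-h) / h) / ((h' + h) / 2)"
 proof -
  have e1: "(g (x+h') - g x) / h' = g1 x + w x * h' / 2 + r (x+h') / h'"
   using h by (simp add: r_def field_simps power2_eq_square)
  have e2: "(g x - g (x-h)) / h = g1 x - w x * h / 2 - r (x-h) / h"
   using h by (simp add: r_def field_simps power2_eq_square)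
  have "(g1 x + w x * h' / 2 + R - (g1 x - w x * h / 2 - L)) / ((h' + h) / 2) - w x =
   (R + L) / ((h' + h) / 2)" for R L using h by (simp add: field_simps)
  thus ?thesis unfolding e1 e2 .
 qed
 moreover have "abs ((r (x+h') / h' + r (x-h) / h) / ((h' + h) / 2)) <= 2 * K"
 proof -
  have "abs (r (x+h') / h' + r (x-h) / h) <= K * h' + K * h"
   using R L abs_triangle_ineq[of "r (x+h') / h'" "r (x-h) / h"] by linarith
  also have "... = 2 * K * ((h'+h)/2)" by (simp add: algebra_simps)
  finally have "abs (r (x+h') / h' + r (x-h) / h) <= 2 * K * ((h'+h)/2)" .
  moreover have D0: "0 < (h'+h)/2" using h by simp
  moreover have "abs (a / c) <= k" if "abs a <= k * c" "0 < c" for a c k :: real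
   using that by (simp add: abs_divide pos_divide_le_eq)
  ultimately show ?thesis by blast
 qed
 ultimately show ?thesis by simp
qed

text \<open>The mean value theorem gives one point where \<open>abs u1\<close> is at most
  \<open>2 * M0 / l\<close>, and the bound on \<open>u2\<close> carries this over to the whole
  interval. The length \<open>l\<close> is left free to balance the two terms.\<close>

lemma landau_inequality:
 fixes u :: "real => real"
 assumes l: "0 < l" and u1: "!!y. y \<in> {a..a+l} ==> DERIV u y :> u1 y"
  and u2: "!!y. y \<in> {a..a+l} ==> DERIV u1 y :> u2 y"
  and M0: "!!y. y \<in> {a..a+l} ==> abs (u y) <= M0" and M2: "!!y. y \<in> {a..a+l} ==> abs (u2 y) <= M2"
  and y: "y \<in> {a..a+l}"
 shows "abs (u1 y) <= 2 * M0 / l + M2 * l"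
proof -
 obtain z where z: "a < z" "z < a+l" "u (a+l) - u a = (a+l-a) * u1 z"
  by (rule MVT_open[of a "a+l" u u1]) (use l u1 in \<open>auto intro!: DERIV_continuous_on_Icc[of _ _ u u1]\<close>)
 have "abs (l * u1 z) <= 2 * M0" using z M0[of a] M0[of "a+l"] l by auto
 hence 1: "abs (u1 z) <= 2 * M0 / l" using l by (simp add: abs_mult field_simps)
 have M2': "0 <= M2" using M2[of a] l by auto
 have "abs (u1 y - u1 z) <= M2 * abs (y - z)"
 proof (cases "z <= y")
  case True
  have "abs (u1 y - u1 z) <= M2 * (y - z)"
   by (rule abs_diff_le_deriv[of _ _ _ u2]) (use True y z u2 M2 in \<open>auto intro!: DERIV_continuous_on_Icc[of _ _ u1 u2]\<close>)
  thus ?thesis using True by simp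
 next
  case False
  have "abs (u1 z - u1 y) <= M2 * (z - y)"
   by (rule abs_diff_le_deriv[of _ _ _ u2]) (use False y z u2 M2 in \<open>auto intro!: DERIV_continuous_on_Icc[of _ _ u1 u2]\<close>)
  thus ?thesis using False by simp
 qed
 moreover have "M2 * abs (y - z) <= M2 * l" using y z M2' by (intro mult_left_mono) auto
 ultimately show ?thesis using 1 by linarith
qed

text \<open>The error is \<open>(c - x) * (x - a) / (c - a)\<close> times the difference of two
  slopes at mean value points on either side of \<open>x\<close>.\<close>

lemma linear_interpolation_error:
 fixes g :: "real => real"
 assumes ac: "a < c" and cont: "continuous_on {a..c} g"
  and g1: "!!y. a < y ==> y < c ==> DERIV g y :> g1 y"
  and w: "!!y. a < y ==> y < c ==> DERIV g1 y :> w y"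
  and K: "!!y. a < y ==> y < c ==> abs (w y) <= K" and x: "x \<in> {a..c}"
 shows "abs (g x - ((c - x) * g a + (x - a) * g c) / (c - a)) <= K * (c - a)^2"
proof -
 have K0: "0 <= K" using K[of "(a+c)/2"] ac by (auto simp: field_simps)
 show ?thesis
 proof (cases "x = a \<or> x = c")
  case True
  thus ?thesis using ac K0 by auto
 next
  case False
  hence xx: "a < x" "x < c" using x by auto
  obtain z1 where z1: "a < z1" "z1 < x" "g x - g a = (x - a) * g1 z1"
   by (rule MVT_open[of a x g g1]) (use xx g1 in \<open>auto intro!: continuous_on_subset[OF cont]\<close>)
  obtain z2 where z2: "x < z2" "z2 < c" "g c - g x = (c - x) * g1 z2"
   by (rule MVT_open[of x c g g1]) (use xx g1 in \<open>auto intro!: continuous_on_subset[OF cont]\<close>)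
  have "abs (g1 z2 - g1 z1) <= K * (z2 - z1)"
   by (rule abs_diff_le_deriv[of _ _ _ w]) (use z1 z2 xx w K in \<open>auto intro!: DERIV_continuous_on_Icc[of _ _ g1 w]\<close>)
  also have "... <= K * (c - a)" using z1 z2 xx K0 by (intro mult_left_mono) auto
  finally have A: "abs (g1 z1 - g1 z2) <= K * (c - a)" by (simp add: abs_minus_commute)
  have ga: "g a = g x - (x - a) * g1 z1" and gc: "g c = g x + (c - x) * g1 z2" using z1 z2 by auto
  have "g x - ((c - x) * g a + (x - a) * g c) / (c - a) = ((c - x) * (x - a) / (c - a)) * (g1 z1 - g1 z2)"
   unfolding ga gc using ac by (simp add: field_simps)
  moreover have "abs ((c - x) * (x - a) / (c - a)) <= c - a"
   using xx ac by (simp add: abs_mult pos_divide_le_eq, intro mult_mono, auto)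
  ultimately have "abs (g x - ((c - x) * g a + (x - a) * g c) / (c - a)) <= (c - a) * (K * (c - a))"
   using A ac by (simp only: abs_mult, intro mult_mono, auto)
  thus ?thesis by (simp add: power2_eq_square mult_ac)
 qed
qed

text \<open>The steps are integer fractions of \<open>\<kappa>\<close>, so that an increment over
  \<open>\<kappa>\<close> is a sum of whole steps and can be telescoped.\<close>

lemma left_deriv_sequence:
 fixes g :: "real => real"
 assumes "(g has_real_derivative d) (at_left t)" "0 < \<kappa>"
 shows "(%n. (g t - g (t - \<kappa> / real (Suc n))) / (\<kappa> / real (Suc n))) \<longlonglongrightarrow> d"
proof -
 have "((%y. (g y - g t) / (y - t)) \<longlongrightarrow> d) (at_left t)"
  using assms(1) by (simp add: has_field_derivative_iff)
 moreover have "filterlim (%n. t - \<kappa> / real (Suc n)) (at_left t) sequentially"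
  unfolding filterlim_at
 proof (intro conjI always_eventually)
  have "(%n. t - \<kappa> * inverse (real (Suc n))) \<longlonglongrightarrow> t - \<kappa> * 0"
   by (intro tendsto_intros LIMSEQ_inverse_real_of_nat)
  thus "(%n. t - \<kappa> / real (Suc n)) \<longlonglongrightarrow> t" by (simp add: divide_inverse)
 qed (use assms(2) in auto)
 ultimately have "(%n. (g (t - \<kappa> / real (Suc n)) - g t) / (t - \<kappa> / real (Suc n) - t)) \<longlonglongrightarrow> d"
  by (rule filterlim_compose)
 moreover have "(g (t - r) - g t) / (t - r - t) = (g t - g (t - r)) / r" for r
  by (simp add: divide_simps)
 ultimately show ?thesis by (simp only:)
qed

lemma left_deriv_le:
 fixes g :: "real => real"
 assumes "(g has_real_derivative d) (at_left t)" "a < t"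
  and "!!s. a < s ==> s < t ==> abs (g t - g s) <= C * (t - s)"
 shows "abs d <= C"
proof -
 have "((%y. abs ((g y - g t) / (y - t))) \<longlongrightarrow> (abs d)) (at_left t)"
  using assms(1) by (intro tendsto_rabs) (simp add: has_field_derivative_iff)
 moreover have "eventually (%y. abs ((g y - g t) / (y - t)) <= C) (at_left t)"
  unfolding eventually_at_left_field
 proof (intro exI[of _ a] conjI allI impI)
  fix y assume "a < y" "y < t"
  thus "abs ((g y - g t) / (y - t)) <= C" using assms(3)[of y]
   by (simp add: abs_divide pos_divide_le_eq abs_minus_commute)
 qed (use assms in auto)
 ultimately show ?thesis by (rule tendsto_upperbound) simp
qed

section \<open>One-sided derivatives controlled by second differences\<close>

context
 fixes g :: "real => real" and a t K :: real
 assumes sd: "!!s p. 0 < p ==> a <= s ==> s + 2 * p <= t ==> abs (g (s + 2*p) - 2 * g (s + p) + g s) <= K * p^2"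
begin

lemma second_differences_telescope:
 assumes "0 < p" "a <= t - (real m + 1) * p"
 shows "abs ((g t - g (t - p)) - (g (t - real m * p) - g (t - (real m + 1) * p))) <= real m * (K * p^2)"
 using assms
proof (induction m)
 case (Suc m)
 have "0 <= real m * p" using Suc by simp
 have "a <= t - (real m + 1) * p" using Suc.prems by (auto simp: algebra_simps)
 hence "abs ((g t - g (t - p)) - (g (t - real m * p) - g (t - (real m + 1) * p))) <= real m * (K * p^2)"
  using Suc by simp
 moreover have "abs (g ((t - (real m + 2) * p) + 2*p) - 2 * g ((t - (real m + 2) * p) + p) + g (t - (real m + 2) * p)) <= K * p^2"
  by (rule sd) (use Suc.prems \<open>0 <= real m * p\<close> in \<open>auto simp: algebra_simps\<close>)
 moreover have "(t - (real m + 2) * p) + 2*p = t - real m * p" "(t - (real m + 2) * p) + p = t - (real m + 1) * p"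
  by (auto simp: algebra_simps)
 ultimately show ?case
  by (simp add: algebra_simps)
qed simp

text \<open>Both derivatives are limits of quotients with step
  \<open>p = \<kappa> / real (Suc n)\<close>. The two first differences lie \<open>Suc n\<close>
  steps apart, so telescoping costs \<open>real (Suc n) * K * p^2 = K * \<kappa> * p\<close>, and
  division by \<open>p\<close> leaves \<open>K * \<kappa>\<close>.\<close>

lemma left_deriv_lipschitz:
 assumes d: "(g has_real_derivative d) (at_left t)" and d': "(g has_real_derivative d') (at_left (t - \<kappa>))"
  and \<kappa>: "0 < \<kappa>" "a < t - \<kappa>"
 shows "abs (d - d') <= K * \<kappa>"
proof -
 have "(%n. abs ((g t - g (t - \<kappa> / real (Suc n))) / (\<kappa> / real (Suc n)) -
   (g (t-\<kappa>) - g (t - \<kappa> - \<kappa> / real (Suc n))) / (\<kappa> / real (Suc n)))) \<longlonglongrightarrow> (abs (d - d'))"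
  by (intro tendsto_intros left_deriv_sequence d d' \<kappa>)
 moreover have "\<forall>\<^sub>F n in sequentially. abs ((g t - g (t - \<kappa> / real (Suc n))) / (\<kappa> / real (Suc n)) -
   (g (t-\<kappa>) - g (t - \<kappa> - \<kappa> / real (Suc n))) / (\<kappa> / real (Suc n))) <= K * \<kappa>"
 proof -
  have "(%n. \<kappa> * inverse (real (Suc n))) \<longlonglongrightarrow> \<kappa> * 0"
   by (intro tendsto_intros LIMSEQ_inverse_real_of_nat)
  hence "\<forall>\<^sub>F n in sequentially. \<kappa> * inverse (real (Suc n)) < t - \<kappa> - a"
   by (rule order_tendstoD(2)) (use \<kappa> in auto)
  thus ?thesis
  proof eventually_elim
   case (elim n)
   define p where "p = \<kappa> / real (Suc n)"
   have p: "p > 0" "real (Suc n) * p = \<kappa>" using \<kappa> by (auto simp: p_def)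
   have "abs ((g t - g (t - p)) - (g (t - real (Suc n) * p) - g (t - (real (Suc n) + 1) * p))) <= real (Suc n) * (K * p^2)"
    by (rule second_differences_telescope[OF p(1)])
     (use elim p in \<open>auto simp: algebra_simps p_def divide_inverse\<close>)
   moreover have "real (Suc n) * (K * p^2) = K * \<kappa> * p" using p(2) by (metis mult.assoc mult.commute power2_eq_square)
   moreover have "t - (real (Suc n) + 1) * p = t - \<kappa> - p" using p(2) by (simp only: distrib_right mult_1 diff_diff_eq)
   ultimately have "abs ((g t - g (t - p)) - (g (t - \<kappa>) - g (t - \<kappa> - p))) <= K * \<kappa> * p" 
    using p(2) by metis
   hence "abs ((g t - g (t - p)) - (g (t - \<kappa>) - g (t - \<kappa> - p))) / p <= K * \<kappa>"
    using p by (simp only: pos_divide_le_eq)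
   thus ?case unfolding p_def[symmetric] using p(1)
    by (simp add: diff_divide_distrib[symmetric])
  qed
 qed
 ultimately show ?thesis by (rule tendsto_upperbound) simp
qed

text \<open>The increment over \<open>\<kappa>\<close> is a sum of \<open>Suc n\<close> first
  differences, each compared with the last one. The total cost
  \<open>(real (Suc n) * p)^2 * K = K * \<kappa>^2\<close> does not depend on \<open>n\<close> and
  survives the limit.\<close>

lemma backward_quotient_error:
 assumes d: "(g has_real_derivative d) (at_left t)" and \<kappa>: "0 < \<kappa>" "a <= t - \<kappa>"
 shows "abs (g t - g (t - \<kappa>) - \<kappa> * d) <= K * \<kappa>^2"
proof -
 have "(%n. abs (g t - g (t - \<kappa>) - \<kappa> * ((g t - g (t - \<kappa> / real (Suc n))) / (\<kappa> / real (Suc n)))))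
  \<longlonglongrightarrow> (abs (g t - g (t - \<kappa>) - \<kappa> * d))"
  by (intro tendsto_intros left_deriv_sequence d \<kappa>)
 moreover have "abs (g t - g (t - \<kappa>) - \<kappa> * ((g t - g (t - \<kappa> / real (Suc n))) / (\<kappa> / real (Suc n)))) <= K * \<kappa>^2" for n
 proof -
  define p where "p = \<kappa> / real (Suc n)"
  have p: "p > 0" "real (Suc n) * p = \<kappa>" using \<kappa> by (auto simp: p_def)
  have "0 <= real n * p" using p by simp
  hence "p <= \<kappa>" using p(2) by (simp add: algebra_simps)
  have K0: "0 <= K * p^2"
  proof -
   have "abs (g (t - p + 2*(p/2)) - 2 * g (t - p + p/2) + g (t - p)) <= K * (p/2)^2"
    by (rule sd) (use p \<kappa> \<open>p <= \<kappa>\<close> in auto)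
   hence "0 <= K * (p/2)^2" by linarith
   thus ?thesis by (simp add: power_divide)
  qed
  have *: "abs ((g t - g (t - real m * p)) - real m * (g t - g (t - p))) <= real m * (real (Suc n) * (K * p^2))"
   if "m <= Suc n" for m
   using that
  proof (induction m)
   case (Suc m)
   have "(real m + 1) * p <= real (Suc n) * p" using Suc.prems p(1) by (intro mult_right_mono) auto
   hence "abs ((g t - g (t - p)) - (g (t - real m * p) - g (t - (real m + 1) * p))) <= real m * (K * p^2)"
    by (intro second_differences_telescope p(1)) (use p(2) \<kappa> in linarith)
   also have "... <= real (Suc n) * (K * p^2)" using Suc.prems K0 by (intro mult_right_mono) auto
   finally show ?case using Suc by (simp add: algebra_simps)
  qed simp
  have "abs ((g t - g (t - \<kappa>)) - real (Suc n) * (g t - g (t - p))) <= real (Suc n) * (real (Suc n) * (K * p^2))"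
   using *[of "Suc n"] unfolding p(2) by simp
  also have "real (Suc n) * (real (Suc n) * (K * p^2)) = K * (real (Suc n) * p)^2"
   by (simp add: power2_eq_square)
  also have "real (Suc n) * (g t - g (t - p)) = \<kappa> * ((g t - g (t - p)) / p)"
   using p by (simp add: field_simps p_def)
  finally show ?thesis unfolding p_def[symmetric] p(2) .
 qed
 ultimately show ?thesis by (intro tendsto_upperbound[OF _ always_eventually]) auto
qed

end

section \<open>The complementary error function\<close>

lemma gauss_integrable: "set_integrable lborel {z..} (%s::real. exp (- s\<^sup>2))"
proof -
 have "has_bochner_integral lborel (%s::real. exp (- s\<^sup>2)) (sqrt pi / 2 + sqrt pi / 2)"
  using has_bochner_integral_even_function[OF gaussian_moment_0] by simp
 hence "integrable lborel (%s::real. exp (- s\<^sup>2))" by (rule integrable.intros)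
 thus ?thesis by (rule set_integrable_subset[of _ UNIV, unfolded set_integrable_def, simplified, folded set_integrable_def]) simp
qed

lemma erfc_eq: "erfc z = 2 / sqrt pi * integral {z..} (%s. exp (- s\<^sup>2))"
 unfolding erfc_def using set_borel_integral_eq_integral(2)[OF gauss_integrable] by simp

lemma erfc_split:
 assumes "a <= z"
 shows "erfc a = 2 / sqrt pi * integral {a..z} (%s. exp (- s\<^sup>2)) + erfc z"
proof -
 have 1: "((%s::real. exp (- s\<^sup>2)) has_integral integral {z..} (%s. exp (- s\<^sup>2))) {z..}"
  using set_borel_integral_eq_integral(1)[OF gauss_integrable] by (rule integrable_integral)
 have 2: "((%s::real. exp (- s\<^sup>2)) has_integral integral {a..z} (%s. exp (- s\<^sup>2))) {a..z}"
  by (intro integrable_integral integrable_continuous_interval continuous_intros)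
 have "{a..z} \<inter> {z..} = {z}" "{a..z} \<union> {z..} = {a..}" using assms by auto
 with has_integral_Un[OF 2 1] have "integral {a..} (%s::real. exp (- s\<^sup>2))
   = integral {a..z} (%s. exp (- s\<^sup>2)) + integral {z..} (%s. exp (- s\<^sup>2))"
  by (auto intro: integral_unique)
 thus ?thesis by (simp add: erfc_eq algebra_simps)
qed

lemma erfc_0: "erfc 0 = 1"
proof -
 have "(LBINT s:{0..}. exp (- s\<^sup>2)) = sqrt pi / 2"
  unfolding set_lebesgue_integral_def using gaussian_moment_0 by (rule has_bochner_integral_integral_eq)
 thus ?thesis by (simp add: erfc_def)
qed

lemma erfc_has_real_derivative: "DERIV erfc z :> - 2 / sqrt pi * exp (- z\<^sup>2)"
proof -
 have "((%y. integral {z-1..y} (%s. exp (- s\<^sup>2))) has_real_derivative exp (- z\<^sup>2)) (at z within {z-1..z+1})"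
  by (rule integral_has_real_derivative) (auto intro!: continuous_intros)
 hence "DERIV (%y. integral {z-1..y} (%s. exp (- s\<^sup>2))) z :> exp (- z\<^sup>2)"
  by (simp add: at_within_Icc_at)
 hence "((%y. erfc (z-1) - 2 / sqrt pi * integral {z-1..y} (%s. exp (- s\<^sup>2))) has_real_derivative
   0 - 2 / sqrt pi * exp (- z\<^sup>2)) (at z)"
  by (intro DERIV_diff DERIV_const DERIV_cmult)
 hence "((%y. erfc (z-1) - 2 / sqrt pi * integral {z-1..y} (%s. exp (- s\<^sup>2))) has_real_derivative
   - 2 / sqrt pi * exp (- z\<^sup>2)) (at z)" by simp
 thus ?thesis
 proof (rule has_field_derivative_transform_within_open[of _ _ _ "{z-1<..<z+1}"])
  fix y assume "y \<in> {z - 1<..<z + 1}"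
  thus "erfc (z - 1) - 2 / sqrt pi * integral {z - 1..y} (%s. exp (- s\<^sup>2)) = erfc y"
   using erfc_split[of "z-1" y] by simp
 qed auto
qed

lemma erfc_nonneg: "0 <= erfc z"
proof -
 have "0 <= integral {z..} (%s::real. exp (- s\<^sup>2))"
  by (rule integral_nonneg[OF set_borel_integral_eq_integral(1)[OF gauss_integrable]]) simp
 thus ?thesis by (simp add: erfc_eq)
qed

text \<open>Mills' inequality: on the domain of integration \<open>r \<le> s\<close>, and
  \<open>2 * s * exp (- s\<^sup>2)\<close> has an explicit primitive.\<close>

lemma erfc_mills:
 assumes "0 <= r" shows "sqrt pi * r * erfc r <= exp (- r\<^sup>2)"
proof -
 have 1: "((%c. 2 * r * (LBINT s:{r..c}. exp (- s\<^sup>2))) \<longlongrightarrow> 2 * r * (LBINT s:{r..}. exp (- s\<^sup>2))) at_top"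
  by (intro tendsto_mult_left tendsto_set_lebesgue_integral_at_top gauss_integrable) auto
 have 2: "2 * r * (LBINT s:{r..c}. exp (- s\<^sup>2)) <= exp (- r\<^sup>2)" if c: "r <= c" for c
 proof -
  have "set_integrable lborel {r..c} (%s::real. exp (- s\<^sup>2))"
   by (rule set_integrable_subset[OF gauss_integrable[of r]]) auto
  hence "2 * r * (LBINT s:{r..c}. exp (- s\<^sup>2)) = integral {r..c} (%s. 2 * r * exp (- s\<^sup>2))"
   by (simp add: set_borel_integral_eq_integral(2))
  also have "... <= exp (- r\<^sup>2) - exp (- c\<^sup>2)"
  proof (rule has_integral_le[OF integrable_integral])
   show "((%s. 2 * s * exp (- s\<^sup>2)) has_integral exp (- r\<^sup>2) - exp (- c\<^sup>2)) {r..c}"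
   proof -
    have "((%s. - exp (- s\<^sup>2)) has_vector_derivative 2 * s * exp (- s\<^sup>2)) (at s within {r..c})" for s :: real
     by (auto intro!: derivative_eq_intros simp: has_real_derivative_iff_has_vector_derivative[symmetric])
    from fundamental_theorem_of_calculus[OF c this] show ?thesis by simp
   qed
  qed (use assms in \<open>auto intro!: integrable_continuous_interval continuous_intros mult_right_mono\<close>)
  also have "... <= exp (- r\<^sup>2)" by simp
  finally show ?thesis .
 qed
 have "2 * r * (LBINT s:{r..}. exp (- s\<^sup>2)) <= exp (- r\<^sup>2)"
  by (rule tendsto_upperbound[OF 1]) (auto intro!: eventually_at_top_linorderI[of r] 2)
 moreover have "sqrt pi * r * erfc r = 2 * r * (LBINT s:{r..}. exp (- s\<^sup>2))"
  by (simp add: erfc_def)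
 ultimately show ?thesis by (simp only:)
qed

text \<open>Up to \<open>1\<close> the bound comes from \<open>erfc 0 = 1\<close> and
  \<open>exp 1 \<le> 3\<close>, which explains the constant; beyond \<open>1\<close> Mills'
  inequality is stronger.\<close>

lemma erfc_le:
 assumes "0 <= r" shows "erfc r <= 3 * exp (- r\<^sup>2)"
proof (cases "r <= 1")
 case True
 have "integral {0..r} (%s. exp (- s\<^sup>2)) >= 0"
  by (intro integral_nonneg integrable_continuous_interval continuous_intros) auto
 hence "0 <= 2 / sqrt pi * integral {0..r} (%s. exp (- s\<^sup>2))" by simp
 hence "erfc r <= 1" using erfc_split[OF assms] erfc_0 by linarith
 moreover have "1 <= 3 * exp (- r\<^sup>2)"
 proof -
  have "exp (r^2) <= exp 1" using True assms by (simp add: power_le_one)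
  also have "... <= (3::real)" by (rule exp_le)
  finally show ?thesis by (simp add: exp_minus field_simps)
 qed
 ultimately show ?thesis by linarith
next
 case False
 have "1 * erfc r <= (sqrt pi * r) * erfc r"
 proof (rule mult_right_mono)
  have "1 <= sqrt pi" using pi_ge_two by simp
  thus "1 <= sqrt pi * r" using False by (smt (verit) mult_le_cancel_left1)
 qed (rule erfc_nonneg)
 also have "... <= exp (- r\<^sup>2)" by (rule erfc_mills[OF assms])
 also have "... <= 3 * exp (- r\<^sup>2)" by simp
 finally show ?thesis by simp
qed

section \<open>Explicit solutions of the heat equation\<close>

definition gs :: "real => real => real" where "gs x t = exp (- (x\<^sup>2 / (4 * t)))"

definition hE :: "real => real => real" where
 "hE x t = (if t = 0 then 0 else erfc (x / (2 * sqrt t)))"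

definition hEx :: "real => real => real" where "hEx x t = - gs x t / (sqrt pi * sqrt t)"

text \<open>One function serves as the time derivative and as the second space derivative of
  \<open>hE\<close>; in this way the heat equation is used without being stated. In the same way
  \<open>hE\<close> serves for \<open>hZ\<close>.\<close>

definition hEt :: "real => real => real" where
 "hEt x t = x * gs x t / (2 * sqrt pi * t * sqrt t)"

definition hEtt :: "real => real => real" where
 "hEtt x t = hEt x t * (x^2 / (4 * t^2) - 3 / (2 * t))"

text \<open>The solution of the heat equation on the quarter plane with initial values \<open>0\<close>
 and boundary values \<open>t\<close>.\<close>

definition hZ :: "real => real => real" where
 "hZ x t = (t + x^2 / 2) * hE x t - x * (sqrt t / sqrt pi) * gs x t"

definition hZx :: "real => real => real" where
 "hZx x t = x * hE x t - 2 * (sqrt t / sqrt pi) * gs x t"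

lemma z0_eq: "z0 e b0 x t = exp (- b0 * t / e) * hE x t"
 by (simp add: z0_def hE_def)

lemma gs_x: "DERIV (%s. gs s t) x :> - x / (2 * t) * gs x t"
 unfolding gs_def by (cases "t = 0") (auto intro!: derivative_eq_intros simp: field_simps)

lemma gs_t: "0 < t ==> DERIV (%s. gs x s) t :> x^2 / (4 * t^2) * gs x t"
 unfolding gs_def by (auto intro!: derivative_eq_intros simp: field_simps power2_eq_square)

context
 fixes t :: real
 assumes t: "0 < t"
begin

lemma erfc_arg: "exp (- (x / (2 * sqrt t))\<^sup>2) = gs x t"
 using t by (simp add: gs_def power_divide power_mult_distrib)

lemma hE_x: "DERIV (%s. hE s t) x :> hEx x t"
proof -
 have "((%s. erfc (s / (2 * sqrt t))) has_real_derivative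
   (- 2 / sqrt pi * exp (- (x / (2 * sqrt t))\<^sup>2)) * (1 / (2 * sqrt t))) (at x)"
  by (rule DERIV_chain2[OF erfc_has_real_derivative]) (rule DERIV_cdivide[OF DERIV_ident])
 thus ?thesis using t by (simp add: hE_def hEx_def erfc_arg)
qed

lemma hE_t: "DERIV (%s. hE x s) t :> hEt x t"
proof -
 have "((%s. erfc (x / (2 * sqrt s))) has_real_derivative
   (- 2 / sqrt pi * exp (- (x / (2 * sqrt t))\<^sup>2)) * (- x / (4 * t * sqrt t))) (at t)"
  by (rule DERIV_chain2[OF erfc_has_real_derivative])
   (use t in \<open>auto intro!: derivative_eq_intros simp: field_simps real_sqrt_mult_self\<close>)
 moreover have "(- 2 / sqrt pi * exp (- (x / (2 * sqrt t))\<^sup>2)) * (- x / (4 * t * sqrt t)) = hEt x t"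
  unfolding erfc_arg hEt_def using t by (simp add: field_simps)
 ultimately have "DERIV (%s. erfc (x / (2 * sqrt s))) t :> hEt x t" by simp
 thus ?thesis
  by (rule has_field_derivative_transform_within_open[of _ _ _ "{0<..}"]) (use t in \<open>auto simp: hE_def\<close>)
qed

lemma hEx_x: "DERIV (%s. hEx s t) x :> hEt x t"
 unfolding hEx_def hEt_def using t
 by (auto intro!: derivative_eq_intros gs_x simp: field_simps)

lemma hEt_t: "DERIV (%s. hEt x s) t :> hEtt x t"
proof -
 \<comment> \<open>With \<open>t\<close> and \<open>pi\<close> written as squares, the identity that
   remains after differentiation is rational.\<close>
 define r p where "r = sqrt t" and "p = sqrt pi"
 have r: "r > 0" "t = r^2" "sqrt (r^2) = r" "p > 0" "pi = p^2" using t by (auto simp: r_def p_def)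
 show ?thesis
  unfolding hEtt_def hEt_def using t
  apply (auto intro!: derivative_eq_intros gs_t)
  unfolding p_def[symmetric] r(2,3) r(5) using r(1,4) by (simp add: field_simps power2_eq_square)
qed

lemma hZx_x: "DERIV (%s. hZx s t) x :> hE x t"
proof -
 define r p where "r = sqrt t" and "p = sqrt pi"
 have r: "r > 0" "t = r^2" "sqrt (r^2) = r" "p > 0" "pi = p^2" using t by (auto simp: r_def p_def)
 show ?thesis
  unfolding hZx_def using t
  apply (auto intro!: derivative_eq_intros gs_x hE_x simp: hEx_def)
  unfolding p_def[symmetric] r(2,3) r(5) using r(1,4) by (simp add: field_simps power2_eq_square)
qed

lemma hZ_x: "DERIV (%s. hZ s t) x :> hZx x t"
proof -
 define r p where "r = sqrt t" and "p = sqrt pi"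
 have r: "r > 0" "t = r^2" "sqrt (r^2) = r" "p > 0" "pi = p^2" using t by (auto simp: r_def p_def)
 show ?thesis
  unfolding hZ_def hZx_def using t
  apply (auto intro!: derivative_eq_intros gs_x hE_x simp: hEx_def)
  unfolding p_def[symmetric] r(2,3) r(5) using r(1,4) by (simp add: field_simps power2_eq_square)
qed

lemma hZ_t: "DERIV (%s. hZ x s) t :> hE x t"
proof -
 define r p where "r = sqrt t" and "p = sqrt pi"
 have r: "r > 0" "t = r^2" "sqrt (r^2) = r" "p > 0" "pi = p^2" using t by (auto simp: r_def p_def)
 show ?thesis
  unfolding hZ_def using t
  apply (auto intro!: derivative_eq_intros gs_t hE_t simp: hEt_def)
  unfolding p_def[symmetric] r(2,3) r(5) using r(1,4) by (simp add: field_simps power2_eq_square)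
qed

text \<open>The inequality \<open>1 + r / 16 \<le> exp (r / 16)\<close>, raised to the fourth power,
  trades the exponential for algebraic decay; \<open>65536 = 16^4\<close>.\<close>

lemma gs_le: "gs x t <= 65536 * (t / (t + x^2))^4"
proof -
 define r where "r = x^2 / t"
 have r: "r >= 0" using t by (simp add: r_def)
 have "(1 + r) / 16 <= 1 + r / 16" using r by simp
 also have "... <= exp (r / 16)" by (rule exp_ge_add_one_self)
 finally have "(1 + r) / 16 <= exp (r / 16)" .
 hence "((1 + r) / 16)^4 <= exp (r / 16)^4" using r by (intro power_mono) auto
 also have "... = exp (r / 4)" by (simp add: exp_of_nat_mult[symmetric])
 finally have "exp (- (r/4)) <= inverse (((1 + r) / 16)^4)"
  unfolding exp_minus using r by (intro le_imp_inverse_le) auto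
 also have "... = 65536 * (1 / (1 + r))^4" using r by (simp add: field_simps)
 also have "1 / (1 + r) = t / (t + x^2)" using t by (simp add: r_def field_simps)
 finally show ?thesis by (simp add: gs_def r_def mult.commute)
qed

text \<open>In powers of the ratio of \<open>sqrt t\<close> to the parabolic distance
  \<open>sqrt (t + x^2)\<close>. The exponent is chosen later so as to cancel the negative powers of
  \<open>t\<close> in the derivatives of \<open>hE\<close>.\<close>

lemma gs_le_power:
 assumes "n <= 8" shows "gs x t <= 65536 * (sqrt t / sqrt (t + x^2))^n"
proof -
 have "0 < t + x^2" using t by (simp add: add_pos_nonneg)
 hence "t / (t + x^2) = (sqrt t / sqrt (t + x^2))^2" using t by (simp add: power_divide)
 hence "(t / (t + x^2))^4 = (sqrt t / sqrt (t + x^2))^8"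
  by (simp only: power_mult[symmetric]) simp
 also have "... <= (sqrt t / sqrt (t + x^2))^n"
  by (rule power_decreasing[OF assms]) (use t in \<open>auto simp: divide_le_eq add_pos_nonneg\<close>)
 finally show ?thesis using gs_le[of x] by simp
qed

lemma hE_nonneg: "0 <= hE x t"
 by (simp add: hE_def erfc_nonneg)

lemma hE_le_gs: "0 <= x ==> hE x t <= 3 * gs x t"
 using erfc_le[of "x / (2 * sqrt t)"] t by (simp add: hE_def erfc_arg[symmetric])

lemma gs_pos: "0 < gs x t" by (simp add: gs_def)

context
 fixes x r d :: real
 assumes x: "0 <= x"
 defines "r \<equiv> sqrt t" and "d \<equiv> sqrt (t + x^2)"
begin

lemma rd: "0 < r" "0 < d" "r <= d" "x <= d" "r^2 = t" "d^2 = t + x^2" "sqrt t = r"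
proof -
 show "0 < r" "r^2 = t" "sqrt t = r" using t by (auto simp: r_def)
 have p: "0 < t + x^2" using t by (simp add: add_pos_nonneg)
 thus "0 < d" "d^2 = t + x^2" by (auto simp: d_def)
 show "r <= d" by (simp add: r_def d_def)
 show "x <= d" unfolding d_def by (rule real_le_rsqrt) (use t in simp)
qed

lemma gs_rd: "n <= 8 ==> gs x t <= 65536 * (r / d)^n"
 using gs_le_power[of n x] by (simp add: r_def d_def)

lemma sqrt_pi_ge_1: "1 <= sqrt pi" using pi_ge_two by simp

lemma hE_le: "hE x t <= 1000000 * (t / (t + x^2))^2"
proof -
 have "hE x t <= 3 * (65536 * (r / d)^4)"
  using hE_le_gs[OF x] gs_rd[of 4] by linarith
 also have "(r/d)^4 = (r^2 / d^2)^2" by (simp add: power_divide power_mult[symmetric])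
 also have "... = (t / (t + x^2))^2" by (simp only: rd(5,6))
 also have "3 * (65536 * (t / (t + x^2))^2) <= 1000000 * (t / (t + x^2))^2" by simp
 finally show ?thesis .
qed

lemma hEt_nonneg: "0 <= hEt x t"
 unfolding hEt_def using x t gs_pos[of x] by (auto intro!: mult_nonneg_nonneg divide_nonneg_nonneg less_imp_le)

text \<open>The exponent stays free because \<open>hEt\<close> is bounded with \<open>n = 3\<close>,
  while the further factor in \<open>hEtt\<close> brings four more negative powers of
  \<open>r\<close> and asks for \<open>n = 7\<close>.\<close>

lemma hEt_le_aux:
 assumes "n <= 8" shows "hEt x t <= 65536 * (r / d)^n * d / r^3"
proof -
 have "hEt x t = x * gs x t / (sqrt pi * (2 * r^3))"
  unfolding hEt_def rd(7) unfolding rd(5)[symmetric] by (simp add: power2_eq_square power3_eq_cube mult_ac)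
 also have "... <= x * gs x t / (1 * r^3)"
  using rd(1) sqrt_pi_ge_1 x gs_pos[of x] by (intro divide_left_mono mult_mono) auto
 also have "... <= d * (65536 * (r/d)^n) / (1 * r^3)"
  using rd x gs_rd[OF assms] gs_pos[of x] by (intro divide_right_mono mult_mono) auto
 finally show ?thesis by (simp add: mult_ac)
qed

lemma hEt_le: "abs (hEt x t) <= 1000000 / (t + x^2)"
proof -
 have "hEt x t <= 65536 * (r / d)^3 * d / r^3" by (rule hEt_le_aux) simp
 also have "... = 65536 / d^2" using rd(1,2) by (simp add: field_simps power2_eq_square power3_eq_cube)
 also have "... <= 1000000 / d^2" by (intro divide_right_mono) auto
 finally show ?thesis using hEt_nonneg rd(6) by simp
qed

lemma hEtt_le: "abs (hEtt x t) <= 1000000 / (t + x^2)^2"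
proof -
 have 1: "abs (x^2 / (4 * t^2) - 3 / (2 * t)) <= 2 * d^2 / r^4"
 proof -
  have "x^2 / (4 * t^2) - 3 / (2 * t) = (x^2 - 6 * t) / (4 * t^2)" using t by (simp add: field_simps power2_eq_square)
  hence "abs (x^2 / (4 * t^2) - 3 / (2 * t)) = abs (x^2 - 6 * t) / (4 * t^2)" by simp
  also have "... <= (8 * (t + x^2)) / (4 * t^2)" using t by (intro divide_right_mono) (auto simp: abs_if)
  also have "... = 2 * (t + x^2) / t^2" using t by (simp add: divide_simps)
  also have "... = 2 * d^2 / (r^2)^2" by (simp only: rd(5,6))
  finally show ?thesis by (simp add: power_mult[symmetric])
 qed
 have "abs (hEtt x t) = hEt x t * abs (x^2 / (4 * t^2) - 3 / (2 * t))"
  unfolding hEtt_def using hEt_nonneg by (simp add: abs_mult)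
 also have "... <= (65536 * (r / d)^7 * d / r^3) * (2 * d^2 / r^4)"
  using hEt_le_aux[of 7] hEt_nonneg rd(1,2) by (intro mult_mono 1) auto
 also have "... = 131072 / (d^2)^2" using rd(1,2) by (simp add: field_simps eval_nat_numeral)
 also have "... <= 1000000 / (d^2)^2" by (intro divide_right_mono) auto
 finally show ?thesis by (simp add: rd)
qed

lemma hEx_le: "abs (hEx x t) <= 1000000 / d"
proof -
 have "abs (hEx x t) = gs x t / (sqrt pi * r)" unfolding hEx_def rd(7) using gs_pos[of x] rd(1) by simp
 also have "... <= gs x t / (1 * r)" using rd(1) sqrt_pi_ge_1 gs_pos[of x] by (intro divide_left_mono mult_right_mono) auto
 also have "... <= (65536 * (r/d)^1) / (1 * r)" using gs_rd[of 1] rd(1) by (intro divide_right_mono) auto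
 also have "... <= 1000000 / d" using rd(1,2) by (simp add: field_simps)
 finally show ?thesis .
qed

lemma hZx_le: "abs (hZx x t) <= 1000000 * t / d"
proof -
 have a: "0 <= x * hE x t" "x * hE x t <= d * (3 * gs x t)"
  using x hE_nonneg[of x] hE_le_gs[OF x] rd(2,4) by (auto intro!: mult_mono)
 have "r / sqrt pi <= r / 1" using rd(1) sqrt_pi_ge_1 by (intro divide_left_mono) auto
 hence "r / sqrt pi <= d" using rd(3) by simp
 hence c: "0 <= (r / sqrt pi) * gs x t" "(r / sqrt pi) * gs x t <= d * gs x t"
  using mult_right_mono[OF \<open>r / sqrt pi <= d\<close>, of "gs x t"] rd(1) gs_pos[of x] by auto
 define A B C where "A = x * hE x t" and "B = r / sqrt pi * gs x t" and "C = d * gs x t"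
 have "0 <= A" "A <= 3 * C" "0 <= B" "B <= C" using a c by (simp_all add: A_def B_def C_def)
 moreover have "hZx x t = A - 2 * B" by (simp add: hZx_def rd(7) A_def B_def)
 ultimately have "abs (hZx x t) <= 5 * (d * gs x t)" unfolding C_def[symmetric] by linarith
 also have "... <= 5 * (d * (65536 * (r/d)^2))" using gs_rd[of 2] rd(2) by simp
 also have "... = 327680 * r^2 / d" using rd(1,2) by (simp add: field_simps power2_eq_square)
 also have "... <= 1000000 * r^2 / d" using rd(2) by (intro divide_right_mono) auto
 finally show ?thesis by (simp add: rd(5))
qed

lemma hZ_abs_le: "abs (hZ x t) <= 1000000 * t"
proof -
 have "t + x^2 / 2 <= d^2" by (simp add: rd(6))
 hence a: "0 <= (t + x^2/2) * hE x t" "(t + x^2/2) * hE x t <= d^2 * (3 * gs x t)"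
  using t hE_nonneg[of x] hE_le_gs[OF x] by (auto intro!: mult_mono mult_nonneg_nonneg)
 have "r / sqrt pi <= r / 1" using rd(1) sqrt_pi_ge_1 by (intro divide_left_mono) auto
 hence "r / sqrt pi <= d" using rd(3) by simp
 hence "x * (r / sqrt pi) <= d * d" using x rd(1,2,4) by (intro mult_mono) auto
 hence c: "0 <= x * (r / sqrt pi) * gs x t" "x * (r / sqrt pi) * gs x t <= d^2 * gs x t"
  using mult_right_mono[OF \<open>x * (r / sqrt pi) <= d * d\<close>, of "gs x t"] rd(1) x gs_pos[of x]
  by (auto simp: power2_eq_square)
 define A B C where "A = (t + x^2/2) * hE x t" and "B = x * (r / sqrt pi) * gs x t" and "C = d^2 * gs x t"
 have "0 <= A" "A <= 3 * C" "0 <= B" "B <= C" using a c by (simp_all add: A_def B_def C_def)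
 moreover have "hZ x t = A - B" by (simp add: hZ_def rd(7) A_def B_def)
 ultimately have "abs (hZ x t) <= 4 * (d^2 * gs x t)" unfolding C_def[symmetric] by linarith
 also have "... <= 4 * (d^2 * (65536 * (r/d)^2))" using gs_rd[of 2] by (intro mult_left_mono) auto
 also have "... = 262144 * r^2" using rd(1,2) by (simp add: field_simps power2_eq_square)
 also have "... <= 1000000 * r^2" by simp
 finally show ?thesis by (simp add: rd(5))
qed

text \<open>By Mills' inequality at \<open>x / (2 * r)\<close>, the Gaussian term of
  \<open>hZ\<close> outweighs \<open>x^2 / 2 * hE x t\<close>.\<close>

lemma hZ_le: "hZ x t <= t * hE x t"
proof -
 have "sqrt pi * (x / (2*r)) * hE x t <= gs x t"
  using erfc_mills[of "x / (2*r)"] x rd(1) t erfc_arg[of x] by (simp add: hE_def rd(7))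
 hence "(x * r / sqrt pi) * (sqrt pi * (x / (2*r)) * hE x t) <= (x * r / sqrt pi) * gs x t"
  using x rd(1) by (intro mult_left_mono) auto
 moreover have "(x * r / sqrt pi) * (sqrt pi * (x / (2*r)) * hE x t) = x^2 / 2 * hE x t"
  using rd(1) by (simp add: field_simps power2_eq_square)
 ultimately have "x^2 / 2 * hE x t <= x * (r / sqrt pi) * gs x t" by (simp only:) simp
 thus ?thesis by (simp add: hZ_def rd(7) algebra_simps)
qed

end

end

lemma hZ_t0 [simp]: "hZ x 0 = 0" "hE x 0 = 0"
 by (simp_all add: hZ_def hE_def)

lemma hZ_abs_le': "0 <= x ==> 0 <= t ==> abs (hZ x t) <= 1000000 * t"
 using hZ_abs_le[of t x] by (cases "t = 0") auto

lemma hZ_x0: "0 <= t ==> hZ 0 t = t"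
 by (auto simp: hZ_def hE_def erfc_0)

text \<open>At \<open>t = 0\<close>, where the formula is singular, the bound by a multiple of
  \<open>t\<close> yields the limit.\<close>

lemma hZ_continuous: "continuous_on ({0..} \<times> {0..}) (%(x,t). hZ x t)"
 unfolding continuous_on_def
proof (intro ballI)
 fix p :: "real \<times> real" assume p: "p \<in> {0..} \<times> {0..}"
 obtain x t where pe: "p = (x,t)" by (cases p)
 show "((%(x,t). hZ x t) \<longlongrightarrow> (case p of (x,t) => hZ x t)) (at p within {0..} \<times> {0..})"
 proof (cases "t = 0")
  case True
  have "((%q::real\<times>real. 1000000 * snd q) \<longlongrightarrow> 1000000 * snd p) (at p within {0..} \<times> {0..})"
   by (intro tendsto_intros)
  hence l: "((%q::real\<times>real. 1000000 * snd q) \<longlongrightarrow> 0) (at p within {0..} \<times> {0..})"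
   using pe True by simp
  have "((%(x,t). hZ x t) \<longlongrightarrow> 0) (at p within {0..} \<times> {0..})"
   by (rule Lim_null_comparison[OF _ l], unfold eventually_at_filter, rule always_eventually) (auto simp: hZ_abs_le')
  thus ?thesis using pe True by simp
 next
  case False
  hence t: "t > 0" using p pe by auto
  have "continuous_on (UNIV \<times> {0<..}) (%q. (snd q + (fst q)^2 / 2) * erfc (fst q / (2 * sqrt (snd q)))
    - fst q * (sqrt (snd q) / sqrt pi) * exp (- ((fst q)\<^sup>2 / (4 * snd q))))"
  proof -
   have "continuous_on UNIV erfc"
    by (rule continuous_at_imp_continuous_on) (use erfc_has_real_derivative DERIV_isCont in blast)
   hence c: "continuous_on S (%q. erfc (h q))" if "continuous_on S h" for S :: "(real\<times>real) set" and h
    using continuous_on_compose2[of UNIV erfc S h] that by auto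
   show ?thesis by (intro continuous_intros c) auto
  qed
  hence "isCont (%q. (snd q + (fst q)^2 / 2) * erfc (fst q / (2 * sqrt (snd q)))
    - fst q * (sqrt (snd q) / sqrt pi) * exp (- ((fst q)\<^sup>2 / (4 * snd q)))) p"
   using t pe by (subst (asm) continuous_on_eq_continuous_at) (auto intro!: open_Times)
  moreover have "\<forall>\<^sub>F q in nhds p. (snd q + (fst q)^2 / 2) * erfc (fst q / (2 * sqrt (snd q)))
    - fst q * (sqrt (snd q) / sqrt pi) * exp (- ((fst q)\<^sup>2 / (4 * snd q))) = (%(x,t). hZ x t) q"
  proof -
   have "\<forall>\<^sub>F q in nhds p. q \<in> UNIV \<times> {0<..}"
    by (rule eventually_nhds_in_open) (use t pe in \<open>auto intro!: open_Times\<close>)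
   thus ?thesis by eventually_elim (auto simp: hZ_def hE_def gs_def)
  qed
  ultimately have "isCont (%(x,t). hZ x t) p" by (rule isCont_cong[THEN iffD1, rotated])
  hence "continuous (at p within {0..} \<times> {0..}) (%(x,t). hZ x t)"
   by (rule continuous_at_imp_continuous_at_within)
  thus ?thesis unfolding continuous_within .
 qed
qed

text \<open>\<open>hZ\<close> vanishes initially, and its time derivative \<open>hE\<close> is
  nonnegative.\<close>

lemma hZ_nonneg:
 assumes "0 <= x" "0 <= t" shows "0 <= hZ x t"
proof (cases "t = 0")
 case False
 hence t: "0 < t" using assms by simp
 have "continuous_on {0..t} (%s. hZ x s)"
 proof -
  have "continuous_on {0..t} (Pair x)" by (intro continuous_intros)
  thus ?thesis using continuous_on_compose2[OF hZ_continuous, of "{0..t}" "Pair x"] assms by (auto simp: image_subset_iff)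
 qed
 then obtain z where "0 < z" "z < t" "hZ x t - hZ x 0 = (t - 0) * hE x z"
  by (rule MVT_open[OF t]) (use hZ_t in auto)
 thus ?thesis using hE_nonneg[of z x] t by (simp add: zero_le_mult_iff)
qed simp

section \<open>Barrier functions and regularity in space\<close>

definition bl :: "real => real => real => real" where
 "bl e be x = exp (- (sqrt (be / e) * x)) + exp (- (sqrt (be / e) * (1 - x)))"

definition il :: "real => real => real => real" where
 "il e be t = exp (- (be * t / e))"

text \<open>A bounded function to which the heat operator assigns a value of the size of
 \<open>1 / (t + x^2)\<close>; it absorbs the singularity at the corner \<open>(0, 0)\<close>.\<close>

definition psi :: "real => real => real" where
 "psi x t = t / (t + x^2 / 12)"

lemma bl_pos: "0 < bl e be x" unfolding bl_def by (intro add_pos_pos) auto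

lemma bl_le_2: "0 < e ==> 0 < be ==> x \<in> Icc ==> bl e be x <= 2"
 unfolding bl_def by (rule order_trans[OF add_mono[of _ 1 _ 1]]) auto

lemma bl_ge_1: "x = 0 \<or> x = 1 ==> 1 <= bl e be x"
 unfolding bl_def by auto

text \<open>A Harnack type inequality: over a distance of order \<open>sqrt e\<close> the layer
  function changes by a bounded factor only.\<close>

lemma bl_shift:
 assumes "0 < e" "0 < be"
 shows "bl e be y <= exp (sqrt (be / e) * abs (y - x)) * bl e be x"
proof -
 define r where "r = sqrt (be / e)"
 have r: "0 <= r" using assms by (simp add: r_def)
 have "r * (x - y) <= r * abs (y - x)" "r * (y - x) <= r * abs (y - x)"
  by (rule mult_left_mono[OF _ r], simp)+
 hence "- (r * y) <= r * abs (y - x) + - (r * x)" "- (r * (1 - y)) <= r * abs (y - x) + - (r * (1 - x))"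
  by (simp_all add: right_diff_distrib)
 thus ?thesis
  unfolding bl_def r_def[symmetric] distrib_left exp_add[symmetric] by (intro add_mono) simp_all
qed

lemma il_pos: "0 < il e be t" by (simp add: il_def)

lemma il_0 [simp]: "il e be 0 = 1" by (simp add: il_def)

lemma il_mono: "0 < e ==> 0 < be ==> s <= t ==> il e be t <= il e be s"
 by (simp add: il_def divide_right_mono)

lemma il_le_1: "0 < e ==> 0 < be ==> 0 <= t ==> il e be t <= 1"
 using il_mono[of e be 0 t] by simp

lemma psi_bounds:
 assumes "0 <= t" shows "0 <= psi x t" "psi x t <= 1"
proof -
 obtain a where a: "t + x^2 / 12 = a" "t <= a" by simp
 thus "0 <= psi x t" "psi x t <= 1"
  unfolding psi_def a(1) using assms by (auto simp: divide_le_eq_1)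
qed

lemma solves_product:
 assumes "!!t. t \<in> {0<..T} ==> DERIV p t :> p' t"
  and "!!x. x \<in> Ioo ==> DERIV q x :> q' x"
  and "!!x. x \<in> Ioo ==> DERIV q' x :> q'' x"
 shows "solves T e b (%x t. p t * q x) (%x t. e * (p' t * q x - p t * q'' x) + b x t * (p t * q x))"
proof (rule solvesI)
 show "heat_deriv T (%x t. p t * q x) (%x t. p t * q' x) (%x t. p t * q'' x) (%x t. p' t * q x)"
  unfolding heat_deriv_def
  by (intro ballI conjI DERIV_cmult DERIV_cmult_right assms has_field_derivative_at_within)
qed auto

lemma bl_x: "(bl e be has_real_derivative
  sqrt (be / e) * (exp (- (sqrt (be / e) * (1 - x))) - exp (- (sqrt (be / e) * x)))) (at x)"
 unfolding bl_def by (auto intro!: derivative_eq_intros simp: algebra_simps)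

lemma bl_xx:
 assumes "0 < e" "0 < be"
 shows "DERIV ((%x. sqrt (be / e) * (exp (- (sqrt (be / e) * (1 - x))) - exp (- (sqrt (be / e) * x))))
 ) x :> be / e * bl e be x"
proof -
 define r where "r = sqrt (be / e)"
 have "be / e = r * r" using assms by (simp add: r_def)
 thus ?thesis unfolding bl_def r_def[symmetric]
  by (auto intro!: derivative_eq_intros simp: algebra_simps)
qed

lemma psi_x:
 assumes "0 < t"
 shows "DERIV (%x. psi x t) x :> - (t * x) / (6 * (t + x^2/12)^2)"
  and "((%x. - (t * x) / (6 * (t + x^2/12)^2)) has_real_derivative
   (t * (x^2 / 18) / (t + x^2/12)^3 - t / (6 * (t + x^2/12)^2))) (at x)"
  and "DERIV (%t. psi x t) t :> (x^2 / 12) / (t + x^2/12)^2"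
proof -
 define a where "a = t + x^2 / 12"
 have a: "a > 0" "t + x^2/12 = a" using assms by (auto simp: a_def add_pos_nonneg)
 show "DERIV (%x. psi x t) x :> - (t * x) / (6 * (t + x^2/12)^2)"
  unfolding psi_def using a by (auto intro!: derivative_eq_intros simp: field_simps power2_eq_square)
 have "((%x. - (t * x) / (6 * (t + x^2/12)^2)) has_real_derivative
  ((- t) * (6 * a\<^sup>2) - (- (t * x)) * (6 * (2 * a * (x / 6)))) / ((6 * a\<^sup>2) * (6 * a^2))) (at x)"
 proof -
  have 1: "DERIV (%x. - (t * x)) x :> - t" by (auto intro!: derivative_eq_intros)
  have 2: "DERIV (%x. 6 * (t + x^2/12)^2) x :> 6 * (2 * (t + x^2/12) * (x / 6))"
   by (auto intro!: derivative_eq_intros simp: algebra_simps)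
  show ?thesis using DERIV_divide[OF 1 2] a(1) unfolding a(2) by simp
 qed
 moreover have "((- t) * (6 * a\<^sup>2) - (- (t * x)) * (6 * (2 * a * (x / 6)))) / ((6 * a\<^sup>2) * (6 * a^2)) =
  t * (x^2 / 18) / a^3 - t / (6 * a^2)"
  using a(1) by (simp add: field_simps power2_eq_square power3_eq_cube)
 ultimately show "((%x. - (t * x) / (6 * (t + x^2/12)^2)) has_real_derivative
   (t * (x^2 / 18) / (t + x^2/12)^3 - t / (6 * (t + x^2/12)^2))) (at x)"
  unfolding a(2) by simp
 show "DERIV (%t. psi x t) t :> (x^2 / 12) / (t + x^2/12)^2"
  unfolding psi_def using a by (auto intro!: derivative_eq_intros simp: power2_eq_square)
qed

text \<open>Over the denominator \<open>a^3\<close>, the numerator exceeds \<open>a^2 / 6\<close> by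
  \<open>5 / 6 * u^2 + t * u / 6\<close>. The \<open>12\<close> in \<open>psi\<close> makes the
  coefficient of the mixed term \<open>t * u\<close> positive; it would become negative for too
  small a constant.\<close>

lemma psi_heat:
 fixes x t :: real
 assumes t: "0 < t"
 shows "1 / (6 * (t + x^2)) <= (x^2 / 12) / (t + x^2/12)^2 - (t * (x^2 / 18) / (t + x^2/12)^3 - t / (6 * (t + x^2/12)^2))"
proof -
 define u where "u = x^2 / 12"
 define a where "a = t + u"
 have u: "u >= 0" "x^2 / 18 = 2 * u / 3" "x^2 = 12 * u" by (auto simp: u_def)
 have a: "a > 0" using t u by (simp add: a_def)
 have "1 / (6 * (t + x^2)) <= 1 / (6 * a)" using t u by (intro divide_left_mono) (auto simp: a_def)
 also have "... = (a^2 / 6) / a^3" using a by (simp add: field_simps power2_eq_square power3_eq_cube)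
 also have "... <= (u * a + t * a / 6 - t * (2 * u / 3)) / a^3"
 proof (rule divide_right_mono)
  have "u * a + t * a / 6 - t * (2 * u / 3) - a^2 / 6 = u * u * (5 / 6) + t * u / 6"
   by (simp add: a_def field_simps power2_eq_square)
  moreover have "0 <= u * u * (5 / 6) + t * u / 6" using t u by simp
  ultimately show "a^2 / 6 <= u * a + t * a / 6 - t * (2 * u / 3)" by linarith
 qed (use a in simp)
 also have "... = u / a^2 - (t * (2 * u / 3) / a^3 - t / (6 * a^2))"
  using a by (simp add: field_simps power2_eq_square power3_eq_cube)
 finally show ?thesis unfolding u(2) unfolding u_def[symmetric] a_def[symmetric] .
qed

text \<open>The factor \<open>il e be t\<close> lets the barrier decay with the initial layer. Its
  time derivative costs \<open>be\<close> times the barrier, and the reaction term pays for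
  that.\<close>

lemma solves_corner:
 assumes "0 < e" "0 < be"
 shows "\<exists>G. solves T e b (%x t. il e be t * psi x t) G \<and>
  (\<forall>x\<in>Ioo. \<forall>t\<in>{0<..T}. be <= b x t --> e * il e be t / (6 * (t + x^2)) <= G x t)"
proof -
 let ?px = "%x t. - (t * x) / (6 * (t + x^2/12)^2)"
 let ?pxx = "%x t. t * (x^2 / 18) / (t + x^2/12)^3 - t / (6 * (t + x^2/12)^2)"
 let ?pt = "%x t. (x^2 / 12) / (t + x^2/12)^2"
 have il': "DERIV (il e be) t :> - (be / e) * il e be t" for t
  unfolding il_def using assms by (auto intro!: derivative_eq_intros)
 have h: "heat_deriv T (%x t. il e be t * psi x t) (%x t. il e be t * ?px x t) (%x t. il e be t * ?pxx x t)
  (%x t. - (be / e) * il e be t * psi x t + ?pt x t * il e be t)"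
  unfolding heat_deriv_def
  by (intro ballI conjI DERIV_cmult psi_x has_field_derivative_at_within[OF DERIV_mult[OF il' psi_x(3)]]) auto
 show ?thesis
 proof (intro exI conjI ballI impI)
  show "solves T e b (%x t. il e be t * psi x t) (%x t. e * ((- (be / e) * il e be t * psi x t + ?pt x t * il e be t)
   - il e be t * ?pxx x t) + b x t * (il e be t * psi x t))"
   by (rule solvesI[OF h]) simp
  fix x t assume x: "x \<in> Ioo" and t: "t \<in> {0<..T}" and b: "be <= b x t"
  have "e * il e be t / (6 * (t + x^2)) = e * il e be t * (1 / (6 * (t + x^2)))" by simp
  also have "... <= e * il e be t * (?pt x t - ?pxx x t)"
   using assms il_pos[of e be t] t by (intro mult_left_mono psi_heat) auto
  also have "... <= e * il e be t * (?pt x t - ?pxx x t) + (b x t - be) * (il e be t * psi x t)"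
   using b il_pos[of e be t] psi_bounds(1)[of t x] t by auto
  also have "... = e * ((- (be / e) * il e be t * psi x t + ?pt x t * il e be t)
   - il e be t * ?pxx x t) + b x t * (il e be t * psi x t)"
  proof -
   have "e * ee * (P - Q) + (bb - be) * (ee * s) = e * ((- (be / e) * ee * s + P * ee) - ee * Q) + bb * (ee * s)"
    for ee P Q bb s using assms by (simp add: field_simps)
   thus ?thesis .
  qed
  finally show "e * il e be t / (6 * (t + x^2)) <= e * ((- (be / e) * il e be t * psi x t + ?pt x t * il e be t)
   - il e be t * ?pxx x t) + b x t * (il e be t * psi x t)" .
 qed
qed

text \<open>Meant for \<open>e\<close> times a second space derivative of the regular part, which is
  not known to be twice differentiable itself but is a limit of such functions. Size, Lipschitz
  constants and second differences survive the limit, and the two weights are the expected sizes of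
  the function and of its second derivative.\<close>

definition xreg :: "real => real => real => (real => real) => bool" where
 "xreg e be C w \<longleftrightarrow> (\<exists>u u1 u2. \<forall>x\<in>Ioo. (%n. u n x) \<longlonglongrightarrow> w x \<and>
  (\<forall>n::nat. DERIV (u n) x :> u1 n x \<and> DERIV (u1 n) x :> u2 n x \<and>
   (abs (u n x)) <= C * (bl e be x + e) \<and> (abs (u2 n x)) <= C * (1 + bl e be x / e)))"

text \<open>Landau's inequality on an interval of length \<open>sqrt e / 4\<close>. On this scale
  the two bounds balance, and \<open>bl\<close> changes at most by the factor
  \<open>exp (sqrt be)\<close>.\<close>

lemma xreg_deriv_bound:
 fixes u :: "real => real"
 assumes eps: "0 < e" "e <= 1" "0 < be"
  and u1: "!!x. x \<in> Ioo ==> DERIV u x :> u1 x"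
  and u2: "!!x. x \<in> Ioo ==> DERIV u1 x :> u2 x"
  and M0: "!!x. x \<in> Ioo ==> abs (u x) <= C * (bl e be x + e)"
  and M2: "!!x. x \<in> Ioo ==> abs (u2 x) <= C * (1 + bl e be x / e)"
  and x: "x \<in> Ioo"
 shows "abs (u1 x) <= 9 * exp (sqrt be) * C * (sqrt e + bl e be x / sqrt e)"
proof -
 define r l where "r = sqrt e" and "l = sqrt e / 4"
 have r: "0 < r" "e = r * r" "r <= 1" "0 < l" "l <= 1/4" "l = r / 4" using eps by (auto simp: r_def l_def)
 \<comment> \<open>The interval extends from \<open>x\<close> towards the middle, so that it stays
   inside the open unit interval.\<close>
 define a where "a = (if x <= 1/2 then x else x - l)"
 have sub: "{a..a+l} \<subseteq> Ioo" and xa: "x \<in> {a..a+l}" using x r by (auto simp: a_def)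
 define k where "k = exp (sqrt be)"
 have k: "1 <= k" using eps by (simp add: k_def)
 define B where "B = bl e be x"
 have B0: "0 < B" by (simp add: B_def bl_pos)
 have "0 <= C * (bl e be x + e)" using M0[OF x] by linarith
 moreover have "0 < bl e be x + e" using add_pos_pos[OF bl_pos eps(1)] .
 ultimately have C0: "0 <= C" by (metis not_le mult_neg_pos)
 have By: "bl e be y <= k * B" if y: "y \<in> {a..a+l}" for y
 proof -
  have "abs (y - x) <= r" using y xa r by auto
  hence "sqrt (be / e) * abs (y - x) <= sqrt (be / e) * r" using eps by (intro mult_left_mono) auto
  also have "... = sqrt be" using r(1) eps by (simp add: r_def real_sqrt_divide)
  finally have "exp (sqrt (be / e) * abs (y - x)) <= k" by (simp add: k_def)
  hence "exp (sqrt (be / e) * abs (y - x)) * bl e be x <= k * B"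
   unfolding B_def using bl_pos[of e be x] by (intro mult_right_mono) auto
  thus ?thesis using bl_shift[OF eps(1,3), of y x] by linarith
 qed
 have "abs (u1 x) <= 2 * (C * (k * B + e)) / l + (C * (1 + k * B / e)) * l"
 proof (rule landau_inequality[OF r(4) _ _ _ _ xa])
  fix y assume y: "y \<in> {a..a+l}"
  hence y': "y \<in> Ioo" using sub by auto
  show "DERIV u y :> u1 y" "DERIV u1 y :> u2 y" using u1 u2 y' by auto
  have "C * (bl e be y + e) <= C * (k * B + e)" using By[OF y] C0 by (intro mult_left_mono) auto
  thus "abs (u y) <= C * (k * B + e)" using M0[OF y'] by linarith
  have "C * (1 + bl e be y / e) <= C * (1 + k * B / e)" using By[OF y] C0 eps
   by (intro mult_left_mono add_left_mono divide_right_mono) auto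
  thus "abs (u2 y) <= C * (1 + k * B / e)" using M2[OF y'] by linarith
 qed
 also have "... = C * (8 * k * (B / r) + 8 * r + r / 4 + k * (B / r) / 4)"
  unfolding r(6) r(2) using r(1) by (simp add: field_simps)
 also have "... <= C * (9 * k * (r + B / r))"
 proof (rule mult_left_mono[OF _ C0])
  define P where "P = B / r"
  have "0 < P" using B0 r by (simp add: P_def)
  hence "0 < k * P" using k by (intro mult_pos_pos) auto
  moreover have "r <= k * r" using k r by simp
  ultimately have "8 * (k * P) + 8 * r + r / 4 + k * P / 4 <= 9 * (k * r) + 9 * (k * P)"
   using r(1) by linarith
  hence "8 * k * P + 8 * r + r / 4 + k * P / 4 <= 9 * k * (r + P)" by (simp add: algebra_simps)
  thus "8 * k * (B / r) + 8 * r + r / 4 + k * (B / r) / 4 <= 9 * k * (r + B / r)" by (simp add: P_def)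
 qed
 finally show ?thesis by (simp add: k_def B_def r_def mult_ac)
qed

lemma xreg_bound:
 assumes "xreg e be C w" "x \<in> Ioo"
 shows "abs (w x) <= C * (bl e be x + e)"
proof -
 from assms obtain u where u: "(%n::nat. u n x) \<longlonglongrightarrow> w x" "!!n. abs (u n x) <= C * (bl e be x + e)"
  unfolding xreg_def by blast
 show ?thesis by (rule tendsto_upperbound[OF tendsto_rabs[OF u(1)] always_eventually]) (use u(2) in auto)
qed

lemma xreg_second_difference:
 assumes w: "xreg e be C w" and s: "0 < s" "0 < x - s" "x + s < 1"
  and B: "!!y. x - s <= y ==> y <= x + s ==> C * (1 + bl e be y / e) <= K"
 shows "abs (w (x+s) - 2 * w x + w (x - s)) <= K * s^2"
proof -
 from w obtain u u1 u2 where u: "!!x. x \<in> Ioo ==> (%n::nat. u n x) \<longlonglongrightarrow> w x"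
  "!!x n. x \<in> Ioo ==> DERIV (u n) x :> u1 n x"
  "!!x n. x \<in> Ioo ==> DERIV (u1 n) x :> u2 n x"
  "!!x n. x \<in> Ioo ==> abs (u2 n x) <= C * (1 + bl e be x / e)"
  unfolding xreg_def by metis
 have "(%n. abs (u n (x+s) - 2 * u n x + u n (x - s))) \<longlonglongrightarrow> (abs (w (x+s) - 2 * w x + w (x - s)))"
  by (intro tendsto_intros u) (use s in auto)
 moreover have "abs (u n (x+s) - 2 * u n x + u n (x - s)) <= K * s^2" for n
 proof -
  have "abs (u n ((x - s) + 2 * s) - 2 * u n ((x - s)+s) + u n (x - s)) <= K * s^2"
  proof (rule second_difference_le[where ?g1.0="u1 n" and ?g2.0="u2 n"])
   show "continuous_on {x - s..x - s+2 * s} (u n)"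
    by (rule DERIV_continuous_on_Icc[where f'="u1 n"]) (use u s in auto)
   fix y assume y: "x - s < y" "y < x - s + 2 * s"
   show "abs (u2 n y) <= K" using u(4)[of y n] B[of y] y s by force
  qed (use u s in auto)
  thus ?thesis by (simp add: algebra_simps)
 qed
 ultimately show ?thesis by (intro tendsto_upperbound[OF _ always_eventually]) auto
qed

lemma xreg_lipschitz:
 assumes w: "xreg e be C w" and eps: "0 < e" "e <= 1" "0 < be" and yx: "y \<in> Ioo" "x \<in> Ioo"
  and B: "!!z. min x y <= z ==> z <= max x y ==> 9 * exp (sqrt be) * C * (sqrt e + bl e be z / sqrt e) <= K"
 shows "abs (w y - w x) <= K * abs (y - x)"
proof -
 from w obtain u u1 u2 where u: "!!x. x \<in> Ioo ==> (%n::nat. u n x) \<longlonglongrightarrow> w x"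
  "!!x n. x \<in> Ioo ==> DERIV (u n) x :> u1 n x"
  "!!x n. x \<in> Ioo ==> DERIV (u1 n) x :> u2 n x"
  "!!x n. x \<in> Ioo ==> abs (u n x) <= C * (bl e be x + e)"
  "!!x n. x \<in> Ioo ==> abs (u2 n x) <= C * (1 + bl e be x / e)"
  unfolding xreg_def by metis
 have "(%n. abs (u n y - u n x)) \<longlonglongrightarrow> (abs (w y - w x))"
  by (intro tendsto_intros u yx)
 moreover have "abs (u n y - u n x) <= K * abs (y - x)" for n
 proof -
  have *: "abs (u n c - u n a) <= K * (c - a)" if "a <= c" "a = min x y" "c = max x y" for a c
  proof (rule abs_diff_le_deriv[OF that(1), where f'="u1 n"])
   show "continuous_on {a..c} (u n)"
    by (rule DERIV_continuous_on_Icc[where f'="u1 n"], rule u(2)) (use yx that in \<open>auto simp: min_def max_def split: if_splits\<close>)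
   fix z assume z: "a < z" "z < c"
   hence z': "z \<in> Ioo" using that yx by auto
   show "DERIV (u n) z :> u1 n z" using u z' by auto
   have "abs (u1 n z) <= 9 * exp (sqrt be) * C * (sqrt e + bl e be z / sqrt e)"
    by (rule xreg_deriv_bound[OF eps u(2,3,4,5) z'])
   thus "abs (u1 n z) <= K" using B[of z] z that by auto
  qed
  show ?thesis using *[of "min x y" "max x y"] by (auto simp: min_def max_def abs_minus_commute abs_if split: if_splits)
 qed
 ultimately show ?thesis by (intro tendsto_upperbound[OF _ always_eventually]) auto
qed

lemma xreg_add:
 assumes "xreg e be C w" "xreg e be C' w'"
 shows "xreg e be (C + C') (%x. w x + w' x)"
proof -
 from assms(1) obtain u u1 u2 where u: "!!x. x \<in> Ioo ==> (%n::nat. u n x) \<longlonglongrightarrow> w x \<and>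
  (\<forall>n::nat. DERIV (u n) x :> u1 n x \<and> DERIV (u1 n) x :> u2 n x \<and>
   (abs (u n x)) <= C * (bl e be x + e) \<and> (abs (u2 n x)) <= C * (1 + bl e be x / e))"
  unfolding xreg_def by blast
 from assms(2) obtain v v1 v2 where v: "!!x. x \<in> Ioo ==> (%n::nat. v n x) \<longlonglongrightarrow> w' x \<and>
  (\<forall>n::nat. DERIV (v n) x :> v1 n x \<and> DERIV (v1 n) x :> v2 n x \<and>
   (abs (v n x)) <= C' * (bl e be x + e) \<and> (abs (v2 n x)) <= C' * (1 + bl e be x / e))"
  unfolding xreg_def by blast
 show ?thesis unfolding xreg_def
 proof (rule exI[of _ "%n x. u n x + v n x"], rule exI[of _ "%n x. u1 n x + v1 n x"],
   rule exI[of _ "%n x. u2 n x + v2 n x"], intro ballI conjI allI)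
  fix x assume x: "x \<in> {0<..<1::real}"
  show "(%n. u n x + v n x) \<longlonglongrightarrow> w x + w' x" using u[OF x] v[OF x] by (intro tendsto_add) auto
 next
  fix x n assume x: "x \<in> {0<..<1::real}"
  note uv = u[OF x] v[OF x]
  show "DERIV (%x. u n x + v n x) x :> u1 n x + v1 n x"
   "DERIV (%x. u1 n x + v1 n x) x :> u2 n x + v2 n x" using uv by (auto intro: DERIV_add)
  have "abs (u n x) <= C * (bl e be x + e)" "abs (v n x) <= C' * (bl e be x + e)" using uv by auto
  thus "abs (u n x + v n x) <= (C + C') * (bl e be x + e)" unfolding distrib_right by linarith
  have "abs (u2 n x) <= C * (1 + bl e be x / e)" "abs (v2 n x) <= C' * (1 + bl e be x / e)" using uv by auto
  thus "abs (u2 n x + v2 n x) <= (C + C') * (1 + bl e be x / e)" unfolding distrib_right by linarith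
 qed
qed

section \<open>A priori estimates\<close>

lemma bl_continuous [continuous_intros]: "continuous_on S f ==> continuous_on S (%x. bl e be (f x))"
 unfolding bl_def by (intro continuous_intros)

lemma il_continuous [continuous_intros]: "continuous_on S f ==> continuous_on S (%x. il e be (f x))"
 unfolding il_def divide_inverse by (intro continuous_intros)

lemma solves_cong:
 assumes "solves T e b u F" "!!x t. x \<in> Ioo ==> t \<in> {0<..T} ==> F x t = G x t"
 shows "solves T e b u G"
proof -
 from assms(1) obtain ux uxx ut where "heat_deriv T u ux uxx ut"
  and "!!x t. x\<in>Ioo ==> t\<in>{0<..T} ==> e * (ut x t - uxx x t) + b x t * u x t = F x t"
  unfolding solves_def by blast
 thus ?thesis by (intro solvesI[of T u ux uxx ut]) (simp_all add: assms(2))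
qed

text \<open>\<open>e\<close> does not occur here, so the constants below are uniform in it. Those of
  the comparison arguments add up what is required: a quotient by \<open>be\<close> where the full
  reaction term dominates a source, a quotient by \<open>\<delta>\<close> where only the excess
  \<open>b - be\<close> is left.\<close>

locale layer_constants =
 fixes be \<delta> K :: real
 assumes beta_pos: "0 < be" and delta_pos: "0 < \<delta>" and K_ge_1: "1 <= K"
begin

definition "C1 = 3 * K / be + 2 * K"
definition "C0 = K + 3 * C1"
definition "C2 = (K + K^2) / be + K"
definition "C3 = K + K^2"
definition "C4 = (K + K * C0) / be + C2 + 2 * K"
definition "C5 = (K + K * C0) / be + 2 * C2 + 2 * C0 + K"
definition "C6 = (2 * K + 2 * K * C4 + K * C0) / be + 2 * K * C4 / \<delta> + 6 * K + 6 * C3"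
definition "C7 = (K + 2 * K * C5 + K * C0) / be + (K + 2 * K * C5) / \<delta> + 6 * K + 18 * C3"
definition "C8 = C4 + K * C1 + K"
definition "C9 = 9 * exp (sqrt be) * (C1 + C8 + K)"
definition "C10 = 2 * C6 + K * C4 + K * C0 + K + K * C1 + 2 * K * C9 + K * (C8 + K) + K + C8"

lemma C1: "0 <= C1" "3 * K <= C1 * be" "2 * K <= C1"
 using beta_pos K_ge_1 by (auto simp: C1_def distrib_right)
lemma C0: "0 <= C0" "K <= C0" using C1 K_ge_1 by (auto simp: C0_def)
lemma C2: "0 <= C2" "K + K^2 <= C2 * be" "K <= C2"
proof -
 have *: "0 <= (K + K^2) / be" using beta_pos K_ge_1 by auto
 thus "0 <= C2" "K <= C2" unfolding C2_def using K_ge_1 by linarith+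
 have "(K + K^2) / be <= C2" unfolding C2_def using K_ge_1 by simp
 thus "K + K^2 <= C2 * be" using beta_pos by (simp add: pos_divide_le_eq)
qed
lemma C3: "0 <= C3" "K <= C3" using K_ge_1 by (auto simp: C3_def)
lemma C4: "0 <= C4" "K + K * C0 <= C4 * be" "C2 <= C4" "2 * K <= C4"
proof -
 have *: "0 <= (K + K * C0) / be" using beta_pos K_ge_1 C0(1) by auto
 thus "0 <= C4" "C2 <= C4" "2 * K <= C4" unfolding C4_def using K_ge_1 C2(1) by linarith+
 have "(K + K * C0) / be <= C4" unfolding C4_def using K_ge_1 C2(1) by simp
 thus "K + K * C0 <= C4 * be" using beta_pos by (simp add: pos_divide_le_eq)
qed
lemma C5: "0 <= C5" "K + K * C0 <= C5 * be" "2 * C2 <= C5" "2 * C0 <= C5" "K <= C5"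
proof -
 have *: "0 <= (K + K * C0) / be" using beta_pos K_ge_1 C0(1) by auto
 thus "0 <= C5" "2 * C2 <= C5" "2 * C0 <= C5" "K <= C5"
  unfolding C5_def using K_ge_1 C2(1) C0(1) by linarith+
 have "(K + K * C0) / be <= C5" unfolding C5_def using K_ge_1 C2(1) C0(1) by simp
 thus "K + K * C0 <= C5 * be" using beta_pos by (simp add: pos_divide_le_eq)
qed
lemma C6: "0 <= C6" "2 * K + 2 * K * C4 + K * C0 <= C6 * be" "2 * K * C4 <= C6 * \<delta>" "6 * K <= C6" "6 * C3 <= C6"
proof -
 have *: "0 <= (2 * K + 2 * K * C4 + K * C0) / be" "0 <= 2 * K * C4 / \<delta>" "0 <= 6 * K" "0 <= 6 * C3"
  using beta_pos delta_pos K_ge_1 C4(1) C0(1) C3(1) by auto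
 thus "0 <= C6" "6 * K <= C6" "6 * C3 <= C6" unfolding C6_def by linarith+
 have "(2 * K + 2 * K * C4 + K * C0) / be <= C6" "2 * K * C4 / \<delta> <= C6" unfolding C6_def using * by linarith+
 thus "2 * K + 2 * K * C4 + K * C0 <= C6 * be" "2 * K * C4 <= C6 * \<delta>"
  using beta_pos delta_pos by (simp_all add: pos_divide_le_eq)
qed
lemma C7: "0 <= C7" "K + 2 * K * C5 + K * C0 <= C7 * be" "K + 2 * K * C5 <= C7 * \<delta>" "6 * K <= C7" "18 * C3 <= C7"
proof -
 have *: "0 <= (K + 2 * K * C5 + K * C0) / be" "0 <= (K + 2 * K * C5) / \<delta>" "0 <= 6 * K" "0 <= 18 * C3"
  using beta_pos delta_pos K_ge_1 C5(1) C0(1) C3(1) by auto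
 thus "0 <= C7" "6 * K <= C7" "18 * C3 <= C7" unfolding C7_def by linarith+
 have "(K + 2 * K * C5 + K * C0) / be <= C7" "(K + 2 * K * C5) / \<delta> <= C7" unfolding C7_def using * by linarith+
 thus "K + 2 * K * C5 + K * C0 <= C7 * be" "K + 2 * K * C5 <= C7 * \<delta>"
  using beta_pos delta_pos by (simp_all add: pos_divide_le_eq)
qed

end

text \<open>In the application \<open>Y\<close> is the regular part, \<open>v\<close> the reduced
  solution \<open>f / b\<close>, \<open>u1\<close> the initial time derivative of \<open>Y\<close>,
  and \<open>G0x\<close>, \<open>G0xx\<close> are space derivatives of the residual
  \<open>b * v - F\<close>. \<open>F_diff2\<close> admits the corner singularity, and
  \<open>bd_init2\<close> says that the boundary values start with slope \<open>u1\<close>, which is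
  first order compatibility.\<close>

locale layer_problem = layer_constants be \<delta> K for be \<delta> K :: real +
 fixes e :: real and b bx bxx F G0x G0xx Y Yx Yxx Yt v vx vxx vt :: "real => real => real"
  and w0x w0xx u1 u1x u1xx :: "real => real"
 assumes eps: "0 < e" "e <= 1"
  and b_ge: "x \<in> Icc ==> t \<in> Icc ==> be + \<delta> <= b x t"
  and b_le: "x \<in> Icc ==> t \<in> Icc ==> b x t <= K"
  and b_lip: "x \<in> Icc ==> s \<in> Icc ==> t \<in> Icc ==> abs (b x t - b x s) <= K * abs (t - s)"
  and b_diff2: "x \<in> Ioo ==> 0 < d ==> 0 <= t ==> t + 2 * d <= 1 ==>
   abs (dif2 (b x) d t) <= K * d^2"
  and b_x: "x \<in> Ioo ==> t \<in> Ioc ==> DERIV (%s. b s t) x :> bx x t"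
  and b_xx: "x \<in> Ioo ==> t \<in> Ioc ==> DERIV (%s. bx s t) x :> bxx x t"
  and b_x_le: "x \<in> Ioo ==> t \<in> Ioc ==> abs (bx x t) <= K"
  and b_xx_le: "x \<in> Ioo ==> t \<in> Ioc ==> abs (bxx x t) <= K"
  and Y_deriv: "heat_deriv 1 Y Yx Yxx Yt"
  and Y_eq: "x \<in> Ioo ==> t \<in> Ioc ==> e * (Yt x t - Yxx x t) + b x t * Y x t = F x t"
  and Y_cont: "continuous_on (Icc \<times> Icc) (%(x,t). Y x t)"
  and v_deriv: "heat_deriv 1 v vx vxx vt"
  and v_cont: "continuous_on (Icc \<times> Icc) (%(x,t). v x t)"
  and v_le: "x \<in> Icc ==> t \<in> Icc ==> abs (v x t) <= K"
  and v_xx_le: "x \<in> Ioo ==> t \<in> Ioc ==> abs (vxx x t) <= K"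
  and v_t_le: "x \<in> Ioo ==> t \<in> Ioc ==> abs (vt x t) <= K"
  and Y_init: "x \<in> Icc ==> Y x 0 = v x 0"
  and w0_x: "x \<in> Ioo ==> DERIV (%s. v s 0) x :> w0x x"
  and w0_xx: "x \<in> Ioo ==> DERIV w0x x :> w0xx x"
  and u1_cont: "continuous_on Icc u1"
  and u1_le: "x \<in> Icc ==> abs (u1 x) <= K"
  and u1_x: "x \<in> Ioo ==> DERIV u1 x :> u1x x"
  and u1_xx: "x \<in> Ioo ==> DERIV u1x x :> u1xx x"
  and u1_xx_le: "x \<in> Ioo ==> abs (u1xx x) <= K"
  and F_init: "x \<in> Ioo ==> F x 0 = b x 0 * v x 0 - e * w0xx x + e * u1 x"
  and F_lip: "x \<in> Ioo ==> s \<in> Icc ==> t \<in> Icc ==> abs (F x t - F x s) <= K * abs (t - s)"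
  and F_v: "x \<in> Ioo ==> t \<in> Ioc ==> abs (b x t * v x t - F x t) <= K * e"
  and F_diff2: "x \<in> Ioo ==> 0 < d ==> 0 < t ==> t + 2 * d <= 1 ==>
   abs (dif2 (F x) d t) <= K * d^2 * (1 + (1 / e + 1 / (t + x^2)) * il e be t)"
  and G0_x: "x \<in> Ioo ==> t \<in> Ioc ==>
   DERIV (%s. b s t * v s t - F s t) x :> G0x x t"
  and G0_xx: "x \<in> Ioo ==> t \<in> Ioc ==> DERIV (%s. G0x s t) x :> G0xx x t"
  and G0_xx_le: "x \<in> Ioo ==> t \<in> Ioc ==> abs (G0xx x t) <= K"
  and bd_le: "c = 0 \<or> c = 1 ==> t \<in> Icc ==> abs (Y c t) <= K"
  and bd_init: "c = 0 \<or> c = 1 ==> t \<in> Icc ==> abs (Y c t - Y c 0) <= K * t / e"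
  and bd_init2: "c = 0 \<or> c = 1 ==> t \<in> Icc ==> abs (Y c t - Y c 0 - t * u1 c) <= K * t^2 / e^2"
  and bd_diff: "c = 0 \<or> c = 1 ==> 0 < d ==> 0 < t ==> t + d <= 1 ==>
   abs (Y c (t + d) - Y c t) <= K * (d + min 1 (d / e) * il e be t)"
  and bd_diff2: "c = 0 \<or> c = 1 ==> 0 < d ==> 0 < t ==> t + 2 * d <= 1 ==>
   abs (dif2 (Y c) d t) <= K * d^2 * (1 + il e be t / e^2)"
begin

abbreviation "B \<equiv> bl e be"
abbreviation "ie \<equiv> il e be"

lemma B_pos: "0 < B x" by (rule bl_pos)
lemma B_le: "x \<in> Icc ==> B x <= 2" using bl_le_2 eps beta_pos by blast
lemma B_ge: "c = 0 \<or> c = 1 ==> 1 <= B c" by (rule bl_ge_1)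
lemma e_pos: "0 < ie t" by (rule il_pos)
lemma e_le: "0 <= t ==> ie t <= 1" using il_le_1 eps beta_pos by blast
lemma K0: "0 <= K" using K_ge_1 by simp

lemma bar_1: "solves T e b (%x t. 1) (%x t. b x t)"
 by (rule solves_cong[OF solves_product[where p="%t. 1" and p'="%t. 0" and q="%x. 1" and q'="%x. 0" and q''="%x. 0", simplified]]) auto

lemma bar_t: "solves T e b (%x t. t) (%x t. e + b x t * t)"
 by (rule solves_cong[OF solves_product[where p="%t. t" and p'="%t. 1" and q="%x. 1" and q'="%x. 0" and q''="%x. 0", simplified]]) auto

lemma bar_tt: "solves T e b (%x t. t^2) (%x t. e * (2 * t) + b x t * t^2)"
proof -
 have "solves T e b (%x t. t^2 * 1) (%x t. e * ((2 * t) * 1 - t^2 * 0) + b x t * (t^2 * 1))"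
  by (rule solves_product[where q'="%x. 0"]) (auto intro!: derivative_eq_intros)
 thus ?thesis by simp
qed

text \<open>The second derivative of \<open>bl\<close> cancels exactly \<open>be\<close> of the
  reaction coefficient, so only the excess \<open>b - be\<close> is left to dominate a source. The
  same happens in \<open>bar_e\<close> with the time derivative of \<open>il\<close>.\<close>

lemma bar_B: "solves T e b (%x t. B x) (%x t. (b x t - be) * B x)"
proof -
 have "solves T e b (%x t. 1 * B x) (%x t. e * (0 * B x - 1 * (be / e * B x)) + b x t * (1 * B x))"
  by (rule solves_product[OF _ bl_x bl_xx]) (use eps beta_pos in auto)
 hence "solves T e b (%x t. B x) (%x t. e * (0 * B x - 1 * (be / e * B x)) + b x t * (1 * B x))" by simp
 thus ?thesis by (rule solves_cong) (use eps in \<open>auto simp: field_simps\<close>)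
qed

lemma bar_tB: "solves T e b (%x t. t * B x) (%x t. e * B x + (b x t - be) * (t * B x))"
 by (rule solves_cong[OF solves_product[OF _ bl_x bl_xx, of T "%t. t" "%t. 1"]])
  (use eps beta_pos in \<open>auto simp: field_simps\<close>)

lemma bar_ttB: "solves T e b (%x t. t^2 * B x) (%x t. e * (2 * t) * B x + (b x t - be) * (t^2 * B x))"
 by (rule solves_cong[OF solves_product[OF _ bl_x bl_xx, of T "%t. t^2" "%t. 2 * t"]])
  (use eps beta_pos in \<open>auto simp: field_simps intro!: derivative_eq_intros\<close>)

lemma bar_e: "solves T e b (%x t. ie t) (%x t. (b x t - be) * ie t)"
proof -
 have il': "DERIV ie t :> - (be / e) * ie t" for t
  unfolding il_def using eps by (auto intro!: derivative_eq_intros)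
 have "solves T e b (%x t. ie t * 1) (%x t. e * ((- (be / e) * ie t) * 1 - ie t * 0) + b x t * (ie t * 1))"
  by (rule solves_product[where q'="%x. 0"]) (rule il', auto)
 hence "solves T e b (%x t. ie t) (%x t. e * ((- (be / e) * ie t) * 1 - ie t * 0) + b x t * (ie t * 1))" by simp
 thus ?thesis by (rule solves_cong) (use eps in \<open>auto simp: field_simps\<close>)
qed

lemma compare:
 assumes T: "T <= 1" and w: "solves T e b w Fw" and W: "solves T e b W G"
  and FG: "!!x t. x \<in> Ioo ==> t \<in> {0<..T} ==> abs (Fw x t) <= G x t"
  and cw: "continuous_on (Icc \<times> {0..T}) (%(x,t). w x t)"
  and cW: "continuous_on (Icc \<times> {0..T}) (%(x,t). W x t)"
  and init: "!!x. x \<in> Icc ==> abs (w x 0) <= W x 0"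
  and bd: "!!c t. c = 0 \<or> c = 1 ==> t \<in> {0<..T} ==> abs (w c t) <= W c t"
  and x: "x \<in> Icc" and t: "t \<in> {0..T}"
 shows "abs (w x t) <= W x t"
proof (cases "t = 0")
 case False
 show ?thesis
 proof (rule comparison_principle[OF eps(1) _ w W FG cw _ cW _ init])
  show "continuous_on (Icc \<times> {0<..T}) (%(x,t). W x t)"
   by (rule continuous_on_subset[OF cW]) auto
  show "0 < b x t" if "x \<in> Ioo" "t \<in> {0<..T}" for x t
   using b_ge[of x t] that T beta_pos delta_pos by auto
 qed (use bd x t False in auto)
qed (use init x in auto)

text \<open>The added barrier \<open>k * (ie t * psi x t)\<close> takes up a source of size
  \<open>e * ie t / (t + x^2)\<close>. It is discontinuous at the corner but nonnegative, so
  \<open>W\<close> serves as the continuous minorant.\<close>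

lemma compare_corner:
 assumes T: "T <= 1" and w: "solves T e b w Fw" and W: "solves T e b W G" and k: "0 <= k"
  and FG: "!!x t. x \<in> Ioo ==> t \<in> {0<..T} ==> abs (Fw x t) <= G x t + k * (e * ie t / (6 * (t + x^2)))"
  and cw: "continuous_on (Icc \<times> {0..T}) (%(x,t). w x t)"
  and cW: "continuous_on (Icc \<times> {0..T}) (%(x,t). W x t)"
  and init: "!!x. x \<in> Icc ==> abs (w x 0) <= W x 0"
  and bd: "!!c t. c = 0 \<or> c = 1 ==> t \<in> {0<..T} ==> abs (w c t) <= W c t"
  and x: "x \<in> Icc" and t: "t \<in> {0..T}"
 shows "abs (w x t) <= W x t + k * ie t"
proof (cases "t = 0")
 case True
 thus ?thesis using init[OF x] k by auto
next
 case False
 obtain Gc where Gc: "solves T e b (%x t. ie t * psi x t) Gc"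
  and Gc': "!!x t. x \<in> Ioo ==> t \<in> {0<..T} ==> be <= b x t ==> e * ie t / (6 * (t + x^2)) <= Gc x t"
  using solves_corner[OF eps(1) beta_pos] by blast
 have bb: "be <= b x t" if "x \<in> Ioo" "t \<in> {0<..T}" for x t
  using b_ge[of x t] that T delta_pos by auto
 have pn: "0 <= k * (ie t * psi x t)" if "0 <= t" for x t
  using psi_bounds(1)[OF that, of x] e_pos[of t] k by simp
 have "abs (w x t) <= W x t + k * (ie t * psi x t)"
 proof (rule comparison_principle[OF eps(1) _ w solves_add[OF W solves_cmult[OF Gc, of k]] _ cw _ cW _ init])
  show "continuous_on (Icc \<times> {0<..T}) (%(x,t). W x t + k * (ie t * psi x t))"
  proof -
   have "continuous_on (Icc \<times> {0<..T}) (%(x,t). W x t)"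
    by (rule continuous_on_subset[OF cW]) auto
   moreover have "continuous_on (Icc \<times> {0<..T}) (%(x,t). k * (ie t * psi x t))"
   proof -
    have "t + x^2 / 12 ~= 0" if "0 < t" for t x :: real
     using add_pos_nonneg[OF that, of "x^2/12"] by simp
    thus ?thesis unfolding psi_def case_prod_unfold by (intro continuous_intros) auto
   qed
   ultimately show ?thesis unfolding case_prod_unfold by (rule continuous_on_add)
  qed
  show "0 < b x t" if "x \<in> Ioo" "t \<in> {0<..T}" for x t
   using bb[OF that] beta_pos by auto
  show "abs (Fw x t) <= G x t + k * Gc x t" if xt: "x \<in> Ioo" "t \<in> {0<..T}" for x t
   using FG[OF xt] mult_left_mono[OF Gc'[OF xt bb[OF xt]] k] by linarith
  show "abs (w 0 t) <= W 0 t + k * (ie t * psi 0 t)" "abs (w 1 t) <= W 1 t + k * (ie t * psi 1 t)" if "t \<in> {0<..T}" for t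
   using bd[OF _ that, of 0] bd[OF _ that, of 1] pn[of t 0] pn[of t 1] that by auto
  show "W x t <= W x t + k * (ie t * psi x t)" if "t \<in> {0<..T}" for x t using pn[of t x] that by simp
 qed (use x t False in auto)
 also have "... <= W x t + k * (ie t * 1)"
  using psi_bounds(2)[of t x] e_pos[of t] k t by (intro add_left_mono mult_left_mono) auto
 finally show ?thesis by simp
qed

lemma Y_solves: "solves 1 e b Y F"
 by (rule solvesI[OF Y_deriv Y_eq])

lemma b_mult: "x \<in> Ioo ==> t \<in> Ioc ==> 0 <= c ==> c * be <= c * b x t"
 and b_mult': "x \<in> Ioo ==> t \<in> Ioc ==> 0 <= c ==> c * \<delta> <= (b x t - be) * c"
 using b_ge[of x t] delta_pos by (auto intro: mult_left_mono simp: mult.commute[of _ c])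

text \<open>\<open>v\<close> satisfies the equation up to terms of order \<open>e\<close>, which the
  constant barrier takes up; its boundary values are wrong, and the layer function takes up
  those.\<close>

lemma Y_v:
 assumes x: "x \<in> Icc" and t: "t \<in> Icc"
 shows "abs (Y x t - v x t) <= C1 * (B x + e)"
proof -
 have "abs (Y x t - v x t) <= C1 * B x + (C1 * e) * 1"
 proof (rule compare[OF order_refl solves_diff[OF Y_solves solvesI[OF v_deriv refl]]
    solves_add[OF solves_cmult[OF bar_B] solves_cmult[OF bar_1]] _ _ _ _ _ x t])
  fix x t assume xt: "x \<in> {0<..<1::real}" "t \<in> {0<..1::real}"
  have "abs (e * vt x t) <= K * e" "abs (e * vxx x t) <= K * e"
   using v_t_le[OF xt] v_xx_le[OF xt] eps by (auto simp: abs_mult mult.commute[of K])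
  hence "abs (F x t - (e * (vt x t - vxx x t) + b x t * v x t)) <= 3 * K * e"
   using F_v[OF xt] unfolding right_diff_distrib by linarith
  also have "... <= C1 * be * e" using C1(2) eps by (intro mult_right_mono) auto
  also have "... <= C1 * ((b x t - be) * B x) + C1 * e * b x t"
   using b_mult[OF xt, of "C1 * e"] b_mult'[OF xt, of "B x"] B_pos[of x] C1(1) eps delta_pos
   by (smt (verit) mult.commute mult.left_commute mult_nonneg_nonneg)
  finally show "abs (F x t - (e * (vt x t - vxx x t) + b x t * v x t)) <= C1 * ((b x t - be) * B x) + C1 * e * b x t" .
 next
  show "continuous_on (Icc \<times> Icc) (%(x, t). Y x t - v x t)"
   using continuous_on_diff[OF Y_cont v_cont] by (simp add: case_prod_unfold)
  show "continuous_on (Icc \<times> Icc) (%(x, t). C1 * B x + C1 * e * 1)"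
   unfolding case_prod_unfold by (intro continuous_intros)
 next
  fix x :: real assume "x \<in> Icc"
  thus "abs (Y x 0 - v x 0) <= C1 * B x + C1 * e * 1" using Y_init[of x] C1(1) eps B_pos[of x] by simp
 next
  fix c t :: real assume c: "c = 0 \<or> c = 1" and t: "t \<in> Ioc"
  have "abs (Y c t - v c t) <= 2 * K" using bd_le[OF c, of t] v_le[of c t] c t by auto
  also have "... <= C1 * 1" using C1 by simp
  also have "... <= C1 * B c" using B_ge[OF c] C1(1) by (intro mult_left_mono)
  also have "... <= C1 * B c + C1 * e * 1" using C1(1) eps by simp
  finally show "abs (Y c t - v c t) <= C1 * B c + C1 * e * 1" .
 qed
 thus ?thesis by (simp add: algebra_simps)
qed

lemma Y_le:
 assumes x: "x \<in> Icc" and t: "t \<in> Icc"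
 shows "abs (Y x t) <= C0"
proof -
 have "C1 * (B x + e) <= C1 * 3" using C1(1) B_le[OF x] eps by (intro mult_left_mono) auto
 thus ?thesis using Y_v[OF x t] v_le[OF x t] unfolding C0_def by linarith
qed

lemma v0_cont: "continuous_on (Icc \<times> Icc) (%p::real\<times>real. v (fst p) 0)"
proof -
 have "continuous_on (Icc \<times> Icc) (%p::real\<times>real. (fst p, 0::real))"
  by (intro continuous_intros)
 from continuous_on_compose2[OF v_cont this] show ?thesis by (auto simp: image_subset_iff)
qed

text \<open>The initial values, frozen in time, leave a residual of order \<open>t + e\<close>
  because of \<open>F_init\<close>; barriers that grow linearly in time dominate it.\<close>

lemma Y_growth:
 assumes x: "x \<in> Icc" and t: "t \<in> Icc"
 shows "abs (Y x t - v x 0) <= C2 * t * (1 + B x / e)"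
proof -
 have h: "heat_deriv 1 (%x t. v x 0) (%x t. w0x x) (%x t. w0xx x) (%x t. 0)"
  unfolding heat_deriv_def by (auto intro: w0_x w0_xx)
 have "abs (Y x t - v x 0) <= C2 * t + (C2 / e) * (t * B x)"
 proof (rule compare[OF order_refl solves_diff[OF Y_solves solvesI[OF h refl]]
    solves_add[OF solves_cmult[OF bar_t] solves_cmult[OF bar_tB]] _ _ _ _ _ x t])
  fix x t assume xt: "x \<in> {0<..<1::real}" "t \<in> {0<..1::real}"
  have "F x t - (e * (0 - w0xx x) + b x t * v x 0) = (F x t - F x 0) - (b x t - b x 0) * v x 0 + e * u1 x"
   using F_init[OF xt(1)] by (simp add: algebra_simps)
  moreover have "abs (F x t - F x 0) <= K * t" using F_lip[OF xt(1), of 0 t] xt by simp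
  moreover have "abs ((b x t - b x 0) * v x 0) <= (K * t) * K"
   unfolding abs_mult using b_lip[of x 0 t] v_le[of x 0] xt K0 by (intro mult_mono) auto
  moreover have "abs (e * u1 x) <= e * K" using u1_le[of x] xt eps by (auto simp: abs_mult)
  ultimately have "abs (F x t - (e * (0 - w0xx x) + b x t * v x 0)) <= (K + K^2) * t + K * e"
   by (simp add: power2_eq_square algebra_simps)
  also have "... <= (C2 * be) * t + C2 * e"
   using C2 xt eps by (intro add_mono mult_right_mono) auto
  also have "... <= C2 * (e + b x t * t)"
   using b_mult[OF xt, of "C2 * t"] C2(1) xt by (simp add: algebra_simps)
  also have "... <= C2 * (e + b x t * t) + C2 / e * (e * B x + (b x t - be) * (t * B x))"
  proof -
   have "0 <= (b x t - be) * (t * B x)" using b_mult'[OF xt, of "t * B x"] delta_pos xt B_pos[of x]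
    by (smt (verit) greaterThanAtMost_iff mult_nonneg_nonneg)
   thus ?thesis using C2(1) eps B_pos[of x] by auto
  qed
  finally show "abs (F x t - (e * (0 - w0xx x) + b x t * v x 0)) <= ..." .
 next
  show "continuous_on (Icc \<times> Icc) (%(x, t). Y x t - v x 0)"
   using continuous_on_diff[OF Y_cont v0_cont] by (simp add: case_prod_unfold)
  show "continuous_on (Icc \<times> Icc) (%(x, t). C2 * t + C2 / e * (t * B x))"
   unfolding case_prod_unfold by (intro continuous_intros)
 next
  fix x :: real assume "x \<in> Icc"
  thus "abs (Y x 0 - v x 0) <= C2 * 0 + C2 / e * (0 * B x)" using Y_init[of x] by simp
 next
  fix c t :: real assume c: "c = 0 \<or> c = 1" and t: "t \<in> Ioc"
  have "abs (Y c t - v c 0) <= K * t / e" using bd_init[OF c, of t] Y_init[of c] c t by auto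
  also have "... <= C2 * (t * B c) / e"
  proof -
   have "t * 1 <= t * B c" using B_ge[OF c] t by (intro mult_left_mono) auto
   thus ?thesis using C2 K0 t eps by (intro divide_right_mono mult_mono) auto
  qed
  finally show "abs (Y c t - v c 0) <= C2 * t + C2 / e * (t * B c)"
   using mult_nonneg_nonneg[OF C2(1), of t] t by auto
 qed
 thus ?thesis by (simp add: algebra_simps)
qed

text \<open>One order further: with the slope \<open>u1\<close> included the residual is of order
  \<open>t\<close>, so quadratic barriers suffice. \<open>bd_init2\<close> makes this approximation
  fit at the boundary as well.\<close>

lemma Y_taylor:
 assumes x: "x \<in> Icc" and t: "t \<in> Icc"
 shows "abs (Y x t - v x 0 - t * u1 x) <= C3 * t^2 * (1 / e + B x / e^2)"
proof -
 have h: "heat_deriv 1 (%x t. v x 0) (%x t. w0x x) (%x t. w0xx x) (%x t. 0)"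
  unfolding heat_deriv_def by (auto intro: w0_x w0_xx)
 have h': "heat_deriv 1 (%x t. t * u1 x) (%x t. t * u1x x) (%x t. t * u1xx x) (%x t. u1 x)"
  unfolding heat_deriv_def by (auto intro!: DERIV_cmult u1_x u1_xx derivative_eq_intros)
 have "abs (Y x t - v x 0 - t * u1 x) <= (C3 / e) * t^2 + (C3 / e^2) * (t^2 * B x)"
 proof (rule compare[OF order_refl solves_diff[OF solves_diff[OF Y_solves solvesI[OF h refl]] solvesI[OF h' refl]]
    solves_add[OF solves_cmult[OF bar_tt] solves_cmult[OF bar_ttB]] _ _ _ _ _ x t])
  fix x t assume xt: "x \<in> {0<..<1::real}" "t \<in> {0<..1::real}"
  have "F x t - (e * (0 - w0xx x) + b x t * v x 0) - (e * (u1 x - t * u1xx x) + b x t * (t * u1 x))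
   = (F x t - F x 0) - (b x t - b x 0) * v x 0 - t * (b x t * u1 x) + t * (e * u1xx x)"
   using F_init[OF xt(1)] by (simp add: algebra_simps)
  moreover have "abs (F x t - F x 0) <= K * t" using F_lip[OF xt(1), of 0 t] xt by simp
  moreover have "abs ((b x t - b x 0) * v x 0) <= (K * t) * K"
   unfolding abs_mult using b_lip[of x 0 t] v_le[of x 0] xt K0 by (intro mult_mono) auto
  moreover have "abs (t * (b x t * u1 x)) <= t * (K * K)"
   unfolding abs_mult using b_le[of x t] b_ge[of x t] beta_pos delta_pos u1_le[of x] xt K0
   by (intro mult_mono) auto
  moreover have "abs (t * (e * u1xx x)) <= t * (1 * K)"
   unfolding abs_mult using u1_xx_le[OF xt(1)] xt eps by (intro mult_mono) auto
  ultimately have "abs (F x t - (e * (0 - w0xx x) + b x t * v x 0) - (e * (u1 x - t * u1xx x) + b x t * (t * u1 x)))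
    <= 2 * C3 * t"
   by (simp add: C3_def power2_eq_square algebra_simps)
  also have "... = C3 / e * (e * (2 * t))" using eps by simp
  also have "... <= C3 / e * (e * (2 * t) + b x t * t^2) + C3 / e^2 * (e * (2 * t) * B x + (b x t - be) * (t^2 * B x))"
  proof -
   have bb: "0 <= b x t" "0 <= b x t - be" using b_ge[of x t] beta_pos delta_pos xt by auto
   have "0 <= C3 / e^2 * (e * (2 * t) * B x + (b x t - be) * (t^2 * B x))"
    using C3(1) eps B_pos[of x] xt bb by (intro mult_nonneg_nonneg add_nonneg_nonneg) auto
   moreover have "0 <= C3 / e * (b x t * t^2)" using C3(1) eps bb by auto
   ultimately show ?thesis unfolding distrib_left by linarith
  qed
  finally show "abs (F x t - (e * (0 - w0xx x) + b x t * v x 0) - (e * (u1 x - t * u1xx x) + b x t * (t * u1 x))) <= ..." .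
 next
  have "continuous_on (Icc \<times> Icc) (%p::real\<times>real. snd p * u1 (fst p))"
   by (intro continuous_intros continuous_on_compose2[OF u1_cont]) auto
  thus "continuous_on (Icc \<times> Icc) (%(x, t). Y x t - v x 0 - t * u1 x)"
   using continuous_on_diff[OF continuous_on_diff[OF Y_cont v0_cont]] by (simp add: case_prod_unfold)
  show "continuous_on (Icc \<times> Icc) (%(x, t). C3 / e * t^2 + C3 / e^2 * (t^2 * B x))"
   unfolding case_prod_unfold by (intro continuous_intros)
 next
  fix x :: real assume "x \<in> Icc"
  thus "abs (Y x 0 - v x 0 - 0 * u1 x) <= C3 / e * 0^2 + C3 / e^2 * (0^2 * B x)" using Y_init[of x] by simp
 next
  fix c t :: real assume c: "c = 0 \<or> c = 1" and t: "t \<in> Ioc"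
  have "abs (Y c t - v c 0 - t * u1 c) <= K * t^2 / e^2" using bd_init2[OF c, of t] Y_init[of c] c t by auto
  also have "... <= C3 * (t^2 * B c) / e^2"
  proof -
   have "t^2 * 1 <= t^2 * B c" using B_ge[OF c] t by (intro mult_left_mono) auto
   thus ?thesis using C3 K0 t eps by (intro divide_right_mono mult_mono) auto
  qed
  finally show "abs (Y c t - v c 0 - t * u1 c) <= C3 / e * t^2 + C3 / e^2 * (t^2 * B c)"
   using C3(1) eps by (simp add: add_increasing)
 qed
 thus ?thesis by (simp add: algebra_simps)
qed

end

section \<open>Differences in time of the regular part\<close>

context layer_problem
begin

lemma shift_cont:
 assumes "0 <= k" "T + k <= 1"
 shows "continuous_on (Icc \<times> {0..T}) (%(x,t). Y x (t + k))"
proof -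
 have c: "continuous_on (Icc \<times> {0..T}) (%p::real\<times>real. (fst p, snd p + k))"
  by (intro continuous_intros)
 from continuous_on_compose2[OF Y_cont c] assms show ?thesis
  by (auto simp: image_subset_iff case_prod_unfold)
qed

text \<open>The shifted function is regarded as a solution for the unshifted coefficient
  \<open>b x t\<close>, so that combinations of shifts satisfy one equation; the mismatch moves to
  the right hand side.\<close>

lemma shift_solves:
 assumes "0 <= k"
 shows "solves (1 - k) e b (%x t. Y x (t + k)) (%x t. F x (t + k) - (b x (t + k) - b x t) * Y x (t + k))"
proof (rule solvesI[OF heat_deriv_shift[OF Y_deriv assms]])
 fix x t :: real assume "x \<in> Ioo" "t \<in> {0<..1 - k}"
 thus "e * (Yt x (t + k) - Yxx x (t + k)) + b x t * Y x (t + k)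
  = F x (t + k) - (b x (t + k) - b x t) * Y x (t + k)"
  using Y_eq[of x "t+k"] assms by (simp add: algebra_simps)
qed

abbreviation "dsrc k x t \<equiv> F x (t + k) - (b x (t + k) - b x t) * Y x (t + k) - F x t"
text \<open>A discrete Leibniz rule: besides the second difference of \<open>F\<close> there are a
  product of first differences of \<open>b\<close> and \<open>Y\<close> and a second difference of
  \<open>b\<close>.\<close>

abbreviation "dsrc2 k x t \<equiv> dif2 (F x) k t - 2 * ((b x (t + k) - b x t) * (Y x (t + k + k) - Y x (t + k)))
 - dif2 (b x) k t * Y x (t + 2 * k)"

lemma diff_solves:
 assumes "0 <= k"
 shows "solves (1 - k) e b (%x t. Y x (t + k) - Y x t)
  (%x t. dsrc k x t)"
 by (rule solves_diff[OF shift_solves[OF assms] solves_subset[OF Y_solves]]) (use assms in simp)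

lemma diff_source:
 assumes "x \<in> Ioo" "0 < k" "0 <= t" "t + k <= 1"
 shows "abs (dsrc k x t) <= (K + K * C0) * k"
proof -
 have "abs (F x (t + k) - F x t) <= K * k" using F_lip[of x t "t+k"] assms by simp
 moreover have "abs ((b x (t + k) - b x t) * Y x (t + k)) <= (K * k) * C0"
  unfolding abs_mult using b_lip[of x t "t+k"] Y_le[of x "t+k"] assms K0 by (intro mult_mono) auto
 ultimately show ?thesis by (simp add: algebra_simps)
qed

lemma diff_cont:
 assumes "0 <= k"
 shows "continuous_on (Icc \<times> {0..1 - k}) (%(x,t). Y x (t + k) - Y x t)"
proof -
 have "continuous_on (Icc \<times> {0..1 - k}) (%(x,t). Y x t)"
  by (rule continuous_on_subset[OF Y_cont]) (use assms in auto)
 from continuous_on_diff[OF shift_cont[OF assms, of "1 - k"] this] show ?thesis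
  by (simp add: case_prod_unfold)
qed

text \<open>The source of the difference is of order \<open>k\<close>, and \<open>Y_growth\<close>
  bounds its initial values. This plays the part of a bound on the time derivative in terms of the
  boundary layer.\<close>

lemma Y_diff:
 assumes x: "x \<in> Icc" and k: "0 < k" and t: "0 <= t" "t + k <= 1"
 shows "abs (Y x (t + k) - Y x t) <= C4 * k * (1 + B x / e)"
proof -
 have "abs (Y x (t + k) - Y x t) <= (C4 * k) * 1 + (C4 * k / e) * B x"
 proof (rule compare[OF _ diff_solves solves_add[OF solves_cmult[OF bar_1] solves_cmult[OF bar_B]]
    _ diff_cont _ _ _ x])
  fix x t :: real assume xt: "x \<in> Ioo" "t \<in> {0<..1 - k}"
  hence xt': "x \<in> Ioo" "t \<in> Ioc" using k by auto
  have "abs (dsrc k x t) <= (K + K * C0) * k"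
   by (rule diff_source) (use xt k in auto)
  also have "... <= (C4 * be) * k" using C4(2) k by (intro mult_right_mono) auto
  also have "... <= C4 * k * b x t" using b_mult[OF xt', of "C4 * k"] C4(1) k by (simp add: mult_ac)
  also have "... <= C4 * k * b x t + C4 * k / e * ((b x t - be) * B x)"
   using b_ge[of x t] delta_pos xt' C4(1) k eps B_pos[of x] by auto
  finally show "abs (dsrc k x t) <= ..." .
 next
  show "continuous_on (Icc \<times> {0..1 - k}) (%(x, t). C4 * k * 1 + C4 * k / e * B x)"
   unfolding case_prod_unfold by (intro continuous_intros)
 next
  fix x :: real assume x: "x \<in> Icc"
  have "abs (Y x k - Y x 0) <= C2 * k * (1 + B x / e)" using Y_growth[OF x, of k] Y_init[OF x] k t by auto
  also have "... <= C4 * k * (1 + B x / e)"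
   using C4(3) k eps B_pos[of x] by (intro mult_right_mono) auto
  finally show "abs (Y x (0 + k) - Y x 0) <= C4 * k * 1 + C4 * k / e * B x" by (simp add: algebra_simps)
 next
  fix c t :: real assume c: "c = 0 \<or> c = 1" and t: "t \<in> {0<..1 - k}"
  have "min 1 (k / e) * ie t <= k / e * 1"
   using e_le[of t] e_pos[of t] k eps t by (intro mult_mono) auto
  hence "K * (k + min 1 (k / e) * ie t) <= K * (k + k / e)" using K0 by (intro mult_left_mono) auto
  also have "... <= C4 * (k + k / e * B c)"
   using C4 K0 k eps B_ge[OF c] mult_left_mono[OF B_ge[OF c], of "k / e"] by (intro mult_mono) auto
  also have "... = C4 * k * 1 + C4 * k / e * B c" by (simp add: algebra_simps)
  finally show "abs (Y c (t + k) - Y c t) <= C4 * k * 1 + C4 * k / e * B c"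
   using bd_diff[OF c k, of t] t by auto
 qed (use k t in auto)
 thus ?thesis by (simp add: algebra_simps)
qed

text \<open>A second bound for the same difference, now by the initial layer: \<open>Y_diff\<close>
  serves the estimates in space, this one those in time. The minimum with \<open>1\<close> covers
  steps \<open>k > e\<close>, for which only the boundedness of \<open>Y\<close> is used
  initially.\<close>

lemma Y_diff':
 assumes x: "x \<in> Icc" and k: "0 < k" and t: "0 <= t" "t + k <= 1"
 shows "abs (Y x (t + k) - Y x t) <= C5 * (k + min 1 (k / e) * ie t)"
proof -
 define m where "m = min 1 (k / e)"
 have m: "0 <= m" using k eps by (simp add: m_def)
 have "abs (Y x (t + k) - Y x t) <= (C5 * k) * 1 + (C5 * m) * ie t"
 proof (rule compare[OF _ diff_solves solves_add[OF solves_cmult[OF bar_1] solves_cmult[OF bar_e]]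
    _ diff_cont _ _ _ x])
  fix x t :: real assume xt: "x \<in> Ioo" "t \<in> {0<..1 - k}"
  hence xt': "x \<in> Ioo" "t \<in> Ioc" using k by auto
  have "abs (dsrc k x t) <= (K + K * C0) * k"
   by (rule diff_source) (use xt k in auto)
  also have "... <= (C5 * be) * k" using C5(2) k by (intro mult_right_mono) auto
  also have "... <= C5 * k * b x t" using b_mult[OF xt', of "C5 * k"] C5(1) k by (simp add: mult_ac)
  also have "... <= C5 * k * b x t + C5 * m * ((b x t - be) * ie t)"
   using b_ge[of x t] delta_pos xt' C5(1) m e_pos[of t] by auto
  finally show "abs (dsrc k x t) <= ..." .
 next
  show "continuous_on (Icc \<times> {0..1 - k}) (%(x, t). C5 * k * 1 + C5 * m * ie t)"
   unfolding case_prod_unfold by (intro continuous_intros)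
 next
  fix x :: real assume x: "x \<in> Icc"
  have "abs (Y x k - Y x 0) <= C5 * k + C5 * m"
  proof (cases "k / e <= 1")
   case True
   have "abs (Y x k - Y x 0) <= C2 * k * (1 + B x / e)" using Y_growth[OF x, of k] Y_init[OF x] k t by auto
   also have "... <= C2 * k * (2 + 2 / e)" using C2(1) k eps B_le[OF x]
    by (intro mult_left_mono add_mono divide_right_mono) auto
   also have "... = 2 * C2 * (k + k / e)" by (simp add: algebra_simps)
   also have "... <= C5 * (k + k / e)" using C5(3) k eps by (intro mult_right_mono) auto
   also have "k / e = m" using True by (simp add: m_def)
   finally show ?thesis by (simp add: algebra_simps)
  next
   case False
   have "abs (Y x k - Y x 0) <= 2 * C0" using Y_le[OF x, of k] Y_le[OF x, of 0] k t by auto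
   also have "... <= C5 * k + C5 * 1" using C5(1,4) k by (smt (verit) mult_nonneg_nonneg)
   finally show ?thesis using False by (simp add: m_def)
  qed
  thus "abs (Y x (0 + k) - Y x 0) <= C5 * k * 1 + C5 * m * ie 0" by simp
 next
  fix c t :: real assume c: "c = 0 \<or> c = 1" and t: "t \<in> {0<..1 - k}"
  have "K * (k + m * ie t) <= C5 * (k + m * ie t)"
   using C5(5) k m e_pos[of t] by (intro mult_right_mono) auto
  thus "abs (Y c (t + k) - Y c t) <= C5 * k * 1 + C5 * m * ie t"
   using bd_diff[OF c k, of t] t by (auto simp: m_def algebra_simps)
 qed (use k t in auto)
 thus ?thesis by (simp add: algebra_simps m_def)
qed

lemma diff2_solves:
 assumes "0 <= k"
 shows "solves (1 - 2 * k) e b (%x t. (dif2 (Y x) k t))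
  (%x t. dsrc2 k x t)"
proof -
 have 2: "0 <= 2 * k" using assms by simp
 have "solves (1 - 2 * k) e b (%x t. (dif2 (Y x) k t))
  (%x t. (F x (t + 2 * k) - (b x (t + 2 * k) - b x t) * Y x (t + 2 * k))
   - 2 * (F x (t + k) - (b x (t + k) - b x t) * Y x (t + k)) + F x t)"
  by (rule solves_add[OF solves_diff[OF shift_solves[OF 2] solves_cmult[OF solves_subset[OF shift_solves[OF assms]]]]
     solves_subset[OF Y_solves]]) (use assms in auto)
 thus ?thesis by (rule solves_cong) (simp add: algebra_simps)
qed

lemma diff2_cont:
 assumes "0 <= k"
 shows "continuous_on (Icc \<times> {0..1 - 2 * k}) (%(x,t). (dif2 (Y x) k t))"
proof -
 have "continuous_on (Icc \<times> {0..1 - 2 * k}) (%(x,t). Y x t)"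
  by (rule continuous_on_subset[OF Y_cont]) (use assms in auto)
 from continuous_on_add[OF continuous_on_diff[OF shift_cont[of "2 * k" "1 - 2 * k"]
   continuous_on_mult_left[OF shift_cont[of k "1 - 2 * k"], of 2]] this] assms
 show ?thesis by (simp add: case_prod_unfold)
qed

text \<open>Two Taylor estimates, at \<open>k\<close> and at \<open>2 * k\<close>. The terms with
  \<open>u1\<close> cancel, and \<open>6\<close> is \<open>2^2 + 2\<close>.\<close>

lemma diff2_init:
 assumes x: "x \<in> Icc" and k: "0 < k" "2 * k <= 1"
 shows "abs (Y x (2 * k) - 2 * Y x k + Y x 0) <= 6 * C3 * k^2 * (1 / e + B x / e^2)"
proof -
 have "abs (Y x (2 * k) - v x 0 - (2 * k) * u1 x) <= C3 * (2 * k)^2 * (1 / e + B x / e^2)"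
  by (rule Y_taylor[OF x]) (use k in auto)
 moreover have "abs (Y x k - v x 0 - k * u1 x) <= C3 * k^2 * (1 / e + B x / e^2)"
  by (rule Y_taylor[OF x]) (use k in auto)
 moreover have "C3 * (2 * k)^2 * P + 2 * (C3 * k^2 * P) = 6 * C3 * k^2 * P" for P
  by (simp add: power2_eq_square algebra_simps)
 moreover have "Y x (2 * k) - 2 * Y x k + Y x 0 = (Y x (2 * k) - v x 0 - (2 * k) * u1 x) - 2 * (Y x k - v x 0 - k * u1 x)"
  using Y_init[OF x] by (simp add: algebra_simps)
 ultimately show ?thesis by (smt (verit))
qed

lemma diff2_source:
 assumes x: "x \<in> Ioo" and k: "0 < k" and t: "0 < t" "t + 2 * k <= 1"
  and P: "abs (Y x (t + k + k) - Y x (t + k)) <= k * P"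
 shows "abs (dsrc2 k x t)
  <= k^2 * (K * (1 + (1 / e + 1 / (t + x^2)) * ie t) + 2 * K * P + K * C0)"
proof -
 have "abs (dif2 (F x) k t) <= K * k^2 * (1 + (1 / e + 1 / (t + x^2)) * ie t)"
  by (rule F_diff2[OF x k t])
 moreover have "abs ((b x (t + k) - b x t) * (Y x (t + k + k) - Y x (t + k))) <= (K * k) * (k * P)"
  unfolding abs_mult using b_lip[of x t "t+k"] x t k K0 by (intro mult_mono P) auto
 moreover have "abs ((dif2 (b x) k t) * Y x (t + 2 * k)) <= (K * k^2) * C0"
  unfolding abs_mult using b_diff2[OF x k _ t(2)] Y_le[of x "t + 2 * k"] x t k K0 by (intro mult_mono) auto
 moreover have "K * k^2 * A + 2 * ((K * k) * (k * P)) + (K * k^2) * C0 = k^2 * (K * A + 2 * K * P + K * C0)" for A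
  by (simp add: power2_eq_square algebra_simps)
 ultimately show ?thesis by (smt (verit))
qed

lemma eps_inv: "1 <= 1 / e" "1 / e <= 1 / e^2" "1 / e^2 = (1 / e)^2"
proof -
 show 1: "1 <= 1 / e" using eps by simp
 show 2: "1 / e^2 = (1 / e)^2" by (simp add: power_divide)
 have "1 / e * 1 <= 1 / e * (1 / e)" using 1 eps by (intro mult_left_mono) auto
 thus "1 / e <= 1 / e^2" unfolding 2 power2_eq_square by simp
qed

text \<open>The comparison for second differences. The term \<open>1 / (t + x^2)\<close> in the
  source is left to the corner barrier with factor \<open>k^2 * (C6 / e)\<close>; the first
  difference in the source is bounded by \<open>Y_diff\<close>.\<close>

lemma Y_diff2:
 assumes x: "x \<in> Icc" and k: "0 < k" and t: "0 <= t" "t + 2 * k <= 1"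
 shows "abs (dif2 (Y x) k t) <= 2 * C6 * (1 / e + B x / e^2) * k^2"
proof -
 define i where "i = 1 / e"
 have i: "1 <= i" "i <= i^2" "e * i = 1" "1 / e = i" "0 < i" "B x / e^2 = B x * i^2" for x
  unfolding i_def eps_inv(3)[symmetric] using eps_inv(1,2) eps(1) by simp_all
 have "abs (dif2 (Y x) k t) <= ((k^2 * (C6 * i)) * 1 + (k^2 * (C6 * i^2)) * B x) + (k^2 * (C6 * i)) * ie t"
 proof (rule compare_corner[OF _ diff2_solves solves_add[OF solves_cmult[OF bar_1] solves_cmult[OF bar_B]]
    _ _ diff2_cont _ _ _ x])
  fix x t :: real assume xt: "x \<in> Ioo" "t \<in> {0<..1 - 2 * k}"
  hence xt': "x \<in> Ioo" "t \<in> Ioc" using k by auto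
  define d where "d = 1 / (t + x^2)"
  have d: "0 < d" unfolding d_def using xt' by (auto intro!: add_pos_nonneg)
  have P: "abs (Y x (t + k + k) - Y x (t + k)) <= k * (C4 * (1 + B x * i))"
   using Y_diff[of x k "t + k"] xt' xt k by (simp add: i_def mult_ac)
  note S = diff2_source[OF xt(1) k _ _ P, unfolded i(4), folded d_def]
  have "0 < t" "t + 2 * k <= 1" using xt by auto
  note S = S[OF this]
  have "K * (1 + (i + d) * ie t) + 2 * K * (C4 * (1 + B x * i)) + K * C0 <=
    (C6 * i) * b x t + (C6 * i^2) * ((b x t - be) * B x) + C6 * (ie t * d / 6)"
  proof -
   have "K * (i * ie t) <= K * (i * 1)"
    using K0 i(5) e_le[of t] xt' by (intro mult_left_mono) auto
   moreover have "K * 1 <= K * i" by (rule mult_left_mono[OF i(1) K0])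
   moreover have "(2 * K * C4 + K * C0) * 1 <= (2 * K * C4 + K * C0) * i"
    using K0 C4(1) C0(1) i(1) by (intro mult_left_mono) auto
   moreover have "(2 * K + 2 * K * C4 + K * C0) * i <= (C6 * be) * i" using C6(2) i by (intro mult_right_mono) auto
   moreover have "(C6 * be) * i <= (C6 * i) * b x t" using b_mult[OF xt', of "C6 * i"] C6(1) i by (simp add: mult_ac)
   moreover have "(2 * K * C4) * (B x * i) <= (C6 * \<delta>) * (B x * i^2)"
   proof (rule mult_mono[OF C6(3)])
    show "B x * i <= B x * i^2" using B_pos[of x] by (intro mult_left_mono[OF i(2)]) auto
   qed (use C6(1) delta_pos B_pos[of x] i(5) in auto)
   moreover have "(C6 * i^2) * (B x * \<delta>) <= (C6 * i^2) * ((b x t - be) * B x)"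
    using b_mult'[OF xt', of "B x"] B_pos[of x] C6(1) by (intro mult_left_mono) auto
   moreover have "(6 * K) * (d * ie t / 6) <= C6 * (d * ie t / 6)" using C6(4) d e_pos[of t] by (intro mult_right_mono) auto
   ultimately show ?thesis by (simp add: algebra_simps)
  qed
  hence "k^2 * (K * (1 + (i + d) * ie t) + 2 * K * (C4 * (1 + B x * i)) + K * C0) <=
    k^2 * ((C6 * i) * b x t + (C6 * i^2) * ((b x t - be) * B x) + C6 * (ie t * d / 6))"
   by (intro mult_left_mono) auto
  also have "... = k^2 * (C6 * i) * b x t + k^2 * (C6 * i^2) * ((b x t - be) * B x) + k^2 * (C6 * i) * (e * ie t / (6 * (t + x^2)))"
  proof -
   have "e * ie t / (6 * (t + x^2)) = e * (ie t * d / 6)" by (simp add: d_def)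
   moreover have "k^2 * (C6 * i) * (e * (ie t * d / 6)) = k^2 * C6 * (e * i) * (ie t * d / 6)" by (simp add: mult_ac)
   ultimately have "k^2 * (C6 * i) * (e * ie t / (6 * (t + x^2))) = k^2 * C6 * 1 * (ie t * d / 6)"
    by (simp only: i(3))
   thus ?thesis by (simp only:) (simp add: algebra_simps)
  qed
  finally show "abs (dsrc2 k x t) <= ..."
   by (rule order_trans[OF S])
 next
  show "continuous_on (Icc \<times> {0..1 - 2 * k}) (%(x, t). k^2 * (C6 * i) * 1 + k^2 * (C6 * i^2) * B x)"
   unfolding case_prod_unfold by (intro continuous_intros)
 next
  fix x :: real assume x: "x \<in> Icc"
  have "abs (Y x (2 * k) - 2 * Y x k + Y x 0) <= 6 * C3 * (k^2 * (i + B x * i^2))"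
   using diff2_init[OF x k] t unfolding i(4,6) by (simp add: algebra_simps)
  also have "... <= C6 * (k^2 * (i + B x * i^2))" using C6(5) i B_pos[of x] by (intro mult_right_mono) auto
  finally show "abs (Y x (0 + 2 * k) - 2 * Y x (0 + k) + Y x 0) <= k^2 * (C6 * i) * 1 + k^2 * (C6 * i^2) * B x"
   by (simp add: algebra_simps)
 next
  fix c t :: real assume c: "c = 0 \<or> c = 1" and t: "t \<in> {0<..1 - 2 * k}"
  have "ie t * i^2 <= 1 * i^2" using e_le[of t] t by (intro mult_right_mono) auto
  hence "K * k^2 * (1 + ie t / e^2) <= K * k^2 * (i + i^2)" using K0 i(1)
   by (intro mult_left_mono) (auto simp: i_def power_divide)
  also have "... <= C6 * k^2 * (i + B c * i^2)"
   using C6(1,4) K0 i B_ge[OF c] by (intro mult_mono add_left_mono) auto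
  finally show "abs (dif2 (Y c) k t) <= k^2 * (C6 * i) * 1 + k^2 * (C6 * i^2) * B c"
   using bd_diff2[OF c k, of t] t by (auto simp: algebra_simps)
 qed (use k t C6(1) i in auto)
 also have "... <= ((k^2 * (C6 * i)) * 1 + (k^2 * (C6 * i^2)) * B x) + (k^2 * (C6 * i)) * 1"
  using C6(1) i e_le[of t] t by (intro add_left_mono mult_left_mono) auto
 also have "... <= 2 * C6 * (i + B x * i^2) * k^2"
  using C6(1) i B_pos[of x] by (simp add: algebra_simps)
 finally show ?thesis unfolding i(4,6) .
qed

text \<open>The counterpart of \<open>Y_diff2\<close> in terms of the initial layer, with
  \<open>Y_diff'\<close> inside the source. A source of order \<open>ie t / e\<close> has to be
  dominated by \<open>(b - be) * ie t / e^2\<close>, which explains the division by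
  \<open>\<delta>\<close> in \<open>C7\<close>.\<close>

lemma Y_diff2':
 assumes x: "x \<in> Icc" and k: "0 < k" and t: "0 <= t" "t + 2 * k <= 1"
 shows "abs (dif2 (Y x) k t) <= 2 * C7 * (1 + ie t / e^2) * k^2"
proof -
 define i where "i = 1 / e"
 have i: "1 <= i" "i <= i^2" "e * i = 1" "1 / e = i" "0 < i" "z / e^2 = z * i^2" "z / e = z * i" for z
  unfolding i_def eps_inv(3)[symmetric] using eps_inv(1,2) eps(1) by simp_all
 have "abs (dif2 (Y x) k t) <= ((k^2 * C7) * 1 + (k^2 * (C7 * i^2)) * ie t) + (k^2 * (C7 * i)) * ie t"
 proof (rule compare_corner[OF _ diff2_solves solves_add[OF solves_cmult[OF bar_1] solves_cmult[OF bar_e]]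
    _ _ diff2_cont _ _ _ x])
  fix x t :: real assume xt: "x \<in> Ioo" "t \<in> {0<..1 - 2 * k}"
  hence xt': "x \<in> Ioo" "t \<in> Ioc" using k by auto
  define d where "d = 1 / (t + x^2)"
  have d: "0 < d" unfolding d_def using xt' by (auto intro!: add_pos_nonneg)
  have P: "abs (Y x (t + k + k) - Y x (t + k)) <= k * (C5 * (1 + i * ie t))"
  proof -
   have "abs (Y x (t + k + k) - Y x (t + k)) <= C5 * (k + min 1 (k / e) * ie (t + k))"
    by (rule Y_diff') (use xt xt' k in auto)
   also have "... <= C5 * (k + (k * i) * ie t)"
    using C5(1) k eps i(5) e_pos[of "t+k"] il_mono[OF eps(1) beta_pos, of t "t+k"]
    by (intro mult_left_mono add_left_mono mult_mono) (auto simp: i(7))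
   finally show ?thesis by (simp add: algebra_simps)
  qed
  note S = diff2_source[OF xt(1) k _ _ P, unfolded i(4), folded d_def]
  have "0 < t" "t + 2 * k <= 1" using xt by auto
  note S = S[OF this]
  have "K * (1 + (i + d) * ie t) + 2 * K * (C5 * (1 + i * ie t)) + K * C0 <=
    C7 * b x t + (C7 * i^2) * ((b x t - be) * ie t) + C7 * (ie t * d / 6)"
  proof -
   have "K + 2 * K * C5 + K * C0 <= C7 * b x t" using C7(2) b_mult[OF xt', of C7] C7(1) by simp
   moreover have "(K + 2 * K * C5) * (ie t * i) <= (C7 * \<delta>) * (ie t * i^2)"
    using C7(3,1) i e_pos[of t] K0 C5(1) delta_pos by (intro mult_mono) auto
   moreover have "(C7 * i^2) * (ie t * \<delta>) <= (C7 * i^2) * ((b x t - be) * ie t)"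
    using b_mult'[OF xt', of "ie t"] e_pos[of t] C7(1) by (intro mult_left_mono) auto
   moreover have "(6 * K) * (d * ie t / 6) <= C7 * (d * ie t / 6)" using C7(4) d e_pos[of t] by (intro mult_right_mono) auto
   ultimately show ?thesis by (simp add: algebra_simps)
  qed
  hence "k^2 * (K * (1 + (i + d) * ie t) + 2 * K * (C5 * (1 + i * ie t)) + K * C0) <=
    k^2 * (C7 * b x t + (C7 * i^2) * ((b x t - be) * ie t) + C7 * (ie t * d / 6))"
   by (intro mult_left_mono) auto
  also have "... = k^2 * C7 * b x t + k^2 * (C7 * i^2) * ((b x t - be) * ie t) + k^2 * (C7 * i) * (e * ie t / (6 * (t + x^2)))"
  proof -
   have "e * ie t / (6 * (t + x^2)) = e * (ie t * d / 6)" by (simp add: d_def)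
   moreover have "k^2 * (C7 * i) * (e * (ie t * d / 6)) = k^2 * C7 * (e * i) * (ie t * d / 6)" by (simp add: mult_ac)
   ultimately have "k^2 * (C7 * i) * (e * ie t / (6 * (t + x^2))) = k^2 * C7 * 1 * (ie t * d / 6)"
    by (simp only: i(3))
   thus ?thesis by (simp only:) (simp add: algebra_simps)
  qed
  finally show "abs (dsrc2 k x t) <= ..."
   by (rule order_trans[OF S])
 next
  show "continuous_on (Icc \<times> {0..1 - 2 * k}) (%(x, t). k^2 * C7 * 1 + k^2 * (C7 * i^2) * ie t)"
   unfolding case_prod_unfold by (intro continuous_intros)
 next
  fix x :: real assume x: "x \<in> Icc"
  have "abs (Y x (2 * k) - 2 * Y x k + Y x 0) <= 6 * C3 * (k^2 * (i + B x * i^2))"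
   using diff2_init[OF x k] t unfolding i(4,6) by (simp add: algebra_simps)
  also have "... <= 6 * C3 * (k^2 * (3 * i^2))"
  proof -
   have "B x * i^2 <= 2 * i^2" using B_le[OF x] by (intro mult_right_mono) auto
   hence "i + B x * i^2 <= 3 * i^2" using i(2) by linarith
   thus ?thesis using C3(1) by (intro mult_left_mono) auto
  qed
  also have "... <= C7 * (k^2 * i^2)" using mult_right_mono[OF C7(5), of "k^2 * i^2"] by simp
  also have "... <= k^2 * C7 * 1 + k^2 * (C7 * i^2) * ie 0" using C7(1) by (simp add: mult_ac)
  finally show "abs (Y x (0 + 2 * k) - 2 * Y x (0 + k) + Y x 0) <= k^2 * C7 * 1 + k^2 * (C7 * i^2) * ie 0"
   by simp
 next
  fix c t :: real assume c: "c = 0 \<or> c = 1" and t: "t \<in> {0<..1 - 2 * k}"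
  have "K <= C7" using C7(4) K0 by simp
  hence "K * (k^2 * (1 + ie t / e^2)) <= C7 * (k^2 * (1 + ie t / e^2))" using e_pos[of t]
   by (intro mult_right_mono) auto
  thus "abs (dif2 (Y c) k t) <= k^2 * C7 * 1 + k^2 * (C7 * i^2) * ie t"
   using bd_diff2[OF c k, of t] t unfolding i(6) by (auto simp: algebra_simps)
 qed (use k t C7(1) i in auto)
 also have "... <= 2 * C7 * (1 + ie t * i^2) * k^2"
 proof -
  have "k^2 * (C7 * i) * ie t <= k^2 * (C7 * i^2) * ie t"
   using C7(1) i e_pos[of t] by (intro mult_right_mono mult_left_mono) auto
  moreover have "0 <= k^2 * C7" using C7(1) by simp
  ultimately show ?thesis by (simp add: algebra_simps)
 qed
 finally show ?thesis unfolding i(6) .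
qed

lemma Y_derivs:
 assumes "x \<in> Ioo" "t \<in> Ioc"
 shows "DERIV (%s. Y s t) x :> Yx x t"
  "DERIV (%s. Yx s t) x :> Yxx x t"
  "((%s. Y x s) has_real_derivative Yt x t) (at_left t)"
 using Y_deriv assms unfolding heat_deriv_def by auto

lemma Yt_le:
 assumes x: "x \<in> Ioo" and t: "t \<in> Ioc"
 shows "abs (Yt x t) <= C4 * (1 + B x / e)"
proof (rule left_deriv_le[OF Y_derivs(3)[OF x t]])
 fix s assume s: "0 < s" "s < t"
 thus "abs (Y x t - Y x s) <= C4 * (1 + B x / e) * (t - s)"
  using Y_diff[of x "t - s" s] x t by (simp add: mult_ac)
qed (use t in auto)

text \<open>The exponential is taken at an earlier time \<open>a\<close>, which avoids a limit; in
  the truncation error \<open>a\<close> is the previous time level.\<close>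

lemma Yt_le':
 assumes x: "x \<in> Ioo" and t: "t \<in> Ioc" and a: "0 <= a" "a < t"
 shows "abs (Yt x t) <= C5 * (1 + ie a / e)"
proof (rule left_deriv_le[OF Y_derivs(3)[OF x t] a(2)])
 fix s assume s: "a < s" "s < t"
 have "abs (Y x (s + (t - s)) - Y x s) <= C5 * ((t - s) + min 1 ((t - s) / e) * ie s)"
  by (rule Y_diff') (use x t a s in auto)
 also have "... <= C5 * ((t - s) + ((t - s) / e) * ie a)"
  using C5(1) eps s e_pos[of s] il_mono[OF eps(1) beta_pos, of a s]
  by (intro mult_left_mono add_left_mono mult_mono) auto
 finally show "abs (Y x t - Y x s) <= C5 * (1 + ie a / e) * (t - s)" by (simp add: algebra_simps)
qed

lemma Yt_lipschitz:
 assumes x: "x \<in> Ioo" and t: "t \<in> Ioc" and \<kappa>: "0 < \<kappa>" "0 < t - \<kappa>"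
 shows "abs (Yt x t - Yt x (t - \<kappa>)) <= 2 * C6 * (1 / e + B x / e^2) * \<kappa>"
proof (rule left_deriv_lipschitz[OF _ Y_derivs(3)[OF x t] Y_derivs(3)[OF x] \<kappa>])
 fix s k :: real assume "0 < k" "0 <= s" "s + 2 * k <= t"
 thus "abs (Y x (s + 2 * k) - 2 * Y x (s + k) + Y x s) <= 2 * C6 * (1 / e + B x / e^2) * k^2"
  using Y_diff2[of x k s] x t by simp
qed (use t \<kappa> in auto)

lemma Y_backward_error:
 assumes x: "x \<in> Ioo" and t: "t \<in> Ioc" and \<kappa>: "0 < \<kappa>" "0 <= t - \<kappa>"
 shows "abs (Y x t - Y x (t - \<kappa>) - \<kappa> * Yt x t) <= 2 * C7 * (1 + ie (t - \<kappa>) / e^2) * \<kappa>^2"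
proof (rule backward_quotient_error[OF _ Y_derivs(3)[OF x t] \<kappa>(1) order_refl])
 fix s k :: real assume s: "0 < k" "t - \<kappa> <= s" "s + 2 * k <= t"
 hence "abs (Y x (s + 2 * k) - 2 * Y x (s + k) + Y x s) <= 2 * C7 * (1 + ie s / e^2) * k^2"
  using Y_diff2'[of x k s] x t \<kappa> by simp
 also have "... <= 2 * C7 * (1 + ie (t - \<kappa>) / e^2) * k^2"
  using C7(1) il_mono[OF eps(1) beta_pos s(2)]
  by (intro mult_right_mono mult_left_mono add_left_mono divide_right_mono) auto
 finally show "abs (Y x (s + 2 * k) - 2 * Y x (s + k) + Y x s) <= 2 * C7 * (1 + ie (t - \<kappa>) / e^2) * k^2" .
qed

text \<open>The equation is solved for \<open>e * Yxx x t\<close>, with \<open>b * v\<close>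
  inserted so that every term is at most of the order of \<open>B x + e\<close>.\<close>

lemma Yxx_le:
 assumes x: "x \<in> Ioo" and t: "t \<in> Ioc"
 shows "abs (Yxx x t) <= C8 * (1 + B x / e)"
proof -
 have z: "abs (b x t * (Y x t - v x t)) <= K * (C1 * (B x + e))"
  unfolding abs_mult using b_le[of x t] b_ge[of x t] beta_pos delta_pos Y_v[of x t] x t K0
  by (intro mult_mono) auto
 have yt: "abs (e * Yt x t) <= C4 * (B x + e)"
 proof -
  have "e * abs (Yt x t) <= e * (C4 * (1 + B x / e))" using Yt_le[OF x t] eps by (intro mult_left_mono) auto
  also have "... = C4 * (B x + e)" using eps by (simp add: field_simps)
  finally show ?thesis using eps by (simp add: abs_mult)
 qed
 have "e * Yxx x t = e * Yt x t + b x t * (Y x t - v x t) + (b x t * v x t - F x t)"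
  using Y_eq[OF x t] by (simp add: algebra_simps)
 moreover have "K * e <= K * (B x + e)" using K0 B_pos[of x] by (intro mult_left_mono) auto
 ultimately have "abs (e * Yxx x t) <= C8 * (B x + e)"
  using z yt F_v[OF x t] unfolding C8_def distrib_right by (smt (verit) mult.assoc)
 thus ?thesis using eps by (simp add: abs_mult field_simps)
qed

lemma z_derivs:
 assumes "x \<in> Ioo" "t \<in> Ioc"
 shows "DERIV (%s. Y s t - v s t) x :> Yx x t - vx x t"
  "DERIV (%s. Yx s t - vx s t) x :> Yxx x t - vxx x t"
 using Y_deriv v_deriv assms unfolding heat_deriv_def by (auto intro!: DERIV_diff)

lemma z_xx_le:
 assumes x: "x \<in> Ioo" and t: "t \<in> Ioc"
 shows "abs (Yxx x t - vxx x t) <= (C8 + K) * (1 + B x / e)"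
proof -
 have "K * 1 <= K * (1 + B x / e)" using K0 eps B_pos[of x] by (intro mult_left_mono) auto
 thus ?thesis using Yxx_le[OF x t] v_xx_le[OF x t] unfolding distrib_right by linarith
qed

lemma C8_nonneg: "0 <= C8" unfolding C8_def using C4 C1 K0 by simp

lemma C9_nonneg: "0 <= C9" unfolding C9_def using C8_nonneg C1 K0 by simp

text \<open>Landau's inequality for \<open>Y - v\<close>, weakened from \<open>sqrt e\<close> to
  \<open>1\<close> and from \<open>1 / sqrt e\<close> to \<open>1 / e\<close>, since this is the
  size of the second derivatives that it accompanies.\<close>

lemma z_x_le:
 assumes x: "x \<in> Ioo" and t: "t \<in> Ioc"
 shows "abs (Yx x t - vx x t) <= C9 * (1 + B x / e)"
proof -
 have "abs (Yx x t - vx x t) <= 9 * exp (sqrt be) * (C1 + C8 + K) * (sqrt e + B x / sqrt e)"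
 proof (rule xreg_deriv_bound[OF eps beta_pos z_derivs(1) z_derivs(2) _ _ x])
  fix y :: real assume y: "y \<in> Ioo"
  have "C1 * (B y + e) <= (C1 + C8 + K) * (B y + e)" "(C8 + K) * (1 + B y / e) <= (C1 + C8 + K) * (1 + B y / e)"
   using C8_nonneg K0 C1(1) eps B_pos[of y] by (intro mult_right_mono; auto)+
  thus "abs (Y y t - v y t) <= (C1 + C8 + K) * (B y + e)"
   "abs (Yxx y t - vxx y t) <= (C1 + C8 + K) * (1 + B y / e)"
   using Y_v[of y t] z_xx_le[OF y t] y t by auto
 qed (use t in auto)
 also have "... = C9 * (sqrt e + B x / sqrt e)" by (simp add: C9_def)
 also have "... <= C9 * (1 + B x / e)"
 proof -
  have "e <= sqrt e" "sqrt e <= 1" using eps by (auto intro!: real_le_rsqrt simp: power2_eq_square mult_left_le)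
  hence "B x / sqrt e <= B x / e" using eps B_pos[of x] by (intro divide_left_mono) auto
  thus ?thesis using \<open>sqrt e <= 1\<close> C9_nonneg by (intro mult_left_mono add_mono)
 qed
 finally show ?thesis .
qed

text \<open>In the equation solved for \<open>e * Yxx\<close>, the time derivative is replaced by
  backward quotients, which are twice differentiable in space. Their second derivatives are
  quotients of \<open>Yxx\<close> in time; the equation expresses these through quotients of
  \<open>Yt\<close>, which \<open>Yt_lipschitz\<close> bounds.\<close>

lemma Yxx_xreg:
 assumes t: "t \<in> Ioc"
 shows "xreg e be C10 (%x. e * Yxx x t)"
proof -
 \<comment> \<open>Steps of at most \<open>t / 2\<close> keep the earlier time positive.\<close>
 define h where "h = (%n::nat. (t / 2) / real (Suc n))"
 have h: "0 < h n" "0 < t - h n" "t - h n \<in> Ioc" for n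
 proof -
  show 1: "0 < h n" using t by (simp add: h_def)
  have "h n <= (t / 2) / 1" unfolding h_def using t by (intro divide_left_mono) auto
  thus "0 < t - h n" using t by auto
  thus "t - h n \<in> Ioc" using t 1 by auto
 qed
 define u where "u = (%n x. e * ((Y x t - Y x (t - h n)) / h n) + (b x t * (Y x t - v x t) + (b x t * v x t - F x t)))"
 define w1 where "w1 = (%n x. e * ((Yx x t - Yx x (t - h n)) / h n) +
  (bx x t * (Y x t - v x t) + (Yx x t - vx x t) * b x t + G0x x t))"
 define w2 where "w2 = (%n x. e * ((Yxx x t - Yxx x (t - h n)) / h n) +
  ((bxx x t * (Y x t - v x t) + (Yx x t - vx x t) * bx x t) + ((Yxx x t - vxx x t) * b x t + bx x t * (Yx x t - vx x t)) + G0xx x t))"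
 show ?thesis unfolding xreg_def
 proof (rule exI[of _ u], rule exI[of _ w1], rule exI[of _ w2], intro ballI conjI allI)
  fix x :: real assume x: "x \<in> Ioo"
  have "(%n. (Y x t - Y x (t - h n)) / h n) \<longlonglongrightarrow> Yt x t"
   unfolding h_def by (rule left_deriv_sequence[OF Y_derivs(3)[OF x t]]) (use t in auto)
  hence "(%n. u n x) \<longlonglongrightarrow> e * Yt x t + (b x t * (Y x t - v x t) + (b x t * v x t - F x t))"
   unfolding u_def by (intro tendsto_intros)
  moreover have "e * Yt x t + (b x t * (Y x t - v x t) + (b x t * v x t - F x t)) = e * Yxx x t"
   using Y_eq[OF x t] by (simp add: algebra_simps)
  ultimately show "(%n. u n x) \<longlonglongrightarrow> e * Yxx x t" by simp
 next
  fix x n assume x: "x \<in> {0<..<1::real}"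
  note h = h[of n]
  have x': "x \<in> Icc" and t': "t \<in> Icc" "t - h n \<in> Icc" using x t h by auto
  show "DERIV (u n) x :> w1 n x" unfolding u_def w1_def
   using h by (intro DERIV_add DERIV_cmult DERIV_cdivide DERIV_diff[OF Y_derivs(1) Y_derivs(1)]
    DERIV_mult[OF b_x z_derivs(1)] G0_x x t h(3))
  show "DERIV (w1 n) x :> w2 n x" unfolding w1_def w2_def
   using h by (intro DERIV_add DERIV_cmult DERIV_cdivide DERIV_diff[OF Y_derivs(2) Y_derivs(2)]
    DERIV_mult[OF b_xx z_derivs(1)] DERIV_mult[OF z_derivs(2) b_x] G0_xx x t h(3))
  define P where "P = 1 + B x / e"
  have P: "1 <= P" "B x + e = e * P" "B x + e <= P"
  proof -
   have "B x * 1 <= B x * (1 / e)" using eps B_pos[of x] by (intro mult_left_mono) auto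
   thus "B x + e <= P" using eps by (simp add: P_def)
  qed (use eps B_pos[of x] in \<open>auto simp: P_def field_simps\<close>)
  have Kb: "abs (b x t) <= K" "abs (b x (t - h n)) <= K"
   using b_le[OF x'] b_ge[OF x'] t' beta_pos delta_pos by (smt (verit))+
  have dq: "abs (Y x t - Y x (t - h n)) <= C4 * P * h n"
   using Y_diff[OF x' h(1), of "t - h n"] h t by (simp add: P_def mult_ac)
  have C10: "C8 <= C10" unfolding C10_def using C8_nonneg C9_nonneg C4(1) C0(1) C1(1) C6(1) K0 by auto
  have z: "abs (Y x t - v x t) <= C1 * P"
  proof -
   have "C1 * (B x + e) <= C1 * P" using P C1(1) by (intro mult_left_mono) auto
   thus ?thesis using Y_v[OF x' t'(1)] by linarith
  qed
  show "abs (u n x) <= C10 * (B x + e)"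
  proof -
   have "abs (e * ((Y x t - Y x (t - h n)) / h n)) <= e * (C4 * P)"
    using dq h(1) eps by (simp add: abs_mult pos_divide_le_eq)
   moreover have "abs (b x t * (Y x t - v x t)) <= K * (C1 * (B x + e))"
    unfolding abs_mult using Kb Y_v[OF x' t'(1)] K0 by (intro mult_mono) auto
   moreover have "K * e <= K * (B x + e)" using K0 B_pos[of x] by (intro mult_left_mono) auto
   moreover have "e * (C4 * P) = C4 * (B x + e)" using P(2) by simp
   ultimately have "abs (u n x) <= C4 * (B x + e) + K * (C1 * (B x + e)) + K * (B x + e)"
    unfolding u_def using F_v[OF x t] by linarith
   also have "... = C8 * (B x + e)" by (simp add: C8_def algebra_simps)
   also have "... <= C10 * (B x + e)" using C10 eps B_pos[of x] by (intro mult_right_mono) auto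
   finally show ?thesis .
  qed
  show "abs (w2 n x) <= C10 * (1 + B x / e)"
  proof -
   have "e * (Yxx x t - Yxx x (t - h n)) = e * (Yt x t - Yt x (t - h n)) + b x t * (Y x t - Y x (t - h n))
    + (b x t - b x (t - h n)) * Y x (t - h n) - (F x t - F x (t - h n))"
    using Y_eq[OF x t] Y_eq[OF x h(3)] by (simp add: algebra_simps)
   moreover have "abs (e * (Yt x t - Yt x (t - h n))) <= 2 * C6 * P * h n"
   proof -
    have "e * abs (Yt x t - Yt x (t - h n)) <= e * (2 * C6 * (1 / e + B x / e^2) * h n)"
     using Yt_lipschitz[OF x t h(1,2)] eps by (intro mult_left_mono) auto
    also have "... = 2 * C6 * P * h n" using eps by (simp add: P_def field_simps power2_eq_square)
    finally show ?thesis using eps by (simp add: abs_mult)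
   qed
   moreover have "abs (b x t * (Y x t - Y x (t - h n))) <= K * (C4 * P * h n)"
    unfolding abs_mult by (intro mult_mono Kb dq) (use K0 in auto)
   moreover have "abs ((b x t - b x (t - h n)) * Y x (t - h n)) <= (K * h n) * C0"
    unfolding abs_mult using b_lip[OF x' t'(2,1)] Y_le[OF x' t'(2)] h K0 by (intro mult_mono) auto
   moreover have "abs (F x t - F x (t - h n)) <= K * h n" using F_lip[OF x t'(2,1)] h by simp
   ultimately have "abs (e * (Yxx x t - Yxx x (t - h n))) <= (2 * C6 * P + K * (C4 * P) + K * C0 + K) * h n"
    by (simp add: algebra_simps)
   hence 1: "abs (e * ((Yxx x t - Yxx x (t - h n)) / h n)) <= 2 * C6 * P + K * (C4 * P) + K * C0 + K"
    using h(1) by (simp add: pos_divide_le_eq abs_mult)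
   have 2: "abs (bxx x t * (Y x t - v x t)) <= K * (C1 * P)"
    unfolding abs_mult by (intro mult_mono b_xx_le x t z) (use K0 in auto)
   have 3: "abs ((Yx x t - vx x t) * bx x t) <= (C9 * P) * K"
    unfolding abs_mult P_def using C9_nonneg eps B_pos[of x] by (intro mult_mono z_x_le b_x_le x t) auto
   have 4: "abs ((Yxx x t - vxx x t) * b x t) <= ((C8 + K) * P) * K"
    unfolding abs_mult P_def using C8_nonneg K0 eps B_pos[of x] by (intro mult_mono z_xx_le Kb x t) auto
   have "abs (w2 n x) <= (2 * C6 * P + K * (C4 * P) + K * C0 + K) + K * (C1 * P) + 2 * ((C9 * P) * K) + ((C8 + K) * P) * K + K"
    unfolding w2_def mult.commute[of "bx x t" "Yx x t - vx x t"] using 1 2 3 4 G0_xx_le[OF x t] by linarith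
   also have "... <= C10 * P"
   proof -
    have "K * C0 * 1 <= K * C0 * P" by (rule mult_left_mono[OF P(1)]) (use K0 C0(1) in simp)
    moreover have "K * 1 <= K * P" by (rule mult_left_mono[OF P(1) K0])
    moreover have "0 <= C8 * P" using P(1) C8_nonneg by simp
    ultimately
    show ?thesis unfolding C10_def by (simp add: algebra_simps)
   qed
   finally show ?thesis by (simp add: P_def)
  qed
 qed
qed

end

section \<open>Smooth data\<close>

text \<open>Boundedness uniform in \<open>e\<close>, \<open>x\<close> and \<open>t\<close>, with
  closure rules instead of explicit constants. Time \<open>0\<close> is left out because quotients
  by \<open>t\<close> occur.\<close>

definition bnd :: "(real => real => real => real) => bool" where
 "bnd g \<longleftrightarrow> (\<exists>C. \<forall>e x t. 0 < e \<and> e <= 1 \<and> 0 <= x \<and> x <= 1 \<and> 0 < t \<and> t <= 1 --> abs (g e x t) <= C)"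

named_theorems bnd_intros

lemma bndI: "(!!e x t. 0 < e ==> e <= 1 ==> 0 <= x ==> x <= 1 ==> 0 < t ==> t <= 1 ==> abs (g e x t) <= C) ==> bnd g"
 unfolding bnd_def by blast

lemma bndE:
 assumes "bnd g"
 obtains C where "1 <= C" "!!e x t. 0 < e ==> e <= 1 ==> 0 <= x ==> x <= 1 ==> 0 < t ==> t <= 1 ==> abs (g e x t) <= C"
proof -
 from assms obtain C where C: "!!e x t. 0 < e ==> e <= 1 ==> 0 <= x ==> x <= 1 ==> 0 < t ==> t <= 1 ==> abs (g e x t) <= C"
  unfolding bnd_def by blast
 show ?thesis
 proof (rule that[of "max 1 C"])
  fix e x t :: real assume "0 < e" "e <= 1" "0 <= x" "x <= 1" "0 < t" "t <= 1"
  from C[OF this] show "abs (g e x t) <= max 1 C" by simp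
 qed simp
qed

lemma bndD:
 "bnd g ==> \<exists>C\<ge>1. unif (%e x t. abs (g e x t) <= C)"
 by (erule bndE) blast

lemma bnd_const [bnd_intros]: "bnd (%e x t. c)"
 by (rule bndI[of _ "abs c"]) simp

lemma bnd_eps [bnd_intros]: "bnd (%e x t. e)" by (rule bndI[of _ 1]) simp
lemma bnd_t [bnd_intros]: "bnd (%e x t. t)" by (rule bndI[of _ 1]) simp

lemma bnd_add [bnd_intros]:
 assumes "bnd g" "bnd h" shows "bnd (%e x t. g e x t + h e x t)"
proof -
 obtain C where C: "1 <= C" "!!e x t. 0 < e ==> e <= 1 ==> 0 <= x ==> x <= 1 ==> 0 < t ==> t <= 1 ==> abs (g e x t) <= C"
  using bndE[OF assms(1)] by metis
 obtain C' where C': "1 <= C'" "!!e x t. 0 < e ==> e <= 1 ==> 0 <= x ==> x <= 1 ==> 0 < t ==> t <= 1 ==> abs (h e x t) <= C'"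
  using bndE[OF assms(2)] by metis
 show ?thesis
 proof (rule bndI[of _ "C + C'"])
  fix e x t :: real assume a: "0 < e" "e <= 1" "0 <= x" "x <= 1" "0 < t" "t <= 1"
  show "abs (g e x t + h e x t) <= C + C'" using C(2)[OF a] C'(2)[OF a] by linarith
 qed
qed

lemma bnd_mult [bnd_intros]:
 assumes "bnd g" "bnd h" shows "bnd (%e x t. g e x t * h e x t)"
proof -
 obtain C where C: "1 <= C" "!!e x t. 0 < e ==> e <= 1 ==> 0 <= x ==> x <= 1 ==> 0 < t ==> t <= 1 ==> abs (g e x t) <= C"
  using bndE[OF assms(1)] by metis
 obtain C' where C': "1 <= C'" "!!e x t. 0 < e ==> e <= 1 ==> 0 <= x ==> x <= 1 ==> 0 < t ==> t <= 1 ==> abs (h e x t) <= C'"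
  using bndE[OF assms(2)] by metis
 show ?thesis
 proof (rule bndI[of _ "C * C'"])
  fix e x t :: real assume a: "0 < e" "e <= 1" "0 <= x" "x <= 1" "0 < t" "t <= 1"
  show "abs (g e x t * h e x t) <= C * C'" unfolding abs_mult
   using C(1) C'(1) by (intro mult_mono C(2)[OF a] C'(2)[OF a]) auto
 qed
qed

lemma bnd_uminus [bnd_intros]: "bnd g ==> bnd (%e x t. - g e x t)"
 unfolding bnd_def by simp

lemma bnd_diff [bnd_intros]: "bnd g ==> bnd h ==> bnd (%e x t. g e x t - h e x t)"
 using bnd_add[of g "%e x t. - h e x t"] bnd_uminus[of h] by simp

lemma bnd_compact:
 assumes "continuous_on Icc g" shows "bnd (%e x t. g x)"
proof -
 have "bounded (g ` Icc)"
  by (rule compact_imp_bounded[OF compact_continuous_image[OF assms compact_Icc]])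
 then obtain C where "\<forall>y\<in>g ` Icc. norm y <= C" unfolding bounded_iff by blast
 thus ?thesis by (intro bndI[of _ C]) auto
qed

text \<open>The power is, up to a constant, a single term of the exponential series of
  \<open>d * s\<close>.\<close>

lemma power_exp_bounded:
 assumes "0 < d"
 shows "\<exists>C. \<forall>s\<ge>0. s ^ m * exp (- (d * s)) <= (C::real)"
proof (intro exI allI impI)
 fix s :: real assume s: "s >= 0"
 have "(\<Sum>n\<in>{m}. (d * s) ^ n /\<^sub>R fact n) <= (\<Sum>n. (d * s) ^ n /\<^sub>R fact n)"
  by (rule sum_le_suminf) (use s assms summable_exp_generic[of "d * s"] in auto)
 hence "(d * s) ^ m / fact m <= exp (d * s)" by (simp add: exp_def divide_inverse mult.commute)
 hence "s ^ m * d ^ m <= exp (d * s) * fact m" by (simp add: pos_divide_le_eq power_mult_distrib mult.commute)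
 thus "s ^ m * exp (- (d * s)) <= fact m / d ^ m"
  using assms by (simp add: exp_minus field_simps)
qed

section \<open>Functions with continuous derivatives up to the boundary\<close>

primrec Ck :: "nat => (real => real) => bool" where
 "Ck 0 g = continuous_on Icc g"
| "Ck (Suc n) g = (\<exists>g'. (\<forall>x\<in>Icc. (g has_real_derivative g' x) (at x within Icc)) \<and> Ck n g')"

lemma Ck_SucE:
 assumes "Ck (Suc n) g"
 obtains g' where "!!x. x \<in> Icc ==> (g has_real_derivative g' x) (at x within Icc)" "Ck n g'"
proof -
 from assms obtain g' where "\<forall>x\<in>Icc. (g has_real_derivative g' x) (at x within Icc)" "Ck n g'" by auto
 thus ?thesis by (intro that[of g']) auto
qed

lemma Ck_Suc_imp: "Ck (Suc n) g ==> Ck n g"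
proof (induction n arbitrary: g)
 case 0
 then obtain g' where "!!x. x\<in>Icc ==> (g has_real_derivative g' x) (at x within Icc)"
  using Ck_SucE by metis
 from DERIV_continuous_on[OF this] show ?case by simp
next
 case (Suc n)
 thus ?case by (metis Ck.simps(2))
qed

lemma Ck_add: "Ck n g ==> Ck n h ==> Ck n (%x. g x + h x)"
proof (induction n arbitrary: g h)
 case 0
 thus ?case by (auto intro!: continuous_intros)
next
 case (Suc n)
 obtain g' where g': "!!x. x\<in>Icc ==> (g has_real_derivative g' x) (at x within Icc)" "Ck n g'"
  using Ck_SucE[OF Suc.prems(1)] by metis
 obtain h' where h': "!!x. x\<in>Icc ==> (h has_real_derivative h' x) (at x within Icc)" "Ck n h'"
  using Ck_SucE[OF Suc.prems(2)] by metis
 note * = g' h'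
 show ?case unfolding Ck.simps
  by (rule exI[of _ "%x. g' x + h' x"]) (auto intro!: DERIV_add * Suc.IH)
qed

lemma Ck_cmult: "Ck n g ==> Ck n (%x. c * g x)"
proof (induction n arbitrary: g)
 case 0
 thus ?case by (auto intro!: continuous_intros)
next
 case (Suc n)
 obtain g' where *: "!!x. x\<in>Icc ==> (g has_real_derivative g' x) (at x within Icc)" "Ck n g'"
  using Ck_SucE[OF Suc.prems(1)] by metis
 show ?case unfolding Ck.simps
  by (rule exI[of _ "%x. c * g' x"]) (auto intro!: DERIV_cmult * Suc.IH)
qed

lemma Ck_mult: "Ck n g ==> Ck n h ==> Ck n (%x. g x * h x)"
proof (induction n arbitrary: g h)
 case 0
 thus ?case by (auto intro!: continuous_intros)
next
 case (Suc n)
 obtain g' where g': "!!x. x\<in>Icc ==> (g has_real_derivative g' x) (at x within Icc)" "Ck n g'"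
  using Ck_SucE[OF Suc.prems(1)] by metis
 obtain h' where h': "!!x. x\<in>Icc ==> (h has_real_derivative h' x) (at x within Icc)" "Ck n h'"
  using Ck_SucE[OF Suc.prems(2)] by metis
 note * = g' h'
 show ?case unfolding Ck.simps
  by (rule exI[of _ "%x. g' x * h x + h' x * g x"])
   (auto intro!: DERIV_mult * Ck_add Suc.IH Ck_Suc_imp[OF Suc.prems(1)] Ck_Suc_imp[OF Suc.prems(2)])
qed

lemma Ck_inverse: "Ck n g ==> (!!x. x \<in> Icc ==> g x ~= 0) ==> Ck n (%x. inverse (g x))"
proof (induction n arbitrary: g)
 case 0
 thus ?case by (auto intro!: continuous_intros)
next
 case (Suc n)
 obtain g' where *: "!!x. x\<in>Icc ==> (g has_real_derivative g' x) (at x within Icc)" "Ck n g'"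
  using Ck_SucE[OF Suc.prems(1)] by metis
 have i: "Ck n (%x. inverse (g x))" by (rule Suc.IH[OF Ck_Suc_imp[OF Suc.prems(1)] Suc.prems(2)])
 show ?case unfolding Ck.simps
 proof (rule exI[of _ "%x. - 1 * (inverse (g x) * (g' x * inverse (g x)))"], intro conjI ballI)
  fix x :: real assume x: "x \<in> Icc"
  show "((%x. inverse (g x)) has_real_derivative - 1 * (inverse (g x) * (g' x * inverse (g x)))) (at x within Icc)"
   using DERIV_inverse'[OF *(1)[OF x] Suc.prems(2)[OF x]] by (simp add: mult_ac)
 qed (intro Ck_cmult Ck_mult i *)
qed

text \<open>A family of successive derivatives under one name, which the explicit formulas for the
  layer functions use. \<open>Ck\<close> is the form in which products and reciprocals are
  handled.\<close>

definition dfam :: "nat => (nat => real => real) => bool" where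
 "dfam n g \<longleftrightarrow> (\<forall>i<n. \<forall>x\<in>Icc. (g i has_real_derivative g (Suc i) x) (at x within Icc)) \<and>
  (\<forall>i\<le>n. continuous_on Icc (g i))"

lemma Ck_dfam: "Ck n g ==> \<exists>h. h 0 = g \<and> dfam n h"
proof (induction n arbitrary: g)
 case 0
 thus ?case by (intro exI[of _ "%_. g"]) (auto simp: dfam_def)
next
 case (Suc n)
 from Suc.prems obtain g' where g': "\<forall>x\<in>Icc. (g has_real_derivative g' x) (at x within Icc)" "Ck n g'" by auto
 then obtain h where h: "h 0 = g'" "dfam n h" using Suc.IH by blast
 have c: "continuous_on Icc g" using g'(1) by (auto intro!: DERIV_continuous_on)
 show ?case
 proof (intro exI[of _ "%i. case i of 0 => g | Suc j => h j"] conjI)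
  show "dfam (Suc n) (%i. case i of 0 => g | Suc j => h j)"
   unfolding dfam_def
  proof (intro conjI allI impI ballI)
   fix i x assume "i < Suc n" "x \<in> {0..1::real}"
   thus "((case i of 0 => g | Suc j => h j) has_real_derivative (case Suc i of 0 => g | Suc j => h j) x) (at x within Icc)"
    using g' h by (cases i) (auto simp: dfam_def)
  next
   fix i assume "i <= Suc n"
   thus "continuous_on Icc (case i of 0 => g | Suc j => h j)"
    using c h by (cases i) (auto simp: dfam_def)
  qed
 qed simp
qed

lemma dfam_Ck: "dfam n g ==> Ck n (g 0)"
proof (induction n arbitrary: g)
 case 0
 thus ?case by (simp add: dfam_def)
next
 case (Suc n)
 have "Ck n (g (Suc 0))" by (rule Suc.IH[of "%i. g (Suc i)"]) (use Suc.prems in \<open>auto simp: dfam_def\<close>)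
 thus ?case using Suc.prems by (auto simp: dfam_def)
qed

lemma differentiable_D:
 "g differentiable (at x within Icc) ==> (g has_real_derivative D g x) (at x within Icc)"
 unfolding D_def has_real_derivative_iff_has_vector_derivative by (simp add: vector_derivative_works)

lemma C_class_dfam: "C_class n g ==> dfam n (%i. (D ^^ i) g)"
 unfolding C_class_def dfam_def
proof (intro conjI allI impI ballI)
 assume *: "(\<forall>i<n. \<forall>s\<in>Icc. (D ^^ i) g differentiable at s within Icc) \<and> continuous_on Icc ((D ^^ n) g)"
 show d: "((D ^^ i) g has_real_derivative (D ^^ Suc i) g x) (at x within Icc)" if "i < n" "x \<in> Icc" for i x
  using * that differentiable_D[of "(D ^^ i) g" x] by auto
 show "continuous_on Icc ((D ^^ i) g)" if "i <= n" for i
 proof (cases "i = n")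
  case False
  thus ?thesis using that by (intro DERIV_continuous_on[OF d]) auto
 qed (use * in auto)
qed

lemma deriv_le_lipschitz:
 fixes g :: "real => real"
 assumes "(g has_real_derivative d) (at x within Icc)" "x \<in> Icc"
  and "!!y. y \<in> Icc ==> abs (g y - g x) <= C * abs (y - x)"
 shows "abs d <= C"
proof -
 have "((%y. abs ((g y - g x) / (y - x))) \<longlongrightarrow> (abs d)) (at x within Icc)"
  using assms(1) by (intro tendsto_rabs) (simp add: has_field_derivative_iff)
 moreover have "eventually (%y. abs ((g y - g x) / (y - x)) <= C) (at x within Icc)"
  unfolding eventually_at_filter using assms(3)
  by (intro always_eventually) (auto simp: abs_divide pos_divide_le_eq)
 ultimately show ?thesis
  by (rule tendsto_upperbound) (use assms(2) in \<open>simp add: trivial_limit_within\<close>)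
qed

lemma lipschitz_within:
 fixes g :: "real => real"
 assumes d: "!!x. x \<in> Icc ==> (g has_real_derivative g' x) (at x within Icc)"
  and K: "!!x. x \<in> Icc ==> abs (g' x) <= K" and xy: "x \<in> Icc" "y \<in> Icc"
 shows "abs (g y - g x) <= K * abs (y - x)"
proof -
 have c: "continuous_on Icc g" by (rule DERIV_continuous_on[OF d])
 have *: "abs (g v - g u) <= K * (v - u)" if "u <= v" "u \<in> Icc" "v \<in> Icc" for u v
 proof (rule abs_diff_le_deriv[OF that(1), where f'=g'])
  show "continuous_on {u..v} g" by (rule continuous_on_subset[OF c]) (use that in auto)
  fix z assume z: "u < z" "z < v"
  hence "0 < z" "z < 1" using that by auto
  thus "DERIV g z :> g' z" using d[of z] by (simp add: at_within_Icc_at)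
  show "abs (g' z) <= K" using z that K by auto
 qed
 show ?thesis using *[of x y] *[of y x] xy by (cases "x <= y") (auto simp: abs_minus_commute)
qed

lemma holder_continuousD:
 assumes "holder_continuous \<gamma> z"
 obtains C where "!!x t x' t'. (x,t) \<in> Qbar ==> (x',t') \<in> Qbar ==>
   abs (z x t - z x' t') <= C * sqrt ((x - x')^2 + abs (t - t')) powr \<gamma>"
proof -
 from assms obtain C where C: "\<forall>(x, t)\<in>Qbar. \<forall>(x', t')\<in>Qbar.
    abs (z x t - z x' t') <= C * sqrt ((x - x')^2 + abs (t - t')) powr \<gamma>"
  unfolding holder_continuous_def by blast
 show ?thesis by (rule that[of C]) (use C in blast)
qed

lemma holder_continuous_bounded:
 assumes "holder_continuous \<gamma> z" "0 < \<gamma>"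
 shows "\<exists>C. \<forall>x\<in>Icc. \<forall>t\<in>Icc. abs (z x t) <= C"
proof -
 obtain C where C: "!!x t x' t'. (x,t) \<in> Qbar ==> (x',t') \<in> Qbar ==>
   abs (z x t - z x' t') <= C * sqrt ((x - x')^2 + abs (t - t')) powr \<gamma>"
  using holder_continuousD[OF assms(1)] by blast
 show ?thesis
 proof (intro exI ballI)
  fix x t :: real assume xt: "x \<in> Icc" "t \<in> Icc"
  have "x^2 <= 1" using xt by (simp add: power_le_one)
  hence "sqrt ((x - 0)^2 + abs (t - 0)) <= sqrt (2^2)" using xt by (intro real_sqrt_le_mono) auto
  hence "sqrt ((x - 0)^2 + abs (t - 0)) <= 2" by simp
  hence "sqrt ((x - 0)^2 + abs (t - 0)) powr \<gamma> <= 2 powr \<gamma>"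
   using assms(2) by (intro powr_mono2) auto
  hence "C * sqrt ((x - 0)^2 + abs (t - 0)) powr \<gamma> <= abs C * 2 powr \<gamma>"
   by (intro mult_mono) auto
  moreover have "abs (z x t - z 0 0) <= C * sqrt ((x - 0)^2 + abs (t - 0)) powr \<gamma>"
   by (rule C) (use xt in \<open>auto simp: Qbar_def\<close>)
  ultimately show "abs (z x t) <= abs (z 0 0) + abs C * 2 powr \<gamma>" by linarith
 qed
qed

lemma holder_continuous_imp_continuous:
 assumes "holder_continuous \<gamma> z" "0 < \<gamma>"
 shows "continuous_on (Icc \<times> Icc) (%(x,t). z x t)"
 unfolding continuous_on_def
proof
 fix p :: "real \<times> real" assume p: "p \<in> Icc \<times> Icc"
 obtain C where C: "!!x t x' t'. (x,t) \<in> Qbar ==> (x',t') \<in> Qbar ==>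
   abs (z x t - z x' t') <= C * sqrt ((x - x')^2 + abs (t - t')) powr \<gamma>"
  using holder_continuousD[OF assms(1)] by blast
 let ?F = "at p within Icc \<times> Icc"
 have "((%q. sqrt ((fst q - fst p)^2 + abs (snd q - snd p))) \<longlongrightarrow> sqrt ((fst p - fst p)^2 + abs (snd p - snd p))) ?F"
  by (intro tendsto_intros)
 hence "((%q. sqrt ((fst q - fst p)^2 + abs (snd q - snd p))) \<longlongrightarrow> 0) ?F" by simp
 hence "((%q. sqrt ((fst q - fst p)^2 + abs (snd q - snd p)) powr \<gamma>) \<longlongrightarrow> 0) ?F"
  by (rule tendsto_zero_powrI[OF _ tendsto_const]) (use assms in \<open>auto intro!: always_eventually\<close>)
 hence l: "((%q. C * sqrt ((fst q - fst p)^2 + abs (snd q - snd p)) powr \<gamma>) \<longlongrightarrow> 0) ?F"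
  by (rule tendsto_mult_right_zero)
 have "((%q. (%(x,t). z x t) q - (%(x,t). z x t) p) \<longlongrightarrow> 0) ?F"
 proof (rule Lim_null_comparison[OF _ l], unfold eventually_at_filter, rule always_eventually, intro allI impI)
  fix q :: "real \<times> real" assume "q \<in> Icc \<times> Icc"
  thus "norm ((%(x,t). z x t) q - (%(x,t). z x t) p) <= C * sqrt ((fst q - fst p)^2 + abs (snd q - snd p)) powr \<gamma>"
   using C[of "fst q" "snd q" "fst p" "snd p"] p by (auto simp: Qbar_def case_prod_unfold)
 qed
 thus "((%(x,t). z x t) \<longlongrightarrow> (%(x,t). z x t) p) ?F" by (rule LIM_zero_cancel)
qed

text \<open>The last conjunct stands in for a bound on the time derivative of
  \<open>Dx z\<close>.\<close>

definition smooth_data :: "real => (real => real => real) => bool" where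
 "smooth_data K z \<longleftrightarrow> (\<forall>x\<in>Icc. \<forall>t\<in>Icc.
  ((%s. z s t) has_real_derivative Dx z x t) (at x within Icc) \<and>
  ((%s. Dx z s t) has_real_derivative Dx (Dx z) x t) (at x within Icc) \<and>
  ((%s. z x s) has_real_derivative Dt z x t) (at t within Icc) \<and>
  ((%s. Dt z x s) has_real_derivative Dt (Dt z) x t) (at t within Icc) \<and>
  (abs (z x t)) <= K \<and> (abs (Dx z x t)) <= K \<and> (abs (Dx (Dx z) x t)) <= K \<and> (abs (Dt z x t)) <= K \<and> (abs (Dt (Dt z) x t)) <= K \<and>
  (abs (Dx z x t - Dx z x 0)) <= K * t)"

lemma holder_class_smooth:
 assumes "holder_class 4 \<gamma> z" "0 < \<gamma>"
 shows "\<exists>K\<ge>1. smooth_data K z" "Ck 4 (%x. z x 0)" "continuous_on (Icc \<times> Icc) (%(x,t). z x t)"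
proof -
 have td: "!!j x t. 2 * (j + 1) <= 4 ==> x \<in> Icc ==> t \<in> Icc ==> t_differentiable (pderiv_xt 0 j z) x t"
  and xd: "!!i j x t. (i + 1) + 2 * j <= 4 ==> x \<in> Icc ==> t \<in> Icc ==> x_differentiable (pderiv_xt i j z) x t"
  and hc: "!!i j. i + 2 * j <= 4 ==> holder_continuous \<gamma> (pderiv_xt i j z)"
  using assms(1) unfolding holder_class_def by (auto simp: Qbar_def)
 have xD: "((%s. w s t) has_real_derivative Dx w x t) (at x within Icc)" if "x_differentiable w x t" for w x t
  using that differentiable_D unfolding x_differentiable_def Dx_def by blast
 have tD: "((%s. w x s) has_real_derivative Dt w x t) (at t within Icc)" if "t_differentiable w x t" for w x t
  using that differentiable_D unfolding t_differentiable_def Dt_def by blast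
 have p: "pderiv_xt 0 0 z = z" "pderiv_xt (Suc 0) 0 z = Dx z" "pderiv_xt 2 0 z = Dx (Dx z)" "pderiv_xt 0 (Suc 0) z = Dt z"
  "pderiv_xt 0 2 z = Dt (Dt z)" "pderiv_xt (Suc 0) (Suc 0) z = Dx (Dt z)"
  by (auto simp: pderiv_xt_def eval_nat_numeral)
 have bd: "\<exists>C. \<forall>x\<in>Icc. \<forall>t\<in>Icc. abs (pderiv_xt i j z x t) <= C" if "i + 2 * j <= 4" for i j
  using holder_continuous_bounded[OF hc[OF that] assms(2)] .
 obtain a1 where a1: "\<forall>x\<in>Icc. \<forall>t\<in>Icc. abs (z x t) <= a1" using bd[of 0 0] unfolding p by auto
 obtain a2 where a2: "\<forall>x\<in>Icc. \<forall>t\<in>Icc. abs (Dx z x t) <= a2" using bd[of "Suc 0" 0] unfolding p by auto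
 obtain a3 where a3: "\<forall>x\<in>Icc. \<forall>t\<in>Icc. abs (Dx (Dx z) x t) <= a3" using bd[of 2 0] unfolding p by auto
 obtain a4 where a4: "\<forall>x\<in>Icc. \<forall>t\<in>Icc. abs (Dt z x t) <= a4" using bd[of 0 "Suc 0"] unfolding p by auto
 obtain a5 where a5: "\<forall>x\<in>Icc. \<forall>t\<in>Icc. abs (Dt (Dt z) x t) <= a5" using bd[of 0 2] unfolding p by auto
 obtain a6 where a6: "\<forall>x\<in>Icc. \<forall>t\<in>Icc. abs (Dx (Dt z) x t) <= a6" using bd[of "Suc 0" "Suc 0"] unfolding p by auto
 note a = a1 a2 a3 a4 a5 a6
 define K where "K = 1 + abs a1 + abs a2 + abs a3 + abs a4 + abs a5 + abs a6"
 have K: "a1 <= K" "a2 <= K" "a3 <= K" "a4 <= K" "a5 <= K" "a6 <= K" "1 <= K" by (auto simp: K_def)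
 have d: "((%s. z s t) has_real_derivative Dx z x t) (at x within Icc)"
  "((%s. Dx z s t) has_real_derivative Dx (Dx z) x t) (at x within Icc)"
  "((%s. z x s) has_real_derivative Dt z x t) (at t within Icc)"
  "((%s. Dt z x s) has_real_derivative Dt (Dt z) x t) (at t within Icc)"
  "((%s. Dt z s t) has_real_derivative Dx (Dt z) x t) (at x within Icc)"
  if "x \<in> Icc" "t \<in> Icc" for x t
  using xD[OF xd[of 0 0, unfolded p, OF _ that]] xD[OF xd[of "Suc 0" 0, unfolded p, OF _ that]]
   xD[OF xd[of 0 "Suc 0", unfolded p, OF _ that]] tD[OF td[of 0, unfolded p, OF _ that]]
   tD[OF td[of "Suc 0", unfolded p, OF _ that]] by simp_all
 \<comment> \<open>The Hoelder class provides \<open>Dx (Dt z)\<close> but not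
   \<open>Dt (Dx z)\<close>. Hence the increment of \<open>z\<close> in space is followed in time
   first, and the derivative in space is taken afterwards.\<close>
 have mixed: "abs (Dx z x t - Dx z x 0) <= K * t" if xt: "x \<in> Icc" "t \<in> Icc" for x t
 proof (rule deriv_le_lipschitz[OF _ xt(1)])
  show "((%s. z s t - z s 0) has_real_derivative Dx z x t - Dx z x 0) (at x within Icc)"
   by (intro DERIV_diff d xt) auto
  fix y :: real assume y: "y \<in> Icc"
  have "abs ((z y t - z x t) - (z y 0 - z x 0)) <= (K * abs (y - x)) * abs (t - 0)"
  proof (rule lipschitz_within[where g="%r. z y r - z x r" and g'="%r. Dt z y r - Dt z x r"])
   fix r :: real assume r: "r \<in> Icc"
   show "((%r. z y r - z x r) has_real_derivative Dt z y r - Dt z x r) (at r within Icc)"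
    by (intro DERIV_diff d xt y r)
   show "abs (Dt z y r - Dt z x r) <= K * abs (y - x)"
   proof (rule lipschitz_within[where g="%s. Dt z s r" and g'="%s. Dx (Dt z) s r"])
    fix s :: real assume s: "s \<in> Icc"
    show "abs (Dx (Dt z) s r) <= K" by (rule order_trans[OF bspec[OF bspec[OF a6 s] r] K(6)])
   qed (use d(5) r xt y in auto)
  qed (use xt in auto)
  thus "abs (z y t - z y 0 - (z x t - z x 0)) <= K * t * abs (y - x)" using xt by (simp add: algebra_simps)
 qed
 have "smooth_data K z" unfolding smooth_data_def
 proof (intro ballI conjI)
  fix x t :: real assume xt: "x \<in> Icc" "t \<in> Icc"
  show "abs (z x t) <= K" by (rule order_trans[OF bspec[OF bspec[OF a1 xt(1)] xt(2)] K(1)])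
  show "abs (Dx z x t) <= K" by (rule order_trans[OF bspec[OF bspec[OF a2 xt(1)] xt(2)] K(2)])
  show "abs (Dx (Dx z) x t) <= K" by (rule order_trans[OF bspec[OF bspec[OF a3 xt(1)] xt(2)] K(3)])
  show "abs (Dt z x t) <= K" by (rule order_trans[OF bspec[OF bspec[OF a4 xt(1)] xt(2)] K(4)])
  show "abs (Dt (Dt z) x t) <= K" by (rule order_trans[OF bspec[OF bspec[OF a5 xt(1)] xt(2)] K(5)])
 qed (rule d mixed; assumption)+
 thus "\<exists>K\<ge>1. smooth_data K z" using K by blast
 show "continuous_on (Icc \<times> Icc) (%(x,t). z x t)"
  using holder_continuous_imp_continuous[OF hc[of 0 0] assms(2)] by (simp add: p)
 have "dfam 4 (%i x. pderiv_xt i 0 z x 0)"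
  unfolding dfam_def
 proof (intro conjI allI impI ballI)
  fix i x assume i: "i < (4::nat)" and x: "x \<in> {0..1::real}"
  have "pderiv_xt (Suc i) 0 z = Dx (pderiv_xt i 0 z)" by (simp add: pderiv_xt_def)
  thus "((%x. pderiv_xt i 0 z x 0) has_real_derivative pderiv_xt (Suc i) 0 z x 0) (at x within Icc)"
   using xD[OF xd[of i 0 x 0]] i x by simp
 next
  fix i assume i: "i <= (4::nat)"
  have c: "continuous_on Icc (%x::real. (x, 0::real))" by (intro continuous_intros)
  from continuous_on_compose2[OF holder_continuous_imp_continuous[OF hc[of i 0] assms(2)] c] i
  show "continuous_on Icc (%x. pderiv_xt i 0 z x 0)" by (auto simp: image_subset_iff)
 qed
 from dfam_Ck[OF this] show "Ck 4 (%x. z x 0)" by (simp add: p)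
qed

section \<open>Initial layer and corner functions\<close>

text \<open>\<open>gl\<close>, \<open>gr\<close> and \<open>ph\<close> list the derivatives of
  \<open>gL\<close>, \<open>gR\<close> and \<open>\<phi>\<close>; \<open>wd\<close> and
  \<open>cd\<close> list those of \<open>f / b\<close> and \<open>b\<close> along
  \<open>t = 0\<close>.\<close>

locale problem_data =
 fixes be \<delta> Kf Kb :: real and f b :: "real => real => real" and gl gr ph wd cd :: "nat => real => real"
 assumes beta_pos: "0 < be" and delta_pos: "0 < \<delta>"
  and b_ge: "x \<in> Icc ==> t \<in> Icc ==> be + \<delta> <= b x t"
  and f_smooth: "smooth_data Kf f" and b_smooth: "smooth_data Kb b"
  and f_cont: "continuous_on (Icc \<times> Icc) (%(x,t). f x t)"
  and b_cont: "continuous_on (Icc \<times> Icc) (%(x,t). b x t)"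
  and wd: "dfam 4 wd" "wd 0 = (%x. f x 0 / b x 0)"
  and cd: "dfam 4 cd" "cd 0 = (%x. b x 0)"
  and ph: "dfam 4 ph" and gl: "dfam 2 gl" and gr: "dfam 2 gr"
  and b_x00: "Dx b 0 0 = 0" and ph_gr: "ph 0 1 = gr 0 0"
begin

definition "a0 = gl 0 0 - ph 0 0"
definition "qd i x = ph i x - wd i x"
text \<open>The value for which, once the initial layer and the corner function are removed, the
  left boundary values start with slope \<open>ph 2 0\<close>, as the initial values demand.\<close>

definition "J e = gl (Suc 0) 0 + b 0 0 * (a0 + qd 0 0) / e - ph 2 0"
definition "ew e t = exp (- (b 0 0 * t / e))"
text \<open>A family closed under differentiation: \<open>kt\<close> and \<open>ktt\<close> are its
  first and second time derivatives scaled by \<open>e\<close> and \<open>e^2\<close>,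
  \<open>kex\<close> and \<open>kexx\<close> its space derivatives.\<close>

definition "ke m A e x t = A x * (t / e) ^ m * exp (- (cd 0 x * t / e))"
definition "kt m A e x t = real m * ke (m - 1) A e x t - ke m (%x. cd 0 x * A x) e x t"
definition "ktt m A e x t = real m * kt (m - 1) A e x t - kt m (%x. cd 0 x * A x) e x t"
definition "kex m A A1 e x t = ke m A1 e x t - ke (Suc m) (%x. A x * cd (Suc 0) x) e x t"
definition "kexx m A A1 A2 e x t = kex m A1 A2 e x t
 - kex (Suc m) (%x. A x * cd (Suc 0) x) (%x. A1 x * cd (Suc 0) x + cd 2 x * A x) e x t"

lemma bounded_atoms [bnd_intros]:
 "i <= 4 ==> bnd (%e x t. wd i x)" "i <= 4 ==> bnd (%e x t. cd i x)" "i <= 4 ==> bnd (%e x t. ph i x)"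
 "i <= 4 ==> bnd (%e x t. qd i x)"
proof -
 show *: "bnd (%e x t. wd i x)" "bnd (%e x t. cd i x)" "bnd (%e x t. ph i x)" if "i <= 4" for i
  using wd cd ph that by (auto simp: dfam_def intro!: bnd_compact)
 thus "bnd (%e x t. qd i x)" if "i <= 4" unfolding qd_def using that by (intro bnd_diff) auto
qed

lemma smoothD:
 assumes "smooth_data C z" "x \<in> Icc" "t \<in> Icc"
 shows "((%s. z s t) has_real_derivative Dx z x t) (at x within Icc)"
  "((%s. Dx z s t) has_real_derivative Dx (Dx z) x t) (at x within Icc)"
  "((%s. z x s) has_real_derivative Dt z x t) (at t within Icc)"
  "((%s. Dt z x s) has_real_derivative Dt (Dt z) x t) (at t within Icc)"
  "abs (z x t) <= C" "abs (Dx z x t) <= C" "abs (Dx (Dx z) x t) <= C" "abs (Dt z x t) <= C" "abs (Dt (Dt z) x t) <= C"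
  "abs (Dx z x t - Dx z x 0) <= C * t"
 using assms(1)[unfolded smooth_data_def, rule_format, OF assms(2,3)] by simp_all

lemma smooth_bnd: "smooth_data C z ==> bnd (%e x t. z x t)" "smooth_data C z ==> bnd (%e x t. Dx z x t)"
 "smooth_data C z ==> bnd (%e x t. Dx (Dx z) x t)" "smooth_data C z ==> bnd (%e x t. Dt z x t)"
 "smooth_data C z ==> bnd (%e x t. Dt (Dt z) x t)"
 by (rule bndI[of _ C], rule smoothD; simp)+

lemmas [bnd_intros] = smooth_bnd[OF f_smooth] smooth_bnd[OF b_smooth]

lemma smooth_interior:
 assumes "smooth_data C z"
 shows "x \<in> Ioo ==> t \<in> Icc ==> DERIV (%s. z s t) x :> Dx z x t"
  "x \<in> Ioo ==> t \<in> Icc ==> DERIV (%s. Dx z s t) x :> Dx (Dx z) x t"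
  "x \<in> Icc ==> t \<in> Ioo ==> DERIV (%s. z x s) t :> Dt z x t"
  "x \<in> Icc ==> t \<in> Ioo ==> DERIV (%s. Dt z x s) t :> Dt (Dt z) x t"
 using smoothD(1-4)[OF assms, of x t] by (auto simp: at_within_Icc_at)

lemma left_deriv_within:
 assumes "(g has_real_derivative d) (at t within Icc)" "t \<in> Ioc"
 shows "(g has_real_derivative d) (at_left t)"
proof -
 have "(g has_real_derivative d) (at t within {0..t})"
  by (rule has_field_derivative_subset[OF assms(1)]) (use assms(2) in auto)
 thus ?thesis using assms(2) by (simp add: at_within_Icc_at_left)
qed

lemma dfam_interior:
 assumes "dfam n g" "i < n" "x \<in> Ioo"
 shows "DERIV (g i) x :> g (Suc i) x"
proof -
 have "(g i has_real_derivative g (Suc i) x) (at x within Icc)" using assms unfolding dfam_def by auto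
 thus ?thesis using assms(3) by (simp add: at_within_Icc_at)
qed

lemma qd_x: "i < 4 ==> x \<in> Ioo ==> DERIV (qd i) x :> qd (Suc i) x"
 unfolding qd_def[abs_def] by (intro DERIV_diff dfam_interior[OF ph] dfam_interior[OF wd(1)])

lemmas cd_x = dfam_interior[OF cd(1)]

lemma cd_ge: "x \<in> Icc ==> be + \<delta> <= cd 0 x"
 using b_ge[of x 0] by (simp add: cd)

text \<open>Of the size of the initial layer, with room for any power of \<open>t / e\<close>. Such
  powers arise when the exponential is differentiated in \<open>x\<close> or when a factor
  \<open>t\<close> compensates a quotient by \<open>e\<close>. The rate \<open>b x 0\<close> exceeds
  \<open>be\<close> by \<open>\<delta>\<close>, which leaves the room.\<close>

definition lay :: "(real => real => real => real) => bool" where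
 "lay g \<longleftrightarrow> (\<forall>n. bnd (%e x t. (t / e) ^ n * g e x t / il e be t))"

named_theorems lay_intros

lemma lay_add [lay_intros]: "lay g ==> lay h ==> lay (%e x t. g e x t + h e x t)"
 unfolding lay_def distrib_left add_divide_distrib by (intro allI bnd_add) simp_all

lemma lay_diff [lay_intros]: "lay g ==> lay h ==> lay (%e x t. g e x t - h e x t)"
 unfolding lay_def right_diff_distrib diff_divide_distrib by (intro allI bnd_diff) simp_all

lemma lay_mult [lay_intros]:
 assumes "bnd g" "lay h" shows "lay (%e x t. g e x t * h e x t)"
 unfolding lay_def
proof
 fix n
 have "bnd (%e x t. g e x t * ((t / e) ^ n * h e x t / il e be t))"
  by (rule bnd_mult[OF assms(1)]) (use assms(2) in \<open>simp add: lay_def\<close>)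
 thus "bnd (%e x t. (t / e) ^ n * (g e x t * h e x t) / il e be t)"
  by (simp add: mult_ac)
qed

lemma lay_s [lay_intros]:
 assumes "lay g" shows "lay (%e x t. (t / e) * g e x t)"
 unfolding lay_def
proof
 fix n
 have "bnd (%e x t. (t / e) ^ Suc n * g e x t / il e be t)" using assms unfolding lay_def by blast
 thus "bnd (%e x t. (t / e) ^ n * ((t / e) * g e x t) / il e be t)"
  by (simp add: mult_ac)
qed

lemma layE:
 assumes "lay g"
 obtains C where "1 <= C" "!!e x t. 0 < e ==> e <= 1 ==> 0 <= x ==> x <= 1 ==> 0 < t ==> t <= 1 ==> abs (g e x t) <= C * il e be t"
proof -
 have "bnd (%e x t. (t / e) ^ 0 * g e x t / il e be t)" using assms unfolding lay_def by blast
 hence *: "bnd (%e x t. g e x t / il e be t)" by simp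
 obtain C where C: "1 <= C" "!!e x t. 0 < e ==> e <= 1 ==> 0 <= x ==> x <= 1 ==> 0 < t ==> t <= 1 ==> abs (g e x t / il e be t) <= C"
  using bndE[OF *] by metis
 show ?thesis
 proof (rule that[OF C(1)])
  fix e x t :: real assume a: "0 < e" "e <= 1" "0 <= x" "x <= 1" "0 < t" "t <= 1"
  show "abs (g e x t) <= C * il e be t" using C(2)[OF a] il_pos[of e be t]
   by (simp add: abs_divide pos_divide_le_eq)
 qed
qed

lemma layD:
 "lay g ==> \<exists>C\<ge>1. unif (%e x t. abs (g e x t) <= C * il e be t)"
 by (erule layE) blast

lemma lay_bnd: assumes "lay g" shows "bnd g"
proof -
 obtain C where C: "1 <= C" "!!e x t. 0 < e ==> e <= 1 ==> 0 <= x ==> x <= 1 ==> 0 < t ==> t <= 1 ==> abs (g e x t) <= C * il e be t"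
  using layE[OF assms] by metis
 show ?thesis
 proof (rule bndI[of _ C])
  fix e x t :: real assume a: "0 < e" "e <= 1" "0 <= x" "x <= 1" "0 < t" "t <= 1"
  have "C * il e be t <= C * 1" using C(1) il_le_1[OF a(1) beta_pos, of t] a by (intro mult_left_mono) auto
  thus "abs (g e x t) <= C" using C(2)[OF a] by simp
 qed
qed

lemma lay_exp:
 assumes "!!x. x \<in> Icc ==> be + \<delta> <= c x"
 shows "lay (%e x t. exp (- (c x * t / e)))"
 unfolding lay_def
proof
 fix n
 obtain C where C: "\<forall>s\<ge>0. s ^ n * exp (- (\<delta> * s)) <= C" using power_exp_bounded[OF delta_pos] by blast
 show "bnd (%e x t. (t / e) ^ n * exp (- (c x * t / e)) / il e be t)"
 proof (rule bndI[of _ C])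
  fix e x t :: real assume a: "0 < e" "e <= 1" "0 <= x" "x <= 1" "0 < t" "t <= 1"
  define s where "s = t / e"
  have s: "0 <= s" using a by (simp add: s_def)
  have "(be + \<delta>) * s <= c x * s" using assms[of x] a s by (intro mult_right_mono) auto
  hence "exp (- (c x * s)) / exp (- (be * s)) <= exp (- (\<delta> * s))"
   unfolding exp_diff[symmetric] by (simp add: algebra_simps)
  hence "s ^ n * (exp (- (c x * s)) / exp (- (be * s))) <= s ^ n * exp (- (\<delta> * s))"
   using s by (intro mult_left_mono) auto
  also have "... <= C" using C s by blast
  finally show "abs ((t / e) ^ n * exp (- (c x * t / e)) / il e be t) <= C"
   using s by (simp add: s_def il_def)
 qed
qed

lemma lay_pow: "lay g ==> lay (%e x t. (t / e) ^ m * g e x t)"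
proof (induction m)
 case (Suc m)
 from lay_s[OF Suc.IH[OF Suc.prems]] show ?case by (simp add: mult_ac)
qed simp

lemma lay_ke [lay_intros]:
 assumes "bnd (%e x t. A x)" shows "lay (ke m A)"
proof -
 have "lay (%e x t. A x * ((t / e) ^ m * exp (- (cd 0 x * t / e))))"
  by (intro lay_mult lay_pow lay_exp assms cd_ge)
 thus ?thesis unfolding ke_def[abs_def] by (simp add: mult.assoc)
qed

lemma lay_kt [lay_intros]: "bnd (%e x t. A x) ==> lay (kt m A)"
 unfolding kt_def[abs_def] by (intro lay_intros bnd_intros) auto

lemma lay_ktt [lay_intros]: "bnd (%e x t. A x) ==> lay (ktt m A)"
 unfolding ktt_def[abs_def] by (intro lay_intros bnd_intros) auto

lemma lay_kex [lay_intros]: "bnd (%e x t. A x) ==> bnd (%e x t. A1 x) ==> lay (kex m A A1)"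
 unfolding kex_def[abs_def] by (intro lay_intros bnd_intros) auto

lemma lay_kexx [lay_intros]:
 "bnd (%e x t. A x) ==> bnd (%e x t. A1 x) ==> bnd (%e x t. A2 x) ==> lay (kexx m A A1 A2)"
 unfolding kexx_def[abs_def] by (intro lay_intros bnd_intros) auto

lemma lay_ew [lay_intros]: "lay (%e x t. ew e t)"
 unfolding ew_def using lay_exp[of "%x. b 0 0"] b_ge[of 0 0] by auto

lemma ke_x:
 assumes "DERIV A x :> A1 x" "x \<in> Ioo"
 shows "DERIV (%s. ke m A e s t) x :> kex m A A1 e x t"
proof -
 have "((%s. A s * (t / e) ^ m * exp (- (cd 0 s * t / e))) has_real_derivative
   (A1 x * (t / e) ^ m) * exp (- (cd 0 x * t / e)) + (exp (- (cd 0 x * t / e)) * (- (cd (Suc 0) x * t / e))) * (A x * (t / e) ^ m)) (at x)"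
  by (intro DERIV_mult DERIV_cmult_right assms DERIV_fun_exp DERIV_minus DERIV_cdivide cd_x) auto
 thus ?thesis unfolding ke_def kex_def by (simp add: algebra_simps)
qed

lemma kex_x:
 assumes "DERIV A x :> A1 x" "DERIV A1 x :> A2 x" "x \<in> Ioo"
 shows "DERIV (%s. kex m A A1 e s t) x :> kexx m A A1 A2 e x t"
proof -
 have "DERIV (%x. A x * cd (Suc 0) x) x :> A1 x * cd (Suc 0) x + cd 2 x * A x"
  using DERIV_mult[OF assms(1) cd_x[of "Suc 0" x]] assms(3) by (simp add: numeral_2_eq_2)
 note 1 = ke_x[where A="%x. A x * cd (Suc 0) x" and ?A1.0="%x. A1 x * cd (Suc 0) x + cd 2 x * A x", OF this assms(3)]
 note 2 = ke_x[where A=A1 and ?A1.0=A2, OF assms(2,3)]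
 show ?thesis unfolding kex_def[of m A A1] kexx_def by (rule DERIV_diff[OF 2 1])
qed

lemma ke_t:
 assumes "e ~= 0"
 shows "DERIV (%s. ke m A e x s) t :> kt m A e x t / e"
proof (cases m)
 case 0
 thus ?thesis unfolding ke_def kt_def using assms
  by (auto intro!: derivative_eq_intros simp: field_simps)
next
 case (Suc k)
 have "((%s. A x * (s / e) ^ Suc k * exp (- (cd 0 x * s / e))) has_real_derivative
   (A x * (real (Suc k) * (t / e) ^ k * (1 / e))) * exp (- (cd 0 x * t / e))
   + exp (- (cd 0 x * t / e)) * (- (cd 0 x * 1 / e)) * (A x * (t / e) ^ Suc k)) (at t)"
 proof (intro DERIV_mult DERIV_cmult DERIV_fun_exp DERIV_minus)
  have "DERIV (%s. (s / e) ^ Suc k) t :> (1 + real k) * (1 / e * (t / e) ^ k)"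
   by (intro DERIV_power_Suc DERIV_cdivide DERIV_ident)
  thus "DERIV (%s. (s / e) ^ Suc k) t :> real (Suc k) * (t / e) ^ k * (1 / e)"
   by (rule DERIV_cong) simp
  show "DERIV (%s. cd 0 x * s / e) t :> cd 0 x * 1 / e"
   by (intro DERIV_cdivide DERIV_cmult DERIV_ident)
 qed
 thus ?thesis unfolding Suc ke_def kt_def by (rule DERIV_cong) (simp add: assms field_simps)
qed

lemma kt_t:
 assumes "e ~= 0"
 shows "DERIV (%s. kt m A e x s) t :> ktt m A e x t / e"
proof -
 have "DERIV (%s. kt m A e x s) t :> real m * (kt (m-1) A e x t / e) - kt m (%x. cd 0 x * A x) e x t / e"
  unfolding kt_def[of m A] by (intro DERIV_diff DERIV_cmult ke_t assms)
 thus ?thesis unfolding ktt_def by (simp add: diff_divide_distrib)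
qed

section \<open>The initial layer and its residual\<close>

definition "p0 = ke 0 (qd 0)"
definition "p0x = kex 0 (qd 0) (qd (Suc 0))"
text \<open>\<open>B1\<close> and \<open>B2\<close> are, up to sign, the coefficients of the first
  and second power of \<open>t / e\<close> in the second space derivative of the layer.\<close>

definition "B1 x = 2 * (qd (Suc 0) x * cd (Suc 0) x) + qd 0 x * cd 2 x"
definition "B1x x = 2 * (qd 2 x * cd (Suc 0) x + qd (Suc 0) x * cd 2 x) + (qd (Suc 0) x * cd 2 x + qd 0 x * cd 3 x)"
definition "B1xx x = 2 * (qd 3 x * cd (Suc 0) x + qd 2 x * cd 2 x + (qd 2 x * cd 2 x + qd (Suc 0) x * cd 3 x))
 + (qd 2 x * cd 2 x + qd (Suc 0) x * cd 3 x + (qd (Suc 0) x * cd 3 x + qd 0 x * cd 4 x))"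
definition "B2 x = qd 0 x * (cd (Suc 0) x * cd (Suc 0) x)"
definition "B2x x = qd (Suc 0) x * (cd (Suc 0) x * cd (Suc 0) x) + 2 * (qd 0 x * (cd (Suc 0) x * cd 2 x))"
definition "B2xx x = qd 2 x * (cd (Suc 0) x * cd (Suc 0) x) + 2 * (qd (Suc 0) x * (cd (Suc 0) x * cd 2 x))
 + 2 * (qd (Suc 0) x * (cd (Suc 0) x * cd 2 x) + qd 0 x * (cd 2 x * cd 2 x + cd (Suc 0) x * cd 3 x))"
definition "p0xx e x t = ke 0 (qd 2) e x t - ke 1 B1 e x t + ke 2 B2 e x t"
definition "p0xxx e x t = kex 0 (qd 2) (qd 3) e x t - kex 1 B1 B1x e x t + kex 2 B2 B2x e x t"
definition "p0xxxx e x t = kexx 0 (qd 2) (qd 3) (qd 4) e x t - kexx 1 B1 B1x B1xx e x t + kexx 2 B2 B2x B2xx e x t"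
definition "p0t = kt 0 (qd 0)"
definition "p0tt = ktt 0 (qd 0)"
definition "p0xxt e x t = kt 0 (qd 2) e x t - kt 1 B1 e x t + kt 2 B2 e x t"
definition "p0xxtt e x t = ktt 0 (qd 2) e x t - ktt 1 B1 e x t + ktt 2 B2 e x t"

lemma B_bnd [bnd_intros]: "bnd (%e x t. B1 x)" "bnd (%e x t. B1x x)" "bnd (%e x t. B1xx x)"
 "bnd (%e x t. B2 x)" "bnd (%e x t. B2x x)" "bnd (%e x t. B2xx x)"
 unfolding B1_def B1x_def B1xx_def B2_def B2x_def B2xx_def by (intro bnd_intros; simp)+

lemma numerals_Suc: "(2::nat) = Suc (Suc 0)" "(3::nat) = Suc (Suc (Suc 0))" "(4::nat) = Suc (Suc (Suc (Suc 0)))"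
 by simp_all

lemma B_x:
 assumes "x \<in> Ioo"
 shows "DERIV B1 x :> B1x x" "DERIV B1x x :> B1xx x"
  "DERIV B2 x :> B2x x" "DERIV B2x x :> B2xx x"
proof -
 have q: "DERIV (qd 0) x :> qd (Suc 0) x" "DERIV (qd (Suc 0)) x :> qd 2 x"
  "DERIV (qd 2) x :> qd 3 x"
  using qd_x[of _ x] assms by (simp_all add: numerals_Suc)
 have c: "DERIV (cd (Suc 0)) x :> cd 2 x" "DERIV (cd 2) x :> cd 3 x" "DERIV (cd 3) x :> cd 4 x"
  using cd_x[of _ x] assms by (simp_all add: numerals_Suc)
 show "DERIV B1 x :> B1x x" unfolding B1_def[abs_def] B1x_def
  by (rule DERIV_cong[OF DERIV_add[OF DERIV_cmult[OF DERIV_mult[OF q(2) c(1)]] DERIV_mult[OF q(1) c(2)]]]) (simp add: algebra_simps)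
 show "DERIV B1x x :> B1xx x" unfolding B1x_def[abs_def] B1xx_def
  by (rule DERIV_cong[OF DERIV_add[OF DERIV_cmult[OF DERIV_add[OF DERIV_mult[OF q(3) c(1)] DERIV_mult[OF q(2) c(2)]]]
   DERIV_add[OF DERIV_mult[OF q(2) c(2)] DERIV_mult[OF q(1) c(3)]]]]) (simp add: algebra_simps)
 show "DERIV B2 x :> B2x x" unfolding B2_def[abs_def] B2x_def
  by (rule DERIV_cong[OF DERIV_mult[OF q(1) DERIV_mult[OF c(1) c(1)]]]) (simp add: algebra_simps)
 show "DERIV B2x x :> B2xx x" unfolding B2x_def[abs_def] B2xx_def
  by (rule DERIV_cong[OF DERIV_add[OF DERIV_mult[OF q(2) DERIV_mult[OF c(1) c(1)]]
   DERIV_cmult[OF DERIV_mult[OF q(1) DERIV_mult[OF c(1) c(2)]]]]]) (simp add: algebra_simps)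
qed

lemma p0_derivs:
 assumes x: "x \<in> Ioo"
 shows "DERIV (%s. p0 e s t) x :> p0x e x t"
  "DERIV (%s. p0x e s t) x :> p0xx e x t"
  "DERIV (%s. p0xx e s t) x :> p0xxx e x t"
  "DERIV (%s. p0xxx e s t) x :> p0xxxx e x t"
proof -
 have q: "DERIV (qd 0) x :> qd (Suc 0) x" "DERIV (qd (Suc 0)) x :> qd 2 x"
  "DERIV (qd 2) x :> qd 3 x" "DERIV (qd 3) x :> qd 4 x"
  using qd_x[of _ x] assms by (simp_all add: numerals_Suc)
 show "DERIV (%s. p0 e s t) x :> p0x e x t" unfolding p0_def p0x_def by (rule ke_x[where A="qd 0" and ?A1.0="qd (Suc 0)", OF q(1) x])
 have "kexx 0 (qd 0) (qd (Suc 0)) (qd 2) e x t = p0xx e x t"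
  unfolding kexx_def kex_def p0xx_def ke_def B1_def B2_def by (simp add: algebra_simps power2_eq_square)
 thus "DERIV (%s. p0x e s t) x :> p0xx e x t"
  using kex_x[where A="qd 0" and ?A1.0="qd (Suc 0)" and ?A2.0="qd 2" and m=0 and e=e and t=t, OF q(1,2) x] unfolding p0x_def by simp
 show "DERIV (%s. p0xx e s t) x :> p0xxx e x t" unfolding p0xx_def p0xxx_def
  by (intro DERIV_add DERIV_diff ke_x q B_x x)
 show "DERIV (%s. p0xxx e s t) x :> p0xxxx e x t" unfolding p0xxx_def p0xxxx_def
  by (intro DERIV_add DERIV_diff kex_x q B_x x)
qed

lemma p0_t:
 assumes "e ~= 0"
 shows "DERIV (%s. p0 e x s) t :> p0t e x t / e"
  "DERIV (%s. p0t e x s) t :> p0tt e x t / e"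
  "DERIV (%s. p0xx e x s) t :> p0xxt e x t / e"
  "DERIV (%s. p0xxt e x s) t :> p0xxtt e x t / e"
 unfolding p0_def p0t_def p0tt_def p0xx_def p0xxt_def p0xxtt_def add_divide_distrib diff_divide_distrib
 by (intro DERIV_add DERIV_diff ke_t kt_t assms)+

lemma p0_lay [lay_intros]: "lay p0" "lay p0x" "lay p0xx" "lay p0xxx" "lay p0xxxx" "lay p0t" "lay p0tt" "lay p0xxt" "lay p0xxtt"
 unfolding p0_def p0x_def p0xx_def[abs_def] p0xxx_def[abs_def] p0xxxx_def[abs_def] p0t_def p0tt_def
  p0xxt_def[abs_def] p0xxtt_def[abs_def]
 by (intro lay_intros bnd_intros; simp)+

lemma bt_bnd [bnd_intros]: "bnd (%e x t. (b x t - cd 0 x) / t)"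
proof (rule bndI[of _ Kb])
 fix e x t :: real assume a: "0 <= x" "x <= 1" "0 < t" "t <= 1"
 have "abs (b x t - b x 0) <= Kb * abs (t - 0)"
  by (rule lipschitz_within[where g="%s. b x s" and g'="%s. Dt b x s"]) (use smoothD[OF b_smooth] a in auto)
 thus "abs ((b x t - cd 0 x) / t) <= Kb" using a by (simp add: cd pos_divide_le_eq)
qed

text \<open>The residual of the initial layer: \<open>p0\<close> satisfies the equation without
  diffusion and with the coefficient frozen at \<open>t = 0\<close>, and these two terms are what
  remains.\<close>

definition "PP e x t = (b x t - cd 0 x) * p0 e x t - e * p0xx e x t"
definition "PPx e x t = (Dx b x t - cd (Suc 0) x) * p0 e x t + p0x e x t * (b x t - cd 0 x) - e * p0xxx e x t"
definition "PPxx e x t = ((Dx (Dx b) x t - cd 2 x) * p0 e x t + p0x e x t * (Dx b x t - cd (Suc 0) x))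
 + (p0xx e x t * (b x t - cd 0 x) + (Dx b x t - cd (Suc 0) x) * p0x e x t) - e * p0xxxx e x t"
definition "PPt e x t = Dt b x t * p0 e x t + p0t e x t / e * (b x t - cd 0 x) - e * (p0xxt e x t / e)"
definition "PPtt e x t = (Dt (Dt b) x t * p0 e x t + p0t e x t / e * Dt b x t)
 + ((p0tt e x t / e) / e * (b x t - cd 0 x) + Dt b x t * (p0t e x t / e)) - e * ((p0xxtt e x t / e) / e)"

lemma PP_x:
 assumes x: "x \<in> Ioo" and t: "t \<in> Icc"
 shows "DERIV (%s. PP e s t) x :> PPx e x t"
  "DERIV (%s. PPx e s t) x :> PPxx e x t"
proof -
 have c: "DERIV (cd 0) x :> cd (Suc 0) x" "DERIV (cd (Suc 0)) x :> cd 2 x"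
  using cd_x[of _ x] x by (simp_all add: numerals_Suc)
 note b = smooth_interior(1,2)[OF b_smooth x t]
 show "DERIV (%s. PP e s t) x :> PPx e x t" unfolding PP_def PPx_def
  by (intro DERIV_diff DERIV_cmult DERIV_mult[OF DERIV_diff] b c p0_derivs[OF x])
 show "DERIV (%s. PPx e s t) x :> PPxx e x t" unfolding PPx_def PPxx_def
  by (intro DERIV_diff DERIV_add DERIV_cmult DERIV_mult[OF DERIV_diff] DERIV_mult[OF _ DERIV_diff] b c p0_derivs[OF x])
qed

lemma PP_t:
 assumes x: "x \<in> Icc" and t: "t \<in> Ioo" and e: "e ~= 0"
 shows "DERIV (%s. PP e x s) t :> PPt e x t"
  "DERIV (%s. PPt e x s) t :> PPtt e x t"
proof -
 note b = smooth_interior(3,4)[OF b_smooth x t]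
 have b': "DERIV (%s. b x s - cd 0 x) t :> Dt b x t"
  using DERIV_diff[OF b(1) DERIV_const[of "cd 0 x"]] by simp
 show "DERIV (%s. PP e x s) t :> PPt e x t" unfolding PP_def PPt_def
  by (intro DERIV_diff DERIV_cmult DERIV_mult[OF b'] p0_t e)
 show "DERIV (%s. PPt e x s) t :> PPtt e x t" unfolding PPt_def PPtt_def
  by (intro DERIV_diff DERIV_add DERIV_cmult DERIV_mult[OF _ b'] DERIV_mult[OF b(2)] DERIV_cdivide p0_t e)
qed

lemma bnd_cong:
 assumes "bnd g" "!!e x t. 0 < e ==> 0 < t ==> 0 <= x ==> g e x t = h e x t"
 shows "bnd h"
 using assms unfolding bnd_def by metis

lemma lay_cong:
 assumes "lay g" "!!e x t. 0 < e ==> 0 < t ==> 0 <= x ==> g e x t = h e x t"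
 shows "lay h"
 unfolding lay_def
proof
 fix n
 have "bnd (%e x t. (t / e) ^ n * g e x t / il e be t)" using assms(1) unfolding lay_def by blast
 thus "bnd (%e x t. (t / e) ^ n * h e x t / il e be t)" by (rule bnd_cong) (simp add: assms(2))
qed

text \<open>The factor \<open>b x t - cd 0 x\<close> is of order \<open>t = e * (t / e)\<close>. It
  gains one power of \<open>e\<close>, and each time derivative loses one.\<close>

lemma PP_lay:
 "lay (%e x t. PP e x t / e)" "lay PPt" "lay (%e x t. e * PPtt e x t)" "lay PPxx"
proof -
 have "lay (%e x t. ((b x t - cd 0 x) / t) * ((t / e) * p0 e x t) - p0xx e x t)"
  by (intro lay_intros bnd_intros)
 thus "lay (%e x t. PP e x t / e)" by (rule lay_cong) (simp add: PP_def field_simps)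
 have "lay (%e x t. Dt b x t * p0 e x t + ((b x t - cd 0 x) / t) * ((t / e) * p0t e x t) - p0xxt e x t)"
  by (intro lay_intros bnd_intros)
 thus "lay PPt" by (rule lay_cong) (simp add: PPt_def field_simps)
 have "lay (%e x t. e * (Dt (Dt b) x t * p0 e x t) + 2 * (Dt b x t * p0t e x t)
  + ((b x t - cd 0 x) / t) * ((t / e) * p0tt e x t) - p0xxtt e x t)"
  by (intro lay_intros bnd_intros)
 thus "lay (%e x t. e * PPtt e x t)" by (rule lay_cong) (simp add: PPtt_def field_simps)
 have "lay (%e x t. ((Dx (Dx b) x t - cd 2 x) * p0 e x t + (Dx b x t - cd (Suc 0) x) * p0x e x t)
 + ((b x t - cd 0 x) * p0xx e x t + (Dx b x t - cd (Suc 0) x) * p0x e x t) - e * p0xxxx e x t)"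
  by (intro lay_intros bnd_intros) auto
 thus "lay PPxx" by (rule lay_cong) (simp add: PPxx_def mult_ac)
qed

text \<open>Each factor below is normalised by its natural size near the corner,
 with \<open>d = t + x^2\<close>.\<close>

lemma corner_atoms [bnd_intros]:
 "bnd (%e x t. hE x t * ((t + x^2) / t))" "bnd (%e x t. hEt x t * (t + x^2))" "bnd (%e x t. hEtt x t * (t + x^2)^2)"
 "bnd (%e x t. hEx x t * sqrt (t + x^2))" "bnd (%e x t. hZ x t * ((t + x^2) / t^2))"
 "bnd (%e x t. hZx x t * (sqrt (t + x^2) / t))" "bnd (%e x t. t / (t + x^2))"
proof -
 let ?c = "1000000 :: real"
 have ratio: "0 <= t / (t + x^2)" "t / (t + x^2) <= 1" "0 < t + x^2" if "0 < t" for t x :: real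
  using that add_pos_nonneg[OF that, of "x^2"] by (auto simp: divide_le_eq_1)
 show "bnd (%e x t. t / (t + x^2))" by (rule bndI[of _ 1]) (use ratio in \<open>simp add: abs_of_nonneg\<close>)
 have E: "abs (hE x t * ((t + x^2) / t)) <= ?c" if "0 <= x" "0 < t" for x t
 proof -
  have "hE x t * ((t + x^2) / t) <= ?c * (t / (t + x^2))^2 * ((t + x^2) / t)"
   using hE_le[OF that(2,1)] ratio[OF that(2), of x] that by (intro mult_right_mono) auto
  also have "... = ?c * (t / (t + x^2))" using ratio[OF that(2), of x] that by (simp add: power2_eq_square)
  also have "... <= ?c * 1" using ratio[OF that(2), of x] by (intro mult_left_mono) auto
  finally have "hE x t * ((t + x^2) / t) <= ?c" by simp
  moreover have "0 <= hE x t * ((t + x^2) / t)"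
   using hE_nonneg[OF that(2), of x] ratio[OF that(2), of x] that by (intro mult_nonneg_nonneg) auto
  ultimately show ?thesis by simp
 qed
 thus "bnd (%e x t. hE x t * ((t + x^2) / t))" by (intro bndI[of _ ?c])
 show "bnd (%e x t. hEt x t * (t + x^2))"
 proof (rule bndI[of _ ?c])
  fix x t :: real assume "0 <= x" "0 < t"
  thus "abs (hEt x t * (t + x^2)) <= ?c" using hEt_le[of t x] ratio[of t x]
   by (simp add: abs_mult pos_le_divide_eq)
 qed
 show "bnd (%e x t. hEtt x t * (t + x^2)^2)"
 proof (rule bndI[of _ ?c])
  fix x t :: real assume "0 <= x" "0 < t"
  thus "abs (hEtt x t * (t + x^2)^2) <= ?c" using hEtt_le[of t x] ratio[of t x]
   by (simp add: abs_mult pos_le_divide_eq)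
 qed
 show "bnd (%e x t. hEx x t * sqrt (t + x^2))"
 proof (rule bndI[of _ ?c])
  fix x t :: real assume "0 <= x" "0 < t"
  thus "abs (hEx x t * sqrt (t + x^2)) <= ?c" using hEx_le[of t x] ratio[of t x]
   by (simp add: abs_mult pos_le_divide_eq)
 qed
 show "bnd (%e x t. hZ x t * ((t + x^2) / t^2))"
 proof (rule bndI[of _ ?c])
  fix x t :: real assume xt: "0 <= x" "0 < t"
  have "abs (hZ x t * ((t + x^2) / t^2)) = hZ x t * ((t + x^2) / t^2)"
   using hZ_nonneg[of x t] ratio[OF xt(2), of x] xt by simp
  also have "... <= (t * hE x t) * ((t + x^2) / t^2)"
   using hZ_le[OF xt(2,1)] ratio[OF xt(2), of x] by (intro mult_right_mono) auto
  also have "... = hE x t * ((t + x^2) / t)" using xt by (simp add: power2_eq_square)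
  finally show "abs (hZ x t * ((t + x^2) / t^2)) <= ?c" using E[OF xt] by linarith
 qed
 show "bnd (%e x t. hZx x t * (sqrt (t + x^2) / t))"
 proof (rule bndI[of _ ?c])
  fix x t :: real assume "0 <= x" "0 < t"
  thus "abs (hZx x t * (sqrt (t + x^2) / t)) <= ?c" using hZx_le[of t x] ratio[of t x]
   by (simp add: abs_mult pos_le_divide_eq pos_divide_le_eq)
 qed
qed

text \<open>Here \<open>Dx b 0 0 = 0\<close> enters: \<open>b - b 0 0\<close> is of the order of the
  squared parabolic distance to the corner and so cancels one power of the singularity of the corner
  functions.\<close>

lemma b_corner [bnd_intros]:
 "bnd (%e x t. (b x t - b 0 0) / (t + x^2))" "bnd (%e x t. Dx b x t / sqrt (t + x^2))"
proof -
 have Kb: "0 <= Kb" using smoothD(5)[OF b_smooth, of 0 0] by simp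
 have bx0: "abs (Dx b x 0) <= Kb * x" if "x \<in> Icc" for x
  using lipschitz_within[of "%x. Dx b x 0" "%x. Dx (Dx b) x 0" Kb 0 x] smoothD[OF b_smooth, of _ 0] that b_x00 by auto
 have b0: "abs (b x 0 - b 0 0) <= Kb * x^2" if x: "x \<in> Icc" for x
 proof -
  have "abs (b x 0 - b 0 0) <= (Kb * x) * (x - 0)"
  proof (rule abs_diff_le_deriv[where f'="%y. Dx b y 0"])
   have "continuous_on Icc (%s. b s 0)"
    by (rule DERIV_continuous_on) (use smoothD(1)[OF b_smooth, of _ 0] in auto)
   thus "continuous_on {0..x} (%s. b s 0)" by (rule continuous_on_subset) (use x in auto)
   fix y assume y: "0 < y" "y < x"
   show "DERIV (%s. b s 0) y :> Dx b y 0"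
    by (rule smooth_interior(1)[OF b_smooth]) (use y x in auto)
   have "Kb * y <= Kb * x" using y Kb by (intro mult_left_mono) auto
   thus "abs (Dx b y 0) <= Kb * x" using bx0[of y] y x by auto
  qed (use x in auto)
  thus ?thesis by (simp add: power2_eq_square mult.assoc)
 qed
 show "bnd (%e x t. (b x t - b 0 0) / (t + x^2))"
 proof (rule bndI[of _ Kb])
  fix x t :: real assume a: "0 <= x" "x <= 1" "0 < t" "t <= 1"
  have "abs (b x t - b x 0) <= Kb * abs (t - 0)"
   by (rule lipschitz_within[where g="%s. b x s" and g'="%s. Dt b x s"]) (use smoothD[OF b_smooth] a in auto)
  hence "abs (b x t - b 0 0) <= Kb * (t + x^2)" using b0[of x] a by (simp add: distrib_left)
  thus "abs ((b x t - b 0 0) / (t + x^2)) <= Kb"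
   using add_pos_nonneg[OF a(3), of "x^2"] by (simp add: pos_divide_le_eq)
 qed
 show "bnd (%e x t. Dx b x t / sqrt (t + x^2))"
 proof (rule bndI[of _ "2 * Kb"])
  fix x t :: real assume a: "0 <= x" "x <= 1" "0 < t" "t <= 1"
  have p: "0 < sqrt (t + x^2)" using add_pos_nonneg[OF a(3), of "x^2"] by simp
  have "x <= sqrt (t + x^2)" by (rule real_le_rsqrt) (use a in simp)
  moreover have "t <= sqrt (t + x^2)"
   by (rule real_le_rsqrt) (use a in \<open>simp add: power2_eq_square mult_left_le add_increasing2\<close>)
  ultimately have "Kb * (x + t) <= Kb * (2 * sqrt (t + x^2))" using Kb by (intro mult_left_mono) auto
  moreover have "abs (Dx b x t) <= Kb * (x + t)"
   using bx0[of x] smoothD(10)[OF b_smooth, of x t] a by (simp add: distrib_left)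
  ultimately show "abs (Dx b x t / sqrt (t + x^2)) <= 2 * Kb" using p by (simp add: pos_divide_le_eq)
 qed
qed

section \<open>Corner functions and their residual\<close>

lemma J_bnd [bnd_intros]: "bnd (%e x t. J e * e)"
proof -
 have "bnd (%e x t. gl (Suc 0) 0 * e + b 0 0 * (a0 + qd 0 0) - ph 2 0 * e)" by (intro bnd_intros)
 thus ?thesis by (rule bnd_cong) (simp add: J_def field_simps)
qed

text \<open>The two corner functions together, the multiple of \<open>z0\<close> already removed in
  problem (Y) and \<open>q\<close>. Both are \<open>ew\<close> times a solution of the heat
  equation, so their residual is \<open>b - b 0 0\<close> times the function.\<close>

definition "Ph e x t = ew e t * (a0 * hE x t + J e * hZ x t)"
definition "Phx e x t = ew e t * (a0 * hEx x t + J e * hZx x t)"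
definition "Phxx e x t = ew e t * (a0 * hEt x t + J e * hE x t)"
definition "Pht e x t = ew e t * (a0 * hEt x t + J e * hE x t) - (b 0 0 / e) * (ew e t * (a0 * hE x t + J e * hZ x t))"
definition "Phtt e x t = ew e t * (a0 * hEtt x t + J e * hEt x t) - 2 * ((b 0 0 / e) * (ew e t * (a0 * hEt x t + J e * hE x t)))
 + (b 0 0 / e) * ((b 0 0 / e) * (ew e t * (a0 * hE x t + J e * hZ x t)))"

lemma ew_t: "e ~= 0 ==> DERIV (%s. ew e s) t :> - (b 0 0 / e) * ew e t"
 unfolding ew_def by (auto intro!: derivative_eq_intros)

lemma Ph_x:
 assumes "0 < t"
 shows "DERIV (%s. Ph e s t) x :> Phx e x t"
  "DERIV (%s. Phx e s t) x :> Phxx e x t"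
 unfolding Ph_def Phx_def Phxx_def
 by (intro DERIV_cmult DERIV_add hE_x hEx_x hZ_x hZx_x assms)+

lemma Ph_t:
 assumes t: "0 < t" and e: "e ~= 0"
 shows "DERIV (%s. Ph e x s) t :> Pht e x t"
  "DERIV (%s. Pht e x s) t :> Phtt e x t"
proof -
 have g: "DERIV (%s. a0 * hE x s + J e * hZ x s) t :> a0 * hEt x t + J e * hE x t"
  "DERIV (%s. a0 * hEt x s + J e * hE x s) t :> a0 * hEtt x t + J e * hEt x t"
  by (intro DERIV_cmult DERIV_add hE_t hEt_t hZ_t t)+
 show 1: "DERIV (%s. Ph e x s) t :> Pht e x t" unfolding Ph_def Pht_def
  by (rule DERIV_cong[OF DERIV_mult[OF ew_t[OF e] g(1)]]) (simp add: algebra_simps)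
 have "((%s. ew e s * (a0 * hEt x s + J e * hE x s) - (b 0 0 / e) * Ph e x s) has_real_derivative
  ((- (b 0 0 / e) * ew e t) * (a0 * hEt x t + J e * hE x t) + (a0 * hEtt x t + J e * hEt x t) * ew e t) - (b 0 0 / e) * Pht e x t) (at t)"
  by (intro DERIV_diff DERIV_cmult DERIV_mult[OF ew_t[OF e] g(2)] 1)
 thus "DERIV (%s. Pht e x s) t :> Phtt e x t"
  unfolding Pht_def[abs_def] Ph_def[symmetric] unfolding Phtt_def Ph_def
  by (rule DERIV_cong) (simp add: algebra_simps)
qed

text \<open>The coefficients in \<open>Ph_eq\<close>: products of normalised factors with an
  exponential, to which \<open>lay\<close> applies. All singular powers of \<open>t + x^2\<close>
  and of \<open>e\<close> are kept outside.\<close>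

definition "U0 e x t = a0 * (hE x t * ((t + x^2) / t)) * ew e t + (J e * e) * (hZ x t * ((t + x^2) / t^2)) * ((t / e) * ew e t)"
definition "U1 e x t = a0 * (hEt x t * (t + x^2)) * ew e t"
definition "U2 e x t = (J e * e) * (hE x t * ((t + x^2) / t)) * ew e t - b 0 0 * U0 e x t"
definition "V0 e x t = a0 * (hEtt x t * (t + x^2)^2) * ew e t"
definition "V1 e x t = (J e * e) * (hEt x t * (t + x^2)) * ew e t - (2 * b 0 0 * a0) * (hEt x t * (t + x^2)) * ew e t"
definition "V2 e x t = b 0 0 * (b 0 0 * U0 e x t) - (2 * b 0 0) * ((J e * e) * (hE x t * ((t + x^2) / t)) * ew e t)"

lemma U_lay [lay_intros]: "lay U0" "lay U1" "lay U2" "lay V0" "lay V1" "lay V2"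
proof -
 show 0: "lay U0" unfolding U0_def[abs_def] by (intro lay_intros bnd_intros)
 show "lay U1" unfolding U1_def[abs_def] by (intro lay_intros bnd_intros)
 show "lay U2" unfolding U2_def[abs_def] by (intro lay_intros bnd_intros 0)
 show "lay V0" unfolding V0_def[abs_def] by (intro lay_intros bnd_intros)
 show "lay V1" unfolding V1_def[abs_def] by (intro lay_intros bnd_intros)
 show "lay V2" unfolding V2_def[abs_def] by (intro lay_intros bnd_intros 0)
qed

lemma Ph_eq:
 assumes "0 < e" "0 < t"
 shows "Ph e x t = t / (t + x^2) * U0 e x t"
  "Pht e x t = U1 e x t / (t + x^2) + (1 / e) * (t / (t + x^2)) * U2 e x t"
  "Phtt e x t = V0 e x t / (t + x^2)^2 + (1 / e) * (V1 e x t / (t + x^2)) + (1 / e) * ((1 / e) * (t / (t + x^2))) * V2 e x t"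
proof -
 define d where "d = t + x^2"
 have d: "0 < d" using assms by (simp add: d_def add_pos_nonneg)
 note defs = Ph_def Pht_def Phtt_def U0_def U1_def U2_def V0_def V1_def V2_def
 show "Ph e x t = t / (t + x^2) * U0 e x t"
  "Pht e x t = U1 e x t / (t + x^2) + (1 / e) * (t / (t + x^2)) * U2 e x t"
  "Phtt e x t = V0 e x t / (t + x^2)^2 + (1 / e) * (V1 e x t / (t + x^2)) + (1 / e) * ((1 / e) * (t / (t + x^2))) * V2 e x t"
  unfolding defs d_def[symmetric] using d assms by (simp_all add: field_simps power2_eq_square)
qed

definition "SS e x t = (b x t - b 0 0) * Ph e x t"
definition "SSx e x t = Dx b x t * Ph e x t + Phx e x t * (b x t - b 0 0)"
definition "SSxx e x t = (Dx (Dx b) x t * Ph e x t + Phx e x t * Dx b x t) + (Phxx e x t * (b x t - b 0 0) + Dx b x t * Phx e x t)"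
definition "SSt e x t = Dt b x t * Ph e x t + Pht e x t * (b x t - b 0 0)"
definition "SStt e x t = (Dt (Dt b) x t * Ph e x t + Pht e x t * Dt b x t) + (Phtt e x t * (b x t - b 0 0) + Dt b x t * Pht e x t)"

lemma SS_x:
 assumes x: "x \<in> Ioo" and t: "t \<in> Ioc"
 shows "DERIV (%s. SS e s t) x :> SSx e x t"
  "DERIV (%s. SSx e s t) x :> SSxx e x t"
proof -
 have t': "t \<in> Icc" "0 < t" using t by auto
 note b = smooth_interior(1,2)[OF b_smooth x t'(1)]
 have b': "DERIV (%s. b s t - b 0 0) x :> Dx b x t"
  using DERIV_diff[OF b(1) DERIV_const[of "b 0 0"]] by simp
 show "DERIV (%s. SS e s t) x :> SSx e x t" unfolding SS_def SSx_def
  by (intro DERIV_mult b' Ph_x t')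
 show "DERIV (%s. SSx e s t) x :> SSxx e x t" unfolding SSx_def SSxx_def
  by (intro DERIV_add DERIV_mult b b' Ph_x t')
qed

lemma SS_t:
 assumes x: "x \<in> Icc" and t: "t \<in> Ioo" and e: "e ~= 0"
 shows "DERIV (%s. SS e x s) t :> SSt e x t"
  "DERIV (%s. SSt e x s) t :> SStt e x t"
proof -
 have t': "0 < t" using t by auto
 note b = smooth_interior(3,4)[OF b_smooth x t]
 have b': "DERIV (%s. b x s - b 0 0) t :> Dt b x t"
  using DERIV_diff[OF b(1) DERIV_const[of "b 0 0"]] by simp
 show "DERIV (%s. SS e x s) t :> SSt e x t" unfolding SS_def SSt_def
  by (intro DERIV_mult b' Ph_t t' e)
 show "DERIV (%s. SSt e x s) t :> SStt e x t" unfolding SSt_def SStt_def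
  by (intro DERIV_add DERIV_mult b b' Ph_t t' e)
qed

text \<open>The second time derivative of the residual splits into \<open>R1 / e\<close> and
  \<open>R2 / (t + x^2)\<close>; the second part is the one for which the barrier \<open>psi\<close>
  is made.\<close>

definition "R1 e x t = e * (Dt (Dt b) x t * (t / (t + x^2)) * U0 e x t) + 2 * (Dt b x t * (t / (t + x^2)) * U2 e x t)
 + ((b x t - b 0 0) / (t + x^2)) * V1 e x t + ((b x t - b 0 0) / (t + x^2)) * ((t / e) * V2 e x t)"
definition "R2 e x t = 2 * (Dt b x t * U1 e x t) + ((b x t - b 0 0) / (t + x^2)) * V0 e x t"

lemma SS_lay: "lay (%e x t. SS e x t / e)" "lay SSt" "lay SSxx" "lay R1" "lay R2"
proof -
 have dpos: "t + x^2 ~= 0" "0 < t + x^2" if "0 < t" for t x :: real using add_pos_nonneg[OF that, of "x^2"] by auto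
 have "lay (%e x t. ((b x t - b 0 0) / (t + x^2)) * ((t / e) * U0 e x t))"
  by (intro lay_intros bnd_intros)
 thus "lay (%e x t. SS e x t / e)" by (rule lay_cong) (simp add: SS_def Ph_eq)
 have "lay (%e x t. Dt b x t * (t / (t + x^2)) * U0 e x t + ((b x t - b 0 0) / (t + x^2)) * (U1 e x t + (t / e) * U2 e x t))"
  by (intro lay_intros bnd_intros)
 thus "lay SSt" by (rule lay_cong) (simp add: SSt_def Ph_eq algebra_simps add_divide_distrib)
 have "lay (%e x t. Dx (Dx b) x t * (t / (t + x^2)) * U0 e x t
   + (2 * (Dx b x t / sqrt (t + x^2))) * (a0 * (hEx x t * sqrt (t + x^2)) * ew e t
    + (J e * e) * (hZx x t * (sqrt (t + x^2) / t)) * ((t / e) * ew e t))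
   + ((b x t - b 0 0) / (t + x^2)) * (U1 e x t + (J e * e) * (hE x t * ((t + x^2) / t)) * ((t / e) * ew e t)))"
  by (intro lay_intros bnd_intros)
 thus "lay SSxx"
 proof (rule lay_cong)
  fix e x t :: real assume a: "0 < e" "0 < t"
  define r where "r = sqrt (t + x^2)"
  have r: "0 < r" "t + x^2 = r * r" using dpos[OF a(2), of x] by (auto simp: r_def)
  have E1: "(2 * (B / r)) * (a0 * (hEx x t * r) * ew e t + (J e * e) * (hZx x t * (r / t)) * ((t / e) * ew e t))
    = 2 * (Phx e x t * B)" for B
   unfolding Phx_def using a r(1) by (simp add: field_simps)
  have E2: "(B / d) * (U1 e x t + (J e * e) * (hE x t * (d / t)) * ((t / e) * ew e t)) = Phxx e x t * B"
   if "d = t + x^2" for B d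
  proof -
   have "0 < d" using dpos[OF a(2), of x] that by simp
   thus ?thesis unfolding Phxx_def U1_def that[symmetric] using a by (simp add: field_simps)
  qed
  show "Dx (Dx b) x t * (t / (t + x^2)) * U0 e x t
   + (2 * (Dx b x t / sqrt (t + x^2))) * (a0 * (hEx x t * sqrt (t + x^2)) * ew e t
    + (J e * e) * (hZx x t * (sqrt (t + x^2) / t)) * ((t / e) * ew e t))
   + ((b x t - b 0 0) / (t + x^2)) * (U1 e x t + (J e * e) * (hE x t * ((t + x^2) / t)) * ((t / e) * ew e t)) = SSxx e x t"
   unfolding SSxx_def Ph_eq(1)[OF a] r_def[symmetric] E1 E2[OF refl] by (simp add: algebra_simps)
 qed
 show "lay R1" unfolding R1_def[abs_def] by (intro lay_intros bnd_intros)
 show "lay R2" unfolding R2_def[abs_def] by (intro lay_intros bnd_intros)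
qed

lemma SStt_eq:
 assumes "0 < e" "0 < t"
 shows "SStt e x t = R1 e x t / e + R2 e x t / (t + x^2)"
proof -
 define d where "d = t + x^2"
 have d: "0 < d" using assms by (simp add: d_def add_pos_nonneg)
 show ?thesis unfolding SStt_def R1_def R2_def Ph_eq[OF assms] d_def[symmetric] using d assms
  by (simp add: field_simps power2_eq_square)
qed

end

text \<open>\<open>lam\<close> is the derivative at \<open>0\<close>.\<close>

definition bfun :: "real => real => real => (real => real) => (real => real) => (real => real) => real => bool" where
 "bfun e be C l l1 l2 lam \<longleftrightarrow> continuous_on Icc l \<and>
  (\<forall>t\<in>Ioo. DERIV l t :> l1 t \<and> DERIV l1 t :> l2 t \<and>
    (abs (l1 t)) <= C / e * il e be t \<and> (abs (l2 t)) <= C / e^2 * il e be t) \<and>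
  (\<forall>t\<in>Icc. abs (l t) <= C * il e be t \<and> (abs (l t - l 0 - t * lam)) <= C * t^2 / e^2)"

lemma bfun_add:
 assumes "bfun e be C l l1 l2 lam" "bfun e be C' k k1 k2 lam'"
 shows "bfun e be (C + C') (%t. l t + k t) (%t. l1 t + k1 t) (%t. l2 t + k2 t) (lam + lam')"
 unfolding bfun_def
proof (intro conjI ballI)
 show "continuous_on Icc (%t. l t + k t)" using assms unfolding bfun_def by (intro continuous_on_add) auto
next
 fix t :: real assume "t \<in> Ioo"
 hence *: "DERIV l t :> l1 t" "DERIV l1 t :> l2 t"
   "abs (l1 t) <= C / e * il e be t" "abs (l2 t) <= C / e^2 * il e be t"
   "DERIV k t :> k1 t" "DERIV k1 t :> k2 t"
   "abs (k1 t) <= C' / e * il e be t" "abs (k2 t) <= C' / e^2 * il e be t"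
  using assms unfolding bfun_def by auto
 show "DERIV (%t. l t + k t) t :> l1 t + k1 t"
  "DERIV (%t. l1 t + k1 t) t :> l2 t + k2 t" using * by (auto intro: DERIV_add)
 show "abs (l1 t + k1 t) <= (C + C') / e * il e be t" "abs (l2 t + k2 t) <= (C + C') / e^2 * il e be t"
  unfolding add_divide_distrib distrib_right using * by linarith+
next
 fix t :: real assume "t \<in> Icc"
 hence *: "abs (l t) <= C * il e be t" "abs (l t - l 0 - t * lam) <= C * t^2 / e^2"
  "abs (k t) <= C' * il e be t" "abs (k t - k 0 - t * lam') <= C' * t^2 / e^2"
  using assms unfolding bfun_def by auto
 show "abs (l t + k t) <= (C + C') * il e be t" unfolding distrib_right using * by linarith
 show "abs (l t + k t - (l 0 + k 0) - t * (lam + lam')) <= (C + C') * t^2 / e^2"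
  unfolding distrib_right distrib_left add_divide_distrib using *(2,4) by linarith
qed

lemma bfun_cmult:
 assumes "bfun e be C l l1 l2 lam" "abs a <= M" "0 <= C" "0 < e"
 shows "bfun e be (M * C) (%t. a * l t) (%t. a * l1 t) (%t. a * l2 t) (a * lam)"
 unfolding bfun_def
proof (intro conjI ballI)
 have M: "0 <= M" using assms by linarith
 show "continuous_on Icc (%t. a * l t)" using assms unfolding bfun_def by (intro continuous_on_mult_left) auto
next
 fix t :: real assume "t \<in> Ioo"
 hence *: "DERIV l t :> l1 t" "DERIV l1 t :> l2 t"
   "abs (l1 t) <= C / e * il e be t" "abs (l2 t) <= C / e^2 * il e be t"
  using assms unfolding bfun_def by auto
 show "DERIV (%t. a * l t) t :> a * l1 t"
  "DERIV (%t. a * l1 t) t :> a * l2 t" using * by (auto intro: DERIV_cmult)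
 have M: "0 <= M" using assms by linarith
 have "abs a * abs (l1 t) <= M * (C / e * il e be t)" by (intro mult_mono assms * M) auto
 thus "abs (a * l1 t) <= M * C / e * il e be t" by (simp add: abs_mult mult.assoc)
 have "abs a * abs (l2 t) <= M * (C / e^2 * il e be t)" by (intro mult_mono assms * M) auto
 thus "abs (a * l2 t) <= M * C / e^2 * il e be t" by (simp add: abs_mult mult.assoc)
next
 fix t :: real assume "t \<in> Icc"
 hence *: "abs (l t) <= C * il e be t" "abs (l t - l 0 - t * lam) <= C * t^2 / e^2"
  using assms unfolding bfun_def by auto
 have M: "0 <= M" using assms by linarith
 have "abs a * abs (l t) <= M * (C * il e be t)" by (intro mult_mono assms * M) auto
 thus "abs (a * l t) <= M * C * il e be t" by (simp add: abs_mult mult.assoc)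
 have "abs a * abs (l t - l 0 - t * lam) <= M * (C * t^2 / e^2)" by (intro mult_mono assms * M) auto
 thus "abs (a * l t - a * l 0 - t * (a * lam)) <= M * C * t^2 / e^2"
  unfolding abs_mult[symmetric] by (simp add: algebra_simps)
qed

lemma dfam_diff2:
 assumes "dfam 2 g" "!!t. t \<in> Icc ==> abs (g 2 t) <= C" "0 < w" "0 <= t" "t + 2 * w <= 1"
 shows "abs (dif2 (g 0) w t) <= C * w^2"
proof (rule second_difference_le[where ?g1.0="g (Suc 0)" and ?g2.0="g 2"])
 show "continuous_on {t..t + 2 * w} (g 0)"
  by (rule continuous_on_subset[of "Icc"]) (use assms in \<open>auto simp: dfam_def\<close>)
 fix s assume s: "t < s" "s < t + 2 * w"
 hence s': "0 < s" "s < 1" "s \<in> Icc" using assms by auto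
 have "(g 0 has_real_derivative g (Suc 0) s) (at s within Icc)"
  "(g (Suc 0) has_real_derivative g 2 s) (at s within Icc)"
  using assms(1) s' unfolding dfam_def by (auto simp: numeral_2_eq_2)
 thus "DERIV (g 0) s :> g (Suc 0) s" "DERIV (g (Suc 0)) s :> g 2 s"
  using s' by (simp_all add: at_within_Icc_at)
 show "abs (g 2 s) <= C" by (rule assms(2)[OF s'(3)])
qed (use assms in auto)

lemma dfam_taylor:
 assumes "dfam 2 g" "!!t. t \<in> Icc ==> abs (g 2 t) <= C" "t \<in> Icc"
 shows "abs (g 0 t - g 0 0 - t * g (Suc 0) 0) <= C * t^2"
proof -
 have C: "0 <= C" using assms(2)[of 0] by auto
 have d: "!!i x. i < 2 ==> x \<in> Icc ==> (g i has_real_derivative g (Suc i) x) (at x within Icc)"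
  and c: "continuous_on Icc (g 0)" using assms(1) unfolding dfam_def by auto
 have "abs ((g 0 t - t * g (Suc 0) 0) - (g 0 0 - 0 * g (Suc 0) 0)) <= (C * t) * (t - 0)"
 proof (rule abs_diff_le_deriv[where f'="%s. g (Suc 0) s - 1 * g (Suc 0) 0"])
  show "continuous_on {0..t} (%t. g 0 t - t * g (Suc 0) 0)"
   by (intro continuous_intros continuous_on_subset[OF c]) (use assms in auto)
  fix s assume s: "0 < s" "s < t"
  hence s': "s \<in> Icc" "0 < s" "s < 1" using assms by auto
  have "DERIV (g 0) s :> g (Suc 0) s" using d[of 0 s] s' by (simp add: at_within_Icc_at)
  thus "DERIV (%t. g 0 t - t * g (Suc 0) 0) s :> g (Suc 0) s - 1 * g (Suc 0) 0"
   by (intro DERIV_diff DERIV_cmult_right DERIV_ident)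
  have "abs (g (Suc 0) s - g (Suc 0) 0) <= C * abs (s - 0)"
   by (rule lipschitz_within[where g'="g 2"]) (use d[of "Suc 0"] assms(2) s' in \<open>auto simp: numeral_2_eq_2\<close>)
  also have "... <= C * t" using s C by (intro mult_left_mono) auto
  finally show "abs (g (Suc 0) s - 1 * g (Suc 0) 0) <= C * t" by simp
 qed (use assms in auto)
 thus ?thesis by (simp add: power2_eq_square mult.assoc algebra_simps)
qed

text \<open>Yields the hypotheses of \<open>layer_problem\<close> on boundary values for the sum of
  a smooth function \<open>r 0\<close> and a layer function \<open>l\<close> of time.\<close>

lemma boundary_bounds:
 assumes eps: "0 < e" "e <= 1" "0 < be" and r: "dfam 2 r"
  and rC: "!!i t. i <= 2 ==> t \<in> Icc ==> abs (r i t) <= C"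
  and l: "bfun e be C l l1 l2 lam" and g: "!!t. t \<in> Icc ==> g t = r 0 t + l t"
 shows "t \<in> Icc ==> abs (g t) <= 2 * C"
  and "t \<in> Icc ==> abs (g t - g 0) <= 2 * C * t / e"
  and "t \<in> Icc ==> abs (g t - g 0 - t * (r (Suc 0) 0 + lam)) <= 2 * C * t^2 / e^2"
  and "0 < w ==> 0 < t ==> t + w <= 1 ==> abs (g (t + w) - g t) <= 2 * C * (w + min 1 (w / e) * il e be t)"
  and "0 < w ==> 0 < t ==> t + 2 * w <= 1 ==>
   abs (dif2 g w t) <= 2 * C * w^2 * (1 + il e be t / e^2)"
proof -
 have C: "0 <= C" using rC[of 0 0] by auto
 have inv: "1 <= 1 / e" "1 <= 1 / e^2" using eps by (auto simp: power_le_one)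
 have lc: "continuous_on Icc l" and ld: "!!t. t \<in> Ioo ==> DERIV l t :> l1 t"
  "!!t. t \<in> Ioo ==> DERIV l1 t :> l2 t"
  and lb: "!!t. t \<in> Ioo ==> abs (l1 t) <= C / e * il e be t" "!!t. t \<in> Ioo ==> abs (l2 t) <= C / e^2 * il e be t"
  "!!t. t \<in> Icc ==> abs (l t) <= C * il e be t" "!!t. t \<in> Icc ==> abs (l t - l 0 - t * lam) <= C * t^2 / e^2"
  using l unfolding bfun_def by auto
 have le1: "il e be t <= 1" if "0 <= t" for t using il_le_1[OF eps(1,3) that] .
 have rl: "abs (r 0 t - r 0 s) <= C * abs (t - s)" if "s \<in> Icc" "t \<in> Icc" for s t
  by (rule lipschitz_within[where g'="r (Suc 0)"]) (use r rC[of "Suc 0"] that in \<open>auto simp: dfam_def\<close>)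
 have ll: "abs (l (s + h) - l s) <= C / e * il e be s * h" if "0 <= s" "0 < h" "s + h <= 1" for s h
 proof -
  have "abs (l (s + h) - l s) <= (C / e * il e be s) * (s + h - s)"
  proof (rule abs_diff_le_deriv[where f'=l1])
   show "continuous_on {s..s + h} l" by (rule continuous_on_subset[OF lc]) (use that in auto)
   fix x assume x: "s < x" "x < s + h"
   hence x': "x \<in> Ioo" using that by auto
   show "DERIV l x :> l1 x" by (rule ld[OF x'])
   have "C / e * il e be x <= C / e * il e be s" using il_mono[OF eps(1,3), of s x] x C eps by (intro mult_left_mono) auto
   thus "abs (l1 x) <= C / e * il e be s" using lb(1)[OF x'] by linarith
  qed (use that in auto)
  thus ?thesis by simp
 qed
 { assume t: "t \<in> Icc"
  have "C * il e be t <= C * 1" using le1[of t] t C by (intro mult_left_mono) auto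
  thus "abs (g t) <= 2 * C" using rC[of 0 t] lb(3)[OF t] g[OF t] t by auto
  show "abs (g t - g 0) <= 2 * C * t / e"
  proof (cases "t = 0")
   case False
   have "abs (r 0 t - r 0 0) <= C * t" using rl[of 0 t] t by simp
   moreover have "C * t * 1 <= C * t * (1 / e)" using C t inv by (intro mult_left_mono) auto
   moreover have "abs (l t - l 0) <= C / e * t" using ll[of 0 t] t False by simp
   moreover have "2 * C * t / e = C * t * (1 / e) + C / e * t" by simp
   ultimately show ?thesis using g[OF t] g[of 0] by (simp only:) auto
  qed simp
  have "abs (r 0 t - r 0 0 - t * r (Suc 0) 0) <= C * t^2"
   by (rule dfam_taylor[OF r rC t]) auto
  moreover have "C * t^2 * 1 <= C * t^2 * (1 / e^2)" using C inv by (intro mult_left_mono) auto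
  moreover have "2 * C * t^2 / e^2 = C * t^2 * (1 / e^2) + C * t^2 / e^2" by simp
  moreover have "g t - g 0 - t * (r (Suc 0) 0 + lam) = (r 0 t - r 0 0 - t * r (Suc 0) 0) + (l t - l 0 - t * lam)"
   using g[OF t] g[of 0] by (simp add: algebra_simps)
  ultimately show "abs (g t - g 0 - t * (r (Suc 0) 0 + lam)) <= 2 * C * t^2 / e^2"
   using lb(4)[OF t] by linarith
 }
 { assume a: "0 < w" "0 < t" "t + w <= 1"
  have t: "t \<in> Icc" "t + w \<in> Icc" using a by auto
  have "abs (l (t + w) - l t) <= 2 * C * (min 1 (w / e) * il e be t)"
  proof (cases "w / e <= 1")
   case True
   have "abs (l (t + w) - l t) <= C * (w / e * il e be t)" using ll[of t w] a by (simp add: mult_ac)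
   also have "... <= 2 * C * (w / e * il e be t)" using C a eps il_pos[of e be t] by (intro mult_right_mono) auto
   finally show ?thesis using True by simp
  next
   case False
   have "C * il e be (t + w) <= C * il e be t" using il_mono[OF eps(1,3), of t "t+w"] a C by (intro mult_left_mono) auto
   thus ?thesis using lb(3)[OF t(1)] lb(3)[OF t(2)] False by simp
  qed
  moreover have "abs (r 0 (t + w) - r 0 t) <= C * w" using rl[OF t] a by simp
  moreover have "C * w <= 2 * C * w" using C a by simp
  ultimately show "abs (g (t + w) - g t) <= 2 * C * (w + min 1 (w / e) * il e be t)"
   using g[OF t(1)] g[OF t(2)] unfolding distrib_left by linarith
 }
 { assume a: "0 < w" "0 < t" "t + 2 * w <= 1"
  have "abs (dif2 (r 0) w t) <= C * w^2"
   by (rule dfam_diff2[OF r rC]) (use a in auto)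
  moreover have "abs (dif2 l w t) <= (C / e^2 * il e be t) * w^2"
  proof (rule second_difference_le[where ?g1.0=l1 and ?g2.0=l2])
   show "continuous_on {t..t + 2 * w} l" by (rule continuous_on_subset[OF lc]) (use a in auto)
   fix s assume s: "t < s" "s < t + 2 * w"
   hence s': "s \<in> Ioo" using a by auto
   show "DERIV l s :> l1 s" "DERIV l1 s :> l2 s" using ld s' by auto
   have "C / e^2 * il e be s <= C / e^2 * il e be t" using il_mono[OF eps(1,3), of t s] s C by (intro mult_left_mono) auto
   thus "abs (l2 s) <= C / e^2 * il e be t" using lb(2)[OF s'] by linarith
  qed (use a in auto)
  moreover have "0 <= C * w^2" "0 <= (C / e^2 * il e be t) * w^2" using C il_pos[of e be t] by auto
  moreover have "dif2 g w t = (dif2 (r 0) w t) + (dif2 l w t)"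
   using g[of t] g[of "t + w"] g[of "t + 2 * w"] a by simp
  moreover have "2 * C * w^2 * (1 + il e be t / e^2) = 2 * (C * w^2) + 2 * ((C / e^2 * il e be t) * w^2)" by (simp add: algebra_simps)
  ultimately show "abs (dif2 g w t) <= 2 * C * w^2 * (1 + il e be t / e^2)"
   by linarith
 }
qed

context problem_data
begin

lemma bfun_ke:
 assumes "bnd (%e x t. A x)"
 shows "\<exists>C\<ge>1. \<forall>e x. 0 < e --> e <= 1 --> 0 <= x --> x <= 1 -->
  bfun e be C (ke m A e x) (%t. kt m A e x t / e) (%t. (ktt m A e x t / e) / e) (kt m A e x 0 / e)"
proof -
 from layD[OF lay_ke[OF assms]] obtain C1 where C1': "1 <= C1" "unif (%e x t. abs (ke m A e x t) <= C1 * il e be t)"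
  by blast
 note C1 = C1'(1) C1'(2)[rule_format]
 from layD[OF lay_kt[OF assms]] obtain C2 where C2': "1 <= C2" "unif (%e x t. abs (kt m A e x t) <= C2 * il e be t)"
  by blast
 note C2 = C2'(1) C2'(2)[rule_format]
 from layD[OF lay_ktt[OF assms]] obtain C3 where C3': "1 <= C3" "unif (%e x t. abs (ktt m A e x t) <= C3 * il e be t)"
  by blast
 note C3 = C3'(1) C3'(2)[rule_format]
 from bndD[OF assms] obtain C4 where C4': "1 <= C4" "unif (%e x t. abs (A x) <= C4)"
  by blast
 note C4 = C4'(1) C4'(2)[rule_format]
 define C where "C = C1 + C2 + C3 + C4"
 have C: "C1 <= C" "C2 <= C" "C3 <= C" "C4 <= C" "1 <= C" using C1(1) C2(1) C3(1) C4(1) by (auto simp: C_def)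
 show ?thesis
 proof (intro exI[of _ C] conjI allI impI C(5))
  fix e x :: real assume e: "0 < e" "e <= 1" and x: "0 <= x" "x <= 1"
  have d: "DERIV (ke m A e x) t :> kt m A e x t / e"
   "DERIV (%t. kt m A e x t / e) t :> (ktt m A e x t / e) / e" for t
   using ke_t[of e m A x t] DERIV_cdivide[OF kt_t[of e m A x t]] e by auto
  have b: "abs (ke m A e x t) <= C * il e be t" "abs (kt m A e x t / e) <= C / e * il e be t"
   "abs ((ktt m A e x t / e) / e) <= C / e^2 * il e be t" if t: "0 < t" "t <= 1" for t
  proof -
   have i: "0 <= il e be t" using il_pos[of e be t] by simp
   show "abs (ke m A e x t) <= C * il e be t" using C1(2)[OF e x t] mult_right_mono[OF C(1) i] by linarith
   have "abs (kt m A e x t) / e <= C * il e be t / e"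
    using C2(2)[OF e x t] mult_right_mono[OF C(2) i] e by (intro divide_right_mono) auto
   thus "abs (kt m A e x t / e) <= C / e * il e be t" using e by simp
   have "abs (ktt m A e x t) / e^2 <= C * il e be t / e^2"
    using C3(2)[OF e x t] mult_right_mono[OF C(3) i] e by (intro divide_right_mono) auto
   thus "abs ((ktt m A e x t / e) / e) <= C / e^2 * il e be t" using e by (simp add: power2_eq_square)
  qed
  have ab: "abs ((ktt m A e x t / e) / e) <= C / e^2" if t: "0 < t" "t <= 1" for t
  proof -
   have "C / e^2 * il e be t <= C / e^2 * 1" using il_le_1[OF e(1) beta_pos, of t] t C by (intro mult_left_mono) auto
   thus ?thesis using b(3)[OF t] by simp
  qed
  show "bfun e be C (ke m A e x) (%t. kt m A e x t / e) (%t. (ktt m A e x t / e) / e) (kt m A e x 0 / e)"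
   unfolding bfun_def
  proof (intro conjI ballI)
   show "continuous_on Icc (ke m A e x)" by (rule DERIV_continuous_on_Icc[OF d(1)])
  next
   fix t :: real assume t: "t \<in> Icc"
   show "abs (ke m A e x t) <= C * il e be t"
   \<comment> \<open>Bounds obtained from \<open>lay\<close> concern positive times; at
     \<open>t = 0\<close> the function is \<open>A x\<close> or \<open>0\<close>.\<close>
   proof (cases "t = 0")
    case True
    have "abs (ke m A e x 0) <= abs (A x)" by (cases m) (auto simp: ke_def)
    also have "... <= C" using C4(2)[OF e x, of 1] C by simp
    finally show ?thesis using True by simp
   qed (use b t in auto)
   have "abs ((ke m A e x t - t * (kt m A e x 0 / e)) - (ke m A e x 0 - 0 * (kt m A e x 0 / e))) <= (C / e^2 * t) * (t - 0)"
   proof (rule abs_diff_le_deriv[where f'="%s. kt m A e x s / e - 1 * (kt m A e x 0 / e)"])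
    show dd: "DERIV (%s. ke m A e x s - s * (kt m A e x 0 / e)) s :> kt m A e x s / e - 1 * (kt m A e x 0 / e)" for s
     by (intro DERIV_diff DERIV_cmult_right DERIV_ident d)
    show "continuous_on {0..t} (%t. ke m A e x t - t * (kt m A e x 0 / e))"
     by (rule DERIV_continuous_on_Icc[OF dd])
    fix s assume s: "0 < s" "s < t"
    have "abs (kt m A e x s / e - kt m A e x 0 / e) <= C / e^2 * (s - 0)"
     by (rule abs_diff_le_deriv[OF _ DERIV_continuous_on_Icc[OF d(2)] d(2)]) (use s t ab in auto)
    also have "... <= C / e^2 * t" using s C by (intro mult_left_mono) auto
    finally show "abs (kt m A e x s / e - 1 * (kt m A e x 0 / e)) <= C / e^2 * t" by simp
   qed (use t in auto)
   thus "abs (ke m A e x t - ke m A e x 0 - t * (kt m A e x 0 / e)) <= C * t^2 / e^2"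
    by (simp add: power2_eq_square algebra_simps)
  qed (use d b in auto)
 qed
qed

lemma Ph_x0 [simp]: "Ph e x 0 = 0" by (simp add: Ph_def)

text \<open>At \<open>x = 1\<close> the squared parabolic distance \<open>t + 1\<close> is bounded
  below, so the corner singularity is absent; \<open>hE 1 t\<close> is of order \<open>t^2\<close>,
  hence the slope \<open>0\<close>.\<close>

lemma bfun_Ph:
 "\<exists>C\<ge>1. \<forall>e. 0 < e --> e <= 1 --> bfun e be C (Ph e 1) (Pht e 1) (Phtt e 1) 0"
proof -
 have one: "bnd (%e x t. t / (t + 1^2))" "bnd (%e x t. 1 / (t + 1^2))" "bnd (%e x t. 1 / (t + 1^2)^2)"
 proof -
  have a: "abs (1 / (t + 1^2)) <= 1" if "0 < t" for t :: real using that by (simp add: divide_le_eq)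
  show i: "bnd (%e x t. 1 / (t + 1^2))" by (rule bndI[of _ 1]) (rule a)
  have "bnd (%e x t. t * (1 / (t + 1^2)))" "bnd (%e x t. (1 / (t + 1^2)) * (1 / (t + 1^2)))"
   by (intro bnd_intros i)+
  thus "bnd (%e x t. t / (t + 1^2))" "bnd (%e x t. 1 / (t + 1^2)^2)" by (simp_all add: power2_eq_square)
 qed
 have at1: "lay (%e x t. g e 1 t)" if "lay g" for g
  using that unfolding lay_def bnd_def by (metis le_numeral_extra(4) zero_le_one)
 note [lay_intros] = U_lay[THEN at1]
 have "lay (%e x t. t / (t + 1^2) * U0 e 1 t)" by (intro lay_intros one)
 hence L0: "lay (%e x t. Ph e 1 t)" by (rule lay_cong) (simp add: Ph_eq)
 have "lay (%e x t. e * (1 / (t + 1^2) * U1 e 1 t) + t / (t + 1^2) * U2 e 1 t)" by (intro lay_intros bnd_intros one)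
 hence L1: "lay (%e x t. e * Pht e 1 t)"
 proof (rule lay_cong)
  fix e x t :: real assume a: "0 < e" "0 < t"
  have "e * (P / d + 1 / e * (t / d) * Q) = e * (1 / d * P) + t / d * Q" if "0 < d" for P Q d :: real
   using a that by (simp add: field_simps)
  from this[of "t + 1^2"] a show "e * (1 / (t + 1^2) * U1 e 1 t) + t / (t + 1^2) * U2 e 1 t = e * Pht e 1 t"
   by (simp add: Ph_eq)
 qed
 have "lay (%e x t. (e * e) * (1 / (t + 1^2)^2 * V0 e 1 t) + e * (1 / (t + 1^2) * V1 e 1 t) + t / (t + 1^2) * V2 e 1 t)"
  by (intro lay_intros bnd_intros one)
 hence L2: "lay (%e x t. e * e * Phtt e 1 t)"
 proof (rule lay_cong)
  fix e x t :: real assume a: "0 < e" "0 < t"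
  have "e * e * (P / d^2 + 1 / e * (Q / d) + 1 / e * (1 / e * (t / d)) * R) =
   (e * e) * (1 / d^2 * P) + e * (1 / d * Q) + t / d * R" if "0 < d" for P Q R d :: real
   using a that by (simp add: field_simps)
  from this[of "t + 1^2"] a show "(e * e) * (1 / (t + 1^2)^2 * V0 e 1 t) + e * (1 / (t + 1^2) * V1 e 1 t) + t / (t + 1^2) * V2 e 1 t
    = e * e * Phtt e 1 t" by (simp add: Ph_eq)
 qed
 from layD[OF L0] obtain C1 where C1': "1 <= C1" "unif (%e x t. abs (Ph e 1 t) <= C1 * il e be t)"
  by blast
 note C1 = C1'(1) C1'(2)[rule_format]
 from layD[OF L1] obtain C2 where C2': "1 <= C2" "unif (%e x t. abs (e * Pht e 1 t) <= C2 * il e be t)"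
  by blast
 note C2 = C2'(1) C2'(2)[rule_format]
 from layD[OF L2] obtain C3 where C3': "1 <= C3" "unif (%e x t. abs (e * e * Phtt e 1 t) <= C3 * il e be t)"
  by blast
 note C3 = C3'(1) C3'(2)[rule_format]
 from bndD[OF J_bnd] obtain C4 where C4': "1 <= C4" "unif (%e x t. abs (J e * e) <= C4)"
  by blast
 note C4 = C4'(1) C4'(2)[rule_format]
 define C where "C = C1 + C2 + C3 + 1000000 * (abs a0 + C4)"
 have "0 <= 1000000 * (abs a0 + C4)" using C4(1) by simp
 hence C: "C1 <= C" "C2 <= C" "C3 <= C" "1000000 * (abs a0 + C4) <= C" "1 <= C"
  using C1(1) C2(1) C3(1) by (auto simp: C_def)
 show ?thesis
 proof (intro exI[of _ C] conjI allI impI C(5))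
  fix e :: real assume e: "0 < e" "e <= 1"
  have sq: "abs (Ph e 1 t) <= C * t^2 / e^2" if t: "0 < t" "t <= 1" for t
  proof -
   have hE: "0 <= hE 1 t" "hE 1 t <= 1000000 * t^2"
   proof -
    have "(t / (t + 1^2))^2 <= t^2" using t by (intro power_mono) (auto simp: divide_le_eq)
    thus "hE 1 t <= 1000000 * t^2" using hE_le[OF t(1), of 1] by simp
   qed (rule hE_nonneg[OF t(1)])
   have hZ: "0 <= hZ 1 t" "hZ 1 t <= hE 1 t"
    using hZ_nonneg[of 1 t] hZ_le[OF t(1), of 1] mult_right_mono[OF t(2) hE(1)] t by auto
   have "1 <= 1 / e" using e by simp
   hence "abs a0 * 1 <= abs a0 * (1 / e)" by (intro mult_left_mono) auto
   moreover have "abs (J e) <= C4 * (1 / e)" using C4(2)[OF e, of 1 1] e by (simp add: abs_mult pos_le_divide_eq)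
   ultimately have aJ: "abs a0 + abs (J e) <= (abs a0 + C4) * (1 / e)" by (simp add: algebra_simps)
   have "abs (a0 * hE 1 t + J e * hZ 1 t) <= abs a0 * hE 1 t + abs (J e) * hZ 1 t"
    using hE hZ by (intro order_trans[OF abs_triangle_ineq]) (simp add: abs_mult)
   also have "... <= abs a0 * hE 1 t + abs (J e) * hE 1 t" using hZ by (intro add_left_mono mult_left_mono) auto
   also have "... = (abs a0 + abs (J e)) * hE 1 t" by (simp add: algebra_simps)
   also have "... <= ((abs a0 + C4) * (1 / e)) * (1000000 * t^2)"
    using aJ hE C4(1) e by (intro mult_mono) auto
   also have "... = (1000000 * (abs a0 + C4)) * t^2 * (1 / e)" by simp
   also have "... <= C * t^2 * (1 / e^2)"
   proof -
    have "1 / e <= 1 / e^2" using e by (intro divide_left_mono) (auto simp: power2_eq_square mult_left_le)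
    thus ?thesis using C(4,5) e by (intro mult_mono mult_right_mono) auto
   qed
   finally have s: "abs (a0 * hE 1 t + J e * hZ 1 t) <= C * t^2 * (1 / e^2)" .
   have "ew e t <= 1" "0 <= ew e t" unfolding ew_def using b_ge[of 0 0] beta_pos delta_pos t e by auto
   hence "abs (ew e t * (a0 * hE 1 t + J e * hZ 1 t)) <= 1 * (C * t^2 * (1 / e^2))"
    unfolding abs_mult using s by (intro mult_mono) auto
   thus ?thesis by (simp add: Ph_def)
  qed
  have b: "abs (Ph e 1 t) <= C * il e be t" "abs (Pht e 1 t) <= C / e * il e be t" "abs (Phtt e 1 t) <= C / e^2 * il e be t"
   if t: "0 < t" "t <= 1" for t
  proof -
   have i: "0 <= il e be t" using il_pos[of e be t] by simp
   show "abs (Ph e 1 t) <= C * il e be t" using C1(2)[OF e _ _ t, of 1] mult_right_mono[OF C(1) i] by simp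
   have "e * abs (Pht e 1 t) <= C * il e be t"
    using C2(2)[OF e _ _ t, of 1] mult_right_mono[OF C(2) i] e by (simp add: abs_mult)
   thus "abs (Pht e 1 t) <= C / e * il e be t" using e by (simp add: field_simps)
   have "e * e * abs (Phtt e 1 t) <= C * il e be t"
    using C3(2)[OF e _ _ t, of 1] mult_right_mono[OF C(3) i] e by (simp add: abs_mult)
   thus "abs (Phtt e 1 t) <= C / e^2 * il e be t" using e by (simp add: field_simps power2_eq_square)
  qed
  show "bfun e be C (Ph e 1) (Pht e 1) (Phtt e 1) 0"
   unfolding bfun_def
  proof (intro conjI ballI)
   have "continuous_on Icc (%t. ew e t)" unfolding ew_def using e by (intro continuous_intros) auto
   moreover have "continuous_on Icc (%t. hZ 1 t)"
   proof -
    have c: "continuous_on Icc (%t::real. (1::real, t))" by (intro continuous_intros)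
    from continuous_on_compose2[OF hZ_continuous c] show ?thesis by (auto simp: image_subset_iff)
   qed
   moreover have "continuous_on Icc (%t. hE 1 t)"
   proof -
    have "((%t::real. 1000000 * t^2) \<longlongrightarrow> 1000000 * 0^2) (at 0 within Icc)" by (intro tendsto_intros)
    hence z: "((%t::real. 1000000 * t^2) \<longlongrightarrow> 0) (at 0 within Icc)" by simp
    have "((%t. hE 1 t) \<longlongrightarrow> 0) (at 0 within Icc)"
    proof (rule Lim_null_comparison[OF _ z], unfold eventually_at_filter, rule always_eventually, intro allI impI)
     fix t :: real assume "t ~= 0" "t \<in> Icc"
     hence t: "0 < t" by auto
     have "(t / (t + 1^2))^2 <= t^2" using t by (intro power_mono) (auto simp: divide_le_eq)
     thus "norm (hE 1 t) <= 1000000 * t^2" using hE_le[OF t, of 1] hE_nonneg[OF t, of 1] by simp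
    qed
    moreover have "continuous (at t within Icc) (%t. hE 1 t)" if "0 < t" for t
     using DERIV_isCont[OF hE_t[OF that]] by (rule continuous_at_imp_continuous_at_within)
    ultimately show ?thesis unfolding continuous_on_def continuous_within
     by (metis atLeastAtMost_iff hZ_t0(2) order_le_less)
   qed
   ultimately show "continuous_on Icc (Ph e 1)" unfolding Ph_def[abs_def] by (intro continuous_intros)
  next
   fix t :: real assume t: "t \<in> Ioo"
   show "DERIV (Ph e 1) t :> Pht e 1 t" "DERIV (Pht e 1) t :> Phtt e 1 t"
    using Ph_t[of t e 1] t e by auto
   show "abs (Pht e 1 t) <= C / e * il e be t" "abs (Phtt e 1 t) <= C / e^2 * il e be t" using b[of t] t by auto
  next
   fix t :: real assume t: "t \<in> Icc"
   show "abs (Ph e 1 t) <= C * il e be t" using b(1)[of t] t C(5) by (cases "t = 0") auto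
   show "abs (Ph e 1 t - Ph e 1 0 - t * 0) <= C * t^2 / e^2" using sq[of t] t by (cases "t = 0") auto
  qed
 qed
qed

end

section \<open>The regular part and its source\<close>

context problem_data
begin

text \<open>The source that is left for the regular part \<open>WW\<close> after the residuals of
  the initial layer and of the corner functions have been subtracted.\<close>

definition "FF e x t = f x t - PP e x t - SS e x t"
definition "vv x t = f x t / b x t"
definition "vn x t = Dx f x t * b x t - f x t * Dx b x t"
definition "vnx x t = (Dx (Dx f) x t * b x t + Dx b x t * Dx f x t) - (Dx f x t * Dx b x t + Dx (Dx b) x t * f x t)"
definition "vvx x t = vn x t / (b x t * b x t)"
definition "vvxx x t = (vnx x t * (b x t * b x t) - vn x t * (Dx b x t * b x t + Dx b x t * b x t)) / ((b x t * b x t) * (b x t * b x t))"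
definition "vvt x t = (Dt f x t * b x t - f x t * Dt b x t) / (b x t * b x t)"
definition "WW e y x t = y x t - p0 e x t - J e * (ew e t * hZ x t)"
definition "WWx e yx x t = yx x t - p0x e x t - J e * (ew e t * hZx x t)"
definition "WWxx e yxx x t = yxx x t - p0xx e x t - J e * (ew e t * hE x t)"
definition "WWt e yt x t = yt x t - p0t e x t / e - J e * (- (b 0 0 / e) * ew e t * hZ x t + hE x t * ew e t)"

lemma b_pos: "x \<in> Icc ==> t \<in> Icc ==> 0 < b x t"
 using b_ge[of x t] beta_pos delta_pos by auto

lemma inv_b_bnd [bnd_intros]: "bnd (%e x t. 1 / b x t)"
proof (rule bndI[of _ "1 / be"])
 fix x t :: real assume "0 <= x" "x <= 1" "0 < t" "t <= 1"
 hence "be <= b x t" using b_ge[of x t] delta_pos by auto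
 thus "abs (1 / b x t) <= 1 / be" using beta_pos by (auto intro!: divide_left_mono)
qed

lemma vv_bnd: "bnd (%e x t. vvxx x t)" "bnd (%e x t. vvt x t)"
proof -
 have n: "bnd (%e x t. vn x t)" "bnd (%e x t. vnx x t)"
  unfolding vn_def vnx_def by (intro bnd_intros)+
 have "bnd (%e x t. (vnx x t * (b x t * b x t) - vn x t * (Dx b x t * b x t + Dx b x t * b x t)) *
  ((1 / b x t * (1 / b x t)) * (1 / b x t * (1 / b x t))))" by (intro bnd_intros n)
 thus "bnd (%e x t. vvxx x t)" unfolding vvxx_def by simp
 have "bnd (%e x t. (Dt f x t * b x t - f x t * Dt b x t) * (1 / b x t * (1 / b x t)))" by (intro bnd_intros)
 thus "bnd (%e x t. vvt x t)" unfolding vvt_def by simp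
qed

lemma vv_le: "x \<in> Icc ==> t \<in> Icc ==> abs (vv x t) <= Kf / be"
proof -
 assume a: "x \<in> Icc" "t \<in> Icc"
 have "abs (f x t) / abs (b x t) <= Kf / be"
  using smoothD(5)[OF f_smooth a] b_ge[OF a] beta_pos delta_pos by (intro frac_le) auto
 thus ?thesis by (simp add: vv_def)
qed

lemma vv_deriv: "heat_deriv 1 vv vvx vvxx vvt"
 unfolding heat_deriv_def
proof (intro ballI conjI)
 fix x t :: real assume x: "x \<in> Ioo" and t: "t \<in> Ioc"
 hence xt: "x \<in> Icc" "t \<in> Icc" by auto
 note b = smooth_interior(1,2)[OF b_smooth x xt(2)] and f = smooth_interior(1,2)[OF f_smooth x xt(2)]
 have b0: "b x t ~= 0" using b_pos[OF xt] by simp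
 show "DERIV (%s. vv s t) x :> vvx x t"
  unfolding vv_def vvx_def vn_def by (rule DERIV_divide[OF f(1) b(1) b0])
 have n: "DERIV (%s. vn s t) x :> vnx x t" unfolding vn_def vnx_def
  by (rule DERIV_cong[OF DERIV_diff[OF DERIV_mult[OF f(2) b(1)] DERIV_mult[OF f(1) b(2)]]]) simp
 show "DERIV (%s. vvx s t) x :> vvxx x t" unfolding vvx_def vvxx_def
  by (rule DERIV_divide[OF n DERIV_mult[OF b(1) b(1)]]) (use b0 in simp)
 have "((%s. vv x s) has_real_derivative vvt x t) (at t within Icc)"
  unfolding vv_def vvt_def by (rule DERIV_divide[OF smoothD(3)[OF f_smooth xt] smoothD(3)[OF b_smooth xt] b0])
 thus "((%s. vv x s) has_real_derivative vvt x t) (at_left t)" by (rule left_deriv_within[OF _ t])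
qed

lemma vv_cont: "continuous_on (Icc \<times> Icc) (%(x,t). vv x t)"
 using continuous_on_divide[OF f_cont b_cont] b_pos unfolding vv_def case_prod_unfold by fastforce

lemma smooth_diff2:
 assumes z: "smooth_data C z" and x: "x \<in> Icc" and k: "0 < k" and t: "0 <= t" "t + 2 * k <= 1"
 shows "abs (dif2 (z x) k t) <= C * k^2"
proof (rule second_difference_le[where ?g1.0="Dt z x" and ?g2.0="Dt (Dt z) x"])
 have "continuous_on Icc (z x)"
  by (rule DERIV_continuous_on) (rule smoothD(3)[OF z x])
 thus "continuous_on {t..t + 2 * k} (z x)" by (rule continuous_on_subset) (use t in auto)
 fix s assume "t < s" "s < t + 2 * k"
 hence s: "s \<in> Ioo" "s \<in> Icc" using t by auto
 show "DERIV (z x) s :> Dt z x s" "DERIV (Dt z x) s :> Dt (Dt z) x s"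
  using smooth_interior(3,4)[OF z x s(1)] .
 show "abs (Dt (Dt z) x s) <= C" by (rule smoothD(9)[OF z x s(2)])
qed (use k in simp)

lemma PP_t_cont:
 assumes "x \<in> Icc" "e ~= 0" shows "continuous_on Icc (PP e x)"
proof -
 have 1: "continuous_on Icc (b x)"
  by (rule DERIV_continuous_on) (rule smoothD(3)[OF b_smooth assms(1)])
 have 2: "continuous_on Icc (p0 e x)" by (rule DERIV_continuous_on_Icc[OF p0_t(1)[OF assms(2)]])
 have 3: "continuous_on Icc (p0xx e x)" by (rule DERIV_continuous_on_Icc[OF p0_t(3)[OF assms(2)]])
 show ?thesis unfolding PP_def[abs_def] by (intro continuous_intros 1 2 3)
qed

lemma SS_t_cont:
 assumes "x \<in> Icc" "e ~= 0" "0 < a" shows "continuous_on {a..1} (SS e x)"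
proof -
 have "continuous_on Icc (b x)"
  by (rule DERIV_continuous_on) (rule smoothD(3)[OF b_smooth assms(1)])
 hence 1: "continuous_on {a..1} (b x)" by (rule continuous_on_subset) (use assms in auto)
 have 2: "continuous_on {a..1} (Ph e x)" by (rule DERIV_continuous_on_Icc[OF Ph_t(1)]) (use assms in auto)
 show ?thesis unfolding SS_def[abs_def] by (intro continuous_intros 1 2)
qed

text \<open>Increments of \<open>SS\<close> from time \<open>0\<close> are treated apart:
  \<open>SS\<close> vanishes there and is of order \<open>t\<close>, whereas
  \<open>SS_t_cont\<close> covers positive times only.\<close>

lemma FF_lip:
 "\<exists>C\<ge>1. \<forall>e x s t. 0 < e --> e <= 1 --> x \<in> Icc --> s \<in> Icc --> t \<in> Icc --> abs (FF e x t - FF e x s) <= C * abs (t - s)"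
proof -
 from bndD[OF lay_bnd[OF PP_lay(2)]] obtain C1 where C1': "1 <= C1" "unif (%e x t. abs (PPt e x t) <= C1)"
  by blast
 note C1 = C1'(1) C1'(2)[rule_format]
 from bndD[OF lay_bnd[OF SS_lay(2)]] obtain C2 where C2': "1 <= C2" "unif (%e x t. abs (SSt e x t) <= C2)"
  by blast
 note C2 = C2'(1) C2'(2)[rule_format]
 have "lay (%e x t. ((b x t - b 0 0) / (t + x^2)) * U0 e x t)" by (intro lay_intros bnd_intros)
 hence "bnd (%e x t. SS e x t / t)"
  by (rule bnd_cong[OF lay_bnd]) (simp add: SS_def Ph_eq)
 from bndD[OF this] obtain C3 where C3': "1 <= C3" "unif (%e x t. abs (SS e x t / t) <= C3)"
  by blast
 note C3 = C3'(1) C3'(2)[rule_format]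
 have Kf: "0 <= Kf" using smoothD(5)[OF f_smooth, of 0 0] by simp
 define C where "C = Kf + C1 + C2 + C3"
 show ?thesis
 proof (intro exI[of _ C] conjI allI impI)
  show "1 <= C" using Kf C1(1) C2(1) C3(1) by (simp add: C_def)
  fix e x s t :: real assume e: "0 < e" "e <= 1" and x: "x \<in> Icc" and st: "s \<in> Icc" "t \<in> Icc"
  have x': "0 <= x" "x <= 1" using x by auto
  have main: "abs (FF e x t - FF e x s) <= C * (t - s)" if st: "s \<in> Icc" "t \<in> Icc" "s < t" for s t
  proof -
   have "abs (f x t - f x s) <= Kf * abs (t - s)"
    by (rule lipschitz_within[where g'="Dt f x"]) (use smoothD[OF f_smooth x] st in auto)
   hence 1: "abs (f x t - f x s) <= Kf * (t - s)" using st by simp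
   have 2: "abs (PP e x t - PP e x s) <= C1 * (t - s)"
   proof (rule abs_diff_le_deriv[where f'="PPt e x"])
    show "continuous_on {s..t} (PP e x)"
     by (rule continuous_on_subset[OF PP_t_cont[OF x]]) (use e st in auto)
    fix r assume r: "s < r" "r < t"
    show "DERIV (PP e x) r :> PPt e x r" by (rule PP_t(1)[OF x]) (use r st e in auto)
    show "abs (PPt e x r) <= C1" by (rule C1(2)[OF e x']) (use r st in auto)
   qed (use st in auto)
   have 3: "abs (SS e x t - SS e x s) <= (C2 + C3) * (t - s)"
   proof (cases "s = 0")
    case True
    have "abs (SS e x t) <= C3 * t" using C3(2)[OF e x', of t] st True by (simp add: pos_divide_le_eq)
    moreover have "0 <= C2 * t" using C2(1) st by simp
    ultimately show ?thesis using True by (simp add: SS_def distrib_right)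
   next
    case False
    have "abs (SS e x t - SS e x s) <= C2 * (t - s)"
    proof (rule abs_diff_le_deriv[where f'="SSt e x"])
     show "continuous_on {s..t} (SS e x)"
      by (rule continuous_on_subset[OF SS_t_cont[OF x, of e s]]) (use e st False in auto)
     fix r assume r: "s < r" "r < t"
     show "DERIV (SS e x) r :> SSt e x r" by (rule SS_t(1)[OF x]) (use r st e in auto)
     show "abs (SSt e x r) <= C2" by (rule C2(2)[OF e x']) (use r st in auto)
    qed (use st in auto)
    moreover have "0 <= C3 * (t - s)" using C3(1) st by simp
    ultimately show ?thesis by (simp add: distrib_right)
   qed
   show ?thesis using 1 2 3 unfolding FF_def C_def distrib_right by linarith
  qed
  show "abs (FF e x t - FF e x s) <= C * abs (t - s)"
   using main[OF st] main[OF st(2,1)] by (cases s t rule: linorder_cases) (auto simp: abs_minus_commute)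
 qed
qed

lemma FF_diff2:
 "\<exists>C\<ge>1. \<forall>e x t k. 0 < e --> e <= 1 --> x \<in> Icc --> 0 < k --> 0 < t --> t + 2 * k <= 1 -->
  abs (dif2 (FF e x) k t) <= C * k^2 * (1 + (1 / e + 1 / (t + x^2)) * il e be t)"
proof -
 from layD[OF PP_lay(3)] obtain C1 where C1': "1 <= C1" "unif (%e x t. abs (e * PPtt e x t) <= C1 * il e be t)"
  by blast
 note C1 = C1'(1) C1'(2)[rule_format]
 from layD[OF SS_lay(4)] obtain C2 where C2': "1 <= C2" "unif (%e x t. abs (R1 e x t) <= C2 * il e be t)"
  by blast
 note C2 = C2'(1) C2'(2)[rule_format]
 from layD[OF SS_lay(5)] obtain C3 where C3': "1 <= C3" "unif (%e x t. abs (R2 e x t) <= C3 * il e be t)"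
  by blast
 note C3 = C3'(1) C3'(2)[rule_format]
 have Kf: "0 <= Kf" using smoothD(5)[OF f_smooth, of 0 0] by simp
 define C where "C = Kf + C1 + C2 + C3"
 show ?thesis
 proof (intro exI[of _ C] conjI allI impI)
  show "1 <= C" using Kf C1(1) C2(1) C3(1) by (simp add: C_def)
  fix e x t k :: real assume e: "0 < e" "e <= 1" and x: "x \<in> Icc" and k: "0 < k" and t: "0 < t" "t + 2 * k <= 1"
  have x': "0 <= x" "x <= 1" using x by auto
  define E where "E = il e be t"
  define d where "d = 1 / (t + x^2)"
  have E: "0 < E" by (simp add: E_def il_pos)
  have d: "0 < d" unfolding d_def using add_pos_nonneg[OF t(1), of "x^2"] by simp
  have 1: "abs (dif2 (f x) k t) <= Kf * k^2"
   by (rule smooth_diff2[OF f_smooth x k]) (use t in auto)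
  have mono: "C * il e be s <= C * E" if "t < s" "0 <= C" for s C
   unfolding E_def using il_mono[OF e(1) beta_pos, of t s] that by (intro mult_left_mono) auto
  have 2: "abs (dif2 (PP e x) k t) <= (C1 * E / e) * k^2"
  proof (rule second_difference_le[where ?g1.0="PPt e x" and ?g2.0="PPtt e x"])
   show "continuous_on {t..t + 2 * k} (PP e x)"
    by (rule continuous_on_subset[OF PP_t_cont[OF x]]) (use e t in auto)
   fix s assume s: "t < s" "s < t + 2 * k"
   show "DERIV (PP e x) s :> PPt e x s" "DERIV (PPt e x) s :> PPtt e x s"
    using PP_t[OF x, of s e] s t e by auto
   have "e * abs (PPtt e x s) <= C1 * E" 
   proof -
    have "abs (e * PPtt e x s) <= C1 * il e be s" by (rule C1(2)[OF e x']) (use s t in auto)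
    moreover have "C1 * il e be s <= C1 * E" by (rule mono) (use s C1 in auto)
    ultimately show ?thesis using e by (simp only: abs_mult abs_of_pos)
   qed
   thus "abs (PPtt e x s) <= C1 * E / e" using e by (simp add: field_simps)
  qed (use k in simp)
  have 3: "abs (dif2 (SS e x) k t) <= (C2 * E / e + C3 * E * d) * k^2"
  proof (rule second_difference_le[where ?g1.0="SSt e x" and ?g2.0="SStt e x"])
   show "continuous_on {t..t + 2 * k} (SS e x)"
    by (rule continuous_on_subset[OF SS_t_cont[OF x, of e t]]) (use e t in auto)
   fix s assume s: "t < s" "s < t + 2 * k"
   show "DERIV (SS e x) s :> SSt e x s" "DERIV (SSt e x) s :> SStt e x s"
    using SS_t[OF x, of s e] s t e by auto
   have dd: "0 < t + x^2" "t + x^2 <= s + x^2" using t s add_pos_nonneg[OF t(1), of "x^2"] by auto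
   have "abs (R1 e x s / e) <= C2 * E / e"

   proof -
    have "abs (R1 e x s) <= C2 * il e be s" by (rule C2(2)[OF e x']) (use s t in auto)
    moreover have "C2 * il e be s <= C2 * E" by (rule mono) (use s C2 in auto)
    ultimately have "abs (R1 e x s) <= C2 * E" by (rule order_trans)
    thus ?thesis using e by (simp only: abs_divide abs_of_pos divide_right_mono less_imp_le)
   qed
   moreover have "abs (R2 e x s / (s + x^2)) <= C3 * E / (t + x^2)"

   proof -
    have "abs (R2 e x s) <= C3 * il e be s" by (rule C3(2)[OF e x']) (use s t in auto)
    moreover have "C3 * il e be s <= C3 * E" by (rule mono) (use s C3 in auto)
    ultimately have *: "abs (R2 e x s) <= C3 * E" by (rule order_trans)
    show ?thesis unfolding abs_divide
     by (rule frac_le) (use * dd E C3(1) in auto)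
   qed
   moreover have "SStt e x s = R1 e x s / e + R2 e x s / (s + x^2)" by (rule SStt_eq) (use e s t in auto)
   moreover have "C3 * E / (t + x^2) = C3 * E * d" by (simp add: d_def)
   ultimately show "abs (SStt e x s) <= C2 * E / e + C3 * E * d" by linarith
  qed (use k in simp)
  have "abs (dif2 (FF e x) k t) <= Kf * k^2 + (C1 * E / e) * k^2 + (C2 * E / e + C3 * E * d) * k^2"
  proof -
   have "abs (p - q - r) <= a + b + c" if "abs p <= a" "abs q <= b" "abs r <= c" for p q r a b c :: real
    using that by linarith
   from this[OF 1 2 3] show ?thesis unfolding FF_def by (simp only: algebra_simps)
  qed
  also have "... = (Kf + (C1 + C2) * (E / e) + C3 * (E * d)) * k^2" by (simp add: add_divide_distrib algebra_simps)
  also have "... <= (C * 1 + C * (E / e) + C * (E * d)) * k^2"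
   using Kf C1(1) C2(1) C3(1) E d e by (intro mult_right_mono add_mono) (auto simp: C_def)
  also have "... = C * k^2 * (1 + (1 / e + d) * E)" by (simp add: algebra_simps)
  finally show "abs (dif2 (FF e x) k t) <= C * k^2 * (1 + (1 / e + 1 / (t + x^2)) * il e be t)"
   by (simp add: d_def E_def)
 qed
qed

end

locale solution = problem_data +
 fixes e :: real and y yx yxx yt :: "real => real => real"
 assumes eps: "0 < e" "e <= 1"
  and y_cont: "continuous_on (Icc \<times> Icc) (%(x,t). y x t)"
  and y_deriv: "heat_deriv 1 y yx yxx yt"
  and y_eq: "x \<in> Ioo ==> t \<in> Ioc ==> e * (yt x t - yxx x t) + b x t * y x t
   = f x t - a0 * (b x t - b 0 0) * (ew e t * hE x t)"
  and y_left: "t \<in> Icc ==> y 0 t = gl 0 t - a0 * ew e t"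
  and y_right: "t \<in> Icc ==> y 1 t = gr 0 t - a0 * (ew e t * hE 1 t)"
  and y_init: "x \<in> Ioo ==> y x 0 = ph 0 x"
  and compat: "e * (gr (Suc 0) 0 - ph 2 1) + b 1 0 * gr 0 0 = f 1 0"
begin

text \<open>The end points are covered by the boundary conditions: at the left, \<open>a0\<close> is
  exactly the jump between the data, and at the right the data agree.\<close>

lemma y_init': "x \<in> Icc ==> y x 0 = ph 0 x"
 using y_init[of x] y_left[of 0] y_right[of 0] ph_gr
 by (cases "x = 0 \<or> x = 1") (auto simp: a0_def ew_def)

lemma WW_deriv: "heat_deriv 1 (WW e y) (WWx e yx) (WWxx e yxx) (WWt e yt)"
 unfolding heat_deriv_def
proof (intro ballI conjI)
 fix x t :: real assume x: "x \<in> Ioo" and t: "t \<in> Ioc"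
 hence t0: "0 < t" and e: "e ~= 0" using eps by auto
 have y: "DERIV (%s. y s t) x :> yx x t" "DERIV (%s. yx s t) x :> yxx x t"
  "((%s. y x s) has_real_derivative yt x t) (at_left t)"
  using y_deriv x t unfolding heat_deriv_def by auto
 show "DERIV (%s. WW e y s t) x :> WWx e yx x t" unfolding WW_def WWx_def
  by (intro DERIV_diff DERIV_cmult y p0_derivs[OF x] hZ_x[OF t0])
 show "DERIV (%s. WWx e yx s t) x :> WWxx e yxx x t" unfolding WWx_def WWxx_def
  by (intro DERIV_diff DERIV_cmult y p0_derivs[OF x] hZx_x[OF t0])
 have "DERIV (%s. ew e s * hZ x s) t :> - (b 0 0 / e) * ew e t * hZ x t + hE x t * ew e t"
  by (rule DERIV_mult[OF ew_t[OF e] hZ_t[OF t0]])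
 thus "((%s. WW e y x s) has_real_derivative WWt e yt x t) (at_left t)" unfolding WW_def WWt_def
  by (rule DERIV_diff[OF DERIV_diff[OF y(3) has_field_derivative_at_within[OF p0_t(1)[OF e]]]
   DERIV_cmult[OF has_field_derivative_at_within]])
qed

lemma WW_eq:
 assumes x: "x \<in> Ioo" and t: "t \<in> Ioc"
 shows "e * (WWt e yt x t - WWxx e yxx x t) + b x t * WW e y x t = FF e x t"
proof -
 have p: "p0t e x t = - (cd 0 x * p0 e x t)" by (simp add: p0t_def p0_def kt_def ke_def)
 have "e * (WWt e yt x t - WWxx e yxx x t) + b x t * WW e y x t
  = (e * (yt x t - yxx x t) + b x t * y x t) - PP e x t - J e * ((b x t - b 0 0) * (ew e t * hZ x t))"
  unfolding WWt_def WWxx_def WW_def PP_def p using eps(1) by (simp add: field_simps)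
 also have "... = FF e x t" unfolding y_eq[OF x t] FF_def SS_def Ph_def by (simp add: algebra_simps)
 finally show ?thesis .
qed

lemma WW_cont: "continuous_on (Icc \<times> Icc) (%(x,t). WW e y x t)"
proof -
 have c: "continuous_on Icc (qd 0)" "continuous_on Icc (cd 0)"
 proof -
  have "continuous_on Icc (ph 0)" "continuous_on Icc (wd 0)" "continuous_on Icc (cd 0)"
   using ph(1) wd(1) cd(1) unfolding dfam_def by auto
  thus "continuous_on Icc (qd 0)" "continuous_on Icc (cd 0)"
   unfolding qd_def[abs_def] by (auto intro: continuous_on_diff)
 qed
 have c': "continuous_on (Icc \<times> Icc) (%p::real\<times>real. qd 0 (fst p))"
  "continuous_on (Icc \<times> Icc) (%p::real\<times>real. cd 0 (fst p))"
  by (rule continuous_on_compose2[OF c(1)] continuous_on_compose2[OF c(2)]; auto intro!: continuous_intros)+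
 have 1: "continuous_on (Icc \<times> Icc) (%(x,t). p0 e x t)"
  unfolding p0_def ke_def case_prod_unfold using eps by (intro continuous_intros c') auto
 have 2: "continuous_on (Icc \<times> Icc) (%(x,t). J e * (ew e t * hZ x t))"
 proof -
  have "continuous_on (Icc \<times> Icc) (%(x,t). hZ x t)" by (rule continuous_on_subset[OF hZ_continuous]) auto
  thus ?thesis unfolding ew_def case_prod_unfold using eps by (intro continuous_intros) auto
 qed
 from continuous_on_diff[OF continuous_on_diff[OF y_cont 1] 2] show ?thesis
  by (simp add: case_prod_unfold WW_def)
qed

lemma WW_init: "x \<in> Icc ==> WW e y x 0 = vv x 0"
 using y_init'[of x] by (simp add: WW_def p0_def ke_def qd_def wd vv_def)

text \<open>On the left boundary \<open>hZ\<close> equals \<open>t\<close>, so the corner function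
  becomes a member of the family \<open>ke\<close> with one power of \<open>t / e\<close>.\<close>

lemma WW_left: "t \<in> Icc ==> WW e y 0 t = gl 0 t + (- 1 * ke 0 (%x. a0 + qd 0 0) e 0 t + (- (J e * e)) * ke (Suc 0) (%x. 1) e 0 t)"
 using y_left[of t] hZ_x0[of t] eps
 by (simp add: WW_def p0_def ke_def ew_def cd algebra_simps)

lemma WW_right: "t \<in> Icc ==> WW e y 1 t = gr 0 t + (- 1 * Ph e 1 t + - 1 * ke 0 (qd 0) e 1 t)"
 using y_right[of t] by (simp add: WW_def p0_def Ph_def algebra_simps)

text \<open>This identity determines \<open>J\<close>.\<close>

lemma lam_left: "gl (Suc 0) 0 + (- 1 * (kt 0 (%x. a0 + qd 0 0) e 0 0 / e) + (- (J e * e)) * (kt (Suc 0) (%x. 1) e 0 0 / e)) = ph 2 0"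
 using eps by (simp add: kt_def ke_def cd J_def)

text \<open>At the right corner the compatibility condition does what the choice of \<open>J\<close>
  does at the left one.\<close>

lemma lam_right: "gr (Suc 0) 0 + (- 1 * 0 + - 1 * (kt 0 (qd 0) e 1 0 / e)) = ph 2 1"
proof -
 have "b 1 0 * qd 0 1 = b 1 0 * ph 0 1 - f 1 0" using b_pos[of 1 0] by (simp add: qd_def wd right_diff_distrib)
 also have "... = - (e * (gr (Suc 0) 0 - ph 2 1))" using compat ph_gr by (simp add: algebra_simps)
 finally have "b 1 0 * qd 0 1 / e = - (gr (Suc 0) 0 - ph 2 1)" using eps by (simp add: field_simps)
 thus ?thesis by (simp add: kt_def ke_def cd)
qed

end

section \<open>Estimates for the solution\<close>

lemma bfun_mono:
 assumes "bfun e be C l l1 l2 lam" "C <= C'" "0 < e"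
 shows "bfun e be C' l l1 l2 lam"
 unfolding bfun_def
proof (intro conjI ballI)
 have a: "C / e * il e be t <= C' / e * il e be t" "C / e^2 * il e be t <= C' / e^2 * il e be t"
  "C * il e be t <= C' * il e be t" for t
  using assms(2,3) il_pos[of e be t] by (auto intro!: mult_right_mono divide_right_mono)
 have b: "C * t^2 / e^2 <= C' * t^2 / e^2" for t
  using assms(2,3) by (auto intro!: mult_right_mono divide_right_mono)
 show "continuous_on Icc l" using assms(1) by (simp add: bfun_def)
 fix t
 { assume t: "t \<in> {0<..<1::real}"
  show "DERIV l t :> l1 t" "DERIV l1 t :> l2 t"
   using assms(1) t by (auto simp: bfun_def)
  have "abs (l1 t) <= C / e * il e be t" "abs (l2 t) <= C / e^2 * il e be t"
   using assms(1) t unfolding bfun_def by blast+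
  thus "abs (l1 t) <= C' / e * il e be t" "abs (l2 t) <= C' / e^2 * il e be t"
   using a(1,2)[of t] by linarith+ }
 { assume t: "t \<in> {0..1::real}"
  have "abs (l t) <= C * il e be t" "abs (l t - l 0 - t * lam) <= C * t^2 / e^2"
   using assms(1) t unfolding bfun_def by blast+
  thus "abs (l t) <= C' * il e be t" "abs (l t - l 0 - t * lam) <= C' * t^2 / e^2"
   using a(3)[of t] b[of t] by linarith+ }
qed

lemma dfam_bounded:
 assumes "dfam n g"
 shows "\<exists>C\<ge>1. \<forall>i\<le>n. \<forall>t\<in>Icc. abs (g i t) <= C"
proof -
 have "\<exists>C. \<forall>t\<in>Icc. abs (g i t) <= C" if "i <= n" for i
 proof -
  have "continuous_on Icc (g i)" using assms that unfolding dfam_def by auto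
  hence "bounded (g i ` Icc)" by (intro compact_imp_bounded compact_continuous_image compact_Icc)
  thus ?thesis unfolding bounded_iff by auto
 qed
 then obtain c where c: "!!i t. i <= n ==> t \<in> Icc ==> abs (g i t) <= c i" by metis
 have "abs (g i t) <= 1 + (\<Sum>i\<le>n. abs (c i))" if "i <= n" "t \<in> Icc" for i t
 proof -
  have "abs (c i) <= (\<Sum>i\<le>n. abs (c i))" by (rule member_le_sum) (use that in auto)
  thus ?thesis using c[OF that] by linarith
 qed
 thus ?thesis by (intro exI[of _ "1 + (\<Sum>i\<le>n. abs (c i))"]) (auto simp: sum_nonneg)
qed

context problem_data
begin

abbreviation "layered K e y yx yxx yt \<equiv> layer_problem be \<delta> K e b (Dx b) (Dx (Dx b)) (FF e)
 (%x t. PPx e x t + SSx e x t) (%x t. PPxx e x t + SSxx e x t)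
 (WW e y) (WWx e yx) (WWxx e yxx) (WWt e yt) vv vvx vvxx vvt (wd (Suc 0)) (wd 2) (ph 2) (ph 3) (ph 4)"

lemma boundary_layers:
 "\<exists>C\<ge>1. \<forall>e. 0 < e --> e <= 1 -->
  (\<exists>l1 l2. bfun e be C (%t. - 1 * ke 0 (%x. a0 + qd 0 0) e 0 t + (- (J e * e)) * ke (Suc 0) (%x. 1) e 0 t) l1 l2
    (- 1 * (kt 0 (%x. a0 + qd 0 0) e 0 0 / e) + (- (J e * e)) * (kt (Suc 0) (%x. 1) e 0 0 / e))) \<and>
  (\<exists>l1 l2. bfun e be C (%t. - 1 * Ph e 1 t + - 1 * ke 0 (qd 0) e 1 t) l1 l2
    (- 1 * 0 + - 1 * (kt 0 (qd 0) e 1 0 / e)))"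
proof -
 have b1: "bnd (%e x t. a0 + qd 0 0)" "bnd (%e x t. 1)" "bnd (%e x t. qd 0 x)"
  unfolding qd_def by (intro bnd_intros; simp)+
 obtain Ca where Ca: "1 <= Ca" "\<forall>(e::real) (x::real). 0 < e --> e <= 1 --> 0 <= x --> x <= 1 -->
  bfun e be Ca (ke 0 (%x. a0 + qd 0 0) e x) (%t. kt 0 (%x. a0 + qd 0 0) e x t / e) (%t. (ktt 0 (%x. a0 + qd 0 0) e x t / e) / e) (kt 0 (%x. a0 + qd 0 0) e x 0 / e)"
  using bfun_ke[OF b1(1), of 0] by blast
 obtain Cb where Cb: "1 <= Cb" "\<forall>(e::real) (x::real). 0 < e --> e <= 1 --> 0 <= x --> x <= 1 -->
  bfun e be Cb (ke (Suc 0) (%x. 1) e x) (%t. kt (Suc 0) (%x. 1) e x t / e) (%t. (ktt (Suc 0) (%x. 1) e x t / e) / e) (kt (Suc 0) (%x. 1) e x 0 / e)"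
  using bfun_ke[OF b1(2), of "Suc 0"] by blast
 obtain Cc where Cc: "1 <= Cc" "\<forall>(e::real) (x::real). 0 < e --> e <= 1 --> 0 <= x --> x <= 1 -->
  bfun e be Cc (ke 0 (qd 0) e x) (%t. kt 0 (qd 0) e x t / e) (%t. (ktt 0 (qd 0) e x t / e) / e) (kt 0 (qd 0) e x 0 / e)"
  using bfun_ke[OF b1(3), of 0] by blast
 obtain Cd where Cd: "1 <= Cd" "\<forall>e. 0 < e --> e <= 1 --> bfun e be Cd (Ph e 1) (Pht e 1) (Phtt e 1) 0"
  using bfun_Ph by blast
 obtain Cj where Cj: "1 <= Cj" "unif (%e x t. abs (J e * e) <= Cj)"
  using bndD[OF J_bnd] by blast
 define C where "C = (1 * Ca + Cj * Cb) + (1 * Cd + 1 * Cc)"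
 have CC: "1 <= C" "1 * Ca + Cj * Cb <= C" "1 * Cd + 1 * Cc <= C"
 proof -
  have "0 <= Cj * Cb" using Cj(1) Cb(1) by simp
  thus "1 <= C" "1 * Ca + Cj * Cb <= C" "1 * Cd + 1 * Cc <= C" unfolding C_def using Ca(1) Cc(1) Cd(1) by linarith+
 qed
 show ?thesis
 proof (intro exI[of _ C] conjI allI impI CC(1))
  fix e :: real assume e: "0 < e" "e <= 1"
  have j: "abs (- (J e * e)) <= Cj" using Cj(2)[rule_format, of e 0 1] e by simp
  note a = Ca(2)[rule_format, OF e order_refl zero_le_one] and b = Cb(2)[rule_format, OF e order_refl zero_le_one]
   and c = Cc(2)[rule_format, OF e zero_le_one order_refl] and d = Cd(2)[rule_format, OF e]
  have m: "abs (- 1 :: real) <= 1" by simp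
  show "\<exists>l1 l2. bfun e be C (%t. - 1 * ke 0 (%x. a0 + qd 0 0) e 0 t + (- (J e * e)) * ke (Suc 0) (%x. 1) e 0 t) l1 l2
    (- 1 * (kt 0 (%x. a0 + qd 0 0) e 0 0 / e) + (- (J e * e)) * (kt (Suc 0) (%x. 1) e 0 0 / e))"
   by (rule exI, rule exI, rule bfun_mono[OF bfun_add[OF bfun_cmult[OF a m _ e(1)] bfun_cmult[OF b j _ e(1)]] CC(2) e(1)])
    (use Ca(1) Cb(1) in auto)
  show "\<exists>l1 l2. bfun e be C (%t. - 1 * Ph e 1 t + - 1 * ke 0 (qd 0) e 1 t) l1 l2
    (- 1 * 0 + - 1 * (kt 0 (qd 0) e 1 0 / e))"
   by (rule exI, rule exI, rule bfun_mono[OF bfun_add[OF bfun_cmult[OF d m _ e(1)] bfun_cmult[OF c m _ e(1)]] CC(3) e(1)])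
    (use Cd(1) Cc(1) in auto)
 qed
qed

text \<open>All constants are collected before \<open>e\<close> and the solution are fixed; this
  secures uniformity in \<open>e\<close>.\<close>

theorem layered_solution:
 "\<exists>K\<ge>1. \<forall>e y yx yxx yt. solution be \<delta> Kf Kb f b gl gr ph wd cd e y yx yxx yt --> layered K e y yx yxx yt"
proof -
 obtain Kl where Kl: "1 <= Kl" "\<forall>i\<le>2. \<forall>t\<in>Icc. abs (gl i t) <= Kl" using dfam_bounded[OF gl] by blast
 obtain Kr where Kr: "1 <= Kr" "\<forall>i\<le>2. \<forall>t\<in>Icc. abs (gr i t) <= Kr" using dfam_bounded[OF gr] by blast
 obtain Kp where Kp: "1 <= Kp" "\<forall>i\<le>4. \<forall>t\<in>Icc. abs (ph i t) <= Kp" using dfam_bounded[OF ph] by blast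
 obtain Kq where Kq: "1 <= Kq" "\<forall>e. 0 < e --> e <= 1 -->
  (\<exists>l1 l2. bfun e be Kq (%t. - 1 * ke 0 (%x. a0 + qd 0 0) e 0 t + (- (J e * e)) * ke (Suc 0) (%x. 1) e 0 t) l1 l2
    (- 1 * (kt 0 (%x. a0 + qd 0 0) e 0 0 / e) + (- (J e * e)) * (kt (Suc 0) (%x. 1) e 0 0 / e))) \<and>
  (\<exists>l1 l2. bfun e be Kq (%t. - 1 * Ph e 1 t + - 1 * ke 0 (qd 0) e 1 t) l1 l2
    (- 1 * 0 + - 1 * (kt 0 (qd 0) e 1 0 / e)))"
  using boundary_layers by blast
 obtain Kv where Kv: "1 <= Kv" "unif (%e x t. abs (vvxx x t) <= Kv)"
  using bndD[OF vv_bnd(1)] by blast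
 obtain Kw where Kw: "1 <= Kw" "unif (%e x t. abs (vvt x t) <= Kw)"
  using bndD[OF vv_bnd(2)] by blast
 obtain Kg where Kg: "1 <= Kg" "unif (%e x t. abs (PPxx e x t + SSxx e x t) <= Kg)"
  using bndD[OF lay_bnd[OF lay_add[OF PP_lay(4) SS_lay(3)]]] by blast
 obtain Kh where Kh: "1 <= Kh" "unif (%e x t. abs (PP e x t / e + SS e x t / e) <= Kh)"
  using bndD[OF lay_bnd[OF lay_add[OF PP_lay(1) SS_lay(1)]]] by blast
 obtain Ki where Ki: "1 <= Ki" "\<forall>(e::real) x s t. 0 < e --> e <= 1 --> x \<in> Icc --> s \<in> Icc --> t \<in> Icc --> abs (FF e x t - FF e x s) <= Ki * abs (t - s)"
  using FF_lip by blast
 obtain Kj where Kj: "1 <= Kj" "\<forall>(e::real) x t k. 0 < e --> e <= 1 --> x \<in> Icc --> 0 < k --> 0 < t --> t + 2 * k <= 1 -->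
  abs (dif2 (FF e x) k t) <= Kj * k^2 * (1 + (1 / e + 1 / (t + x^2)) * il e be t)"
  using FF_diff2 by blast
 define G where "G = Kl + Kr + Kq"
 define X where "X = max 0 (max Kb (Kf / be))"
 have X: "0 <= X" "Kb <= X" "Kf / be <= X" by (auto simp: X_def)
 define K where "K = X + Kp + Kv + Kw + Kg + Kh + Ki + Kj + 2 * G"
 have KK: "1 <= K" "Kb <= K" "Kf / be <= K" "Kp <= K" "Kv <= K" "Kw <= K" "Kg <= K" "Kh <= K" "Ki <= K" "Kj <= K" "2 * G <= K"
  using Kl(1) Kr(1) Kp(1) Kq(1) Kv(1) Kw(1) Kg(1) Kh(1) Ki(1) Kj(1) X
  unfolding K_def G_def by simp_all
 show ?thesis
 proof (intro exI[of _ K] conjI allI impI KK(1))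
  fix e y yx yxx yt assume sol: "solution be \<delta> Kf Kb f b gl gr ph wd cd e y yx yxx yt"
  interpret solution be \<delta> Kf Kb f b gl gr ph wd cd e y yx yxx yt by fact
  \<comment> \<open>Both boundaries in one form: a smooth part, a layer part, and the combined
    initial slope \<open>ph 2 c\<close>, which is the \<open>u1\<close> of
    \<open>layer_problem\<close>.\<close>
  have bd: "c = 0 \<or> c = 1 ==> \<exists>r l l1 l2 lam. dfam 2 r \<and> (\<forall>i\<le>2. \<forall>t\<in>Icc. abs (r i t) <= G) \<and>
    bfun e be G l l1 l2 lam \<and> (\<forall>t\<in>Icc. WW e y c t = r 0 t + l t) \<and> r (Suc 0) 0 + lam = ph 2 c" for c
  proof (elim disjE)
   assume c: "c = 0"
   obtain l1 l2 where l: "bfun e be Kq (%t. - 1 * ke 0 (%x. a0 + qd 0 0) e 0 t + (- (J e * e)) * ke (Suc 0) (%x. 1) e 0 t) l1 l2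
    (- 1 * (kt 0 (%x. a0 + qd 0 0) e 0 0 / e) + (- (J e * e)) * (kt (Suc 0) (%x. 1) e 0 0 / e))"
    using Kq(2) eps by blast
   have "Kq <= G" "Kl <= G" using Kl(1) Kr(1) Kq(1) by (auto simp: G_def)
   hence 1: "\<forall>i\<le>2. \<forall>t\<in>Icc. abs (gl i t) <= G" and 2: "Kq <= G" using Kl(2) by (force, simp)
   show ?thesis unfolding c
    by (rule exI[of _ gl], rule exI, rule exI, rule exI, rule exI, intro conjI, rule gl, rule 1, rule bfun_mono[OF l 2 eps(1)])
     (use WW_left lam_left in auto)
  next
   assume c: "c = 1"
   obtain l1 l2 where l: "bfun e be Kq (%t. - 1 * Ph e 1 t + - 1 * ke 0 (qd 0) e 1 t) l1 l2
    (- 1 * 0 + - 1 * (kt 0 (qd 0) e 1 0 / e))"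
    using Kq(2) eps by blast
   have "Kq <= G" "Kr <= G" using Kl(1) Kr(1) Kq(1) by (auto simp: G_def)
   hence 1: "\<forall>i\<le>2. \<forall>t\<in>Icc. abs (gr i t) <= G" and 2: "Kq <= G" using Kr(2) by (force, simp)
   show ?thesis unfolding c
    by (rule exI[of _ gr], rule exI, rule exI, rule exI, rule exI, intro conjI, rule gr, rule 1, rule bfun_mono[OF l 2 eps(1)])
     (use WW_right lam_right in auto)
  qed
  have G0: "0 <= G" using Kl(1) Kr(1) Kq(1) by (simp add: G_def)
  have bb: "abs (WW e y c t) <= K" "abs (WW e y c t - WW e y c 0) <= K * t / e"
    "abs (WW e y c t - WW e y c 0 - t * ph 2 c) <= K * t^2 / e^2" if c: "c = 0 \<or> c = 1" and t: "t \<in> Icc" for c t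
  proof -
   obtain r l l1 l2 lam where r: "dfam 2 r" "\<forall>i\<le>2. \<forall>t\<in>Icc. abs (r i t) <= G" "bfun e be G l l1 l2 lam"
    "\<forall>t\<in>Icc. WW e y c t = r 0 t + l t" and u: "r (Suc 0) 0 + lam = ph 2 c" using bd[OF c] by metis
   note bs = boundary_bounds[OF eps beta_pos r(1) r(2)[rule_format] r(3) r(4)[rule_format], unfolded u]
   have m: "2 * G * s <= K * s" if "0 <= s" for s using KK(11) that by (rule mult_right_mono)
   show "abs (WW e y c t) <= K" 
   proof (rule order_trans[OF _ KK(11)])
    show "abs (WW e y c t) <= 2 * G" by (rule bs(1)) (use t in auto)
   qed
   have "abs (WW e y c t - WW e y c 0) <= 2 * G * t / e" by (rule bs(2)) (use t in auto)
   also have "... <= K * t / e" using m[of t] t eps by (intro divide_right_mono) auto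
   finally show "abs (WW e y c t - WW e y c 0) <= K * t / e" .
   have "abs (WW e y c t - WW e y c 0 - t * ph 2 c) <= 2 * G * t^2 / e^2" by (rule bs(3)) (use t in auto)
   also have "... <= K * t^2 / e^2" using m[of "t^2"] by (intro divide_right_mono) auto
   finally show "abs (WW e y c t - WW e y c 0 - t * ph 2 c) <= K * t^2 / e^2" .
  qed
  have bb2: "abs (WW e y c (t + k) - WW e y c t) <= K * (k + min 1 (k / e) * il e be t)"
   if c: "c = 0 \<or> c = 1" and t: "0 < k" "0 < t" "t + k <= 1" for c t k
  proof -
   obtain r l l1 l2 lam where r: "dfam 2 r" "\<forall>i\<le>2. \<forall>t\<in>Icc. abs (r i t) <= G" "bfun e be G l l1 l2 lam"
    "\<forall>t\<in>Icc. WW e y c t = r 0 t + l t" using bd[OF c] by metis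
   have "abs (WW e y c (t + k) - WW e y c t) <= 2 * G * (k + min 1 (k / e) * il e be t)"
    by (rule boundary_bounds(4)[OF eps beta_pos r(1) r(2)[rule_format] r(3) r(4)[rule_format]]) (use t in auto)
   also have "... <= K * (k + min 1 (k / e) * il e be t)"
    using KK(11) t eps il_pos[of e be t] by (intro mult_right_mono) auto
   finally show ?thesis .
  qed
  have bb3: "abs (WW e y c (t + 2 * k) - 2 * WW e y c (t + k) + WW e y c t) <= K * k^2 * (1 + il e be t / e^2)"
   if c: "c = 0 \<or> c = 1" and t: "0 < k" "0 < t" "t + 2 * k <= 1" for c t k
  proof -
   obtain r l l1 l2 lam where r: "dfam 2 r" "\<forall>i\<le>2. \<forall>t\<in>Icc. abs (r i t) <= G" "bfun e be G l l1 l2 lam"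
    "\<forall>t\<in>Icc. WW e y c t = r 0 t + l t" using bd[OF c] by metis
   have "abs (WW e y c (t + 2 * k) - 2 * WW e y c (t + k) + WW e y c t) <= 2 * G * k^2 * (1 + il e be t / e^2)"
    by (rule boundary_bounds(5)[OF eps beta_pos r(1) r(2)[rule_format] r(3) r(4)[rule_format]]) (use t in auto)
   also have "... <= K * k^2 * (1 + il e be t / e^2)"
    using KK(11) il_pos[of e be t] by (intro mult_right_mono) auto
   finally show ?thesis .
  qed
  have bv: "b x t * vv x t = f x t" if "x \<in> Icc" "t \<in> Icc" for x t
   using b_pos[OF that] by (simp add: vv_def)
  have G0: "b x t * vv x t - FF e x t = PP e x t + SS e x t" if "x \<in> Icc" "t \<in> Icc" for x t
   using bv[OF that] by (simp add: FF_def)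
  have in1: "x \<in> Icc" if "x \<in> {0<..<1::real}" for x using that by auto
  have in2: "t \<in> Icc" if "t \<in> {0<..1::real}" for t using that by auto
  show "layered K e y yx yxx yt"
  proof (unfold_locales)
   show "abs (b x t - b x s) <= K * abs (t - s)" if "x \<in> Icc" "s \<in> Icc" "t \<in> Icc" for x s t
   proof -
    have "abs (b x t - b x s) <= Kb * abs (t - s)"
     by (rule lipschitz_within[where g'="Dt b x"]) (use smoothD[OF b_smooth that(1)] that in auto)
    also have "... <= K * abs (t - s)" using KK(2) by (intro mult_right_mono) auto
    finally show ?thesis .
   qed
   show "abs (dif2 (b x) k t) <= K * k^2"
    if "x \<in> Ioo" "0 < k" "0 <= t" "t + 2 * k <= 1" for x t k
    using smooth_diff2[OF b_smooth in1[OF that(1)] that(2-4)] mult_right_mono[OF KK(2), of "k^2"] by simp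
   show "DERIV (%s. b s t) x :> Dx b x t" "DERIV (%s. Dx b s t) x :> Dx (Dx b) x t"
    if "x \<in> Ioo" "t \<in> Ioc" for x t
    using smooth_interior(1,2)[OF b_smooth that(1) in2[OF that(2)]] .
   show "DERIV (%s. b s t * vv s t - FF e s t) x :> PPx e x t + SSx e x t"
    if x: "x \<in> Ioo" and t: "t \<in> Ioc" for x t
   proof (rule has_field_derivative_transform_within_open[where S="Ioo"])
    show "DERIV (%s. PP e s t + SS e s t) x :> PPx e x t + SSx e x t"
     by (intro DERIV_add PP_x(1)[OF x in2[OF t]] SS_x(1)[OF x t])
    fix s assume "s \<in> {0<..<1::real}"
    thus "PP e s t + SS e s t = b s t * vv s t - FF e s t" using G0[OF in1 in2[OF t]] by simp
   qed (use x in auto)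
   show "DERIV (%s. PPx e s t + SSx e s t) x :> PPxx e x t + SSxx e x t"
    if x: "x \<in> Ioo" and t: "t \<in> Ioc" for x t
    by (intro DERIV_add PP_x(2)[OF x in2[OF t]] SS_x(2)[OF x t])
   show "abs (b x t * vv x t - FF e x t) <= K * e" if x: "x \<in> Ioo" and t: "t \<in> Ioc" for x t
   proof -
    have "abs (PP e x t / e + SS e x t / e) <= K" using Kh(2)[rule_format, of e x t] KK(8) eps x t by fastforce
    moreover have "PP e x t / e + SS e x t / e = (b x t * vv x t - FF e x t) / e"
     using G0[OF in1[OF x] in2[OF t]] by (simp add: add_divide_distrib)
    ultimately have "abs (b x t * vv x t - FF e x t) / e <= K" using eps by (simp add: abs_divide)
    thus ?thesis using eps by (simp add: pos_divide_le_eq)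
   qed
   show "abs (FF e x t - FF e x s) <= K * abs (t - s)" if "x \<in> Ioo" "s \<in> Icc" "t \<in> Icc" for x s t
    using Ki(2)[rule_format, OF eps in1[OF that(1)] that(2,3)] mult_right_mono[OF KK(9), of "abs (t - s)"] by simp
   show "abs (dif2 (FF e x) k t) <= K * k^2 * (1 + (1 / e + 1 / (t + x^2)) * il e be t)"
    if "x \<in> Ioo" "0 < k" "0 < t" "t + 2 * k <= 1" for x t k
   proof -
    have "0 <= 1 + (1 / e + 1 / (t + x^2)) * il e be t" using eps that il_pos[of e be t] by (intro add_nonneg_nonneg mult_nonneg_nonneg) auto
    hence "Kj * k^2 * (1 + (1 / e + 1 / (t + x^2)) * il e be t) <= K * k^2 * (1 + (1 / e + 1 / (t + x^2)) * il e be t)"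
     using KK(10) by (intro mult_right_mono) auto
    thus ?thesis using Kj(2)[rule_format, OF eps in1[OF that(1)] that(2-4)] by linarith
   qed
   show "FF e x 0 = b x 0 * vv x 0 - e * wd 2 x + e * ph 2 x" if "x \<in> Ioo" for x
    using bv[OF in1[OF that], of 0]
    by (simp add: FF_def PP_def SS_def cd p0xx_def ke_def qd_def algebra_simps)
   show "DERIV (%s. vv s 0) x :> wd (Suc 0) x" if "x \<in> Ioo" for x
    using dfam_interior[OF wd(1) _ that, of 0] by (simp add: wd(2) vv_def)
   show "DERIV (wd (Suc 0)) x :> wd 2 x" if "x \<in> Ioo" for x
    using dfam_interior[OF wd(1) _ that, of "Suc 0"] by (simp add: numeral_2_eq_2)
   show "DERIV (ph 2) x :> ph 3 x" "DERIV (ph 3) x :> ph 4 x" if "x \<in> Ioo" for x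
    using dfam_interior[OF ph _ that, of 2] dfam_interior[OF ph _ that, of 3] by simp_all
   show "continuous_on Icc (ph 2)" using ph unfolding dfam_def by auto
   show "abs (ph 2 x) <= K" if "x \<in> Icc" for x using Kp(2)[rule_format, of 2 x] KK(4) that by simp
   show "abs (ph 4 x) <= K" if "x \<in> Ioo" for x using Kp(2)[rule_format, of 4 x] KK(4) that by simp
   show "abs (PPxx e x t + SSxx e x t) <= K" if "x \<in> Ioo" "t \<in> Ioc" for x t
    using Kg(2)[rule_format, of e x t] KK(7) eps that by fastforce
   show "abs (vvxx x t) <= K" if "x \<in> Ioo" "t \<in> Ioc" for x t
    using Kv(2)[rule_format, of e x t] KK(5) eps that by fastforce
   show "abs (vvt x t) <= K" if "x \<in> Ioo" "t \<in> Ioc" for x t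
    using Kw(2)[rule_format, of e x t] KK(6) eps that by fastforce
   show "abs (vv x t) <= K" if "x \<in> Icc" "t \<in> Icc" for x t using vv_le[OF that] KK(3) by simp
   show "b x t <= K" if "x \<in> Icc" "t \<in> Icc" for x t using smoothD(5)[OF b_smooth that] KK(2) by simp
   show "abs (Dx b x t) <= K" "abs (Dx (Dx b) x t) <= K" if "x \<in> Ioo" "t \<in> Ioc" for x t
    using smoothD(6,7)[OF b_smooth in1[OF that(1)] in2[OF that(2)]] KK(2) by simp_all
  qed (fact beta_pos delta_pos eps KK(1) b_ge WW_deriv WW_eq WW_cont vv_deriv vv_cont WW_init bb bb2 bb3)+
 qed
qed

end

section \<open>Truncation and interpolation errors\<close>

definition dd :: "(real => real) => real => real => real => real" where
 "dd g x h h' = ((g (x + h') - g x) / h' - (g x - g (x - h)) / h) / ((h' + h) / 2)"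

definition lb :: "real => real => real => real" where
 "lb e be x = exp (- (sqrt (be / e) * x))"

definition itp :: "(real => real) => real => real => real => real" where
 "itp g a c x = ((c - x) * g a + (x - a) * g c) / (c - a)"

lemma lb_bl: "lb e be x <= bl e be x"
 by (simp add: lb_def bl_def)

lemma lb_mono: "0 < e ==> 0 < be ==> x <= y ==> lb e be y <= lb e be x"
 by (simp add: lb_def mult_left_mono)

lemma lb_le_1: "0 < e ==> 0 < be ==> 0 <= x ==> lb e be x <= 1"
 by (simp add: lb_def)

lemma lb_pos: "0 < lb e be x" by (simp add: lb_def)

lemma dd_add: "dd (%x. g x + k x) x h h' = dd g x h h' + dd k x h h'"
proof -
 have 1: "((a + a') - (b + b')) / c = (a - b) / c + (a' - b') / (c::real)" for a a' b b' c
  by (simp add: add_divide_distrib diff_divide_distrib)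
 show ?thesis unfolding dd_def 1 by (simp add: 1[symmetric] add_divide_distrib diff_divide_distrib)
qed

lemma dd_uniform: "0 < h ==> dd g x h h = (g (x + h) - 2 * g x + g (x - h)) / h^2"
 by (simp add: dd_def field_simps power2_eq_square)

lemma dd_cmult: "dd (%x. a * g x) x h h' = a * dd g x h h'"
proof -
 have 1: "a * p - a * q = a * (p - q)" "(a * p) / c = a * (p / c)" for p q c :: real by (simp_all add: right_diff_distrib)
 show ?thesis unfolding dd_def 1 ..
qed

lemma divide_le_multiple:
 fixes a b c n :: real
 assumes "0 < a" "0 < b" "0 <= c" "b <= n * a"
 shows "c / a <= n * c / b"
 using mult_left_mono[OF assms(4,3)] assms(1,2) by (simp add: frac_le_eq field_simps)

lemma itp_add: "itp (%x. g x + k x) a c x = itp g a c x + itp k a c x"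
 by (simp add: itp_def distrib_left add_divide_distrib[symmetric] algebra_simps)

lemma itp_abs_le:
 assumes "a < c" "x \<in> {a..c}" "abs (g a) <= B" "abs (g c) <= B"
 shows "abs (itp g a c x) <= B"
proof -
 have "abs ((c - x) * g a) <= (c - x) * B" "abs ((x - a) * g c) <= (x - a) * B"
  unfolding abs_mult using assms by (auto intro!: mult_mono)
 hence "abs ((c - x) * g a + (x - a) * g c) <= B * (c - a)" by (simp add: algebra_simps)
 thus ?thesis unfolding itp_def abs_divide using assms(1) by (simp add: pos_divide_le_eq)
qed

text \<open>What the error analysis uses of the solution, sorted by mesh region. \<open>b0\<close>
  is a local bound for a layer function. In \<open>x_right\<close> it concerns only the left layer:
  near the right end the fine mesh resolves the right layer, and the corner function is small
  there.\<close>

locale mesh_estimates =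
 fixes e be C :: real and y yxx yt :: "real => real => real"
 assumes x_fine: "[|0 < h; h <= x; x + h <= 1; t \<in> Ioc|] ==>
   e * abs (dd (%x. y x t) x h h - yxx x t) <= C * (h^2 / e + h^2 / (t + x^2))"
  and x_right: "[|0 < h; h <= x; x + h <= 1; t \<in> Ioc; lb e be (x - h) <= b0|] ==>
   e * abs (dd (%x. y x t) x h h - yxx x t) <= C * (h^2 / e + b0)"
  and x_coarse: "[|0 < h; h <= x; x + h <= 1; t \<in> Ioc; !!z. x - h <= z ==> z <= x + h ==> bl e be z <= b0|] ==>
   e * abs (dd (%x. y x t) x h h - yxx x t) <= C * (h^2 + b0)"
  and x_transition: "[|0 < h; 0 < h'; h <= m; h' <= m; h <= x; x + h' <= 1; t \<in> Ioc;
   !!z. x - h <= z ==> z <= x + h' ==> bl e be z <= b0|] ==>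
   e * abs (dd (%x. y x t) x h h' - yxx x t) <= C * (sqrt e * m + b0)"
  and t_fine: "[|x \<in> Ioo; 0 < k; k <= t; t <= 1|] ==>
   e * abs ((y x t - y x (t - k)) / k - yt x t) <= C * (k / e + k / (t + x^2))"
  and t_coarse: "[|x \<in> Ioo; 0 < k; k <= t; t <= 1|] ==>
   e * abs ((y x t - y x (t - k)) / k - yt x t) <= C * (k + il e be (t - k))"
  and itp_fine: "[|0 <= a; a < c; c <= 1; x \<in> {a..c}; t \<in> Icc|] ==>
   abs (y x t - itp (%x. y x t) a c x) <= C * ((c - a)^2 / e)"
  and itp_coarse: "[|0 <= a; a < c; c <= 1; x \<in> {a..c}; t \<in> Icc; !!z. a <= z ==> z <= c ==> bl e be z <= b0|] ==>
   abs (y x t - itp (%x. y x t) a c x) <= C * ((c - a)^2 + b0)"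
  and t_diff: "[|x \<in> Icc; 0 <= s; s < t; t <= 1|] ==>
   abs (y x t - y x s) <= C * ((t - s) + min 1 ((t - s) / e) * il e be s)"

text \<open>In the application \<open>r\<close> is the regular part plus the initial layer,
  \<open>q\<close> the corner function, and \<open>V\<close> the reduced solution plus the initial
  layer, so that \<open>r - V\<close> is the boundary layer up to order \<open>e\<close>.\<close>

locale split_solution =
 fixes e be C :: real and r rx rxx rt q qx qxx q3 q4 qt qtt V Vx Vxx :: "real => real => real" and g0 g1 g2 :: "real => real"
 assumes eps: "0 < e" "e <= 1" and beta_pos: "0 < be" and C_ge_1: "1 <= C"
  and r_x: "x \<in> Ioo ==> t \<in> Ioc ==> DERIV (%x. r x t) x :> rx x t"
  and r_xx: "x \<in> Ioo ==> t \<in> Ioc ==> DERIV (%x. rx x t) x :> rxx x t"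
  and r_cont: "t \<in> Ioc ==> continuous_on Icc (%x. r x t)"
  and r_xreg: "t \<in> Ioc ==> xreg e be C (%x. e * rxx x t)"
  and r_diff: "x \<in> Icc ==> 0 <= s ==> s < t ==> t <= 1 ==>
    abs (r x t - r x s) <= C * ((t - s) + min 1 ((t - s) / e) * il e be s)"
  and r_t_le: "x \<in> Ioo ==> t \<in> Ioc ==> 0 <= a ==> a < t ==> abs (rt x t) <= C * (1 + il e be a / e)"
  and r_back: "x \<in> Ioo ==> 0 < k ==> k <= t ==> t <= 1 ==>
    abs (r x t - r x (t - k) - k * rt x t) <= C * (1 + il e be (t - k) / e^2) * k^2"
  and V_x: "x \<in> Ioo ==> t \<in> Ioc ==> DERIV (%x. V x t) x :> Vx x t"
  and V_xx: "x \<in> Ioo ==> t \<in> Ioc ==> DERIV (%x. Vx x t) x :> Vxx x t"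
  and V_cont: "t \<in> Ioc ==> continuous_on Icc (%x. V x t)"
  and V_xx_le: "x \<in> Ioo ==> t \<in> Ioc ==> abs (Vxx x t) <= C"
  and r_V: "x \<in> Icc ==> t \<in> Ioc ==> abs (r x t - V x t) <= C * (bl e be x + e)"
  and q_x: "t \<in> Ioc ==> DERIV (%x. q x t) x :> qx x t"
  and q_xx: "t \<in> Ioc ==> DERIV (%x. qx x t) x :> qxx x t"
  and q_3: "t \<in> Ioc ==> DERIV (%x. qxx x t) x :> q3 x t"
  and q_4: "t \<in> Ioc ==> DERIV (%x. q3 x t) x :> q4 x t"
  and q_t: "t \<in> Ioc ==> DERIV (%t. q x t) t :> qt x t"
  and q_tt: "t \<in> Ioc ==> DERIV (%t. qt x t) t :> qtt x t"
  and q_cont_t: "x \<in> Icc ==> continuous_on Icc (%t. q x t)"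
  and q_le: "x \<in> Icc ==> t \<in> Ioc ==> abs (q x t) <= C * lb e be x"
  and q_le': "x \<in> Icc ==> t \<in> Icc ==> abs (q x t) <= C * il e be t"
  and q_xx_le: "x \<in> Icc ==> t \<in> Ioc ==> abs (e * qxx x t) <= C * lb e be x"
  and q_4_le: "x \<in> Icc ==> t \<in> Ioc ==> abs (e * q4 x t) <= C / (t + x^2)"
  and q_t_le: "x \<in> Icc ==> t \<in> Ioc ==> abs (e * qt x t) <= C * il e be t"
  and q_tt_le: "x \<in> Icc ==> t \<in> Ioc ==> abs (e * qtt x t) <= C * (1 / e + 1 / (t + x^2))"
  and init: "x \<in> Icc ==> r x 0 + q x 0 = g0 x" and init_cont: "continuous_on Icc g0"
  and init_x: "x \<in> Ioo ==> DERIV g0 x :> g1 x"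
  and init_xx: "x \<in> Ioo ==> DERIV g1 x :> g2 x"
  and init_le: "x \<in> Ioo ==> abs (g2 x) <= C"
begin

lemma C0: "0 <= C" using C_ge_1 by simp
lemma bl_le: "x \<in> Icc ==> bl e be x <= 2" using bl_le_2 eps beta_pos by blast
lemma il_le: "0 <= t ==> il e be t <= 1" using il_le_1 eps beta_pos by blast
lemma bl0: "0 <= bl e be x" using bl_pos[of e be x] by simp

text \<open>On equal steps the error is governed by second differences of \<open>e * rxx\<close>,
  which \<open>xreg\<close> supplies.\<close>

lemma r_uniform:
 assumes h: "0 < h" "h <= x" "x + h <= 1" and t: "t \<in> Ioc"
  and B: "!!z. x - h <= z ==> z <= x + h ==> bl e be z <= b0"
 shows "e * abs (dd (%x. r x t) x h h - rxx x t) <= C * (h^2 + b0 * h^2 / e)"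
proof -
 have "abs (e * r (x+h) t - 2 * (e * r x t) + e * r (x-h) t - h^2 * (e * rxx x t)) <= (C * (1 + b0 / e)) * h^4"
 proof (rule second_difference_error[where ?g1.0="%x. e * rx x t" and w="%x. e * rxx x t"])
  show "0 < h" by fact
  show "continuous_on {x - h..x + h} (%x. e * r x t)"
   by (intro continuous_on_mult_left continuous_on_subset[OF r_cont[OF t]]) (use h in auto)
  fix z assume "z \<in> {x - h<..<x + h}"
  hence z: "z \<in> Ioo" using h by auto
  show "DERIV (%x. e * r x t) z :> e * rx z t" by (intro DERIV_cmult r_x[OF z t])
  show "DERIV (%x. e * rx x t) z :> e * rxx z t" by (intro DERIV_cmult r_xx[OF z t])
 next
  fix s assume s: "0 < s" "s < h"
  show "abs (e * rxx (x + s) t - 2 * (e * rxx x t) + e * rxx (x - s) t) <= C * (1 + b0 / e) * s^2"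
  proof (rule xreg_second_difference[OF r_xreg[OF t]])
   fix z assume "x - s <= z" "z <= x + s"
   hence "bl e be z <= b0" by (intro B) (use s in auto)
   thus "C * (1 + bl e be z / e) <= C * (1 + b0 / e)"
    using C0 eps by (intro mult_left_mono add_left_mono divide_right_mono) auto
  qed (use s h in auto)
 qed
 moreover have "e * r (x+h) t - 2 * (e * r x t) + e * r (x-h) t - h^2 * (e * rxx x t)
  = h^2 * (e * (dd (%x. r x t) x h h - rxx x t))"
  unfolding dd_uniform[OF h(1)] using h(1) by (simp add: field_simps)
 ultimately have "h^2 * (e * abs (dd (%x. r x t) x h h - rxx x t)) <= h^2 * (C * (1 + b0 / e) * h^2)"
  using eps by (simp add: abs_mult power4_eq_xxxx power2_eq_square mult_ac)
 hence "e * abs (dd (%x. r x t) x h h - rxx x t) <= C * (1 + b0 / e) * h^2" using h(1) by simp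
 also have "... = C * (h^2 + b0 * h^2 / e)" by (simp add: algebra_simps)
 finally show ?thesis .
qed

lemma r_consistency:
 assumes h: "0 < h" "0 < h'" "h <= x" "x + h' <= 1" and t: "t \<in> Ioc"
  and K: "!!z. z \<in> {x-h<..<x+h'} ==> abs (e * rxx z t - e * rxx x t) <= K"
 shows "e * abs (dd (%x. r x t) x h h' - rxx x t) <= 2 * K"
proof -
 have "abs (dd (%x. e * r x t) x h h' - e * rxx x t) <= 2 * K" unfolding dd_def
 proof (rule second_diff_consistency[where ?g1.0="%x. e * rx x t" and w="%x. e * rxx x t"])
  show "continuous_on {x - h..x + h'} (%x. e * r x t)"
   by (intro continuous_on_mult_left continuous_on_subset[OF r_cont[OF t]]) (use h in auto)
  fix z assume zz: "z \<in> {x - h<..<x + h'}"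
  hence z: "z \<in> Ioo" using h by auto
  show "DERIV (%x. e * r x t) z :> e * rx z t" by (intro DERIV_cmult r_x[OF z t])
  show "DERIV (%x. e * rx x t) z :> e * rxx z t" by (intro DERIV_cmult r_xx[OF z t])
  show "abs (e * rxx z t - e * rxx x t) <= K" by (rule K[OF zz])
 qed (use h in auto)
 thus ?thesis using eps by (simp add: dd_cmult right_diff_distrib[symmetric] abs_mult)
qed

lemma r_crude:
 assumes h: "0 < h" "0 < h'" "h <= x" "x + h' <= 1" and t: "t \<in> Ioc"
  and B: "!!z. x - h <= z ==> z <= x + h' ==> bl e be z <= b0"
 shows "e * abs (dd (%x. r x t) x h h' - rxx x t) <= 4 * C * (b0 + e)"
proof -
 have *: "abs (e * rxx z t) <= C * (b0 + e)" if "x - h < z" "z < x + h'" for z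
 proof -
  have "abs (e * rxx z t) <= C * (bl e be z + e)" by (rule xreg_bound[OF r_xreg[OF t]]) (use that h in auto)
  also have "... <= C * (b0 + e)" using C0 B[of z] that by (intro mult_left_mono) auto
  finally show ?thesis .
 qed
 have "e * abs (dd (%x. r x t) x h h' - rxx x t) <= 2 * (2 * (C * (b0 + e)))"
 proof (rule r_consistency[OF h t])
  fix z assume "z \<in> {x - h<..<x + h'}"
  thus "abs (e * rxx z t - e * rxx x t) <= 2 * (C * (b0 + e))"
   using *[of z] *[of x] h by auto
 qed
 thus ?thesis by simp
qed

text \<open>For \<open>h^2 \<le> e\<close> the quotient \<open>h^2 / e\<close> in
  \<open>r_uniform\<close> is harmless; otherwise \<open>e\<close> is below \<open>h^2\<close> and
  the crude bound is good enough.\<close>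

lemma r_coarse:
 assumes h: "0 < h" "h <= x" "x + h <= 1" and t: "t \<in> Ioc"
  and B: "!!z. x - h <= z ==> z <= x + h ==> bl e be z <= b0"
 shows "e * abs (dd (%x. r x t) x h h - rxx x t) <= 4 * C * (h^2 + b0)"
proof -
 have b0: "0 <= b0" using B[of x] bl0[of x] h(1) by linarith
 show ?thesis
 proof (cases "h^2 <= e")
  case True
  have "b0 * h^2 / e <= b0 * e / e" using b0 True eps by (intro divide_right_mono mult_left_mono) auto
  hence "C * (h^2 + b0 * h^2 / e) <= C * (h^2 + b0)" using C0 eps by (intro mult_left_mono) auto
  moreover have "0 <= C * (h^2 + b0)" using C0 b0 by simp
  moreover have "e * abs (dd (%x. r x t) x h h - rxx x t) <= C * (h^2 + b0 * h^2 / e)"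
   by (rule r_uniform[OF h t B])
  ultimately show ?thesis by linarith
 next
  case False
  hence "4 * C * (b0 + e) <= 4 * C * (h^2 + b0)" using C0 by (intro mult_left_mono) auto
  thus ?thesis using r_crude[OF h(1,1,2,3) t B] by linarith
 qed
qed

text \<open>Unequal steps give first order only: the step times the Lipschitz constant
  \<open>sqrt e + b0 / sqrt e\<close> of \<open>e * rxx\<close>. For \<open>m > sqrt e\<close> the
  crude bound is of the same size, since then \<open>e \<le> sqrt e * m\<close>.\<close>

lemma r_transition:
 assumes h: "0 < h" "0 < h'" "h <= m" "h' <= m" "h <= x" "x + h' <= 1" and t: "t \<in> Ioc"
  and B: "!!z. x - h <= z ==> z <= x + h' ==> bl e be z <= b0"
 shows "e * abs (dd (%x. r x t) x h h' - rxx x t) <= 18 * exp (sqrt be) * C * (sqrt e * m + b0)"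
proof -
 have b0: "0 <= b0" using B[of x] bl0[of x] h(1,2) by linarith
 define s where "s = sqrt e"
 have s: "0 < s" "s * s = e" using eps by (auto simp: s_def)
 have ee: "1 <= exp (sqrt be)" using beta_pos by simp
 define E where "E = exp (sqrt be) * C"
 have E: "C <= E" "0 <= E" using mult_right_mono[OF ee C0] C0 by (simp_all add: E_def)
 show ?thesis
 proof (cases "m <= s")
  case True
  have "e * abs (dd (%x. r x t) x h h' - rxx x t) <= 2 * (9 * E * (s + b0 / s) * m)"
  proof (rule r_consistency[OF h(1,2,5,6) t])
   fix z assume z: "z \<in> {x - h<..<x + h'}"
   have "abs (e * rxx z t - e * rxx x t) <= (9 * E * (s + b0 / s)) * abs (z - x)"
   proof (rule xreg_lipschitz[OF r_xreg[OF t] eps beta_pos])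
    show "z \<in> Ioo" "x \<in> Ioo" using z h by auto
    fix u assume "min x z <= u" "u <= max x z"
    hence "bl e be u <= b0" by (intro B) (use z h(1,2) in auto)
    hence "E * (s + bl e be u / s) <= E * (s + b0 / s)"
     using E(2) s(1) by (intro mult_left_mono add_left_mono divide_right_mono) auto
    thus "9 * exp (sqrt be) * C * (sqrt e + bl e be u / sqrt e) <= 9 * E * (s + b0 / s)"
     unfolding s_def[symmetric] E_def by (simp only: mult.assoc; linarith)
   qed
   also have "... <= (9 * E * (s + b0 / s)) * m"
    using E(2) s(1) b0 z h by (intro mult_left_mono) auto
   finally show "abs (e * rxx z t - e * rxx x t) <= 9 * E * (s + b0 / s) * m" .
  qed
  also have "2 * (9 * E * (s + b0 / s) * m) = 18 * E * (s * m + b0 * m / s)" by (simp add: algebra_simps)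
  also have "... <= 18 * E * (s * m + b0)"
  proof -
   have "b0 * m / s <= b0 * s / s" using b0 True s by (intro divide_right_mono mult_left_mono) auto
   thus ?thesis using E(2) s by (intro mult_left_mono) auto
  qed
  finally show ?thesis by (simp add: E_def s_def mult_ac)
 next
  case False
  have m: "e <= s * m" using False s by (metis less_imp_le mult_left_mono not_le)
  have "4 * C * (b0 + e) <= 18 * E * (s * m + b0)"
   using E C0 m b0 s eps by (intro mult_mono) auto
  thus ?thesis using r_crude[OF h(1,2,5,6) t B] by (simp add: E_def s_def mult_ac)
 qed
qed

lemma r_t_fine:
 assumes "x \<in> Ioo" "0 < k" "k <= t" "t <= 1"
 shows "e * abs ((r x t - r x (t - k)) / k - rt x t) <= C * (e * k + k / e * il e be (t - k))"
proof -
 have "(r x t - r x (t - k)) / k - rt x t = (r x t - r x (t - k) - k * rt x t) / k"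
  using assms(2) by (simp add: field_simps)
 hence "e * abs ((r x t - r x (t - k)) / k - rt x t) = e * (abs (r x t - r x (t - k) - k * rt x t) / k)"
  using assms(2) by simp
 also have "... <= e * ((C * (1 + il e be (t - k) / e^2) * k^2) / k)"
  using r_back[OF assms] eps assms(2) by (intro mult_left_mono divide_right_mono) auto
 also have "... = C * (e * k + k / e * il e be (t - k))"
  using eps assms(2) by (simp add: field_simps power2_eq_square)
 finally show ?thesis .
qed

text \<open>For steps \<open>k > e\<close> nothing is gained from cancellation, and the quotient and
  the derivative are estimated separately.\<close>

lemma r_t_coarse:
 assumes x: "x \<in> Ioo" and k: "0 < k" "k <= t" "t <= 1"
 shows "e * abs ((r x t - r x (t - k)) / k - rt x t) <= 2 * C * (k + il e be (t - k))"
proof -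
 define a where "a = il e be (t - k)"
 have a: "0 < a" by (simp add: a_def il_pos)
 show ?thesis
 proof (cases "k <= e")
  case True
  have "e * k + k / e * a <= 1 * k + 1 * a"
   using eps k(1) a True by (intro add_mono mult_right_mono) auto
  hence "C * (e * k + k / e * a) <= C * (k + a)" using C0 by (intro mult_left_mono) auto
  moreover have "0 <= C * (k + a)" using C0 a k(1) by simp
  ultimately show ?thesis using r_t_fine[OF x k] unfolding a_def[symmetric] by (simp only: mult.assoc; linarith)
 next
  case False
  have "abs (rt x t) <= C * (1 + il e be (t - k) / e)" by (rule r_t_le) (use x k in auto)
  hence "e * abs (rt x t) <= e * (C * (1 + a / e))" unfolding a_def using eps by (intro mult_left_mono) auto
  also have "... = C * (e + a)" using eps by (simp add: field_simps)
  finally have 1: "e * abs (rt x t) <= C * (e + a)" .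
  have "abs (r x t - r x (t - k)) <= C * ((t - (t - k)) + min 1 ((t - (t - k)) / e) * il e be (t - k))"
   by (rule r_diff) (use x k in auto)
  also have "... <= C * (k + (k / e) * a)"
   unfolding a_def[symmetric] using C0 a by (intro mult_left_mono add_mono mult_right_mono) auto
  finally have "e * (abs (r x t - r x (t - k)) / k) <= e * (C * (k + (k / e) * a) / k)"
   using eps k(1) by (intro mult_left_mono divide_right_mono) auto
  also have "... = C * (e + a)" using eps k(1) by (simp add: field_simps)
  finally have 2: "e * (abs (r x t - r x (t - k)) / k) <= C * (e + a)" .
  have "abs ((r x t - r x (t - k)) / k - rt x t) <= abs (r x t - r x (t - k)) / k + abs (rt x t)"
   using abs_triangle_ineq4[of "(r x t - r x (t - k)) / k" "rt x t"] k(1) by (simp add: abs_divide)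
  hence "e * abs ((r x t - r x (t - k)) / k - rt x t) <= e * (abs (r x t - r x (t - k)) / k + abs (rt x t))"
   using eps by (intro mult_left_mono) auto
  also have "... <= 2 * C * (e + a)" using 1 2 by (simp only: distrib_left mult.assoc; linarith)
  also have "... <= 2 * C * (k + a)" using False C0 by (intro mult_left_mono) auto
  finally show ?thesis by (simp add: a_def)
 qed
qed

lemma q_consistency:
 assumes h: "0 < h" "0 < h'" "h <= x" "x + h' <= 1" and t: "t \<in> Ioc" and b0: "lb e be (x - h) <= b0"
 shows "e * abs (dd (%x. q x t) x h h' - qxx x t) <= 4 * C * b0"
proof -
 have *: "abs (e * qxx z t) <= C * b0" if "x - h < z" "z < x + h'" for z
 proof -
  have "abs (e * qxx z t) <= C * lb e be z" by (rule q_xx_le) (use that h t in auto)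
  also have "... <= C * b0" using lb_mono[OF eps(1) beta_pos, of "x - h" z] b0 that C0 by (intro mult_left_mono) auto
  finally show ?thesis .
 qed
 have "abs (dd (%x. e * q x t) x h h' - e * qxx x t) <= 2 * (2 * (C * b0))" unfolding dd_def
 proof (rule second_diff_consistency[where ?g1.0="%x. e * qx x t" and w="%x. e * qxx x t"])
  show "continuous_on {x - h..x + h'} (%x. e * q x t)"
   by (rule DERIV_continuous_on_Icc[where f'="%z. e * qx z t"]) (intro DERIV_cmult q_x t)
  fix z assume z: "z \<in> {x - h<..<x + h'}"
  show "DERIV (%x. e * q x t) z :> e * qx z t" by (intro DERIV_cmult q_x t)
  show "DERIV (%x. e * qx x t) z :> e * qxx z t" by (intro DERIV_cmult q_xx t)
  show "abs (e * qxx z t - e * qxx x t) <= 2 * (C * b0)" using *[of z] *[of x] z h by auto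
 qed (use h in auto)
 thus ?thesis using eps by (simp add: dd_cmult right_diff_distrib[symmetric] abs_mult)
qed

text \<open>If \<open>2 * h \<le> x\<close> or \<open>h^2 \<le> t\<close>, then
  \<open>t + x^2\<close> is at most \<open>5\<close> times \<open>t + z^2\<close> on the stencil,
  and the fourth derivative is used. Otherwise \<open>t + x^2 \<le> 5 * h^2\<close>, and the right
  hand side is so large that a crude bound suffices.\<close>

lemma q_uniform:
 assumes h: "0 < h" "h <= x" "x + h <= 1" and t: "t \<in> Ioc"
 shows "e * abs (dd (%x. q x t) x h h - qxx x t) <= 20 * C * (h^2 / (t + x^2))"
proof -
 have t0: "0 < t" using t by simp
 have d: "0 < t + x^2" using add_pos_nonneg[OF t0, of "x^2"] by simp
 have fine: ?thesis if K: "!!z. x - h < z ==> z < x + h ==> t + x^2 <= 5 * (t + z^2)"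
 proof -
  have "abs (e * q (x+h) t - 2 * (e * q x t) + e * q (x-h) t - h^2 * (e * qxx x t)) <= (5 * C / (t + x^2)) * h^4"
  proof (rule second_difference_error[where ?g1.0="%x. e * qx x t" and w="%x. e * qxx x t"])
   show "continuous_on {x - h..x + h} (%x. e * q x t)"
    by (rule DERIV_continuous_on_Icc[where f'="%z. e * qx z t"]) (intro DERIV_cmult q_x t)
   fix z
   show "DERIV (%x. e * q x t) z :> e * qx z t" by (intro DERIV_cmult q_x t)
   show "DERIV (%x. e * qx x t) z :> e * qxx z t" by (intro DERIV_cmult q_xx t)
  next
   fix s assume s: "0 < s" "s < h"
   have "abs (e * qxx (x - s + 2 * s) t - 2 * (e * qxx (x - s + s) t) + e * qxx (x - s) t) <= (5 * C / (t + x^2)) * s^2"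
   proof (rule second_difference_le[where ?g1.0="%x. e * q3 x t" and ?g2.0="%x. e * q4 x t"])
    show "continuous_on {x - s..x - s + 2 * s} (%x. e * qxx x t)"
     by (rule DERIV_continuous_on_Icc[where f'="%z. e * q3 z t"]) (intro DERIV_cmult q_3 t)
    fix z assume z: "x - s < z" "z < x - s + 2 * s"
    show "DERIV (%x. e * qxx x t) z :> e * q3 z t" by (intro DERIV_cmult q_3 t)
    show "DERIV (%x. e * q3 x t) z :> e * q4 z t" by (intro DERIV_cmult q_4 t)
    have dz: "0 < t + z^2" using add_pos_nonneg[OF t0, of "z^2"] by simp
    have "abs (e * q4 z t) <= C / (t + z^2)" by (rule q_4_le) (use z s h t in auto)
    also have "... <= 5 * C / (t + x^2)" by (rule divide_le_multiple[OF dz d C0 K]) (use z s in auto)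
    finally show "abs (e * q4 z t) <= 5 * C / (t + x^2)" .
   qed (use s in simp)
   moreover have "x - s + 2 * s = x + s" "x - s + s = x" by simp_all
   ultimately show "abs (e * qxx (x + s) t - 2 * (e * qxx x t) + e * qxx (x - s) t) <= (5 * C / (t + x^2)) * s^2"
    by (simp only:)
  qed fact
  moreover have "e * q (x+h) t - 2 * (e * q x t) + e * q (x-h) t - h^2 * (e * qxx x t)
   = h^2 * (e * (dd (%x. q x t) x h h - qxx x t))"
   unfolding dd_uniform[OF h(1)] using h(1) by (simp add: field_simps)
  ultimately have "h^2 * (e * abs (dd (%x. q x t) x h h - qxx x t)) <= h^2 * (5 * C / (t + x^2) * h^2)"
   using eps by (simp add: abs_mult power4_eq_xxxx power2_eq_square mult_ac)
  hence "e * abs (dd (%x. q x t) x h h - qxx x t) <= 5 * C / (t + x^2) * h^2"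
   by (rule mult_left_le_imp_le) (use h(1) in simp)
  also have "... = 5 * (C * (h^2 / (t + x^2)))" by simp
  also have "... <= 20 * (C * (h^2 / (t + x^2)))" using C0 d by (intro mult_right_mono) auto
  finally show ?thesis by simp
 qed
 show ?thesis
 proof (cases "2 * h <= x \<or> h^2 <= t")
  case True
  show ?thesis
  proof (rule fine)
   fix z assume z: "x - h < z" "z < x + h"
   show "t + x^2 <= 5 * (t + z^2)"
   proof (cases "2 * h <= x")
    case True
    hence "x <= 2 * z" using z by linarith
    hence "x^2 <= (2 * z)^2" using h by (intro power_mono) auto
    hence "x^2 <= 4 * z^2" by (simp add: power_mult_distrib)
    thus ?thesis using t0 zero_le_power2[of z] by (simp only: distrib_left; linarith)
   next
    case False
    hence "x^2 <= (2 * h)^2" using h by (intro power_mono) auto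
    hence "x^2 <= 4 * t" using True False by (simp add: power_mult_distrib)
    thus ?thesis using zero_le_power2[of z] by (simp only: distrib_left; linarith)
   qed
  qed
 next
  case False
  hence "x^2 <= (2 * h)^2" using h by (intro power_mono) auto
  hence "t + x^2 <= 5 * h^2" using False by (simp add: power_mult_distrib)
  hence 1: "1 <= 5 * (h^2 / (t + x^2))" using d by (simp add: pos_le_divide_eq)
  have "e * abs (dd (%x. q x t) x h h - qxx x t) <= 4 * C * 1"
   by (rule q_consistency[OF h(1,1,2,3) t]) (rule lb_le_1[OF eps(1) beta_pos], use h in auto)
  also have "... <= 4 * C * (5 * (h^2 / (t + x^2)))" using 1 C0 by (intro mult_left_mono) auto
  finally show ?thesis by simp
 qed
qed

lemma q_diff_le:
 assumes x: "x \<in> Icc" and k: "0 <= s" "s < t" "t <= 1"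
 shows "e * abs (q x t - q x s) <= C * il e be s * (t - s)"
proof -
 have "abs (e * q x t - e * q x s) <= (C * il e be s) * (t - s)"
 proof (rule abs_diff_le_deriv[where f'="%t. e * qt x t"])
  show "continuous_on {s..t} (%t. e * q x t)"
   by (intro continuous_on_mult_left continuous_on_subset[OF q_cont_t[OF x]]) (use k in auto)
  fix u assume u: "s < u" "u < t"
  hence u': "u \<in> Ioc" using k by auto
  show "DERIV (%t. e * q x t) u :> e * qt x u" by (intro DERIV_cmult q_t[OF u'])
  have "C * il e be u <= C * il e be s" using il_mono[OF eps(1) beta_pos, of s u] u C0 by (intro mult_left_mono) auto
  thus "abs (e * qt x u) <= C * il e be s" using q_t_le[OF x u'] by linarith
 qed (use k in auto)
 thus ?thesis using eps by (simp add: right_diff_distrib[symmetric] abs_mult)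
qed

lemma q_t_coarse:
 assumes x: "x \<in> Icc" and k: "0 < k" "k <= t" "t <= 1"
 shows "e * abs ((q x t - q x (t - k)) / k - qt x t) <= 2 * C * il e be (t - k)"
proof -
 define a where "a = il e be (t - k)"
 have "e * abs (q x t - q x (t - k)) <= C * a * k" using q_diff_le[OF x, of "t - k" t] k by (simp add: a_def)
 hence 1: "e * (abs (q x t - q x (t - k)) / k) <= C * a" using k(1) by (simp add: pos_divide_le_eq)
 have "abs (e * qt x t) <= C * il e be t" by (rule q_t_le[OF x]) (use k in auto)
 also have "... <= C * a" unfolding a_def using il_mono[OF eps(1) beta_pos, of "t - k" t] k C0 by (intro mult_left_mono) auto
 finally have 2: "e * abs (qt x t) <= C * a" using eps by (simp add: abs_mult)
 have "abs ((q x t - q x (t - k)) / k - qt x t) <= abs (q x t - q x (t - k)) / k + abs (qt x t)"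
  using abs_triangle_ineq4[of "(q x t - q x (t - k)) / k" "qt x t"] k(1) by (simp add: abs_divide)
 hence "e * abs ((q x t - q x (t - k)) / k - qt x t) <= e * (abs (q x t - q x (t - k)) / k + abs (qt x t))"
  using eps by (intro mult_left_mono) auto
 also have "... <= 2 * C * a" using 1 2 by (simp only: distrib_left mult.assoc; linarith)
 finally show ?thesis by (simp add: a_def)
qed

text \<open>The same alternative in time: for \<open>k \<le> x^2\<close> or
  \<open>2 * k \<le> t\<close> the sum \<open>t + x^2\<close> is at most doubled against earlier
  times of the step; otherwise \<open>t + x^2 \<le> 3 * k\<close> and a crude bound
  suffices.\<close>

lemma q_t_fine:
 assumes x: "x \<in> Icc" and k: "0 < k" "k <= t" "t <= 1"
 shows "e * abs ((q x t - q x (t - k)) / k - qt x t) <= 6 * C * (k / e + k / (t + x^2))"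
proof -
 have t0: "0 < t" using k by simp
 have d: "0 < t + x^2" using add_pos_nonneg[OF t0, of "x^2"] by simp
 have ke: "0 <= k / e" using k eps by simp
 show ?thesis
 proof (cases "k <= x^2 \<or> 2 * k <= t")
  case True
  define K where "K = C * (1 / e + 2 / (t + x^2))"
  have K: "0 <= K" unfolding K_def using C0 eps d by (intro mult_nonneg_nonneg add_nonneg_nonneg) auto
  have qtt: "abs (e * qtt x s) <= K" if "t - k < s" "s <= t" for s
  proof -
   have s0: "0 < s" using that k by linarith
   have ds: "0 < s + x^2" using add_pos_nonneg[OF s0, of "x^2"] by simp
   have "t + x^2 <= 2 * (s + x^2)" using True that k zero_le_power2[of x] by (simp only: distrib_left; linarith)
   hence "1 / (s + x^2) <= 2 * 1 / (t + x^2)" by (rule divide_le_multiple[OF ds d zero_le_one])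
   hence "C * (1 / e + 1 / (s + x^2)) <= K" unfolding K_def using C0 by (intro mult_left_mono) auto
   moreover have "abs (e * qtt x s) <= C * (1 / e + 1 / (s + x^2))" by (rule q_tt_le[OF x]) (use that k s0 in auto)
   ultimately show ?thesis by linarith
  qed
  have qt: "abs (e * qt x s - e * qt x t) <= K * k" if s: "t - k < s" "s < t" for s
  proof -
   have "abs (e * qt x t - e * qt x s) <= K * (t - s)"
   proof (rule abs_diff_le_deriv[where f'="%s. e * qtt x s"])
    show "continuous_on {s..t} (%s. e * qt x s)"
     by (rule DERIV_continuous_on_Icc[where f'="%s. e * qtt x s"]) (intro DERIV_cmult q_tt, use s k in auto)
    fix u assume u: "s < u" "u < t"
    show "DERIV (%s. e * qt x s) u :> e * qtt x u" by (intro DERIV_cmult q_tt) (use u s k in auto)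
    show "abs (e * qtt x u) <= K" by (rule qtt) (use u s in auto)
   qed (use s in simp)
   also have "... <= K * k" using s K by (intro mult_left_mono) auto
   finally show ?thesis by (simp add: abs_minus_commute)
  qed
  have "abs ((e * q x t - t * (e * qt x t)) - (e * q x (t - k) - (t - k) * (e * qt x t))) <= (K * k) * (t - (t - k))"
  proof (rule abs_diff_le_deriv[where f="%s. e * q x s - s * (e * qt x t)" and f'="%s. e * qt x s - e * qt x t"])
   have "continuous_on {t - k..t} (%s. q x s)" by (rule continuous_on_subset[OF q_cont_t[OF x]]) (use k in auto)
   thus "continuous_on {t - k..t} (%s. e * q x s - s * (e * qt x t))" by (intro continuous_intros)
   fix u assume u: "t - k < u" "u < t"
   have "DERIV (%s. e * q x s - s * (e * qt x t)) u :> e * qt x u - 1 * (e * qt x t)"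
    by (intro DERIV_diff DERIV_cmult DERIV_cmult_right DERIV_ident q_t) (use u k in auto)
   thus "DERIV (%s. e * q x s - s * (e * qt x t)) u :> e * qt x u - e * qt x t" by simp
   show "abs (e * qt x u - e * qt x t) <= K * k" by (rule qt[OF u])
  qed (use k in simp)
  moreover have "(e * q x t - t * (e * qt x t)) - (e * q x (t - k) - (t - k) * (e * qt x t))
   = k * (e * ((q x t - q x (t - k)) / k - qt x t))"
   using k(1) by (simp add: field_simps)
  ultimately have "k * (e * abs ((q x t - q x (t - k)) / k - qt x t)) <= k * (K * k)"
   using eps k(1) by (simp add: abs_mult mult_ac)
  hence "e * abs ((q x t - q x (t - k)) / k - qt x t) <= K * k" using k(1) by simp
  also have "... = C * (k / e) + 2 * (C * (k / (t + x^2)))" by (simp add: K_def algebra_simps)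
  also have "... <= 6 * C * (k / e + k / (t + x^2))"
  proof -
   have "0 <= C * (k / e)" "0 <= C * (k / (t + x^2))" using C0 ke d k by (auto intro!: mult_nonneg_nonneg simp del: times_divide_eq_right)
   thus ?thesis by (simp only: distrib_left mult.assoc; linarith)
  qed
  finally show ?thesis .
 next
  case False
  hence "t + x^2 <= 3 * k" by simp
  hence 1: "1 <= 3 * (k / (t + x^2))" using d by (simp add: pos_le_divide_eq)
  have "il e be (t - k) <= 1" using il_le k by simp
  hence "2 * C * il e be (t - k) <= 2 * C * (3 * (k / (t + x^2)))" using 1 C0 by (intro mult_left_mono) auto
  also have "... = 6 * C * (k / (t + x^2))" by simp
  also have "... <= 6 * C * (k / e + k / (t + x^2))" using C0 ke by (intro mult_left_mono) auto
  finally show ?thesis using q_t_coarse[OF x k] by linarith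
 qed
qed

abbreviation "y x t \<equiv> r x t + q x t"

lemma dd_y: "e * abs (dd (%x. y x t) x h h' - (rxx x t + qxx x t))
 <= e * abs (dd (%x. r x t) x h h' - rxx x t) + e * abs (dd (%x. q x t) x h h' - qxx x t)"
proof -
 have "abs (dd (%x. y x t) x h h' - (rxx x t + qxx x t)) <= abs (dd (%x. r x t) x h h' - rxx x t) + abs (dd (%x. q x t) x h h' - qxx x t)"
  unfolding dd_add by linarith
 thus ?thesis using eps by (simp add: distrib_left[symmetric])
qed

lemma Dt_y: "e * abs ((y x t - y x (t - k)) / k - (rt x t + qt x t))
 <= e * abs ((r x t - r x (t - k)) / k - rt x t) + e * abs ((q x t - q x (t - k)) / k - qt x t)"
proof -
 have "(y x t - y x (t - k)) / k = (r x t - r x (t - k)) / k + (q x t - q x (t - k)) / k"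
  by (simp add: add_divide_distrib[symmetric])
 hence "abs ((y x t - y x (t - k)) / k - (rt x t + qt x t)) <= abs ((r x t - r x (t - k)) / k - rt x t) + abs ((q x t - q x (t - k)) / k - qt x t)"
  by linarith
 thus ?thesis using eps by (simp add: distrib_left[symmetric])
qed

lemma r_itp_fine:
 assumes a: "0 <= a" "a < c" "c <= 1" "x \<in> {a..c}" and t: "t \<in> Ioc"
  and B: "!!z. a <= z ==> z <= c ==> bl e be z <= b0"
 shows "abs (r x t - itp (%x. r x t) a c x) <= C * (1 + b0 / e) * (c - a)^2"
 unfolding itp_def
proof (rule linear_interpolation_error[where ?g1.0="%x. rx x t" and w="%x. rxx x t"])
 show "continuous_on {a..c} (%x. r x t)" by (rule continuous_on_subset[OF r_cont[OF t]]) (use a in auto)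
 fix z assume "a < z" "z < c"
 hence z: "z \<in> Ioo" "a <= z" "z <= c" using a by auto
 show "DERIV (%x. r x t) z :> rx z t" by (rule r_x[OF z(1) t])
 show "DERIV (%x. rx x t) z :> rxx z t" by (rule r_xx[OF z(1) t])
 have "abs (e * rxx z t) <= C * (bl e be z + e)" by (rule xreg_bound[OF r_xreg[OF t] z(1)])
 also have "... <= C * (b0 + e)" using C0 B[OF z(2,3)] by (intro mult_left_mono) auto
 finally have "abs (rxx z t) * e <= C * (b0 + e)" using eps by (simp add: abs_mult mult.commute)
 hence "abs (rxx z t) <= C * (b0 + e) / e" using eps by (simp add: pos_le_divide_eq)
 also have "... = C * (1 + b0 / e)" using eps by (simp add: field_simps)
 finally show "abs (rxx z t) <= C * (1 + b0 / e)" .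
qed (use a in auto)

lemma q_itp_fine:
 assumes a: "0 <= a" "a < c" "c <= 1" "x \<in> {a..c}" and t: "t \<in> Ioc"
 shows "abs (q x t - itp (%x. q x t) a c x) <= C / e * (c - a)^2"
 unfolding itp_def
proof (rule linear_interpolation_error[where ?g1.0="%x. qx x t" and w="%x. qxx x t"])
 show "continuous_on {a..c} (%x. q x t)" by (rule DERIV_continuous_on_Icc[OF q_x[OF t]])
 fix z assume "a < z" "z < c"
 hence z: "z \<in> Icc" using a by auto
 show "DERIV (%x. q x t) z :> qx z t" by (rule q_x[OF t])
 show "DERIV (%x. qx x t) z :> qxx z t" by (rule q_xx[OF t])
 have "abs (e * qxx z t) <= C * lb e be z" by (rule q_xx_le[OF z t])
 also have "... <= C * 1" using C0 lb_le_1[OF eps(1) beta_pos] z by (intro mult_left_mono) auto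
 finally have "abs (qxx z t) * e <= C" using eps by (simp add: abs_mult mult.commute)
 thus "abs (qxx z t) <= C / e" using eps by (simp add: pos_le_divide_eq)
qed (use a in auto)

lemma init_itp:
 assumes a: "0 <= a" "a < c" "c <= 1" "x \<in> {a..c}"
 shows "abs (y x 0 - itp (%x. y x 0) a c x) <= C * (c - a)^2"
proof -
 have "abs (g0 x - itp g0 a c x) <= C * (c - a)^2" unfolding itp_def
  by (rule linear_interpolation_error[where ?g1.0=g1 and w=g2])
   (use a in \<open>auto intro!: continuous_on_subset[OF init_cont] init_x init_xx init_le\<close>)
 moreover have "y x 0 = g0 x" "y a 0 = g0 a" "y c 0 = g0 c" using init a by auto
 ultimately show ?thesis by (simp add: itp_def)
qed

lemma itp_y: "abs (y x t - itp (%x. y x t) a c x) <= abs (r x t - itp (%x. r x t) a c x) + abs (q x t - itp (%x. q x t) a c x)"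
 unfolding itp_add by linarith

lemma y_itp_fine:
 assumes a: "0 <= a" "a < c" "c <= 1" "x \<in> {a..c}" and t: "t \<in> Icc"
 shows "abs (y x t - itp (%x. y x t) a c x) <= 4 * C * ((c - a)^2 / e)"
proof -
 have inv: "1 <= 1 / e" using eps by simp
 define D where "D = C * (c - a)^2"
 have D: "0 <= D" "D <= D / e" using C0 mult_left_mono[OF inv, of D] by (auto simp: D_def)
 show ?thesis
 proof (cases "t = 0")
  case True
  thus ?thesis using init_itp[OF a] D by (simp add: D_def)
 next
  case False
  hence t': "t \<in> Ioc" using t by auto
  have "abs (r x t - itp (%x. r x t) a c x) <= C * (1 + 2 / e) * (c - a)^2"
   by (rule r_itp_fine[OF a t']) (use a bl_le in auto)
  also have "... = D + 2 * (D / e)" by (simp add: D_def algebra_simps)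
  finally show ?thesis using itp_y[of x t a c] q_itp_fine[OF a t'] D by (simp add: D_def)
 qed
qed

text \<open>\<open>q\<close> itself is of order \<open>b0\<close>. For \<open>r\<close> the second
  derivative is used on cells with \<open>(c - a)^2 \<le> e\<close>; on wider cells \<open>V\<close>
  is split off, whose second derivative is bounded, while \<open>r - V\<close> is of order
  \<open>b0 + e\<close> and thus small enough without cancellation.\<close>

lemma y_itp_coarse:
 assumes a: "0 <= a" "a < c" "c <= 1" "x \<in> {a..c}" and t: "t \<in> Icc"
  and B: "!!z. a <= z ==> z <= c ==> bl e be z <= b0"
 shows "abs (y x t - itp (%x. y x t) a c x) <= 5 * C * ((c - a)^2 + b0)"
proof -
 have b0: "0 <= b0" using B[of a] bl0[of a] a by linarith
 define m where "m = (c - a)^2"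
 have m: "0 <= m" by (simp add: m_def)
 have Cm: "0 <= C * m" "0 <= C * b0" using C0 m b0 by auto
 show ?thesis
 proof (cases "t = 0")
  case True
  have "C * m <= 5 * C * (m + b0)" using Cm by (simp only: distrib_left mult.assoc; linarith)
  thus ?thesis using True init_itp[OF a] unfolding m_def by simp
 next
  case False
  hence t': "t \<in> Ioc" using t by auto
  have abs2: "abs (g x - itp g a c x) <= 2 * M" if "!!z. z \<in> {a..c} ==> abs (g z) <= M" for g M
   using itp_abs_le[of a c x g M] that[of x] that[of a] that[of c] a by fastforce
  have q: "abs (q x t - itp (%x. q x t) a c x) <= 2 * (C * b0)"
  proof (rule abs2)
   fix z assume z: "z \<in> {a..c}"
   have "abs (q z t) <= C * lb e be z" by (rule q_le) (use z a t' in auto)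
   also have "... <= C * b0" using lb_bl[of e be z] B[of z] z C0 by (intro mult_left_mono) auto
   finally show "abs (q z t) <= C * b0" .
  qed
  have r: "abs (r x t - itp (%x. r x t) a c x) <= C * m + 2 * (C * (b0 + m))"
  proof (cases "m <= e")
   case True
   have "b0 * m / e <= b0 * e / e" using b0 True eps by (intro divide_right_mono mult_left_mono) auto
   hence "C * (m + b0 * m / e) <= C * (m + b0)" using C0 eps by (intro mult_left_mono) auto
   moreover have "C * (1 + b0 / e) * m = C * (m + b0 * m / e)" by (simp add: algebra_simps)
   ultimately show ?thesis using r_itp_fine[OF a t' B] Cm unfolding m_def[symmetric] by (simp add: distrib_left)
  next
   case False
   have 1: "abs (V x t - itp (%x. V x t) a c x) <= C * m" unfolding itp_def m_def
   proof (rule linear_interpolation_error[where ?g1.0="%x. Vx x t" and w="%x. Vxx x t"])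
    show "continuous_on {a..c} (%x. V x t)" by (rule continuous_on_subset[OF V_cont[OF t']]) (use a in auto)
    fix z assume "a < z" "z < c"
    hence z: "z \<in> Ioo" using a by auto
    show "DERIV (%x. V x t) z :> Vx z t" "DERIV (%x. Vx x t) z :> Vxx z t" "abs (Vxx z t) <= C"
     by (rule V_x[OF z t'] V_xx[OF z t'] V_xx_le[OF z t'])+
   qed (use a in auto)
   have 2: "abs ((r x t - V x t) - itp (%x. r x t - V x t) a c x) <= 2 * (C * (b0 + m))"
   proof (rule abs2)
    fix z assume z: "z \<in> {a..c}"
    have "abs (r z t - V z t) <= C * (bl e be z + e)" by (rule r_V) (use z a t' in auto)
    also have "... <= C * (b0 + m)" using B[of z] z C0 False by (intro mult_left_mono add_mono) auto
    finally show "abs (r z t - V z t) <= C * (b0 + m)" .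
   qed
   have "itp (%x. r x t) a c x = itp (%x. V x t) a c x + itp (%x. r x t - V x t) a c x"
    using itp_add[of "%x. V x t" "%x. r x t - V x t" a c x] by simp
   thus ?thesis using 1 2 by linarith
  qed
  show ?thesis using itp_y[of x t a c] q r Cm unfolding m_def[symmetric] by (simp only: distrib_left mult.assoc; linarith)
 qed
qed

lemma y_t_diff:
 assumes x: "x \<in> Icc" and k: "0 <= s" "s < t" "t <= 1"
 shows "abs (y x t - y x s) <= 3 * C * ((t - s) + min 1 ((t - s) / e) * il e be s)"
proof -
 define a where "a = il e be s"
 have a: "0 < a" by (simp add: a_def il_pos)
 define m where "m = min 1 ((t - s) / e)"
 have q: "abs (q x t - q x s) <= 2 * (C * (m * a))"
 proof (cases "(t - s) / e <= 1")
  case True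
  have "abs (q x t - q x s) <= C * a * (t - s) / e" using q_diff_le[OF x k] eps by (simp add: a_def pos_le_divide_eq mult.commute)
  also have "... = C * (m * a)" using True by (simp add: m_def min_def)
  finally show ?thesis using C0 by simp
 next
  case False
  have "abs (q x t) <= C * il e be t" "abs (q x s) <= C * a" unfolding a_def by (rule q_le'; use x k in auto)+
  moreover have "C * il e be t <= C * a" unfolding a_def using il_mono[OF eps(1) beta_pos, of s t] k C0 by (intro mult_left_mono) auto
  ultimately have "abs (q x t - q x s) <= 2 * (C * a)" by linarith
  thus ?thesis using False by (simp add: m_def min_def)
 qed
 have nn: "0 <= C * (t - s)" "0 <= C * (m * a)" using C0 k a eps by (auto simp: m_def)
 have "abs (r x t - r x s) <= C * (t - s) + C * (m * a)" using r_diff[OF x k] by (simp add: a_def m_def distrib_left)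
 hence "abs (y x t - y x s) <= 3 * C * ((t - s) + m * a)" using q nn by (simp only: distrib_left mult.assoc; linarith)
 thus ?thesis by (simp add: a_def m_def)
qed

theorem mesh_estimates: "mesh_estimates e be (30 * exp (sqrt be) * C) (%x t. r x t + q x t) (%x t. rxx x t + qxx x t) (%x t. rt x t + qt x t)"
proof -
 have ee: "1 <= exp (sqrt be)" using beta_pos by simp
 define E where "E = exp (sqrt be) * C"
 have E: "C <= E" "0 <= E" using mult_right_mono[OF ee C0] C0 by (simp_all add: E_def)
 have up: "a * C * s <= 30 * exp (sqrt be) * C * s" if "0 <= s" "a <= 30" "0 <= a" for a s
 proof -
  have "a * C <= 30 * E" using that E C0 by (intro mult_mono) auto
  hence "a * C * s <= 30 * E * s" using that(1) by (rule mult_right_mono)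
  thus ?thesis by (simp add: E_def mult_ac)
 qed
 have inv: "1 <= 1 / e" using eps by simp
 have fine: "e * abs (dd (%x. r x t) x h h - rxx x t) <= 3 * (C * (h^2 / e))"
  if h: "0 < h" "h <= x" "x + h <= 1" and t: "t \<in> Ioc" for x h t
 proof -
  have "e * abs (dd (%x. r x t) x h h - rxx x t) <= C * (h^2 + 2 * h^2 / e)"
   by (rule r_uniform[OF h t]) (use h bl_le in auto)
  also have "... <= C * (3 * (h^2 / e))" using mult_left_mono[OF inv, of "h^2"] C0 by (intro mult_left_mono) auto
  also have "... = 3 * (C * (h^2 / e))" by (rule mult.left_commute)
  finally show ?thesis .
 qed
 show ?thesis
 proof
  fix h x t :: real assume h: "0 < h" "h <= x" "x + h <= 1" and t: "t \<in> {0<..1::real}"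
  have d: "0 < t + x^2" using t add_pos_nonneg[of t "x^2"] by auto
  have nn: "0 <= C * (h^2 / e)" "0 <= h^2 / e + h^2 / (t + x^2)" "0 <= C * (h^2 / (t + x^2))" using C0 eps d by auto
  have "e * abs (dd (%x. y x t) x h h - (rxx x t + qxx x t)) <= 20 * C * (h^2 / e + h^2 / (t + x^2))"
   using dd_y[of t x h h] fine[OF h t] q_uniform[OF h t] nn by (simp only: distrib_left mult.assoc; linarith)
  thus "e * abs (dd (%x. y x t) x h h - (rxx x t + qxx x t)) <= 30 * exp (sqrt be) * C * (h^2 / e + h^2 / (t + x^2))"
   using up[OF nn(2), of 20] by linarith
 next
  fix h x t b0 :: real assume h: "0 < h" "h <= x" "x + h <= 1" and t: "t \<in> {0<..1::real}" and b: "lb e be (x - h) <= b0"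
  have b0: "0 <= b0" using b lb_pos[of e be "x - h"] by linarith
  have nn: "0 <= C * (h^2 / e)" "0 <= h^2 / e + b0" "0 <= C * b0" using C0 eps b0 by auto
  have "e * abs (dd (%x. y x t) x h h - (rxx x t + qxx x t)) <= 4 * C * (h^2 / e + b0)"
   using dd_y[of t x h h] fine[OF h t] q_consistency[OF h(1,1,2,3) t b] nn by (simp only: distrib_left mult.assoc; linarith)
  thus "e * abs (dd (%x. y x t) x h h - (rxx x t + qxx x t)) <= 30 * exp (sqrt be) * C * (h^2 / e + b0)"
   using up[OF nn(2), of 4] by linarith
 next
  fix h x t b0 :: real assume h: "0 < h" "h <= x" "x + h <= 1" and t: "t \<in> {0<..1::real}"
   and B: "!!z. x - h <= z ==> z <= x + h ==> bl e be z <= b0"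
  have b: "lb e be (x - h) <= b0" using lb_bl[of e be "x - h"] B[of "x - h"] h by linarith
  have b0: "0 <= b0" using b lb_pos[of e be "x - h"] by linarith
  have nn: "0 <= C * h^2" "0 <= h^2 + b0" "0 <= C * b0" using C0 eps b0 by auto
  have rr: "e * abs (dd (%x. r x t) x h h - rxx x t) <= 4 * C * (h^2 + b0)" by (rule r_coarse[OF h t B])
  have "e * abs (dd (%x. y x t) x h h - (rxx x t + qxx x t)) <= 8 * C * (h^2 + b0)"
   using dd_y[of t x h h] rr q_consistency[OF h(1,1,2,3) t b] nn by (simp only: distrib_left mult.assoc; linarith)
  thus "e * abs (dd (%x. y x t) x h h - (rxx x t + qxx x t)) <= 30 * exp (sqrt be) * C * (h^2 + b0)"
   using up[OF nn(2), of 8] by linarith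
 next
  fix h h' m x t b0 :: real assume h: "0 < h" "0 < h'" "h <= m" "h' <= m" "h <= x" "x + h' <= 1" and t: "t \<in> {0<..1::real}"
   and B: "!!z. x - h <= z ==> z <= x + h' ==> bl e be z <= b0"
  have b: "lb e be (x - h) <= b0" using lb_bl[of e be "x - h"] B[of "x - h"] h by linarith
  have b0: "0 <= b0" using b lb_pos[of e be "x - h"] by linarith
  have m: "0 <= sqrt e * m" using eps h by auto
  have nn: "0 <= E * (sqrt e * m)" "0 <= sqrt e * m + b0" "C * b0 <= E * b0" "0 <= E * b0"
   using E b0 m by (auto intro: mult_right_mono)
  have r: "18 * exp (sqrt be) * C * (sqrt e * m + b0) = 18 * (E * (sqrt e * m)) + 18 * (E * b0)"
   by (simp add: E_def algebra_simps)
  have rr: "e * abs (dd (%x. r x t) x h h' - rxx x t) <= 18 * exp (sqrt be) * C * (sqrt e * m + b0)"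
   by (rule r_transition[OF h t B])
  have "e * abs (dd (%x. y x t) x h h' - (rxx x t + qxx x t)) <= 30 * (E * (sqrt e * m)) + 30 * (E * b0)"
   using dd_y[of t x h h'] rr q_consistency[OF h(1,2,5,6) t b] nn unfolding r
   by (simp only: mult.assoc; linarith)
  also have "... = 30 * exp (sqrt be) * C * (sqrt e * m + b0)" by (simp add: E_def algebra_simps)
  finally show "e * abs (dd (%x. y x t) x h h' - (rxx x t + qxx x t)) <= 30 * exp (sqrt be) * C * (sqrt e * m + b0)" .
 next
  fix x k t :: real assume x: "x \<in> {0<..<1::real}" and k: "0 < k" "k <= t" "t <= 1"
  have x': "x \<in> Icc" using x by auto
  have d: "0 < t + x^2" using k add_pos_nonneg[of t "x^2"] by auto
  have il: "il e be (t - k) <= 1" using il_le k by simp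
  have ke: "k <= k / e" using mult_left_mono[OF inv, of k] k by simp
  { have "e * k + k / e * il e be (t - k) <= 1 * k + k / e * 1"
    using eps k il by (intro add_mono mult_right_mono mult_left_mono) auto
   hence "C * (e * k + k / e * il e be (t - k)) <= C * (2 * (k / e))" using ke C0 by (intro mult_left_mono) auto
   also have "C * (2 * (k / e)) = 2 * (C * (k / e))" by (rule mult.left_commute)
   finally have r: "e * abs ((r x t - r x (t - k)) / k - rt x t) <= 2 * (C * (k / e))" using r_t_fine[OF x k] by linarith
   have nn: "0 <= C * (k / e)" "0 <= k / e + k / (t + x^2)" "0 <= C * (k / (t + x^2))" using C0 eps d k by auto
   have "e * abs ((y x t - y x (t - k)) / k - (rt x t + qt x t)) <= 8 * C * (k / e + k / (t + x^2))"
    using Dt_y[of x t k] r q_t_fine[OF x' k] nn by (simp only: distrib_left mult.assoc; linarith)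
   thus "e * abs ((y x t - y x (t - k)) / k - (rt x t + qt x t)) <= 30 * exp (sqrt be) * C * (k / e + k / (t + x^2))"
    using up[OF nn(2), of 8] by linarith }
  { have nn: "0 <= C * k" "0 <= k + il e be (t - k)" "0 <= C * il e be (t - k)" using C0 k il_pos[of e be "t - k"] by auto
   have "e * abs ((y x t - y x (t - k)) / k - (rt x t + qt x t)) <= 4 * C * (k + il e be (t - k))"
    using Dt_y[of x t k] r_t_coarse[OF x k] q_t_coarse[OF x' k] nn by (simp only: distrib_left mult.assoc; linarith)
   thus "e * abs ((y x t - y x (t - k)) / k - (rt x t + qt x t)) <= 30 * exp (sqrt be) * C * (k + il e be (t - k))"
    using up[OF nn(2), of 4] by linarith }
 next
  fix a c x t :: real assume a: "0 <= a" "a < c" "c <= 1" "x \<in> {a..c}" and t: "t \<in> {0..1::real}"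
  have nn: "0 <= (c - a)^2 / e" using eps by simp
  show "abs (y x t - itp (%x. y x t) a c x) <= 30 * exp (sqrt be) * C * ((c - a)^2 / e)"
   using y_itp_fine[OF a t] up[OF nn, of 4] by linarith
 next
  fix a c x t b0 :: real assume a: "0 <= a" "a < c" "c <= 1" "x \<in> {a..c}" and t: "t \<in> {0..1::real}"
   and B: "!!z. a <= z ==> z <= c ==> bl e be z <= b0"
  have b0: "0 <= b0" using B[of a] bl0[of a] a by linarith
  have nn: "0 <= (c - a)^2 + b0" using b0 by simp
  show "abs (y x t - itp (%x. y x t) a c x) <= 30 * exp (sqrt be) * C * ((c - a)^2 + b0)"
   by (rule order_trans[OF y_itp_coarse[OF a t B] up[OF nn]]) simp_all
 next
  fix x s t :: real assume x: "x \<in> {0..1::real}" and k: "0 <= s" "s < t" "t <= (1::real)"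
  have nn: "0 <= (t - s) + min 1 ((t - s) / e) * il e be s" using k eps il_pos[of e be s] by auto
  show "abs (y x t - y x s) <= 30 * exp (sqrt be) * C * ((t - s) + min 1 ((t - s) / e) * il e be s)"
   using y_t_diff[OF x k] up[OF nn, of 3] by linarith
 qed
qed

end

text \<open>Completing the square: \<open>be * t / e + x^2 / (4 * t)\<close> is at least
  \<open>sqrt (be / e) * x\<close>. So decay in time and the Gaussian in space combine into a
  boundary layer function.\<close>

lemma il_gs_le_lb:
 assumes "0 < e" "0 < be" "0 < t" "0 <= x"
 shows "il e be t * gs x t <= lb e be x"
proof -
 define u where "u = sqrt (be / e)"
 define w where "w = sqrt t"
 have u: "be * t / e = (u * w)^2" using assms by (simp add: u_def w_def power_mult_distrib)
 have w: "x^2 / (4 * t) = (x / (2 * w))^2" using assms by (simp add: w_def power_divide power_mult_distrib)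
 have "0 <= (u * w - x / (2 * w))^2" by simp
 also have "... = (u * w)^2 + (x / (2 * w))^2 - 2 * ((u * w) * (x / (2 * w)))" by (simp add: power2_diff)
 also have "2 * ((u * w) * (x / (2 * w))) = u * x" using assms by (simp add: w_def)
 finally have "u * x <= (u * w)^2 + (x / (2 * w))^2" by simp
 thus ?thesis unfolding il_def gs_def lb_def u w u_def[symmetric] exp_add[symmetric] by simp
qed

lemma backward_taylor:
 fixes g :: "real => real"
 assumes g: "!!s. t - k <= s ==> s <= t ==> DERIV g s :> g1 s"
  "!!s. t - k <= s ==> s <= t ==> DERIV g1 s :> g2 s"
  "!!s. t - k <= s ==> s <= t ==> abs (g2 s) <= K" and k: "0 < k"
 shows "abs (g t - g (t - k) - k * g1 t) <= K * k^2"
proof -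
 have K: "0 <= K" using g(3)[of t] k by simp
 have 1: "abs (g1 s - g1 t) <= K * k" if "t - k < s" "s < t" for s
 proof -
  have "abs (g1 t - g1 s) <= K * (t - s)"
   by (rule abs_diff_le_deriv[where f'=g2, OF _ DERIV_continuous_on_Icc[where f'=g2]]) (use that g in auto)
  also have "... <= K * k" using that K by (intro mult_left_mono) auto
  finally show ?thesis by (simp add: abs_minus_commute)
 qed
 have "abs ((g t - t * g1 t) - (g (t - k) - (t - k) * g1 t)) <= (K * k) * (t - (t - k))"
 proof (rule abs_diff_le_deriv[where f="%s. g s - s * g1 t" and f'="%s. g1 s - g1 t"])
  have d: "DERIV (%s. g s - s * g1 t) u :> g1 u - g1 t" if "t - k <= u" "u <= t" for u
   using DERIV_diff[OF g(1)[OF that] DERIV_cmult_right[OF DERIV_ident, of "g1 t"]] by simp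
  thus "continuous_on {t - k..t} (%s. g s - s * g1 t)" by (intro DERIV_continuous_on_Icc[OF d]) auto
  fix u assume u: "t - k < u" "u < t"
  show "DERIV (%s. g s - s * g1 t) u :> g1 u - g1 t" by (rule d) (use u in auto)
  show "abs (g1 u - g1 t) <= K * k" by (rule 1[OF u])
 qed (use k in simp)
 thus ?thesis by (simp add: algebra_simps power2_eq_square)
qed

lemma continuous_on_slices:
 assumes "continuous_on (Icc \<times> Icc) (%(x,t). g x t)"
 shows "t \<in> Icc ==> continuous_on {0..1::real} (%x. g x t)"
  "x \<in> Icc ==> continuous_on {0..1::real} (%t. g x t)"
proof -
 assume "t \<in> Icc"
 hence "continuous_on {0..1::real} (%x. case (x, t) of (x,t) => g x t)"
  by (intro continuous_on_compose2[OF assms]) (auto intro!: continuous_intros)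
 thus "continuous_on {0..1::real} (%x. g x t)" by simp
next
 assume "x \<in> Icc"
 hence "continuous_on {0..1::real} (%t. case (x, t) of (x,t) => g x t)"
  by (intro continuous_on_compose2[OF assms]) (auto intro!: continuous_intros)
 thus "continuous_on {0..1::real} (%t. g x t)" by simp
qed

lemma xreg_mono:
 assumes "xreg e be C w" "C <= C'" "0 < e"
 shows "xreg e be C' w"
proof -
 have m: "C * (bl e be x + e) <= C' * (bl e be x + e)" "C * (1 + bl e be x / e) <= C' * (1 + bl e be x / e)" for x
  using assms(2,3) bl_pos[of e be x] by (auto intro!: mult_right_mono add_nonneg_nonneg)
 from assms(1) obtain u u1 u2 where u: "!!x. x \<in> Ioo ==> (%n::nat. u n x) \<longlonglongrightarrow> w x \<and>
  (\<forall>n::nat. DERIV (u n) x :> u1 n x \<and> DERIV (u1 n) x :> u2 n x \<and>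
   (abs (u n x)) <= C * (bl e be x + e) \<and> (abs (u2 n x)) <= C * (1 + bl e be x / e))"
  unfolding xreg_def by blast
 show ?thesis unfolding xreg_def
 proof (rule exI[of _ u], rule exI[of _ u1], rule exI[of _ u2], intro ballI conjI allI)
  fix x :: real and n assume x: "x \<in> Ioo"
  note ux = u[OF x, THEN conjunct1] u[OF x, THEN conjunct2, rule_format, of n]
  show "(%n. u n x) \<longlonglongrightarrow> w x" by (rule ux(1))
  show "DERIV (u n) x :> u1 n x" "DERIV (u1 n) x :> u2 n x" using ux(2) by auto
  show "abs (u n x) <= C' * (bl e be x + e)" "abs (u2 n x) <= C' * (1 + bl e be x / e)"
   using ux(2) m[of x] by linarith+
 qed
qed

context problem_data
begin

definition "qq e x t = J e * (ew e t * hZ x t)"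
definition "qqx e x t = J e * (ew e t * hZx x t)"
definition "qqxx e x t = J e * (ew e t * hE x t)"
definition "qq3 e x t = J e * (ew e t * hEx x t)"
definition "qq4 e x t = J e * (ew e t * hEt x t)"
definition "qqt e x t = J e * (- (b 0 0 / e) * ew e t * hZ x t + hE x t * ew e t)"
definition "qqtt e x t = J e * ((- (b 0 0 / e) * (- (b 0 0 / e) * ew e t * hZ x t + hE x t * ew e t))
 + (hEt x t * ew e t + (- (b 0 0 / e) * ew e t) * hE x t))"

lemma qq_x:
 assumes "0 < t"
 shows "DERIV (%s. qq e s t) x :> qqx e x t" "DERIV (%s. qqx e s t) x :> qqxx e x t"
  "DERIV (%s. qqxx e s t) x :> qq3 e x t" "DERIV (%s. qq3 e s t) x :> qq4 e x t"
 unfolding qq_def qqx_def qqxx_def qq3_def qq4_def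
 by (intro DERIV_cmult hE_x hEx_x hZ_x hZx_x assms)+

lemma qq_t:
 assumes t: "0 < t" and e: "e ~= 0"
 shows "DERIV (%s. qq e x s) t :> qqt e x t" "DERIV (%s. qqt e x s) t :> qqtt e x t"
proof -
 have 1: "DERIV (%s. ew e s * hZ x s) t :> - (b 0 0 / e) * ew e t * hZ x t + hE x t * ew e t"
  by (rule DERIV_mult[OF ew_t[OF e] hZ_t[OF t]])
 show "DERIV (%s. qq e x s) t :> qqt e x t" unfolding qq_def qqt_def by (rule DERIV_cmult[OF 1])
 have "((%s. (- (b 0 0 / e)) * (ew e s * hZ x s) + hE x s * ew e s) has_real_derivative
  (- (b 0 0 / e) * (- (b 0 0 / e) * ew e t * hZ x t + hE x t * ew e t))
 + (hEt x t * ew e t + (- (b 0 0 / e) * ew e t) * hE x t)) (at t)"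
  by (rule DERIV_add[OF DERIV_cmult[OF 1] DERIV_mult[OF hE_t[OF t] ew_t[OF e]]])
 from DERIV_cmult[OF this, of "J e"] show "DERIV (%s. qqt e x s) t :> qqtt e x t"
  unfolding qqt_def qqtt_def by (simp only: mult.assoc)
qed

lemma qq_cont_t:
 assumes "x \<in> Icc" "e ~= 0" shows "continuous_on Icc (%t. qq e x t)"
proof -
 have "continuous_on (Icc \<times> Icc) (%(x,t). hZ x t)" by (rule continuous_on_subset[OF hZ_continuous]) auto
 hence "continuous_on Icc (%t. hZ x t)" by (rule continuous_on_slices(2)[OF _ assms(1)])
 thus ?thesis unfolding qq_def ew_def using assms(2) by (intro continuous_intros) auto
qed

lemma ew_le_1: "0 < e ==> 0 <= t ==> ew e t <= 1" "0 < ew e t"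
 using b_pos[of 0 0] by (auto simp: ew_def)

lemma hZ_bnd [bnd_intros]: "bnd (%e x t. hZ x t / t)" "bnd (%e x t. hE x t)"
proof -
 show "bnd (%e x t. hZ x t / t)"
 proof (rule bndI[of _ 1000000])
  fix x t :: real assume "0 <= x" "0 < t"
  thus "abs (hZ x t / t) <= 1000000" using hZ_abs_le'[of x t] by (simp add: pos_divide_le_eq)
 qed
 show "bnd (%e x t. hE x t)"
 proof (rule bndI[of _ 3])
  fix x t :: real assume a: "0 <= x" "0 < t"
  have "gs x t <= 1" using a by (simp add: gs_def)
  thus "abs (hE x t) <= 3" using hE_le_gs[OF a(2,1)] hE_nonneg[of t x] a by simp
 qed
qed

lemma corner_lay:
 "lay (%e x t. qq e x t)" "lay (%e x t. e * qqt e x t)"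
 "lay (%e x t. (J e * e) * (b 0 0 * (b 0 0 * ((hZ x t / t) * ((t / e) * ew e t)) - 2 * (hE x t * ew e t))))"
proof -
 have "lay (%e x t. (J e * e) * ((hZ x t / t) * ((t / e) * ew e t)))" by (intro lay_intros bnd_intros)
 thus "lay (%e x t. qq e x t)" by (rule lay_cong) (simp add: qq_def)
 have "lay (%e x t. (J e * e) * (hE x t * ew e t - b 0 0 * ((hZ x t / t) * ((t / e) * ew e t))))" by (intro lay_intros bnd_intros)
 thus "lay (%e x t. e * qqt e x t)" by (rule lay_cong) (simp add: qqt_def field_simps)
 show "lay (%e x t. (J e * e) * (b 0 0 * (b 0 0 * ((hZ x t / t) * ((t / e) * ew e t)) - 2 * (hE x t * ew e t))))"
  by (intro lay_intros bnd_intros)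
qed

text \<open>\<open>J e\<close> is of order \<open>1 / e\<close>. In \<open>qq\<close> this is
  compensated by \<open>hZ x t \<le> t * hE x t\<close>, the resulting \<open>t / e\<close> being
  absorbed by the exponential; the derivatives are weighted with \<open>e\<close>.\<close>

lemma corner_bounds:
 "\<exists>C\<ge>1. unif (%e x t. abs (qq e x t) <= C * lb e be x \<and> (abs (qq e x t)) <= C * il e be t \<and> (abs (e * qqxx e x t)) <= C * lb e be x \<and>
  (abs (e * qq4 e x t)) <= C / (t + x^2) \<and> (abs (e * qqt e x t)) <= C * il e be t \<and>
  (abs (e * qqtt e x t)) <= C * (1 / e + 1 / (t + x^2)))"
proof -
 obtain Cj where Cj: "1 <= Cj" "unif (%e x t. abs (J e * e) <= Cj)"
  using bndD[OF J_bnd] by blast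
 obtain C1 where C1: "1 <= C1" "unif (%e x t. abs ((t / e) * ew e t) <= C1 * il e be t)"
  using layD[OF lay_s[OF lay_ew]] by blast
 obtain C2 where C2: "1 <= C2" "unif (%e x t. abs (qq e x t) <= C2 * il e be t)"
  using layD[OF corner_lay(1)] by blast
 obtain C3 where C3: "1 <= C3" "unif (%e x t. abs (e * qqt e x t) <= C3 * il e be t)"
  using layD[OF corner_lay(2)] by blast
 obtain C4 where C4: "1 <= C4" "unif (%e x t. abs ((J e * e) * (b 0 0 * (b 0 0 * ((hZ x t / t) * ((t / e) * ew e t)) - 2 * (hE x t * ew e t)))) <= C4)"
  using bndD[OF lay_bnd[OF corner_lay(3)]] by blast
 obtain C5 where C5: "1 <= C5" "unif (%e x t. abs (ew e t) <= C5 * il e be t)"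
  using layD[OF lay_ew] by blast
 define C where "C = 3 * (Cj * (C1 + C5)) + C2 + C3 + C4 + 1000000 * Cj"
 have pos: "0 <= Cj * C1" "0 <= Cj * C5" using Cj(1) C1(1) C5(1) by auto
 have CC: "1 <= C" "3 * (Cj * C1) <= C" "3 * (Cj * C5) <= C" "C2 <= C" "C3 <= C" "C4 <= C" "1000000 * Cj <= C"
  using pos Cj(1) C2(1) C3(1) C4(1) unfolding C_def distrib_left by simp_all
 show ?thesis
 proof (intro exI[of _ C] conjI allI impI CC(1))
  fix e x t :: real assume a: "0 < e" "e <= 1" "0 <= x" "x <= 1" "0 < t" "t <= 1"
  have d: "0 < t + x^2" using a add_pos_nonneg[of t "x^2"] by auto
  have j: "abs (J e * e) <= Cj" by (rule Cj(2)[rule_format, OF a])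
  have E: "0 <= hE x t" "hE x t <= 3 * gs x t" using hE_nonneg[OF a(5)] hE_le_gs[OF a(5,3)] by auto
  have glb: "il e be t * gs x t <= lb e be x" by (rule il_gs_le_lb[OF a(1) beta_pos a(5,3)])
  have key: "abs (J e * e) * (w * hE x t) <= C * lb e be x" if w: "abs w <= C' * il e be t" "3 * (Cj * C') <= C" "1 <= C'" for w C'
  proof -
   have "w * hE x t <= (C' * il e be t) * (3 * gs x t)"
    using w E il_pos[of e be t] by (intro mult_mono) auto
   also have "... = 3 * C' * (il e be t * gs x t)" by simp
   also have "... <= 3 * C' * lb e be x" using glb w(3) by (intro mult_left_mono) auto
   finally have "abs (J e * e) * (w * hE x t) <= abs (J e * e) * (3 * C' * lb e be x)" by (rule mult_left_mono) simp
   also have "... <= Cj * (3 * C' * lb e be x)" using j w(3) lb_pos[of e be x] by (intro mult_right_mono) auto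
   also have "... = (3 * (Cj * C')) * lb e be x" by simp
   also have "... <= C * lb e be x" using w(2) lb_pos[of e be x] by (intro mult_right_mono) auto
   finally show ?thesis .
  qed
  have hZ: "0 <= hZ x t" "hZ x t <= t * hE x t" using hZ_nonneg[of x t] hZ_le[of t x] a by auto
  note ew = ew_le_1(1)[OF a(1) less_imp_le[OF a(5)]] ew_le_1(2)[of e t]
  have "abs (qq e x t) = abs (J e * e) * ((1 / e) * ew e t * hZ x t)" unfolding qq_def using a hZ ew by (simp add: abs_mult)
  also have "... <= abs (J e * e) * ((1 / e) * ew e t * (t * hE x t))" using a hZ ew by (intro mult_left_mono) auto
  also have "... = abs (J e * e) * (((t / e) * ew e t) * hE x t)" by (simp add: mult_ac)
  also have "... <= C * lb e be x" by (rule key[OF C1(2)[rule_format, OF a] CC(2) C1(1)])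
  finally show "abs (qq e x t) <= C * lb e be x" .
  have "abs (e * qqxx e x t) = abs (J e * e) * (ew e t * hE x t)" unfolding qqxx_def using a E ew by (simp add: abs_mult)
  also have "... <= C * lb e be x" by (rule key[OF C5(2)[rule_format, OF a] CC(3) C5(1)])
  finally show "abs (e * qqxx e x t) <= C * lb e be x" .
  have il: "c * il e be t <= C * il e be t" if "c <= C" for c using that il_pos[of e be t] by (intro mult_right_mono) auto
  show "abs (qq e x t) <= C * il e be t" using C2(2)[rule_format, OF a] il[OF CC(4)] by linarith
  show "abs (e * qqt e x t) <= C * il e be t" using C3(2)[rule_format, OF a] il[OF CC(5)] by linarith
  have "abs (ew e t) * abs (hEt x t) <= 1 * (1000000 / (t + x^2))" using ew hEt_le[OF a(5,3)] by (intro mult_mono) auto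
  hence "abs (J e * e) * (abs (ew e t) * abs (hEt x t)) <= Cj * (1 * (1000000 / (t + x^2)))"
   by (rule mult_mono[OF j]) (use Cj(1) in auto)
  also have "... = (1000000 * Cj) / (t + x^2)" by simp
  also have "... <= C / (t + x^2)" using CC(7) d by (intro divide_right_mono) auto
  finally have q4: "abs ((J e * e) * (ew e t * hEt x t)) <= C / (t + x^2)" by (simp only: abs_mult)
  thus "abs (e * qq4 e x t) <= C / (t + x^2)" unfolding qq4_def by (simp only: mult_ac)
  define X where "X = (J e * e) * (b 0 0 * (b 0 0 * ((hZ x t / t) * ((t / e) * ew e t)) - 2 * (hE x t * ew e t)))"
  have X: "abs (X / e) <= C / e" unfolding X_def abs_divide using C4(2)[rule_format, OF a] CC(6) a(1) by (intro frac_le) auto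
  have "e * qqtt e x t = X / e + (J e * e) * (ew e t * hEt x t)" unfolding qqtt_def X_def using a by (simp add: field_simps)
  hence "abs (e * qqtt e x t) <= C / e + C / (t + x^2)" using X q4 by linarith
  thus "abs (e * qqtt e x t) <= C * (1 / e + 1 / (t + x^2))" by (simp add: distrib_left)
 qed
qed

text \<open>The regular part and the initial layer are merged into \<open>r\<close>, as both satisfy
  the bounds required there; the corner function stays apart because of its singular
  derivatives.\<close>

theorem solution_estimates:
 "\<exists>C\<ge>1. \<forall>e y yx yxx yt. solution be \<delta> Kf Kb f b gl gr ph wd cd e y yx yxx yt --> mesh_estimates e be C y yxx yt"
proof -
 obtain K where K: "1 <= K" "\<forall>e y yx yxx yt. solution be \<delta> Kf Kb f b gl gr ph wd cd e y yx yxx yt --> layered K e y yx yxx yt"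
  using layered_solution by blast
 interpret lc: layer_constants be \<delta> K by unfold_locales (use beta_pos delta_pos K(1) in auto)
 obtain Kp where Kp: "1 <= Kp" "\<forall>i\<le>4. \<forall>t\<in>Icc. abs (ph i t) <= Kp" using dfam_bounded[OF ph] by blast
 obtain Cq where Cq: "1 <= Cq" "unif (%e x t. abs (qq e x t) <= Cq * lb e be x \<and> (abs (qq e x t)) <= Cq * il e be t \<and> (abs (e * qqxx e x t)) <= Cq * lb e be x \<and>
  (abs (e * qq4 e x t)) <= Cq / (t + x^2) \<and> (abs (e * qqt e x t)) <= Cq * il e be t \<and>
  (abs (e * qqtt e x t)) <= Cq * (1 / e + 1 / (t + x^2)))"
  using corner_bounds by blast
 obtain C1 where C1: "1 <= C1" "unif (%e x t. abs (p0 e x t) <= C1 * il e be t)"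
  using layD[OF p0_lay(1)] by blast
 obtain C2 where C2: "1 <= C2" "unif (%e x t. abs (p0t e x t) <= C2 * il e be t)"
  using layD[OF p0_lay(6)] by blast
 obtain C3 where C3: "1 <= C3" "unif (%e x t. abs (p0tt e x t) <= C3 * il e be t)"
  using layD[OF p0_lay(7)] by blast
 obtain C4 where C4: "1 <= C4" "unif (%e x t. abs (p0xx e x t) <= C4)"
  using bndD[OF lay_bnd[OF p0_lay(3)]] by blast
 obtain C5 where C5: "1 <= C5" "unif (%e x t. abs (p0xxxx e x t) <= C5)"
  using bndD[OF lay_bnd[OF p0_lay(5)]] by blast
 define P where "P = C1 + C2 + C3 + C4 + C5"
 have PP: "1 <= P" "C1 <= P" "C2 <= P" "C3 <= P" "C4 <= P" "C5 <= P"
  using C1(1) C2(1) C3(1) C4(1) C5(1) by (auto simp: P_def)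
 have lc10: "0 <= lc.C10"
  using lc.C6(1) lc.C4(1) lc.C0(1) lc.C1(1) K(1) beta_pos unfolding lc.C10_def lc.C9_def lc.C8_def
  by (intro add_nonneg_nonneg mult_nonneg_nonneg) auto
 define C where "C = lc.C1 + lc.C5 + 2 * lc.C7 + lc.C10 + K + Kp + Cq + 2 * P"
 have CC: "1 <= C" "lc.C1 <= C" "lc.C5 + 2 * P <= C" "2 * lc.C7 + P <= C" "lc.C10 + P <= C" "K + P <= C" "Kp <= C" "Cq <= C"
  using lc.C1(1) lc.C5(1) lc.C7(1) lc10 K(1) Kp(1) Cq(1) PP(1) unfolding C_def by simp_all
 show ?thesis
 proof (intro exI[of _ "30 * exp (sqrt be) * C"] conjI allI impI)
  show "1 <= 30 * exp (sqrt be) * C"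
  proof -
   have "1 <= exp (sqrt be)" using beta_pos by simp
   hence "1 <= 30 * exp (sqrt be)" by linarith
   thus ?thesis using mult_mono[of 1 "30 * exp (sqrt be)" 1 C] CC(1) by simp
  qed
  fix e y yx yxx yt assume sol: "solution be \<delta> Kf Kb f b gl gr ph wd cd e y yx yxx yt"
  interpret solution be \<delta> Kf Kb f b gl gr ph wd cd e y yx yxx yt by fact
  interpret lp: layer_problem be \<delta> K e b "Dx b" "Dx (Dx b)" "FF e"
   "%x t. PPx e x t + SSx e x t" "%x t. PPxx e x t + SSxx e x t"
   "WW e y" "WWx e yx" "WWxx e yxx" "WWt e yt" vv vvx vvxx vvt "wd (Suc 0)" "wd 2" "ph 2" "ph 3" "ph 4"
   using K(2) sol by blast
  have e0: "e ~= 0" using eps by simp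
  note cq = Cq(2)[rule_format, OF eps]
  note p0b = C1(2)[rule_format, OF eps] and p0tb = C2(2)[rule_format, OF eps] and p0ttb = C3(2)[rule_format, OF eps]
   and p0xxb = C4(2)[rule_format, OF eps] and p04b = C5(2)[rule_format, OF eps]
  have ilm: "c * il e be t <= P * il e be s" if "c <= P" "s <= t" for c s t
   using that PP(1) il_pos[of e be t] il_mono[OF eps(1) beta_pos that(2)] by (intro mult_mono) auto
  have Yv: "WW e y x t + p0 e x t + qq e x t = y x t" for x t by (simp add: WW_def qq_def)
  have yc: "continuous_on Icc (%x. y x t)" "continuous_on Icc (%x. WW e y x t)" "continuous_on Icc (%x. vv x t)" if "t \<in> Icc" for t
   using continuous_on_slices(1)[OF y_cont that] continuous_on_slices(1)[OF WW_cont that] continuous_on_slices(1)[OF vv_cont that] .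
  have qc: "continuous_on Icc (%x. qq e x t)" if "0 < t" for t by (rule DERIV_continuous_on_Icc[OF qq_x(1)[OF that]])
  have pc: "continuous_on Icc (%x. p0 e x t)" if t: "t \<in> Ioc" for t
  proof -
   have "continuous_on Icc (%x. y x t - WW e y x t - qq e x t)"
    by (intro continuous_on_diff yc qc) (use t in auto)
   thus ?thesis by (simp add: Yv[symmetric])
  qed
  have split: "split_solution e be C (%x t. WW e y x t + p0 e x t) (%x t. WWx e yx x t + p0x e x t)
   (%x t. WWxx e yxx x t + p0xx e x t) (%x t. WWt e yt x t + p0t e x t / e) (qq e) (qqx e) (qqxx e) (qq3 e) (qq4 e) (qqt e) (qqtt e)
   (%x t. vv x t + p0 e x t) (%x t. vvx x t + p0x e x t) (%x t. vvxx x t + p0xx e x t) (ph 0) (ph (Suc 0)) (ph 2)"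
  proof
   show "0 < e" "e <= 1" "0 < be" "1 <= C" by (fact eps beta_pos CC(1))+
  next
   fix x t :: real assume x: "x \<in> Ioo" and t: "t \<in> Ioc"
   have w: "DERIV (%x. WW e y x t) x :> WWx e yx x t" "DERIV (%x. WWx e yx x t) x :> WWxx e yxx x t"
    using WW_deriv x t unfolding heat_deriv_def by auto
   show "DERIV (%x. WW e y x t + p0 e x t) x :> WWx e yx x t + p0x e x t"
    "DERIV (%x. WWx e yx x t + p0x e x t) x :> WWxx e yxx x t + p0xx e x t"
    by (rule DERIV_add[OF w(1) p0_derivs(1)[OF x]], rule DERIV_add[OF w(2) p0_derivs(2)[OF x]])
   have v: "DERIV (%x. vv x t) x :> vvx x t" "DERIV (%x. vvx x t) x :> vvxx x t"
    using vv_deriv x t unfolding heat_deriv_def by auto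
   show "DERIV (%x. vv x t + p0 e x t) x :> vvx x t + p0x e x t"
    "DERIV (%x. vvx x t + p0x e x t) x :> vvxx x t + p0xx e x t"
    by (rule DERIV_add[OF v(1) p0_derivs(1)[OF x]], rule DERIV_add[OF v(2) p0_derivs(2)[OF x]])
   have "abs (vvxx x t) <= K" by (rule lp.v_xx_le[OF x t])
   moreover have "abs (p0xx e x t) <= C4" by (rule p0xxb) (use x t in auto)
   ultimately show "abs (vvxx x t + p0xx e x t) <= C" using PP(5) CC(6) by linarith
  next
   fix t :: real assume t: "t \<in> Ioc"
   show "continuous_on Icc (%x. WW e y x t + p0 e x t)" "continuous_on Icc (%x. vv x t + p0 e x t)"
    by (intro continuous_on_add yc pc t; use t in auto)+
   have "xreg e be P (%x. e * p0xx e x t)" unfolding xreg_def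
   proof (rule exI[of _ "%n x. e * p0xx e x t"], rule exI[of _ "%n x. e * p0xxx e x t"], rule exI[of _ "%n x. e * p0xxxx e x t"], intro ballI conjI allI)
    fix x :: real assume x: "x \<in> Ioo"
    show "DERIV (%x. e * p0xx e x t) x :> e * p0xxx e x t" "DERIV (%x. e * p0xxx e x t) x :> e * p0xxxx e x t"
     by (intro DERIV_cmult p0_derivs[OF x])+
    have "abs (p0xx e x t) <= C4" "abs (p0xxxx e x t) <= C5" by (rule p0xxb p04b; use x t in auto)+
    hence b: "abs (p0xx e x t) <= P" "abs (p0xxxx e x t) <= P" using PP by linarith+
    have "abs (e * p0xx e x t) <= P * e" using b(1) eps by (simp add: abs_mult mult.commute)
    also have "... <= P * (bl e be x + e)" using PP(1) bl_pos[of e be x] by (intro mult_left_mono) auto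
    finally show "abs (e * p0xx e x t) <= P * (bl e be x + e)" .
    have "abs (e * p0xxxx e x t) <= 1 * P" unfolding abs_mult using b(2) eps by (intro mult_mono) auto
    also have "1 * P <= P * (1 + bl e be x / e)" using mult_left_mono[of 1 "1 + bl e be x / e" P] PP(1) bl_pos[of e be x] eps by simp
    finally show "abs (e * p0xxxx e x t) <= P * (1 + bl e be x / e)" .
   qed auto
   from xreg_mono[OF xreg_add[OF lp.Yxx_xreg[OF t] this] CC(5) eps(1)]
   show "xreg e be C (%x. e * (WWxx e yxx x t + p0xx e x t))" by (simp add: distrib_left)
  next
   fix x s t :: real assume x: "x \<in> Icc" and k: "0 <= s" "s < t" "t <= 1"
   define m where "m = min 1 ((t - s) / e)"
   define a where "a = il e be s"
   have a: "0 < a" by (simp add: a_def il_pos)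
   have m0: "0 <= m" using k eps by (simp add: m_def)
   have x': "0 <= x" "x <= 1" using x by auto
   have 1: "abs (WW e y x t - WW e y x s) <= lc.C5 * ((t - s) + m * a)"
    using lp.Y_diff'[of x "t - s" s] x k by (simp add: m_def a_def)
   have 2: "abs (p0 e x t - p0 e x s) <= 2 * (P * (m * a))"
   proof (cases "(t - s) / e <= 1")
    case True
    have "abs (p0 e x t - p0 e x s) <= (P * a / e) * (t - s)"
    proof (rule abs_diff_le_deriv[where f'="%t. p0t e x t / e", OF less_imp_le[OF k(2)] DERIV_continuous_on_Icc[OF p0_t(1)[OF e0]] p0_t(1)[OF e0]])
     fix u assume u: "s < u" "u < t"
     have "abs (p0t e x u) <= C2 * il e be u" by (rule p0tb) (use x k u in auto)
     also have "... <= P * a" unfolding a_def by (rule ilm) (use PP u in auto)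
     finally show "abs (p0t e x u / e) <= P * a / e" using eps by (simp add: divide_right_mono)
    qed
    also have "... = P * (m * a)" using True by (simp add: m_def min_def)
    also have "... <= 2 * (P * (m * a))" using PP(1) m0 a by simp
    finally show ?thesis .
   next
    case False
    have b: "abs (p0 e x u) <= P * a" if u: "s <= u" "0 < u" "u <= 1" for u
    proof -
     have "abs (p0 e x u) <= C1 * il e be u" by (rule p0b) (use x k u in auto)
     also have "... <= P * a" unfolding a_def by (rule ilm) (use PP u in auto)
     finally show ?thesis .
    qed
    have "abs (p0 e x s) <= P * a"
    \<comment> \<open>The bounds by \<open>il\<close> concern positive times; time \<open>0\<close>
      is reached by continuity.\<close>
    proof (cases "s = 0")
     case True
     have c: "continuous_on Icc (%u. abs (p0 e x u))" by (intro continuous_on_rabs DERIV_continuous_on_Icc[OF p0_t(1)[OF e0]])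
     have "(%u. abs (p0 e x u)) \<midarrow>0\<rightarrow> (abs (p0 e x 0))" by (intro tendsto_rabs isContD DERIV_isCont[OF p0_t(1)[OF e0]])
     hence "((%u. abs (p0 e x u)) \<longlongrightarrow> (abs (p0 e x 0))) (at_right 0)" by (rule tendsto_within_subset) simp
     moreover have "\<forall>\<^sub>F u in at_right 0. abs (p0 e x u) <= P * a"
      unfolding eventually_at_right_field by (intro exI[of _ 1]) (use b True in auto)
     ultimately show ?thesis using True by (intro tendsto_upperbound[of "%u. abs (p0 e x u)" _ "at_right 0"]) auto
    qed (use b[of s] k in auto)
    moreover have "abs (p0 e x t) <= P * a" by (rule b) (use k in auto)
    moreover have "m = 1" using False by (simp add: m_def)
    ultimately show ?thesis by (simp; linarith)
   qed
   have "0 <= P * (t - s)" using PP(1) k by simp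
   hence "abs ((WW e y x t + p0 e x t) - (WW e y x s + p0 e x s)) <= lc.C5 * ((t - s) + m * a) + 2 * (P * (t - s)) + 2 * (P * (m * a))"
    using 1 2 by linarith
   also have "... = (lc.C5 + 2 * P) * ((t - s) + m * a)" by (simp add: algebra_simps)
   also have "... <= C * ((t - s) + m * a)" using CC(3) m0 a k by (intro mult_right_mono) auto
   finally show "abs ((WW e y x t + p0 e x t) - (WW e y x s + p0 e x s)) <= C * ((t - s) + min 1 ((t - s) / e) * il e be s)"
    by (simp add: m_def a_def)
  next
   fix x t a :: real assume x: "x \<in> Ioo" and t: "t \<in> Ioc" and a: "0 <= a" "a < t"
   have nn: "0 <= il e be a / e" using il_pos[of e be a] eps by simp
   have 1: "abs (WWt e yt x t) <= lc.C5 * (1 + il e be a / e)" by (rule lp.Yt_le'[OF x t a])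
   have "abs (p0t e x t) <= C2 * il e be t" by (rule p0tb) (use x t in auto)
   also have "... <= P * il e be a" by (rule ilm) (use PP a in auto)
   finally have "abs (p0t e x t / e) <= P * (il e be a / e)" using eps by (simp add: divide_right_mono)
   moreover have "P * (il e be a / e) <= 2 * P * (1 + il e be a / e)" using PP(1) nn by (intro mult_mono) auto
   ultimately have "abs (WWt e yt x t + p0t e x t / e) <= (lc.C5 + 2 * P) * (1 + il e be a / e)" using 1 unfolding distrib_right[of lc.C5] by linarith
   also have "... <= C * (1 + il e be a / e)" using CC(3) nn by (intro mult_right_mono) auto
   finally show "abs (WWt e yt x t + p0t e x t / e) <= C * (1 + il e be a / e)" .
  next
   fix x k t :: real assume x: "x \<in> Ioo" and k: "0 < k" "k <= t" "t <= 1"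
   define A where "A = il e be (t - k) / e^2"
   have A: "0 <= A" using il_pos[of e be "t - k"] by (simp add: A_def)
   have 1: "abs (WW e y x t - WW e y x (t - k) - k * WWt e yt x t) <= 2 * lc.C7 * (1 + A) * k^2" unfolding A_def
    by (rule lp.Y_backward_error[OF x]) (use k in auto)
   have "abs (p0 e x t - p0 e x (t - k) - k * (p0t e x t / e)) <= (P * A) * k^2"
   proof -
    have tt: "DERIV (%s. p0t e x s / e) s :> p0tt e x s / e / e" for s
     by (rule DERIV_cdivide[OF p0_t(2)[OF e0]])
    have tt_le: "abs (p0tt e x s / e / e) <= P * A" if s: "t - k < s" "s <= t" for s
    proof -
     have "abs (p0tt e x s) <= C3 * il e be s" by (rule p0ttb) (use x k s in auto)
     also have "... <= P * il e be (t - k)" by (rule ilm) (use PP s in auto)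
     finally have "abs (p0tt e x s) / e^2 <= P * il e be (t - k) / e^2" by (rule divide_right_mono) simp
     thus ?thesis using eps by (simp add: A_def power2_eq_square abs_divide)
    qed
    \<comment> \<open>For \<open>k = t\<close> the step reaches back to time \<open>0\<close>,
      outside the range of the bound on \<open>p0tt\<close>. So shorter steps are treated first, and
      then \<open>l\<close> tends to \<open>k\<close>.\<close>
    have near: "abs (p0 e x t - p0 e x (t - l) - l * (p0t e x t / e)) <= (P * A) * l^2" if l: "0 < l" "l < k" for l
     by (rule backward_taylor[where ?g2.0="%s. p0tt e x s / e / e", OF p0_t(1)[OF e0] tt tt_le]) (use l in auto)
    have "((%l. abs (p0 e x t - p0 e x (t - l) - l * (p0t e x t / e))) \<longlongrightarrow> (abs (p0 e x t - p0 e x (t - k) - k * (p0t e x t / e)))) (at_left k)"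
    proof (intro tendsto_intros)
     have "isCont (%l. p0 e x (t - l)) k"
      by (rule continuous_within_compose3[where g="p0 e x"]) (auto intro!: DERIV_isCont[OF p0_t(1)[OF e0]] continuous_intros)
     thus "((%l. p0 e x (t - l)) \<longlongrightarrow> p0 e x (t - k)) (at_left k)"
      by (auto simp: isCont_def intro: tendsto_within_subset)
    qed
    moreover have "((%l. (P * A) * l^2) \<longlongrightarrow> (P * A) * k^2) (at_left k)" by (intro tendsto_intros)
    moreover have "\<forall>\<^sub>F l in at_left k. abs (p0 e x t - p0 e x (t - l) - l * (p0t e x t / e)) <= (P * A) * l^2"
     unfolding eventually_at_left_field by (intro exI[of _ 0]) (use k near in auto)
    ultimately show ?thesis by (intro tendsto_le[OF trivial_limit_at_left_real]) 
   qed
   moreover have "(P * A) * k^2 <= P * (1 + A) * k^2" using PP(1) by (intro mult_right_mono) auto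
   moreover have "P * (1 + A) * k^2 = P * ((1 + A) * k^2)" "2 * lc.C7 * (1 + A) * k^2 = 2 * lc.C7 * ((1 + A) * k^2)" by simp_all
   ultimately have "abs ((WW e y x t + p0 e x t) - (WW e y x (t - k) + p0 e x (t - k)) - k * (WWt e yt x t + p0t e x t / e))
    <= (2 * lc.C7 + P) * ((1 + A) * k^2)" using 1 unfolding distrib_right[of "2 * lc.C7" P] distrib_left[of k "WWt e yt x t"] by linarith
   also have "... <= C * ((1 + A) * k^2)" using CC(4) A by (intro mult_right_mono) auto
   finally show "abs ((WW e y x t + p0 e x t) - (WW e y x (t - k) + p0 e x (t - k)) - k * (WWt e yt x t + p0t e x t / e))
    <= C * (1 + il e be (t - k) / e^2) * k^2" by (simp add: A_def)
  next
   fix x t :: real assume x: "x \<in> Icc" and t: "t \<in> Ioc"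
   have "abs (WW e y x t - vv x t) <= lc.C1 * (bl e be x + e)" by (rule lp.Y_v) (use x t in auto)
   also have "... <= C * (bl e be x + e)" using CC(2) bl_pos[of e be x] eps by (intro mult_right_mono) auto
   finally show "abs (WW e y x t + p0 e x t - (vv x t + p0 e x t)) <= C * (bl e be x + e)" by simp
   have t': "0 < t" "t <= 1" "0 <= x" "x <= 1" using x t by auto
   have d: "0 < t + x^2" using t' add_pos_nonneg[of t "x^2"] by auto
   have m: "Cq * lb e be x <= C * lb e be x" "Cq / (t + x^2) <= C / (t + x^2)" "Cq * il e be t <= C * il e be t"
    "Cq * (1 / e + 1 / (t + x^2)) <= C * (1 / e + 1 / (t + x^2))"
    using CC(8) lb_pos[of e be x] il_pos[of e be t] eps d by (auto intro!: mult_right_mono divide_right_mono)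
   note c = cq[of x t, OF t'(3,4,1,2)]
   show "abs (qq e x t) <= C * lb e be x" "abs (e * qqxx e x t) <= C * lb e be x" "abs (e * qq4 e x t) <= C / (t + x^2)"
    "abs (e * qqt e x t) <= C * il e be t" "abs (e * qqtt e x t) <= C * (1 / e + 1 / (t + x^2))"
    using c m by linarith+
  next
   fix x t :: real assume x: "x \<in> Icc" and t: "t \<in> Icc"
   show "abs (qq e x t) <= C * il e be t"
   proof (cases "t = 0")
    case True
    thus ?thesis using CC(1) il_pos[of e be t] by (simp add: qq_def)
   next
    case False
    hence "abs (qq e x t) <= Cq * il e be t" using cq[of x t] x t by auto
    also have "... <= C * il e be t" using CC(8) il_pos[of e be t] by (intro mult_right_mono) auto
    finally show ?thesis .
   qed
  next
   fix x t :: real assume t: "t \<in> Ioc"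
   hence t0: "0 < t" by simp
   show "DERIV (%s. qq e s t) x :> qqx e x t" "DERIV (%s. qqx e s t) x :> qqxx e x t"
    "DERIV (%s. qqxx e s t) x :> qq3 e x t" "DERIV (%s. qq3 e s t) x :> qq4 e x t"
    by (rule qq_x[OF t0])+
   show "DERIV (%s. qq e x s) t :> qqt e x t" "DERIV (%s. qqt e x s) t :> qqtt e x t"
    by (rule qq_t[OF t0 e0])+
  next
   fix x :: real assume x: "x \<in> Icc"
   show "continuous_on Icc (%t. qq e x t)" by (rule qq_cont_t[OF x e0])
   show "WW e y x 0 + p0 e x 0 + qq e x 0 = ph 0 x" unfolding Yv by (rule y_init'[OF x])
  next
   show "continuous_on Icc (ph 0)" using ph unfolding dfam_def by auto
   fix x :: real assume x: "x \<in> Ioo"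
   show "DERIV (ph 0) x :> ph (Suc 0) x" "DERIV (ph (Suc 0)) x :> ph 2 x"
    using dfam_interior[OF ph _ x, of 0] dfam_interior[OF ph _ x, of "Suc 0"] by (simp_all add: numeral_2_eq_2)
   have "abs (ph 2 x) <= Kp" using Kp(2)[rule_format, of 2 x] x by auto
   thus "abs (ph 2 x) <= C" using CC(7) by linarith
  qed
  have eqs: "(%x t. WW e y x t + p0 e x t + qq e x t) = y" "(%x t. WWxx e yxx x t + p0xx e x t + qqxx e x t) = yxx"
   "(%x t. WWt e yt x t + p0t e x t / e + qqt e x t) = yt"
   by (intro ext; simp add: WW_def WWxx_def WWt_def qq_def qqxx_def qqt_def)+
  show "mesh_estimates e be (30 * exp (sqrt be) * C) y yxx yt"
   using split_solution.mesh_estimates[OF split] unfolding eqs .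
 qed
qed

end

section \<open>The discrete operator\<close>

lemma dd_mono:
 assumes "0 < h" "0 < h'" "g x = f x" "g (x + h') <= f (x + h')" "g (x - h) <= f (x - h)"
 shows "dd g x h h' <= dd f x h h'"
 unfolding dd_def using assms by (intro divide_right_mono diff_mono) auto

lemma dd_affine: "0 < h ==> 0 < h' ==> dd (%x. a * x + c) x h h' = 0"
proof -
 have 1: "a * (x + h') + c - (a * x + c) = a * h'" "a * x + c - (a * (x - h) + c) = a * h" by (simp_all add: algebra_simps)
 assume "0 < h" "0 < h'"
 thus ?thesis unfolding dd_def 1 by simp
qed

lemma psi_le_1: "0 <= t ==> psi x t <= 1"
proof -
 assume t: "0 <= t"
 hence d: "0 <= t + x^2 / 12" by (intro add_nonneg_nonneg) auto
 show ?thesis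
 proof (cases "t + x^2 / 12 = 0")
  case False
  hence "0 < t + x^2 / 12" using d by linarith
  thus ?thesis unfolding psi_def by (simp add: divide_le_eq_1_pos)
 qed (simp add: psi_def)
qed

lemma psi_nonneg: "0 <= t ==> 0 <= psi x t"
 unfolding psi_def by (intro divide_nonneg_nonneg add_nonneg_nonneg) auto

lemma psi_time:
 assumes "0 < x" "0 < k" "k <= t"
 shows "(psi x t - psi x (t - k)) / k = (x^2 / 12) / ((t + x^2 / 12) * (t - k + x^2 / 12))"
proof -
 define X where "X = x^2 / 12"
 have X: "0 < X" using assms by (simp add: X_def)
 have "0 < t + X" "0 < t - k + X" using assms X by auto
 hence "t / (t + X) - (t - k) / (t - k + X) = (t * (t - k + X) - (t - k) * (t + X)) / ((t + X) * (t - k + X))"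
  by (intro diff_frac_eq) auto
 also have "t * (t - k + X) - (t - k) * (t + X) = X * k" by (simp add: algebra_simps)
 finally show ?thesis unfolding psi_def X_def[symmetric] using assms(2) by simp
qed

lemma psi_time_mono:
 assumes "0 < x" "0 < k" "k <= t"
 shows "0 <= (psi x t - psi x (t - k)) / k"
 unfolding psi_time[OF assms] using assms by (intro divide_nonneg_nonneg mult_nonneg_nonneg add_nonneg_nonneg) auto

text \<open>With \<open>X = x^2/12\<close> and \<open>d = h^2/12\<close> the denominators at the neighbours of \<open>x\<close> are
 \<open>P = t + X + d + x h/6\<close> and \<open>R = t + X + d - x h/6\<close>.\<close>

lemma psi_dd:
 fixes x h t :: real
 assumes h: "0 < h" "h <= x" and t: "0 < t"
 defines "X \<equiv> x^2 / 12" and "d \<equiv> h^2 / 12"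
 defines "P \<equiv> t + (x + h)^2 / 12" and "R \<equiv> t + (x - h)^2 / 12"
 shows "dd (%x. psi x t) x h h = (t / 6) * (3 * X - t - d) / ((t + X) * (P * R))"
proof -
 have pos: "0 < t + X" "0 < P" "0 < R" using t by (auto simp: X_def P_def R_def intro: add_pos_nonneg)
 have sum: "P + R = 2 * (t + X + d)" by (simp add: P_def R_def X_def d_def power2_eq_square field_simps)
 have prod: "P * R = (t + X + d)^2 - 4 * X * d"
  by (simp add: P_def R_def X_def d_def power2_eq_square field_simps)
 have h2: "h^2 = 12 * d" by (simp add: d_def)
 have d: "0 < d" using h by (simp add: d_def)
 have "psi (x + h) t - 2 * psi x t + psi (x - h) t = t / P - 2 * (t / (t + X)) + t / R"
  by (simp add: psi_def P_def R_def X_def)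
 also have "... = t * ((P + R) * (t + X) - 2 * (P * R)) / ((t + X) * (P * R))"
 proof -
  have "t / P - 2 * (t / a) + t / R = t * ((P + R) * a - 2 * (P * R)) / (a * (P * R))" if "0 < a" for a
   using pos that by (simp add: field_simps)
  thus ?thesis using pos by blast
 qed
 also have "(P + R) * (t + X) - 2 * (P * R) = 2 * d * (3 * X - t - d)"
  unfolding sum prod by (simp add: power2_eq_square algebra_simps)
 finally have e: "psi (x + h) t - 2 * psi x t + psi (x - h) t = t * (2 * d * (3 * X - t - d)) / ((t + X) * (P * R))" .
 have "t * (2 * d * y) / a / (12 * d) = t / 6 * y / a" for y a using d by simp
 thus ?thesis unfolding dd_uniform[OF h(1)] h2 e .
qed

text \<open>The discrete counterpart of \<open>psi_heat\<close>. For \<open>6 * X \<le> t\<close>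
  the second difference is sufficiently negative; otherwise the time quotient is at least twice the
  bound used for the second difference.\<close>

lemma psi_supersolution:
 assumes h: "0 < h" "h <= x" and k: "0 < k" "k <= t"
 shows "1 / (24 * (t + x^2)) <= (psi x t - psi x (t - k)) / k - dd (%x. psi x t) x h h"
proof -
 define X d P R where "X = x^2 / 12" and "d = h^2 / 12" and "P = t + (x + h)^2 / 12" and "R = t + (x - h)^2 / 12"
 have t: "0 < t" using k by simp
 have x: "0 < x" using h by simp
 have X: "0 < X" using x by (simp add: X_def)
 have d: "0 < d" "d <= X" using h by (auto simp: X_def d_def power_mono)
 have P: "t + X <= P" "P <= t + 4 * X" unfolding P_def X_def
 proof -
  have "x^2 <= (x + h)^2" by (rule power_mono) (use h in auto)
  moreover have "(x + h)^2 <= (2 * x)^2" by (rule power_mono) (use h in auto)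
  ultimately have "x^2 <= (x + h)^2" "(x + h)^2 <= 4 * x^2" by (auto simp: power_mult_distrib)
  thus "t + x^2 / 12 <= t + (x + h)^2 / 12" "t + (x + h)^2 / 12 <= t + 4 * (x^2 / 12)" by auto
 qed
 have R: "t <= R" "R <= t + X"
 proof -
  have "(x - h)^2 <= x^2" using h by (intro power_mono) auto
  thus "t <= R" "R <= t + X" by (auto simp: R_def X_def)
 qed
 have tm: "12 * X / (t + X) / (12 * (t + X)) <= (psi x t - psi x (t - k)) / k"
 proof -
  have "X / ((t + X) * (t + X)) <= X / ((t + X) * (t - k + X))"
   using X k t by (intro divide_left_mono mult_left_mono mult_pos_pos) auto
  moreover have "12 * X / a / (12 * a) = X / (a * a)" for a by simp
  ultimately show ?thesis unfolding psi_time[OF x k] X_def[symmetric] by (simp only:)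
 qed
 have ddX: "dd (%x. psi x t) x h h = (2 * t * (3 * X - t - d) / (P * R)) / (12 * (t + X))"
 proof -
  have "t / 6 * y / (a * c) = (2 * t * y / c) / (12 * a)" for y a c by simp
  thus ?thesis using psi_dd[OF h t] unfolding X_def[symmetric] d_def[symmetric] P_def[symmetric] R_def[symmetric]
   by (simp only:)
 qed
 have PR: "0 < P * R" using P R t X by (intro mult_pos_pos) auto
 have main: "1 / 2 <= 12 * X / (t + X) - 2 * t * (3 * X - t - d) / (P * R)"
 proof (cases "6 * X <= t")
  case True
  have "P * R <= (5 / 3 * t) * (7 / 6 * t)" using P R X True t by (intro mult_mono) auto
  also have "... <= 2 * (t * t)" using t by simp
  also have "... <= 2 * (2 * t * (t + d - 3 * X))"
  proof -
   have "t <= 2 * (t + d - 3 * X)" using True d by (simp add: algebra_simps)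
   from mult_left_mono[OF this, of "2 * t"] t show ?thesis by (simp only: mult.assoc mult.left_commute[of t])
  qed
  finally have "1 / 2 <= (2 * t * (t + d - 3 * X)) / (P * R)" using PR by (simp add: pos_le_divide_eq)
  moreover have "(2 * t * (t + d - 3 * X)) / (P * R) = - (2 * t * (3 * X - t - d) / (P * R))"
   by (simp add: minus_divide_left algebra_simps)
  moreover have "0 <= 12 * X / (t + X)" using X t by simp
  ultimately show ?thesis by linarith
 next
  case False
  have "2 * t * (3 * X - t - d) / (P * R) <= 2 * t * (3 * X) / (P * R)"
   using t d PR by (intro divide_right_mono mult_left_mono) auto
  also have "... <= 2 * t * (3 * X) / ((t + X) * t)"
   using P R t X PR by (intro divide_left_mono mult_mono) auto
  also have "... = 6 * X / (t + X)" using t by simp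
  finally have "2 * t * (3 * X - t - d) / (P * R) <= 6 * X / (t + X)" .
  moreover have "12 * X / (t + X) = 6 * X / (t + X) + 6 * X / (t + X)" by (simp add: add_divide_distrib[symmetric])
  moreover have "1 / 2 <= 6 * X / (t + X)" using False X t by (simp add: pos_le_divide_eq)
  ultimately show ?thesis by linarith
 qed
 have "1 / (24 * (t + x^2)) <= 1 / (24 * (t + X))" 
 proof -
  have "0 < t + x^2" "0 < t + X" using t X by (auto intro: add_pos_nonneg)
  moreover have "X <= x^2" by (simp add: X_def)
  ultimately show ?thesis by (intro frac_le) auto
 qed
 also have "... = (1 / 2) / (12 * (t + X))" by simp
 also have "... <= (12 * X / (t + X) - 2 * t * (3 * X - t - d) / (P * R)) / (12 * (t + X))"
  using main X t by (intro divide_right_mono) auto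
 finally show ?thesis using tm ddX by (simp only: diff_divide_distrib; linarith)
qed

text \<open>Beyond the transition point \<open>psi\<close> is not expected to help; its second
  difference must merely stay small enough for the reaction term to outweigh it.\<close>

lemma psi_dd_le:
 assumes h: "0 < h" "s <= x - h" "0 < s" and t: "0 < t"
 shows "dd (%x. psi x t) x h h <= 6 / s^2"
proof -
 define X d P R where "X = x^2 / 12" and "d = h^2 / 12" and "P = t + (x + h)^2 / 12" and "R = t + (x - h)^2 / 12"
 have x: "0 < x" using h by simp
 have X: "0 < X" "0 <= d" using x by (auto simp: X_def d_def)
 have "x^2 <= (x + h)^2" by (rule power_mono) (use h x in auto)
 hence P: "X <= P" using t by (simp add: X_def P_def)
 have "s^2 <= (x - h)^2" by (rule power_mono) (use h in auto)
 hence R: "s^2 / 12 <= R" using t by (simp add: R_def)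
 have s2: "0 < s^2" using h by simp
 have "0 < s^2 / 12" using s2 by simp
 hence R0: "0 < R" using R by linarith
 have pos: "0 < (t + X) * (P * R)" using t X P R0 by (intro mult_pos_pos) auto
 have "dd (%x. psi x t) x h h = (t / 6) * (3 * X - t - d) / ((t + X) * (P * R))"
  unfolding X_def d_def P_def R_def by (rule psi_dd) (use h t in auto)
 also have "... <= (t / 6) * (3 * X) / ((t + X) * (P * R))"
  using t X pos by (intro divide_right_mono mult_left_mono) auto
 also have "... <= (t / 6) * (3 * X) / (t * (X * (s^2 / 12)))"
 proof (rule divide_left_mono)
  show "t * (X * (s^2 / 12)) <= (t + X) * (P * R)"
   by (rule mult_mono[OF _ mult_mono[OF P R]]) (use t X P s2 in auto)
  show "0 < (t + X) * (P * R) * (t * (X * (s^2 / 12)))" by (rule mult_pos_pos[OF pos]) (use t X s2 in auto)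
 qed (use t X in auto)
 also have "... = 6 / s^2" using t X by simp
 finally show ?thesis .
qed

text \<open>As \<open>psi\<close> decreases in \<open>x\<close>, only the slope on the left
  contributes, and it is at most \<open>2 / x\<close> in modulus. Divided by the mean step this is
  large; the kink of \<open>theta\<close> pays for it at the transition points.\<close>

lemma psi_dd_le_nonuniform:
 assumes h: "0 < h" "h <= x" "0 < h'" and t: "0 < t"
 shows "dd (%x. psi x t) x h h' <= (2 / x) / ((h' + h) / 2)"
proof -
 have x: "0 < x" using h by simp
 have x2: "0 < x^2" using x by simp
 have den: "0 < t + y^2 / 12" for y :: real using t by (intro add_pos_nonneg) auto
 have "x^2 <= (x + h')^2" by (rule power_mono) (use h x in auto)
 hence "psi (x + h') t <= psi x t" unfolding psi_def using t den by (intro divide_left_mono) auto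
 hence 1: "(psi (x + h') t - psi x t) / h' <= 0" using h by (simp add: divide_nonpos_pos)
 have "psi (x - h) t - psi x t = (t * (t + x^2 / 12) - t * (t + (x - h)^2 / 12)) / ((t + (x - h)^2 / 12) * (t + x^2 / 12))"
  unfolding psi_def using den[of x] den[of "x - h"] by (intro diff_frac_eq) auto
 also have "t * (t + x^2 / 12) - t * (t + (x - h)^2 / 12) = t * (h * (2 * x - h) / 12)"
  by (simp add: power2_eq_square field_simps)
 also have "t * (h * (2 * x - h) / 12) / ((t + (x - h)^2 / 12) * (t + x^2 / 12)) <= t * (h * (2 * x) / 12) / ((t + (x - h)^2 / 12) * (t + x^2 / 12))"
  using t h den[of x] den[of "x - h"] by (intro divide_right_mono mult_left_mono) auto
 also have "... <= t * (h * (2 * x) / 12) / (t * (x^2 / 12))"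
  using t h x x2 den[of x] den[of "x - h"] by (intro divide_left_mono mult_mono mult_pos_pos) auto
 also have "... = 2 / x * h" using t x by (simp add: power2_eq_square)
 finally have "(psi (x - h) t - psi x t) / h <= 2 / x" using h by (simp add: pos_divide_le_eq)
 moreover have "(psi (x - h) t - psi x t) / h = - ((psi x t - psi (x - h) t) / h)" by (simp add: minus_divide_left)
 ultimately show ?thesis unfolding dd_def using 1 h by (intro divide_right_mono) auto
qed

text \<open>A concave trapezoid with kinks at the transition points. There its second difference is
  at most \<open>- 1 / s\<close> over the mean step, the order of the terms that unequal steps
  produce.\<close>

definition theta :: "real => real => real" where "theta s x = min (x / s) (min 1 ((1 - x) / s))"

lemma theta_bounds: "0 < s ==> x \<in> Icc ==> 0 <= theta s x" "theta s x <= 1"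
 by (auto simp: theta_def)

text \<open>A supporting line touches the concave \<open>theta\<close> from above at
  \<open>x\<close>, and affine functions have second difference zero even on unequal steps.\<close>

lemma theta_dd_nonpos:
 assumes h: "0 < h" "0 < h'"
 shows "dd (theta s) x h h' <= 0"
proof -
 have "\<exists>a c. theta s x = a * x + c \<and> (\<forall>y. theta s y <= a * y + c)"
 proof (cases "theta s x = 1")
  case True
  thus ?thesis by (intro exI[of _ 0] exI[of _ "1::real"]) (auto simp: theta_def)
 next
  case False
  then consider "theta s x = x / s" | "theta s x = (1 - x) / s" by (auto simp: theta_def min_def split: if_splits)
  thus ?thesis
  proof cases
   case 1
   thus ?thesis by (intro exI[of _ "1 / s"] exI[of _ "0::real"]) (auto simp: theta_def)
  next
   case 2
   thus ?thesis by (intro exI[of _ "- (1 / s)"] exI[of _ "1 / s"]) (auto simp: theta_def diff_divide_distrib)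
  qed
 qed
 then obtain a c where "theta s x = a * x + c" "!!y. theta s y <= a * y + c" by blast
 hence "dd (theta s) x h h' <= dd (%y. a * y + c) x h h'" by (intro dd_mono h) auto
 thus ?thesis using dd_affine[OF h] by simp
qed

lemma theta_dd_left:
 assumes h: "0 < h" "0 < h'" and s: "0 < s" "s <= 1 / 2"
 shows "dd (theta s) s h h' <= - (1 / s) / ((h' + h) / 2)"
proof -
 have 1: "theta s s = 1" "theta s (s + h') <= 1" "theta s (s - h) <= (s - h) / s" using s by (auto simp: theta_def)
 have "theta s (s - h) <= 1 - h / s" using 1(3) s by (simp add: diff_divide_distrib)
 hence "1 / s * h <= theta s s - theta s (s - h)" using 1(1) by simp
 hence "1 / s <= (theta s s - theta s (s - h)) / h" using h by (simp add: pos_le_divide_eq)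
 moreover have "(theta s (s + h') - theta s s) / h' <= 0" using 1 h by (simp add: divide_nonpos_pos)
 ultimately show ?thesis unfolding dd_def using h by (intro divide_right_mono) auto
qed

lemma theta_dd_right:
 assumes h: "0 < h" "0 < h'" and s: "0 < s" "s <= 1 / 2"
 shows "dd (theta s) (1 - s) h h' <= - (1 / s) / ((h' + h) / 2)"
proof -
 have 1: "theta s (1 - s) = 1" "theta s (1 - s - h) <= 1" "theta s (1 - s + h') <= (s - h') / s" using s by (auto simp: theta_def)
 have "theta s (1 - s + h') <= 1 - h' / s" using 1(3) s by (simp add: diff_divide_distrib)
 hence "theta s (1 - s + h') - theta s (1 - s) <= - (1 / s) * h'" using 1(1) by simp
 hence "(theta s (1 - s + h') - theta s (1 - s)) / h' <= - (1 / s)" using h by (simp add: pos_divide_le_eq)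
 moreover have "0 <= (theta s (1 - s) - theta s (1 - s - h)) / h" using 1 h by simp
 ultimately show ?thesis unfolding dd_def using h by (intro divide_right_mono) auto
qed

section \<open>The discrete comparison principle\<close>

lemma second_diff_dd: "0 < i ==> second_diff p (%k. g (p k)) i = dd g (p i) (p i - p (i - 1)) (p (Suc i) - p i)"
 by (simp add: second_diff_def backward_diff_def dd_def)

lemma discrete_minimum_principle:
 fixes V :: "nat => nat => real"
 assumes p: "!!i. p i < p (Suc i)" and q: "!!j. q j < q (Suc j)" and eps: "0 < e"
  and b: "!!i j. 0 < i ==> i < N ==> 0 < j ==> j <= M ==> 0 < b (p i) (q j)"
  and L: "!!i j. 0 < i ==> i < N ==> 0 < j ==> j <= M ==> 0 <= discrete_L e b p q V i j"
  and bd: "!!i j. i <= N ==> j <= M ==> i = 0 \<or> i = N \<or> j = 0 ==> 0 <= V i j"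
  and ij: "i <= N" "j <= M"
 shows "0 <= V i j"
proof (rule ccontr)
 assume neg: "\<not> 0 <= V i j"
 define S where "S = {..N} \<times> {..M}"
 have S: "finite S" "S ~= {}" by (auto simp: S_def)
 obtain z where z: "z \<in> S" "!!w. w \<in> S ==> V (fst z) (snd z) <= V (fst w) (snd w)"
  using ex_is_arg_min_if_finite[OF S, of "%w. V (fst w) (snd w)"] unfolding is_arg_min_linorder by blast
 define k l where "k = fst z" and "l = snd z"
 have mn: "V k l <= V k' l'" if "k' <= N" "l' <= M" for k' l' using z(2)[of "(k', l')"] that by (simp add: S_def k_def l_def)
 have kl: "k <= N" "l <= M" using z(1) by (auto simp: S_def k_def l_def)
 have Vn: "V k l < 0" using mn[OF ij] neg by linarith
 hence int: "0 < k" "k < N" "0 < l" "l <= M" using bd[OF kl] kl by fastforce+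
 have pk: "0 < p (Suc k) - p k" "0 < p k - p (k - 1)" "0 < q l - q (l - 1)"
  using p[of k] p[of "k - 1"] q[of "l - 1"] int by auto
 have t: "backward_diff q (%l. V k l) l <= 0" unfolding backward_diff_def
  using mn[of k "l - 1"] int pk by (intro divide_nonpos_pos) auto
 have "0 <= backward_diff p (%k. V k l) (k + 1)" unfolding backward_diff_def
  using mn[of "Suc k" l] int pk by (intro divide_nonneg_pos) auto
 moreover have "backward_diff p (%k. V k l) k <= 0" unfolding backward_diff_def
  using mn[of "k - 1" l] int pk by (intro divide_nonpos_pos) auto
 ultimately have x: "0 <= second_diff p (%k. V k l) k" unfolding second_diff_def
  using pk by (intro divide_nonneg_nonneg) auto
 have "e * backward_diff q (%l. V k l) l <= 0" "0 <= e * second_diff p (%k. V k l) k"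
  using t x eps by (auto simp: mult_nonneg_nonpos)
 moreover have "b (p k) (q l) * V k l < 0" using b[OF int] Vn by (rule mult_pos_neg)
 ultimately show False using L[OF int] unfolding discrete_L_def by linarith
qed

lemma discrete_L_add: "discrete_L e b p q (%i j. V i j + W i j) i j = discrete_L e b p q V i j + discrete_L e b p q W i j"
proof -
 have 1: "backward_diff q (%l. v l + w l) j = backward_diff q v j + backward_diff q w j" for q v w j
  unfolding backward_diff_def by (simp add: add_divide_distrib[symmetric])
 have 2: "second_diff p (%k. v k + w k) i = second_diff p v i + second_diff p w i" for p v w i
  unfolding second_diff_def 1 by (simp add: add_divide_distrib[symmetric])
 show ?thesis unfolding discrete_L_def 1 2 by (simp add: algebra_simps)
qed

lemma discrete_L_cmult: "discrete_L e b p q (%i j. c * V i j) i j = c * discrete_L e b p q V i j"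
proof -
 have 0: "c * x - c * y = c * (x - y)" "c * x / d = c * (x / d)" for x y d :: real by (simp_all add: right_diff_distrib)
 have 1: "backward_diff q (%l. c * v l) j = c * backward_diff q v j" for q v j
  unfolding backward_diff_def 0 ..
 have 2: "second_diff p (%k. c * v k) i = c * second_diff p v i" for p v i
  unfolding second_diff_def 1 0 ..
 show ?thesis unfolding discrete_L_def 1 2 by (simp add: algebra_simps)
qed

lemma discrete_comparison:
 fixes E S :: "nat => nat => real"
 assumes p: "!!i. p i < p (Suc i)" and q: "!!j. q j < q (Suc j)" and eps: "0 < e"
  and b: "!!i j. 0 < i ==> i < N ==> 0 < j ==> j <= M ==> 0 < b (p i) (q j)"
  and L: "!!i j. 0 < i ==> i < N ==> 0 < j ==> j <= M ==> abs (discrete_L e b p q E i j) <= discrete_L e b p q S i j"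
  and bd: "!!i j. i <= N ==> j <= M ==> i = 0 \<or> i = N \<or> j = 0 ==> abs (E i j) <= S i j"
  and ij: "i <= N" "j <= M"
 shows "abs (E i j) <= S i j"
proof -
 have "0 <= S i j + c * E i j" if c: "c = 1 \<or> c = -1" for c
 proof (rule discrete_minimum_principle[where V="%i j. S i j + c * E i j" and p=p and q=q and b=b and e=e and N=N and M=M])
  show "i <= N" "j <= M" "0 < e" by (fact ij eps)+
  show "p i < p (Suc i)" "q i < q (Suc i)" for i by (rule p q)+
  show "0 < b (p i) (q j)" if "0 < i" "i < N" "0 < j" "j <= M" for i j by (rule b[OF that])
 next
  fix i j assume "0 < i" "i < N" "0 < j" "j <= M"
  from L[OF this] show "0 <= discrete_L e b p q (%i j. S i j + c * E i j) i j"
   unfolding discrete_L_add discrete_L_cmult using c by auto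
 next
  fix i j assume "i <= N" "j <= M" "i = 0 \<or> i = N \<or> j = 0"
  from bd[OF this] show "0 <= S i j + c * E i j" using c by auto
 qed
 from this[of 1] this[of "-1"] show ?thesis by auto
qed

section \<open>The Shishkin mesh\<close>

locale shishkin_mesh =
 fixes e be :: real and N M n m :: nat
 assumes eps: "0 < e" "e <= 1" and beta_pos: "0 < be"
  and N: "N = 4 * n" "0 < n" and M: "M = 2 * m" "0 < m"
begin

abbreviation "p \<equiv> xmesh e be N"
abbreviation "q \<equiv> tmesh e be M"
abbreviation "s \<equiv> sigma e be N"
abbreviation "r \<equiv> tau e be M"
definition "h1 = s / real n"
definition "H = (1 - 2 * s) / (2 * real n)"
definition "k1 = r / real m"
definition "k2 = (1 - r) / real m"
definition "A = (ln (real N))^2 / (real N)^2 + ln (real M) / real M"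

lemma n_pos: "0 < real n" "0 < real m" using N M by auto

lemma Nr: "real N = 4 * real n" "real M = 2 * real m" using N M by auto

lemma ln_N: "1 <= ln (real N)"
proof -
 have "exp 1 <= real N" using exp_le N by linarith
 thus ?thesis using N by (subst ln_ge_iff) auto
qed

lemma ln_M: "1 / 2 <= ln (real M)"
proof -
 have "1 / 2 <= ln (2::real)" using ln2_ge_two_thirds by linarith
 also have "... <= ln (real M)" using M by simp
 finally show ?thesis .
qed

lemma s_bounds: "0 < s" "s <= 1 / 4" "s <= 2 * sqrt (e / be) * ln (real N)" "s < 1 / 4 ==> s = 2 * sqrt (e / be) * ln (real N)"
 using ln_N eps beta_pos by (auto simp: sigma_def min_def)

lemma r_bounds: "0 < r" "r <= 1 / 2" "r <= e / be * ln (real M)" "r < 1 / 2 ==> r = e / be * ln (real M)"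
 using ln_M eps beta_pos by (auto simp: tau_def min_def)

lemma p_left: "i <= n ==> p i = h1 * real i"
 using n_pos by (simp add: xmesh_def Let_def h1_def Nr)

lemma p_mid: "n <= i ==> i <= 3 * n ==> p i = s + H * (real i - real n)"
 using n_pos by (cases "i = n") (simp_all add: xmesh_def Let_def H_def Nr)

lemma p_right: "3 * n <= i ==> p i = 1 - s + h1 * (real i - 3 * real n)"
proof (cases "i = 3 * n")
 case True
 thus ?thesis using p_mid[of i] n_pos by (simp add: H_def)
next
 case False
 moreover assume "3 * n <= i"
 ultimately show ?thesis using n_pos by (simp add: xmesh_def Let_def h1_def Nr)
qed

lemma q_left: "j <= m ==> q j = k1 * real j"
 using n_pos by (simp add: tmesh_def Let_def k1_def Nr)

lemma q_right: "m <= j ==> q j = r + k2 * (real j - real m)"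
 using n_pos by (cases "j = m") (simp_all add: tmesh_def Let_def k2_def Nr)

lemma steps_pos: "0 < h1" "0 < H" "0 < k1" "0 < k2" "h1 <= H"
proof -
 show "0 < h1" "0 < H" "0 < k1" "0 < k2" using s_bounds r_bounds n_pos by (auto simp: h1_def H_def k1_def k2_def)
 show "h1 <= H" using s_bounds n_pos by (simp add: h1_def H_def field_simps)
qed

lemma p_Suc:
 "Suc i <= n ==> p (Suc i) - p i = h1" "n <= i ==> Suc i <= 3 * n ==> p (Suc i) - p i = H"
 "3 * n <= i ==> p (Suc i) - p i = h1"
 by (simp_all add: p_left p_mid p_right algebra_simps)

lemma q_Suc: "Suc j <= m ==> q (Suc j) - q j = k1" "m <= j ==> q (Suc j) - q j = k2"
 by (simp_all add: q_left q_right algebra_simps)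

text \<open>The last linear piece of the mesh formula continues beyond index \<open>N\<close>, so
  strict monotonicity holds for all indices, in the form that the discrete comparison asks
  for.\<close>

lemma p_less: "p i < p (Suc i)"
proof -
 have "Suc i <= n \<or> (n <= i \<and> Suc i <= 3 * n) \<or> 3 * n <= i" by linarith
 thus ?thesis using p_Suc[of i] steps_pos by auto
qed

lemma q_less: "q j < q (Suc j)"
proof -
 have "Suc j <= m \<or> m <= j" by linarith
 thus ?thesis using q_Suc[of j] steps_pos by auto
qed

lemma p_strict: "strict_mono p" using p_less by (simp add: strict_mono_Suc_iff)
lemma q_strict: "strict_mono q" using q_less by (simp add: strict_mono_Suc_iff)

lemma p_values: "p 0 = 0" "p n = s" "p (3 * n) = 1 - s" "p N = 1"
 using n_pos p_right[of N] N(1) Nr(1) by (simp_all add: p_left p_right h1_def)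

lemma q_values: "q 0 = 0" "q m = r" "q M = 1"
 using n_pos q_right[of M] M(1) Nr(2) by (simp_all add: q_left q_right k1_def k2_def)

lemma p_le_iff: "p i <= p j \<longleftrightarrow> i <= j" and p_less_iff: "p i < p j \<longleftrightarrow> i < j"
 using p_strict by (auto simp: strict_mono_less_eq strict_mono_less)

lemma q_le_iff: "q i <= q j \<longleftrightarrow> i <= j" and q_less_iff: "q i < q j \<longleftrightarrow> i < j"
 using q_strict by (auto simp: strict_mono_less_eq strict_mono_less)

lemma A_parts: "0 <= A" "(ln (real N))^2 / (real N)^2 <= A" "1 / (real N)^2 <= A" "ln (real M) / real M <= A" "1 / real M <= 2 * A"
proof -
 have M0: "0 < real M" using M by simp
 have 1: "0 <= (ln (real N))^2 / (real N)^2" "0 <= ln (real M) / real M" using ln_M M0 by auto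
 show 2: "0 <= A" "(ln (real N))^2 / (real N)^2 <= A" and 3: "ln (real M) / real M <= A" using 1 by (auto simp: A_def)
 have "1 <= (ln (real N))^2" using ln_N by simp
 hence "1 / (real N)^2 <= (ln (real N))^2 / (real N)^2" by (intro divide_right_mono) auto
 thus "1 / (real N)^2 <= A" using 2 by linarith
 have "(1 / 2) / real M <= ln (real M) / real M" using ln_M M0 by (intro divide_right_mono) auto
 thus "1 / real M <= 2 * A" using 3 by simp
qed

lemma h1_sq: "h1^2 <= 64 / be * (e * A)"
proof -
 have "h1^2 <= (2 * sqrt (e / be) * ln (real N) / real n)^2"
  unfolding h1_def using s_bounds n_pos by (intro power_mono divide_right_mono) auto
 also have "... = 64 / be * (e * ((ln (real N))^2 / (real N)^2))"
  using eps beta_pos by (simp add: power_divide power_mult_distrib Nr)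
 also have "... <= 64 / be * (e * A)" using A_parts eps beta_pos by (intro mult_left_mono) auto
 finally show ?thesis .
qed

lemma H_bounds: "H <= 2 / real N" "1 / real N <= H" "H^2 <= 4 * A"
proof -
 show 1: "H <= 2 / real N" "1 / real N <= H" using s_bounds n_pos by (simp_all add: H_def Nr field_simps)
 have "H^2 <= (2 / real N)^2" using 1 steps_pos by (intro power_mono) auto
 thus "H^2 <= 4 * A" using A_parts(3) by (simp add: power_divide)
qed

lemma H_uniform: "s = 1 / 4 ==> H = h1"
proof -
 assume "s = 1 / 4"
 hence "1 - 2 * s = 2 * s" by simp
 thus ?thesis unfolding H_def h1_def by (simp only: mult_divide_mult_cancel_left_if) simp
qed

text \<open>By the choice of \<open>sigma\<close> the layer function equals
  \<open>1 / (real N)^2\<close> at the transition point. The stencil reaches one fine step further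
  to the left, which costs at most the factor \<open>exp 8\<close> because
  \<open>8 * (ln (real N) / real N) \<le> 8\<close>.\<close>

lemma lb_transition:
 assumes "s < 1 / 4" "s - h1 <= z"
 shows "lb e be z <= exp 8 * A"
proof -
 have u: "sqrt (be / e) * s = 2 * ln (real N)"
 proof -
  have "sqrt (be / e) * sqrt (e / be) = 1" using eps beta_pos by (simp add: real_sqrt_mult[symmetric])
  thus ?thesis using s_bounds(4)[OF assms(1)] by (simp add: mult.assoc[symmetric] mult.left_commute)
 qed
 have "sqrt (be / e) * h1 = 8 * (ln (real N) / real N)"
  unfolding h1_def using u n_pos by (simp add: Nr)
 also have "... <= 8"
 proof -
  have "0 < real N" using n_pos Nr by simp
  hence "ln (real N) / real N <= 1" using ln_le_minus_one[of "real N"] by (simp only: divide_le_eq_1_pos; linarith)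
  thus ?thesis by simp
 qed
 finally have "2 * ln (real N) - 8 <= sqrt (be / e) * (s - h1)" by (simp add: right_diff_distrib u)
 also have "... <= sqrt (be / e) * z" using assms eps beta_pos by (intro mult_left_mono) auto
 finally have "lb e be z <= exp (8 - 2 * ln (real N))" by (simp add: lb_def)
 also have "... = exp 8 * (1 / (real N)^2)"
 proof -
  have "exp (2 * ln (real N)) = (real N)^2" using N by (simp add: exp_double)
  thus ?thesis by (simp add: exp_diff)
 qed
 also have "... <= exp 8 * A" using A_parts(3) by (intro mult_left_mono) auto
 finally show ?thesis .
qed

lemma bl_transition:
 assumes "s < 1 / 4" "s - h1 <= z" "z <= 1 - s + h1"
 shows "bl e be z <= 2 * exp 8 * A"
 using lb_transition[OF assms(1,2)] lb_transition[OF assms(1), of "1 - z"] assms(3)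
 by (simp add: bl_def lb_def)

text \<open>Brings the first order error at a transition point into the form
  \<open>A * (e * real N / s)\<close> that the kink of \<open>theta\<close> dominates. The logarithm
  in the bound for \<open>s\<close> is matched by those in \<open>A\<close>.\<close>

lemma sqrt_eps: "sqrt e * H <= 4 / sqrt be * (A * (e * real N / s))"
proof -
 define l where "l = ln (real N)"
 define Nr where "Nr = real N"
 define w where "w = sqrt e"
 define v where "v = sqrt be"
 have pos: "1 <= l" "0 < Nr" "0 < w" "0 < v" using ln_N N eps beta_pos by (auto simp: l_def Nr_def w_def v_def)
 have e: "e = w * w" using eps by (simp add: w_def)
 have s: "0 < s" "s <= 2 * (w / v) * l" using s_bounds by (auto simp: w_def v_def l_def real_sqrt_divide)
 have Al: "l^2 / Nr^2 <= A" using A_parts(2) by (simp add: l_def Nr_def)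
 have "w * 2 / Nr <= w * 2 / Nr * l" using mult_left_mono[of 1 l "w * 2 / Nr"] pos by simp
 also have "... = 4 / v * ((l^2 / Nr^2) * (w * w * Nr / (2 * (w / v) * l)))"
  using pos by (simp add: field_simps power2_eq_square)
 also have "... <= 4 / v * (A * (w * w * Nr / s))"
  using pos s A_parts(1) Al by (intro mult_left_mono mult_mono divide_left_mono mult_pos_pos) auto
 finally have "w * (2 / Nr) <= 4 / v * (A * (e * Nr / s))" by (simp add: e)
 moreover have "w * H <= w * (2 / Nr)" using H_bounds(1) pos by (intro mult_left_mono) (auto simp: Nr_def)
 ultimately show ?thesis by (simp add: w_def v_def Nr_def)
qed

lemma eps_s: "s < 1 / 4 ==> e / s^2 <= be / 4"
proof -
 assume "s < 1 / 4"
 hence "s^2 = 4 * (e / be) * (ln (real N))^2" using s_bounds(4) eps beta_pos by (simp add: power_mult_distrib)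
 moreover have "1 <= (ln (real N))^2" using ln_N by simp
 ultimately have "4 * (e / be) * 1 <= s^2" using eps beta_pos by (simp only:) (intro mult_left_mono; simp)
 thus ?thesis using s_bounds(1) beta_pos by (simp add: field_simps)
qed

text \<open>Either the step is small relative to \<open>e\<close>, or it starts at or after
  \<open>tau\<close>, where the initial layer has decayed to \<open>1 / real M\<close>. The start of
  the step counts because the truncation error involves \<open>il\<close> at the earlier
  level.\<close>

lemma time_step:
 assumes "0 < j" "j <= M"
 shows "q j - q (j - 1) <= 4 * A"
  "q j - q (j - 1) <= 2 / be * (e * A) \<or> il e be (q (j - 1)) <= 2 * A"
proof -
 have k1: "k1 <= 2 / be * (e * A)"
 proof -
  have "k1 <= e / be * ln (real M) / real m" unfolding k1_def using r_bounds n_pos by (intro divide_right_mono) auto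
  also have "... = 2 / be * (e * (ln (real M) / real M))" by (simp add: Nr)
  also have "... <= 2 / be * (e * A)" using A_parts eps beta_pos by (intro mult_left_mono) auto
  finally show ?thesis .
 qed
 have k: "k1 <= 4 * A" "k2 <= 4 * A"
 proof -
  have "k1 <= 2 * (1 / real M)" "k2 <= 2 * (1 / real M)" using r_bounds n_pos by (simp_all add: k1_def k2_def Nr field_simps)
  thus "k1 <= 4 * A" "k2 <= 4 * A" using A_parts(5) by linarith+
 qed
 consider "j <= m" | "m <= j - 1" by linarith
 hence "q j - q (j - 1) <= 4 * A \<and> (q j - q (j - 1) <= 2 / be * (e * A) \<or> il e be (q (j - 1)) <= 2 * A)"
 proof cases
  case 1
  hence "q j - q (j - 1) = k1" using q_Suc(1)[of "j - 1"] assms by simp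
  thus ?thesis using k k1 by simp
 next
  case 2
  hence e: "q j - q (j - 1) = k2" using q_Suc(2)[of "j - 1"] assms by simp
  show ?thesis
  proof (cases "r < 1 / 2")
   case True
   have "r <= q (j - 1)" using q_values(2) q_le_iff[of m "j - 1"] 2 by simp
   hence "il e be (q (j - 1)) <= il e be r" by (rule il_mono[OF eps(1) beta_pos])
   also have "... = exp (- ln (real M))" unfolding il_def r_bounds(4)[OF True] using eps beta_pos by simp
   also have "... = 1 / real M"
   proof -
    have "0 < real M" using n_pos Nr by simp
    thus ?thesis unfolding exp_minus by (simp only: exp_ln inverse_eq_divide)
   qed
   finally show ?thesis using A_parts(5) e k by simp
  next
   case False
   hence "r = 1 / 2" using r_bounds by simp
   hence "k2 = k1" by (simp add: k1_def k2_def)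
   thus ?thesis using e k k1 by simp
  qed
 qed
 thus "q j - q (j - 1) <= 4 * A" "q j - q (j - 1) <= 2 / be * (e * A) \<or> il e be (q (j - 1)) <= 2 * A" by auto
qed

text \<open>The shape of a truncation error that the barriers can dominate. The last term occurs at
  transition points of a genuinely nonuniform mesh.\<close>

definition "defect G i j = G * (A * (1 + e / (q j + (p i)^2) + (if s < 1 / 4 \<and> (i = n \<or> i = 3 * n) then e * real N / s else 0)))"

text \<open>An upper bound for the barrier \<open>c1 + 24 * psi + c3 * theta\<close>. The
  \<open>24\<close> undoes the \<open>1 / 24\<close> of \<open>psi_supersolution\<close>. At a
  transition point \<open>24 * psi\<close> costs \<open>4 * 24\<close> times
  \<open>e * real N / s\<close>, the defect adds one more, and the kink of \<open>theta\<close>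
  yields half of its coefficient: hence \<open>2 * (4 * 24 + 1)\<close>. The first two terms let the
  reaction term dominate beyond \<open>s\<close>, where \<open>e / s^2 \<le> be / 4\<close>.\<close>

definition "stab = (1 + be / 4) / be + 48 + 24 + 2 * (4 * 24 + 1)"

lemma stability:
 assumes b: "!!x t. x \<in> Icc ==> t \<in> Icc ==> be <= b x t" and G: "0 <= G"
  and L: "!!i j. 0 < i ==> i < N ==> 0 < j ==> j <= M ==> abs (discrete_L e b p q E i j) <= defect G i j"
  and bd: "!!i j. i <= N ==> j <= M ==> i = 0 \<or> i = N \<or> j = 0 ==> E i j = 0"
  and ij: "i <= N" "j <= M"
 shows "abs (E i j) <= stab * (G * A)"
proof -
 define c1 c3 where "c1 = (1 + be / 4) / be + 48" and "c3 = (2 * (4 * 24 + 1) :: real)"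
 have c1: "0 <= c1" "c1 * be = 1 + be / 4 + 48 * be"
 proof -
  have "0 <= (1 + be / 4) / be" using beta_pos by (intro divide_nonneg_pos) auto
  thus "0 <= c1" by (simp add: c1_def)
  have "(1 + be / 4) / be * be = 1 + be / 4" using beta_pos by simp
  thus "c1 * be = 1 + be / 4 + 48 * be" by (simp only: c1_def distrib_right)
 qed
 define S0 where "S0 = (%i j. c1 + 24 * psi (p i) (q j) + c3 * theta s (p i))"
 have GA: "0 <= G * A" using G A_parts by simp
 have pin: "p i \<in> Icc" if "i <= N" for i using that p_le_iff[of 0 i] p_le_iff[of i N] p_values by simp
 have qin: "q j \<in> Icc" if "j <= M" for j using that q_le_iff[of 0 j] q_le_iff[of j M] q_values by simp
 have stab: "stab = c1 + 24 + c3" by (simp add: stab_def c1_def c3_def)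
 have S0: "0 <= S0 i j" "S0 i j <= stab" if "i <= N" "j <= M" for i j
 proof -
  have b: "0 <= psi (p i) (q j)" "psi (p i) (q j) <= 1" "0 <= theta s (p i)" "theta s (p i) <= 1"
   using psi_nonneg[of "q j" "p i"] psi_le_1[of "q j" "p i"] theta_bounds(1)[OF s_bounds(1) pin[OF that(1)]]
    theta_bounds(2)[of s "p i"] qin[OF that(2)] by auto
  hence "0 <= c3 * theta s (p i)" "c3 * theta s (p i) <= c3" by (auto simp: c3_def)
  thus "0 <= S0 i j" "S0 i j <= stab" using b c1(1) unfolding S0_def stab by linarith+
 qed
 have "abs (E i j) <= (G * A) * S0 i j"
 proof (rule discrete_comparison[where S="%i j. (G * A) * S0 i j" and p=p and q=q and b=b and e=e and N=N and M=M])
  show "p i < p (Suc i)" "q i < q (Suc i)" for i by (rule p_less q_less)+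
  show "0 < e" "i <= N" "j <= M" by (fact eps ij)+
  show "0 < b (p i) (q j)" if "0 < i" "i < N" "0 < j" "j <= M" for i j
   using b[OF pin qin, of i j] that beta_pos by simp
  show "abs (E i j) <= (G * A) * S0 i j" if "i <= N" "j <= M" "i = 0 \<or> i = N \<or> j = 0" for i j
   using bd[OF that] S0(1)[OF that(1,2)] GA by simp
 next
  fix i j assume ij: "0 < i" "i < N" "0 < j" "j <= M"
  define x t h h' k where "x = p i" and "t = q j" and "h = p i - p (i - 1)" and "h' = p (Suc i) - p i" and "k = q j - q (j - 1)"
  have hp: "0 < h" "0 < h'" "0 < k" using p_less[of "i - 1"] p_less[of i] q_less[of "j - 1"] ij by (auto simp: h_def h'_def k_def)
  have hx: "h <= x" using pin[of "i - 1"] ij by (simp add: h_def x_def)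
  have kt: "k <= t" using qin[of "j - 1"] ij by (simp add: k_def t_def)
  have t0: "0 < t" using hp kt by simp
  have x0: "0 < x" using hp hx by simp
  have d: "0 < t + x^2" using t0 by (intro add_pos_nonneg) auto
  have tk: "q (j - 1) = t - k" by (simp add: t_def k_def)
  define T where "T = (psi x t - psi x (t - k)) / k"
  define D1 where "D1 = dd (%x. psi x t) x h h'"
  define D2 where "D2 = dd (theta s) x h h'"
  have T: "0 <= T" unfolding T_def by (rule psi_time_mono[OF x0 hp(3) kt])
  have D2: "D2 <= 0" unfolding D2_def by (rule theta_dd_nonpos[OF hp(1,2)])
  have disc: "discrete_L e b p q S0 i j = e * (24 * (T - D1)) - e * (c3 * D2) + b x t * S0 i j"
  proof -
   have "backward_diff q (%l. S0 i l) j = 24 * T"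
    unfolding backward_diff_def S0_def T_def tk[symmetric] k_def t_def x_def by (simp add: diff_divide_distrib[symmetric] right_diff_distrib)
   moreover have "second_diff p (%k. S0 k j) i = 24 * D1 + c3 * D2"
   proof -
    have "second_diff p (%k. S0 k j) i = dd (%x. (c1 + 24 * psi x t) + c3 * theta s x) x h h'"
     using second_diff_dd[OF ij(1), of p "%x. c1 + 24 * psi x (q j) + c3 * theta s x"]
     by (simp add: S0_def x_def t_def h_def h'_def)
    also have "... = dd (%x. 0 * x + c1) x h h' + 24 * D1 + c3 * D2"
     unfolding dd_add dd_cmult D1_def D2_def by (simp add: dd_add dd_cmult)
    finally show ?thesis by (simp only: dd_affine[OF hp(1,2)])
   qed
   ultimately show ?thesis unfolding discrete_L_def x_def t_def by (simp add: algebra_simps)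
  qed
  have bS: "1 + be / 4 + 48 * be <= b x t * S0 i j"
  proof -
   have "c1 <= S0 i j" unfolding S0_def
    using psi_nonneg[of "q j" "p i"] theta_bounds(1)[OF s_bounds(1) pin[of i]] qin[OF ij(4)] ij by (simp add: c3_def)
   moreover have "be <= b x t" unfolding x_def t_def by (rule b) (use pin[of i] qin[of j] ij in auto)
   ultimately have "be * c1 <= b x t * S0 i j" using beta_pos c1 by (intro mult_mono) auto
   thus ?thesis using c1 by (simp add: mult.commute)
  qed
  define X where "X = (if s < 1 / 4 \<and> (i = n \<or> i = 3 * n) then e * real N / s else 0)"
  have main: "1 + e / (t + x^2) + X <= discrete_L e b p q S0 i j"
  \<comment> \<open>On the left fine part, and everywhere on a uniform mesh, \<open>psi\<close>
    takes care of \<open>e / (t + x^2)\<close>. Otherwise \<open>s \<le> x\<close>, this term is at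
    most \<open>be / 4\<close>, and the reaction term suffices.\<close>
  proof (cases "i < n \<or> s = 1 / 4")
   case True
   have hh: "h' = h"
   proof (cases "i < n")
    case True
    thus ?thesis using p_Suc(1)[of i] p_Suc(1)[of "i - 1"] ij by (simp add: h_def h'_def)
   next
    case False
    hence "H = h1" using True H_uniform by simp
    moreover have "Suc a <= n \<or> (n <= a \<and> Suc a <= 3 * n) \<or> 3 * n <= a" for a by linarith
    ultimately have "p (Suc a) - p a = h1" for a using p_Suc[of a] by metis
    from this[of i] this[of "i - 1"] ij show ?thesis by (simp add: h_def h'_def)
   qed
   have "1 / (24 * (t + x^2)) <= T - D1" unfolding T_def D1_def hh by (rule psi_supersolution[OF hp(1) hx hp(3) kt])
   hence "e * (24 * (1 / (24 * (t + x^2)))) <= e * (24 * (T - D1))" using eps by (intro mult_left_mono) auto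
   moreover have "e * (24 * (1 / (24 * (t + x^2)))) = e / (t + x^2)"
   proof -
    have "e * (24 * (1 / (24 * a))) = e / a" for a by simp
    thus ?thesis .
   qed
   moreover have "e * (c3 * D2) <= 0" using D2 eps by (simp add: c3_def mult_nonneg_nonpos)
   moreover have "X = 0" using True N by (auto simp: X_def)
   ultimately show ?thesis using disc bS beta_pos by linarith
  next
   case False
   hence s4: "s < 1 / 4" and ni: "n <= i" using s_bounds by auto
   have xs: "s <= x" using p_le_iff[of n i] ni p_values by (simp add: x_def)
   have s2: "s^2 <= x^2" using xs s_bounds by (intro power_mono) auto
   have "e / (t + x^2) <= e / s^2" using s2 t0 s_bounds(1) eps by (intro divide_left_mono mult_pos_pos d) auto
   hence cor: "e / (t + x^2) <= be / 4" using eps_s[OF s4] by linarith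
   have eT: "0 <= e * (24 * T)" using T eps by simp
   show ?thesis
   proof (cases "i = n \<or> i = 3 * n")
    case False
    have hh: "h' = h" and xh: "s <= x - h"
    proof -
     show "h' = h"
     proof (cases "i < 3 * n")
      case True
      thus ?thesis using p_Suc(2)[of i] p_Suc(2)[of "i - 1"] ij ni False by (simp add: h_def h'_def)
     next
      case ge: False
      thus ?thesis using p_Suc(3)[of i] p_Suc(3)[of "i - 1"] ij False by (simp add: h_def h'_def)
     qed
     have "n <= i - 1" using ni False by linarith
     thus "s <= x - h" using p_le_iff[of n "i - 1"] p_values by (simp add: h_def x_def)
    qed
    have "D1 <= 6 / s^2" unfolding D1_def hh by (rule psi_dd_le[OF hp(1) xh s_bounds(1) t0])
    hence "e * (24 * D1) <= e * (24 * (6 / s^2))" using eps by (intro mult_left_mono) auto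
    also have "... = 144 * (e / s^2)" by simp
    also have "... <= 36 * be" using eps_s[OF s4] by simp
    finally have "e * (24 * D1) <= 36 * be" .
    moreover have "e * (c3 * D2) <= 0" using D2 eps by (simp add: c3_def mult_nonneg_nonpos)
    moreover have "X = 0" using False by (simp add: X_def)
    moreover have "e * (24 * (T - D1)) = e * (24 * T) - e * (24 * D1)" by (simp add: algebra_simps)
    ultimately show ?thesis using disc bS eT cor beta_pos by linarith
   next
    case True
    define w where "w = (h' + h) / 2"
    have N0: "0 < real N" using N by simp
    have w: "1 / (2 * real N) <= w" "w <= 2 / real N" "0 < w"
    proof -
     have "h = H \<and> h' = h1 \<or> h = h1 \<and> h' = H"
      using True p_Suc(1)[of "i - 1"] p_Suc(2)[of i] p_Suc(2)[of "i - 1"] p_Suc(3)[of i] ij N by (auto simp: h_def h'_def)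
     hence wH: "w = (H + h1) / 2" by (auto simp: w_def)
     define z where "z = 1 / real N"
     have z: "1 / (2 * real N) = z / 2" "2 / real N = 2 * z" by (simp_all add: z_def)
     have b: "H <= 2 * z" "z <= H" by (rule H_bounds(1)[unfolded z(2)], rule H_bounds(2)[folded z_def])
     have "z / 2 <= (H + h1) / 2" using b(2) less_imp_le[OF steps_pos(1)] by (intro divide_right_mono) auto
     moreover have "(H + h1) / 2 <= (2 * z + 2 * z) / 2" using b(1) order_trans[OF steps_pos(5) b(1)] by (intro divide_right_mono add_mono) auto
     hence "(H + h1) / 2 <= 2 * z" by simp
     moreover have "0 < (H + h1) / 2" using steps_pos(1,2) by simp
     ultimately have "z / 2 <= w" "w <= 2 * z" "0 < w" unfolding wH .
     thus "1 / (2 * real N) <= w" "w <= 2 / real N" "0 < w" unfolding z by auto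
    qed
    have "D1 <= (2 / x) / w" unfolding D1_def w_def by (rule psi_dd_le_nonuniform[OF hp(1) hx hp(2) t0])
    also have "... <= (2 / s) / (1 / (2 * real N))" using xs s_bounds(1) x0 w N0 by (intro frac_le divide_left_mono) auto
    also have "... = 4 * (real N / s)" by simp
    finally have "e * (24 * D1) <= e * (24 * (4 * (real N / s)))" using eps by (intro mult_left_mono) auto
    also have "... = 96 * (e * real N / s)" by simp
    finally have D1: "e * (24 * D1) <= 96 * (e * real N / s)" .
    have "D2 <= - (1 / s) / w"
    proof (cases "i = n")
     case True
     thus ?thesis unfolding D2_def w_def using theta_dd_left[OF hp(1,2) s_bounds(1)] s_bounds(2) p_values(2) by (simp add: x_def)
    next
     case False
     hence "x = 1 - s" using True p_values(3) by (simp add: x_def)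
     thus ?thesis unfolding D2_def w_def using theta_dd_right[OF hp(1,2) s_bounds(1)] s_bounds(2) by simp
    qed
    moreover have "(1 / s) / (2 / real N) <= (1 / s) / w" using s_bounds(1) w N0 by (intro divide_left_mono) auto
    ultimately have "D2 <= - (real N / s / 2)" by simp
    hence "e * (c3 * D2) <= e * (c3 * (- (real N / s / 2)))" using eps by (intro mult_left_mono) (auto simp: c3_def)
    also have "... = - (97 * (e * real N / s))" by (simp add: c3_def)
    finally have "e * (c3 * D2) <= - (97 * (e * real N / s))" .
    moreover have "X = e * real N / s" using True s4 by (auto simp: X_def)
    moreover have "e * (24 * (T - D1)) = e * (24 * T) - e * (24 * D1)" by (simp add: algebra_simps)
    ultimately show ?thesis using disc bS eT cor beta_pos D1 by linarith
   qed
  qed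
  have "defect G i j = (G * A) * (1 + e / (t + x^2) + X)" by (simp add: defect_def X_def x_def t_def)
  also have "... <= (G * A) * discrete_L e b p q S0 i j" using main GA by (rule mult_left_mono)
  also have "... = discrete_L e b p q (%i j. (G * A) * S0 i j) i j" by (rule discrete_L_cmult[symmetric])
  finally show "abs (discrete_L e b p q E i j) <= discrete_L e b p q (%i j. (G * A) * S0 i j) i j" using L[OF ij] by linarith
 qed
 also have "... <= (G * A) * stab" using S0(2)[OF ij] GA by (rule mult_left_mono)
 finally show ?thesis by (simp add: mult.commute)
qed

end

section \<open>The error of the scheme\<close>

lemma mesh_cell:
 fixes p :: "nat => real"
 assumes "p 0 <= x" "x <= p N" "0 < N"
 shows "\<exists>i<N. p i <= x \<and> x <= p (Suc i)"
 using assms(2,3)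
proof (induction N)
 case (Suc N)
 show ?case
 proof (cases "N = 0 \<or> p N <= x")
  case True
  thus ?thesis using Suc.prems assms(1) by (intro exI[of _ N]) auto
 next
  case False
  thus ?thesis using Suc.IH by (auto intro: less_SucI)
 qed
qed simp

lemma convex_abs_le:
 fixes a c x :: real
 assumes "a < c" "a <= x" "x <= c" "abs u <= B" "abs v <= B"
 shows "abs (((c - x) * u + (x - a) * v) / (c - a)) <= B"
 using itp_abs_le[of a c x "%z. if z = a then u else v" B] assms by (simp add: itp_def)

lemma hat_cell:
 assumes p: "strict_mono p" and i: "i < N" and x: "p i <= x" "x <= p (Suc i)"
 shows "(\<Sum>k\<le>N. f k * hat p N k x) = ((p (Suc i) - x) * f i + (x - p i) * f (Suc i)) / (p (Suc i) - p i)"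
proof -
 have le: "p k <= p l" if "k <= l" for k l using strict_mono_less_eq[OF p] that by simp
 have less: "p k < p l" if "k < l" for k l using strict_monoD[OF p] that by simp
 have d: "0 < p (Suc i) - p i" using less[of i "Suc i"] by simp
 have zero: "hat p N k x = 0" if "k ~= i" "k ~= Suc i" for k
 proof (cases "k < i")
  case True
  hence "p k < x" "p (k + 1) <= x" using less[of k i] le[of "k + 1" i] x by simp_all
  thus ?thesis by (auto simp: hat_def)
 next
  case False
  hence k: "Suc i < k" "Suc i <= k - 1" using that by linarith+
  hence "x < p k" "x <= p (k - 1)" using less[OF k(1)] le[OF k(2)] x by linarith+
  thus ?thesis by (auto simp: hat_def)
 qed
 have hi: "hat p N i x = (p (Suc i) - x) / (p (Suc i) - p i)"
 \<comment> \<open>At the node itself the first branch of \<open>hat\<close> applies; its value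
   \<open>1\<close> agrees with the formula for the cell on the right.\<close>
 proof (cases "0 < i \<and> x = p i")
  case True
  thus ?thesis using less[of "i - 1" i] d by (simp add: hat_def)
 next
  case False
  thus ?thesis using x i by (auto simp: hat_def)
 qed
 have hS: "hat p N (Suc i) x = (x - p i) / (p (Suc i) - p i)" using x by (simp add: hat_def)
 have "(\<Sum>k\<le>N. f k * hat p N k x) = (\<Sum>k\<in>{i, Suc i}. f k * hat p N k x)"
  by (rule sum.mono_neutral_right) (use i zero in auto)
 also have "... = f i * ((p (Suc i) - x) / (p (Suc i) - p i)) + f (Suc i) * ((x - p i) / (p (Suc i) - p i))"
  by (simp add: hi hS)
 finally show ?thesis by (simp add: add_divide_distrib mult.commute)
qed

locale scheme = shishkin_mesh e be N M n m + mesh_estimates e be C y yxx yt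
 for e be C :: real and N M n m :: nat and y yxx yt :: "real => real => real" +
 fixes b F :: "real => real => real" and Y :: "nat => nat => real"
 assumes C_ge_1: "1 <= C" and b_ge: "x \<in> Icc ==> t \<in> Icc ==> be <= b x t"
  and y_eq: "x \<in> Ioo ==> t \<in> Ioc ==> e * (yt x t - yxx x t) + b x t * y x t = F x t"
  and Y_eq: "0 < i ==> i < N ==> 0 < j ==> j <= M ==> discrete_L e b p q Y i j = F (p i) (q j)"
  and Y_bd: "i <= N ==> j <= M ==> i = 0 \<or> i = N \<or> j = 0 ==> Y i j = y (p i) (q j)"
begin

text \<open>The sum of the constants of the truncation errors in time, \<open>2 / be + 6\<close>,
  and in space, \<open>64 / be + 4 + 2 * exp 8 + 4 / sqrt be\<close>.\<close>

definition "g = 66 / be + 10 + 2 * exp 8 + 4 / sqrt be"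

lemma C0: "0 <= C" using C_ge_1 by simp

lemma g_parts: "64 / be <= g" "4 + 2 * exp 8 <= g" "6 + 2 / be <= g" "0 <= g"
proof -
 have "0 <= 1 / be" "0 <= 4 / sqrt be" "0 < exp (8::real)" using beta_pos by auto
 moreover have "64 / be = 64 * (1 / be)" "66 / be = 66 * (1 / be)" "2 / be = 2 * (1 / be)" by simp_all
 ultimately show "64 / be <= g" "4 + 2 * exp 8 <= g" "6 + 2 / be <= g" "0 <= g" unfolding g_def by linarith+
qed

lemma p_in: "i <= N ==> p i \<in> Icc" using p_le_iff[of 0 i] p_le_iff[of i N] p_values by simp
lemma q_in: "j <= M ==> q j \<in> Icc" using q_le_iff[of 0 j] q_le_iff[of j M] q_values by simp

lemma h1_eps: "h1^2 / e <= 64 / be * A"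
 using h1_sq eps by (simp add: pos_divide_le_eq mult_ac)

lemma time_truncation:
 assumes x: "x \<in> Ioo" and j: "0 < j" "j <= M"
 shows "e * abs ((y x (q j) - y x (q (j - 1))) / (q j - q (j - 1)) - yt x (q j))
  <= C * (2 / be + 6) * (A * (1 + e / (q j + x^2)))"
proof -
 define t k where "t = q j" and "k = q j - q (j - 1)"
 have k: "0 < k" "k <= t" "t <= 1" using q_less[of "j - 1"] q_in[of "j - 1"] q_in[of j] j by (auto simp: k_def t_def)
 have e: "q (j - 1) = t - k" "q j = t" by (simp_all add: t_def k_def)
 have d: "0 < t + x^2" using k by (intro add_pos_nonneg) auto
 define D where "D = A * (1 + e / (t + x^2))"
 have D: "A <= D" "D = A + A * (e / (t + x^2))" "0 <= D" using A_parts(1) d eps by (auto simp: D_def distrib_left)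
 have "e * abs ((y x t - y x (t - k)) / k - yt x t) <= C * (2 / be + 6) * D"
  using time_step(2)[OF j]
 proof
  assume "q j - q (j - 1) <= 2 / be * (e * A)"
  hence k2: "k <= 2 / be * (e * A)" by (simp add: k_def)
  hence 1: "k / e <= 2 / be * A" using eps by (simp add: pos_divide_le_eq mult_ac)
  have "k / (t + x^2) <= 2 / be * (e * A) / (t + x^2)" using k2 d by (intro divide_right_mono) auto
  hence "k / e + k / (t + x^2) <= 2 / be * A + 2 / be * (e * A) / (t + x^2)" using 1 by linarith
  also have "... = 2 / be * D" unfolding D(2) by (simp add: algebra_simps)
  also have "... <= (2 / be + 6) * D" using D(3) by (intro mult_right_mono) auto
  finally have "C * (k / e + k / (t + x^2)) <= C * ((2 / be + 6) * D)" using C0 by (rule mult_left_mono)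
  thus ?thesis using t_fine[OF x k] by (simp only: mult.assoc; linarith)
 next
  assume il: "il e be (q (j - 1)) <= 2 * A"
  have "k + il e be (t - k) <= 6 * D" using time_step(1)[OF j] il D(1) unfolding e by simp
  also have "... <= (2 / be + 6) * D" using D(3) beta_pos by (intro mult_right_mono) auto
  finally have "C * (k + il e be (t - k)) <= C * ((2 / be + 6) * D)" using C0 by (rule mult_left_mono)
  thus ?thesis using t_coarse[OF x k] by (simp only: mult.assoc; linarith)
 qed
 moreover have "t - (t - k) = k" by simp
 ultimately show ?thesis unfolding e D_def by (simp only:)
qed

text \<open>Each mesh region has its own estimate. On the right fine part only the left layer
  function has to be of order \<open>A\<close>: the right layer is resolved there, and the corner
  function has decayed with the left layer.\<close>

lemma space_truncation:
 assumes i: "0 < i" "i < N" and t: "t \<in> Ioc"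
 shows "e * abs (dd (%x. y x t) (p i) (p i - p (i - 1)) (p (Suc i) - p i) - yxx (p i) t)
  <= C * (64 / be + 4 + 2 * exp 8 + 4 / sqrt be) * (A * (1 + e / (t + (p i)^2) +
   (if s < 1 / 4 \<and> (i = n \<or> i = 3 * n) then e * real N / s else 0)))"
proof -
 define x h h' where "x = p i" and "h = p i - p (i - 1)" and "h' = p (Suc i) - p i"
 define X where "X = (if s < 1 / 4 \<and> (i = n \<or> i = 3 * n) then e * real N / s else 0)"
 define c where "c = 64 / be + 4 + 2 * exp 8 + 4 / sqrt be"
 have c: "64 / be + 2 * exp 8 <= c" "4 + 2 * exp 8 <= c" "4 / sqrt be <= c" "0 <= c" "64 / be <= c" "2 * exp 8 <= c"
  using beta_pos by (auto simp: c_def intro!: add_nonneg_nonneg)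
 have hp: "0 < h" "0 < h'" "h <= x" "x + h' <= 1"
  using p_less[of "i - 1"] p_less[of i] p_in[of "i - 1"] p_in[of "Suc i"] i by (auto simp: h_def h'_def x_def)
 have d: "0 < t + x^2" using t by (intro add_pos_nonneg) auto
 have X0: "0 <= X" using eps s_bounds by (auto simp: X_def)
 define D where "D = A * (1 + e / (t + x^2) + X)"
 have nn: "0 <= A * (e / (t + x^2))" "0 <= A * X" using A_parts(1) d eps X0 by auto
 have D: "D = A + A * (e / (t + x^2)) + A * X" by (simp add: D_def distrib_left)
 hence D0: "A <= D" "0 <= D" "A + A * (e / (t + x^2)) <= D" "A * X <= D" using nn A_parts(1) by linarith+
 have up: "C * w <= C * c * D" if "w <= c * D" for w using mult_left_mono[OF that C0] by (simp only: mult.assoc)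
 have AcD: "a * A <= c * D" if "a <= c" "0 <= a" for a using that D0 c A_parts(1) by (intro mult_mono) auto
 have "e * abs (dd (%x. y x t) x h h' - yxx x t) <= C * c * D"
 proof (cases "i < n \<or> s = 1 / 4")
  case True
  have hh: "h = h1" "h' = h1"
  proof -
   have "p (Suc a) - p a = h1" if "a <= i" for a
   proof (cases "i < n")
    case True
    thus ?thesis using p_Suc(1)[of a] that by simp
   next
    case False
    hence "H = h1" using True H_uniform by simp
    moreover have "Suc a <= n \<or> (n <= a \<and> Suc a <= 3 * n) \<or> 3 * n <= a" by linarith
    ultimately show ?thesis using p_Suc[of a] by metis
   qed
   from this[of i] this[of "i - 1"] i show "h = h1" "h' = h1" by (simp_all add: h_def h'_def)
  qed
  have "h1^2 / (t + x^2) <= 64 / be * (e * A) / (t + x^2)" using h1_sq d by (intro divide_right_mono) auto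
  hence "h1^2 / e + h1^2 / (t + x^2) <= 64 / be * A + 64 / be * (e * A) / (t + x^2)" using h1_eps by linarith
  also have "... = 64 / be * (A + A * (e / (t + x^2)))" by (simp add: algebra_simps)
  also have "... <= c * D" using c D0 nn A_parts(1) beta_pos by (intro mult_mono) auto
  finally have "C * (h1^2 / e + h1^2 / (t + x^2)) <= C * c * D" by (rule up)
  thus ?thesis using x_fine[of h x t] hp t unfolding hh by linarith
 next
  case False
  hence s4: "s < 1 / 4" and ni: "n <= i" using s_bounds by auto
  consider "i = n \<or> i = 3 * n" | "n < i" "i < 3 * n" | "3 * n < i" using ni by linarith
  thus ?thesis
  proof cases
   case 1
   have n3: "n <= 3 * n - 1" "0 < 3 * n" "Suc n <= 3 * n" using N by linarith+
   have hh: "(h = h1 \<and> h' = H) \<or> (h = H \<and> h' = h1)"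
    using 1 n3 p_Suc(1)[of "i - 1"] p_Suc(2)[of i] p_Suc(2)[of "i - 1"] p_Suc(3)[of i] i by (auto simp: h_def h'_def)
   have le: "h <= H" "h' <= H" using hh steps_pos by auto
   \<comment> \<open>A coarse step that starts at one transition point does not pass the
     other.\<close>
   have H_le: "H <= 1 - 2 * s" using s_bounds n_pos unfolding H_def by (simp add: divide_le_eq)
   have ends: "s - h1 <= x - h" "x + h' <= 1 - s + h1"
   proof -
    have "(x = s \<and> h = h1 \<and> h' = H) \<or> (x = 1 - s \<and> h = H \<and> h' = h1)"
     using 1 n3 p_values p_Suc(1)[of "i - 1"] p_Suc(2)[of i] p_Suc(2)[of "i - 1"] p_Suc(3)[of i] i by (auto simp: h_def h'_def x_def)
    thus "s - h1 <= x - h" "x + h' <= 1 - s + h1" using H_le steps_pos by auto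
   qed
   have tr: "e * abs (dd (%x. y x t) x h h' - yxx x t) <= C * (sqrt e * H + 2 * exp 8 * A)"
    by (rule x_transition[OF hp(1,2) le hp(3,4) t]) (rule bl_transition[OF s4], use ends in auto)
   have Xe: "X = e * real N / s" using 1 s4 by (auto simp: X_def)
   have "sqrt e * H + 2 * exp 8 * A <= 4 / sqrt be * (A * X) + 2 * exp 8 * A" using sqrt_eps Xe by simp
   also have "... <= c * (A * X) + c * A"
    using c nn A_parts(1) by (intro add_mono mult_right_mono) auto
   also have "... = c * (A * X + A)" by (simp add: distrib_left)
   also have "... <= c * D" using c D nn by (intro mult_left_mono) auto
   finally have "C * (sqrt e * H + 2 * exp 8 * A) <= C * c * D" by (rule up)
   thus ?thesis using tr by linarith
  next
   case 2
   have hh: "h = H" "h' = H" using 2 p_Suc(2)[of i] p_Suc(2)[of "i - 1"] i by (auto simp: h_def h'_def)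
   have ends: "s - h1 <= x - H" "x + H <= 1 - s + h1"
   proof -
    have "s <= p (i - 1)" "p (Suc i) <= 1 - s" using p_le_iff[of n "i - 1"] p_le_iff[of "Suc i" "3 * n"] 2 p_values by auto
    thus "s - h1 <= x - H" "x + H <= 1 - s + h1" using steps_pos hh by (auto simp: h_def h'_def x_def)
   qed
   have "e * abs (dd (%x. y x t) x H H - yxx x t) <= C * (H^2 + 2 * exp 8 * A)"
    by (rule x_coarse[OF _ _ _ t]) (use hp hh in auto, rule bl_transition[OF s4], use ends in auto)
   moreover have "H^2 + 2 * exp 8 * A <= (4 + 2 * exp 8) * A" using H_bounds(3) by (simp add: distrib_right)
   hence "H^2 + 2 * exp 8 * A <= c * D" using AcD[of "4 + 2 * exp 8"] c by simp
   hence "C * (H^2 + 2 * exp 8 * A) <= C * c * D" by (rule up)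
   ultimately show ?thesis unfolding hh by linarith
  next
   case 3
   have hh: "h = h1" "h' = h1" using 3 p_Suc(3)[of i] p_Suc(3)[of "i - 1"] i by (auto simp: h_def h'_def)
   have "s <= 1 - s" using s_bounds by simp
   moreover have "1 - s <= x - h1"
   proof -
    have "3 * n <= i - 1" using 3 by linarith
    hence "1 - s <= p (i - 1)" using p_le_iff[of "3 * n" "i - 1"] p_values by simp
    moreover have "x - h1 = p (i - 1)" using hh by (simp add: h_def x_def)
    ultimately show ?thesis by simp
   qed
   ultimately have "s - h1 <= x - h1" using steps_pos by linarith
   hence b: "lb e be (x - h1) <= exp 8 * A" by (rule lb_transition[OF s4])
   have "e * abs (dd (%x. y x t) x h1 h1 - yxx x t) <= C * (h1^2 / e + exp 8 * A)"
    by (rule x_right[OF _ _ _ t b]) (use hp hh in auto)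
   moreover have "h1^2 / e + exp 8 * A <= (64 / be + exp 8) * A" using h1_eps by (simp add: distrib_right)
   moreover have "(64 / be + exp 8) * A <= c * D"
    by (rule AcD) (use c(1) exp_gt_zero[of "8::real"] beta_pos in \<open>linarith, auto intro!: add_nonneg_nonneg\<close>)
   ultimately show ?thesis unfolding hh using up[of "h1^2 / e + exp 8 * A"] by linarith
  qed
 qed
 thus ?thesis by (simp only: x_def h_def h'_def c_def D_def X_def)
qed

lemma nodal_error:
 assumes "i <= N" "j <= M"
 shows "abs (Y i j - y (p i) (q j)) <= stab * (C * g * A)"
proof (rule stability[where E="%i j. Y i j - y (p i) (q j)" and b=b, OF b_ge _ _ _ assms])
 show "0 <= C * g" using C0 g_parts by simp
 show "Y i j - y (p i) (q j) = 0" if "i <= N" "j <= M" "i = 0 \<or> i = N \<or> j = 0" for i j using Y_bd[OF that] by simp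
next
 fix i j assume ij: "0 < i" "i < N" "0 < j" "j <= M"
 define x t where "x = p i" and "t = q j"
 have x: "x \<in> Ioo" using p_less_iff[of 0 i] p_less_iff[of i N] p_values ij by (simp add: x_def)
 have t: "t \<in> Ioc" using q_less_iff[of 0 j] q_le_iff[of j M] q_values ij by (simp add: t_def)
 define Dy where "Dy = (y x (q j) - y x (q (j - 1))) / (q j - q (j - 1))"
 define Sy where "Sy = dd (%x. y x t) (p i) (p i - p (i - 1)) (p (Suc i) - p i)"
 have "discrete_L e b p q (%i j. Y i j + - 1 * y (p i) (q j)) i j = F x t + - 1 * (e * Dy - e * Sy + b x t * y x t)"
  unfolding discrete_L_add discrete_L_cmult Y_eq[OF ij]
  using second_diff_dd[OF ij(1), of p "%x. y x t"] by (simp add: discrete_L_def backward_diff_def Dy_def Sy_def x_def t_def)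
 also have "F x t = e * (yt x t - yxx x t) + b x t * y x t" using y_eq[OF x t] by simp
 finally have "discrete_L e b p q (%i j. Y i j - y (p i) (q j)) i j = e * (Sy - yxx x t) - e * (Dy - yt x t)"
  by (simp add: algebra_simps)
 hence "abs (discrete_L e b p q (%i j. Y i j - y (p i) (q j)) i j) <= e * abs (Sy - yxx x t) + e * abs (Dy - yt x t)"
  using abs_triangle_ineq4[of "e * (Sy - yxx x t)" "e * (Dy - yt x t)"] eps by (simp add: abs_mult)
 moreover have "e * abs (Dy - yt x t) <= C * (2 / be + 6) * (A * (1 + e / (t + x^2)))"
  unfolding Dy_def t_def by (rule time_truncation[OF x ij(3,4)])
 moreover have "e * abs (Sy - yxx x t) <= C * (64 / be + 4 + 2 * exp 8 + 4 / sqrt be) * (A * (1 + e / (t + x^2) +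
   (if s < 1 / 4 \<and> (i = n \<or> i = 3 * n) then e * real N / s else 0)))"
  unfolding Sy_def x_def by (rule space_truncation[OF ij(1,2) t])
 moreover
 define X where "X = (if s < 1 / 4 \<and> (i = n \<or> i = 3 * n) then e * real N / s else 0)"
 have "C * (2 / be + 6) * (A * (1 + e / (t + x^2))) <= C * (2 / be + 6) * (A * (1 + e / (t + x^2) + X))"
  using C0 beta_pos A_parts(1) eps s_bounds(1) by (intro mult_left_mono) (auto simp: X_def)
 moreover have "C * (2 / be + 6) * W + C * (64 / be + 4 + 2 * exp 8 + 4 / sqrt be) * W = C * g * W" for W
  by (simp add: g_def algebra_simps add_divide_distrib[symmetric])
 ultimately show "abs (discrete_L e b p q (%i j. Y i j - y (p i) (q j)) i j) <= defect (C * g) i j"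
  unfolding defect_def X_def x_def[symmetric] t_def[symmetric] by (smt (verit))
qed

lemma cell_x:
 assumes i: "i < N" and x: "p i <= x" "x <= p (Suc i)" and t: "t \<in> Icc"
 shows "abs (y x t - itp (%x. y x t) (p i) (p (Suc i)) x) <= C * g * A"
proof -
 have a: "0 <= p i" "p i < p (Suc i)" "p (Suc i) <= 1" "x \<in> {p i..p (Suc i)}" using p_in[of i] p_in[of "Suc i"] p_less[of i] i x by auto
 have up: "C * w <= C * g * A" if "w <= a * A" "a <= g" for w a
 proof -
  have "w <= g * A" using that(1) mult_right_mono[OF that(2) A_parts(1)] by linarith
  thus ?thesis using mult_left_mono[OF _ C0] by (simp only: mult.assoc)
 qed
 show ?thesis
 proof (cases "p (Suc i) - p i = h1")
  case True
  thus ?thesis using itp_fine[OF a t] up[OF h1_eps g_parts(1)] by simp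
 next
  case False
  moreover have "Suc i <= n \<or> (n <= i \<and> Suc i <= 3 * n) \<or> 3 * n <= i" by linarith
  ultimately have ni: "n <= i" "Suc i <= 3 * n" and hH: "p (Suc i) - p i = H" using p_Suc[of i] by auto
  have "s ~= 1 / 4" using H_uniform False hH by auto
  hence s4: "s < 1 / 4" using s_bounds by simp
  have ends: "s <= p i" "p (Suc i) <= 1 - s" using p_le_iff[of n i] p_le_iff[of "Suc i" "3 * n"] ni p_values by auto
  have "abs (y x t - itp (%x. y x t) (p i) (p (Suc i)) x) <= C * ((p (Suc i) - p i)^2 + 2 * exp 8 * A)"
   by (rule itp_coarse[OF a t]) (rule bl_transition[OF s4], use ends steps_pos in auto)
  moreover have "(p (Suc i) - p i)^2 + 2 * exp 8 * A <= (4 + 2 * exp 8) * A" unfolding hH using H_bounds(3) by (simp add: distrib_right)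
  ultimately show ?thesis using up[OF _ g_parts(2)] by force
 qed
qed

text \<open>In time the oscillation over a cell is enough, as only first order is claimed there. The
  alternative of \<open>time_step\<close> decides whether the step or the decayed layer makes it
  small.\<close>

lemma cell_t:
 assumes j: "j < M" and st: "q j <= u" "u < t" "t <= q (Suc j)" and x: "x \<in> Icc"
 shows "abs (y x t - y x u) <= C * g * A"
proof -
 have u: "0 <= u" "t <= 1" using q_in[of j] q_in[of "Suc j"] j st by auto
 define k where "k = q (Suc j) - q j"
 have k: "t - u <= k" "k <= 4 * A" "k <= 2 / be * (e * A) \<or> il e be (q j) <= 2 * A"
  using time_step[of "Suc j"] j st by (auto simp: k_def)
 have il: "0 < il e be u" "il e be u <= 1" "il e be u <= il e be (q j)"
  using il_pos il_le_1[OF eps(1) beta_pos u(1)] il_mono[OF eps(1) beta_pos st(1)] by auto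
 have "min 1 ((t - u) / e) * il e be u <= (2 + 2 / be) * A"
  using k(3)
 proof
  assume "k <= 2 / be * (e * A)"
  hence "(t - u) / e <= 2 / be * A" using k(1) eps by (simp add: pos_divide_le_eq mult_ac)
  hence "min 1 ((t - u) / e) <= 2 / be * A" by simp
  hence "min 1 ((t - u) / e) * il e be u <= (2 / be * A) * 1" using il A_parts(1) beta_pos by (intro mult_mono) auto
  thus ?thesis using A_parts(1) by (simp add: distrib_right)
 next
  assume "il e be (q j) <= 2 * A"
  hence "min 1 ((t - u) / e) * il e be u <= 1 * (2 * A)" using il by (intro mult_mono) auto
  moreover have "0 <= 2 / be * A" using A_parts(1) beta_pos by simp
  ultimately show ?thesis by (simp only: distrib_right; linarith)
 qed
 hence "(t - u) + min 1 ((t - u) / e) * il e be u <= 4 * A + (2 + 2 / be) * A" using k by linarith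
 also have "... = (6 + 2 / be) * A" by (simp add: algebra_simps)
 also have "... <= g * A" by (rule mult_right_mono[OF g_parts(3) A_parts(1)])
 finally have "C * ((t - u) + min 1 ((t - u) / e) * il e be u) <= C * (g * A)" using C0 by (rule mult_left_mono)
 thus ?thesis using t_diff[OF x u(1) st(2) u(2)] by (simp only: mult.assoc; linarith)
qed

text \<open>Interpolation in time at the two neighbouring abscissae, then in space. The weights are
  convex, so the nodal error passes through unchanged, and each direction adds one interpolation
  error: hence \<open>2 + stab\<close>.\<close>

theorem interpolation_error:
 assumes x: "x \<in> Icc" and t: "t \<in> Icc"
 shows "abs (y x t - bilinear_interpolant p N q M Y x t) <= (2 + stab) * C * g * A"
proof -
 have N0: "0 < N" and M0: "0 < M" using N M by auto
 obtain i where i: "i < N" "p i <= x" "x <= p (Suc i)" using mesh_cell[of p x N] p_values x N0 by auto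
 obtain j where j: "j < M" "q j <= t" "t <= q (Suc j)" using mesh_cell[of q t M] q_values t M0 by auto
 define B where "B = C * g * A"
 have B: "0 <= B" using C0 g_parts(4) A_parts(1) by (simp add: B_def)
 define U where "U = (%k. ((q (Suc j) - t) * Y k j + (t - q j) * Y k (Suc j)) / (q (Suc j) - q j))"
 have dq: "q j < q (Suc j)" and dp: "p i < p (Suc i)" by (rule q_less p_less)+
 have U: "(\<Sum>l\<le>M. Y k l * hat q M l t) = U k" for k unfolding U_def by (rule hat_cell[OF q_strict j])
 have "bilinear_interpolant p N q M Y x t = (\<Sum>k\<le>N. (\<Sum>l\<le>M. Y k l * hat q M l t) * hat p N k x)"
  unfolding bilinear_interpolant_def sum_distrib_right by (intro sum.cong refl) (simp add: mult_ac)
 also have "... = ((p (Suc i) - x) * U i + (x - p i) * U (Suc i)) / (p (Suc i) - p i)"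
  unfolding U by (rule hat_cell[OF p_strict i])
 finally have bil: "bilinear_interpolant p N q M Y x t = ((p (Suc i) - x) * U i + (x - p i) * U (Suc i)) / (p (Suc i) - p i)" .
 have Uy: "abs (y (p k) t - U k) <= B + stab * B" if k: "k <= N" for k
 proof -
  have "abs (y (p k) t - y (p k) (q l)) <= B" if "l = j \<or> l = Suc j" for l
  proof (cases "q l = t")
   case False
   hence "(q l < t \<and> l = j) \<or> (t < q l \<and> l = Suc j)" using that j by auto
   then consider "q l < t" "l = j" | "t < q l" "l = Suc j" by blast
   thus ?thesis
   proof cases
    case 1
    thus ?thesis unfolding B_def using j by (intro cell_t[OF j(1)] p_in[OF k]) auto
   next
    case 2
    have "abs (y (p k) (q l) - y (p k) t) <= B" unfolding B_def using j 2 by (intro cell_t[OF j(1)] p_in[OF k]) auto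
    thus ?thesis by (simp add: abs_minus_commute)
   qed
  qed (use B in simp)
  moreover have "abs (Y k l - y (p k) (q l)) <= stab * B" if "l = j \<or> l = Suc j" for l
   unfolding B_def by (rule nodal_error[OF k]) (use that j in auto)
  ultimately have n: "abs (y (p k) t - Y k l) <= B + stab * B" if "l = j \<or> l = Suc j" for l using that by (smt (verit))
  have "y (p k) t - U k = ((q (Suc j) - t) * (y (p k) t - Y k j) + (t - q j) * (y (p k) t - Y k (Suc j))) / (q (Suc j) - q j)"
   unfolding U_def using dq by (simp add: field_simps)
  thus ?thesis using convex_abs_le[OF dq j(2,3) n n] by simp
 qed
 have "itp (%x. y x t) (p i) (p (Suc i)) x - bilinear_interpolant p N q M Y x t
  = ((p (Suc i) - x) * (y (p i) t - U i) + (x - p i) * (y (p (Suc i)) t - U (Suc i))) / (p (Suc i) - p i)"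
  unfolding bil itp_def by (simp add: diff_divide_distrib[symmetric] algebra_simps)
 hence "abs (itp (%x. y x t) (p i) (p (Suc i)) x - bilinear_interpolant p N q M Y x t) <= B + stab * B"
  using convex_abs_le[OF dp i(2,3) Uy[of i] Uy[of "Suc i"]] i(1) by simp
 moreover have "abs (y x t - itp (%x. y x t) (p i) (p (Suc i)) x) <= B" unfolding B_def by (rule cell_x[OF i t])
 ultimately have "abs (y x t - bilinear_interpolant p N q M Y x t) <= 2 * B + stab * B" by linarith
 thus ?thesis by (simp add: B_def distrib_right mult.assoc)
qed

text \<open>From \<open>1 / 2 \<le> ln (real M)\<close> follows
  \<open>ln (real M) \<le> 2 * (ln (real M))^2\<close>, which accounts for the factor
  \<open>2\<close>.\<close>

lemma interpolation_error_rate: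
 assumes "x \<in> Icc" "t \<in> Icc"
 shows "abs (y x t - bilinear_interpolant p N q M Y x t)
  <= 2 * ((2 + stab) * C * g) * (max ((ln (real N))^2) (ln (real M)) / (real N)^2 + (ln (real M))^2 / real M)"
proof -
 define R where "R = max ((ln (real N))^2) (ln (real M)) / (real N)^2 + (ln (real M))^2 / real M"
 have "0 <= (1 + be / 4) / be" using beta_pos by (intro divide_nonneg_pos) auto
 hence c: "0 <= (2 + stab) * C * g" using C0 g_parts(4) by (intro mult_nonneg_nonneg) (auto simp: stab_def)
 have M0: "0 < real M" using n_pos Nr by simp
 have "ln (real M) * 1 <= ln (real M) * (2 * ln (real M))" using ln_M by (intro mult_left_mono) auto
 hence "ln (real M) / real M <= 2 * (ln (real M))^2 / real M"
  using M0 by (intro divide_right_mono) (auto simp: power2_eq_square)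
 moreover have "(ln (real N))^2 / (real N)^2 <= max ((ln (real N))^2) (ln (real M)) / (real N)^2"
  by (intro divide_right_mono) auto
 moreover have "0 <= max ((ln (real N))^2) (ln (real M)) / (real N)^2" by (intro divide_nonneg_nonneg) (auto simp: le_max_iff_disj)
 ultimately have "A <= 2 * R" unfolding A_def R_def by simp
 hence "(2 + stab) * C * g * A <= (2 + stab) * C * g * (2 * R)" using c by (rule mult_left_mono)
 also have "... = 2 * ((2 + stab) * C * g) * R" by (simp only: mult_ac)
 finally show ?thesis using interpolation_error[OF assms] unfolding R_def by linarith
qed

end

theorem corollary1:
  fixes f b :: "real \<Rightarrow> real \<Rightarrow> real" and gL gR \<phi> :: "real \<Rightarrow> real" and \<beta> \<gamma> :: real
  assumes "\<gamma> > 0"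
    and "holder_class 4 \<gamma> f" and "holder_class 4 \<gamma> b"
    and "C_class 2 gL" and "C_class 2 gR" and "C_class 4 \<phi>"
    and "\<beta> > 0" and "\<forall>(x, t)\<in>Qbar. b x t > \<beta>"
    and "Dx b 0 0 = 0"
    and "\<phi> 0 \<noteq> gL 0" and "\<phi> 1 = gR 0"
  shows "\<exists>C::real. \<forall>\<epsilon> N M y Y.
    0 < \<epsilon> \<and> \<epsilon> \<le> 1 \<and> compatible \<epsilon> f b gR \<phi> \<and>
    N > 0 \<and> 4 dvd N \<and> M > 0 \<and> even M \<and>
    solves_Y \<epsilon> f b gL gR \<phi> y \<and>
    solves_D \<epsilon> f b gL \<phi> \<beta> N M y Y \<longrightarrow>
      (SUP (x, t)\<in>Qbar.
         \<bar>y x t - bilinear_interpolant (xmesh \<epsilon> \<beta> N) N (tmesh \<epsilon> \<beta> M) M Y x t\<bar>)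
      \<le> C * (max ((ln (real N))\<^sup>2) (ln (real M)) / (real N)\<^sup>2
               + (ln (real M))\<^sup>2 / real M)"
proof -
 obtain Kf where Kf: "smooth_data Kf f" using holder_class_smooth(1)[OF assms(2,1)] by blast
 obtain Kb where Kb: "smooth_data Kb b" using holder_class_smooth(1)[OF assms(3,1)] by blast
 note fC = holder_class_smooth(2,3)[OF assms(2,1)] and bC = holder_class_smooth(2,3)[OF assms(3,1)]
 have b_gt: "\<beta> < b x t" if "x \<in> Icc" "t \<in> Icc" for x t using assms(8) that by (auto simp: Qbar_def)
 \<comment> \<open>\<open>b\<close> attains its minimum on the compact domain, and the strict
   inequality there leaves the margin \<open>\<delta>\<close>.\<close>
 obtain z where z: "z \<in> Icc \<times> {0..1::real}" "!!w. w \<in> Icc \<times> {0..1::real} ==> (case z of (x,t) => b x t) <= (case w of (x,t) => b x t)"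
  using continuous_attains_inf[OF compact_Times[OF compact_Icc compact_Icc] _ bC(2)] by (metis Times_empty atLeastatMost_empty_iff2 zero_less_one_class.zero_le_one)
 define \<delta> where "\<delta> = (case z of (x,t) => b x t) - \<beta>"
 have \<delta>: "0 < \<delta>" using z(1) b_gt by (auto simp: \<delta>_def)
 have b_ge: "\<beta> + \<delta> <= b x t" if "x \<in> Icc" "t \<in> Icc" for x t using z(2)[of "(x, t)"] that by (simp add: \<delta>_def)
 have b0: "b x 0 ~= 0" if "x \<in> Icc" for x using b_gt[of x 0] assms(7) that by auto
 have "Ck 4 (%x. f x 0 * inverse (b x 0))" by (intro Ck_mult Ck_inverse fC bC b0)
 then obtain wd where wd: "wd 0 = (%x. f x 0 / b x 0)" "dfam 4 wd" using Ck_dfam unfolding divide_inverse by blast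
 obtain cd where cd: "cd 0 = (%x. b x 0)" "dfam 4 cd" using Ck_dfam[OF bC(1)] by blast
 interpret problem_data \<beta> \<delta> Kf Kb f b "%i. (D ^^ i) gL" "%i. (D ^^ i) gR" "%i. (D ^^ i) \<phi>" wd cd
  by unfold_locales (use assms(7,9,11) \<delta> b_ge Kf Kb fC bC wd cd C_class_dfam[OF assms(4)] C_class_dfam[OF assms(5)] C_class_dfam[OF assms(6)] in auto)
 obtain C where C: "1 <= C" "!!e y yx yxx yt. solution \<beta> \<delta> Kf Kb f b (%i. (D ^^ i) gL) (%i. (D ^^ i) gR) (%i. (D ^^ i) \<phi>) wd cd e y yx yxx yt
   ==> mesh_estimates e \<beta> C y yxx yt"
  using solution_estimates by blast
 show ?thesis
 \<comment> \<open>Outside their locales \<open>stab\<close> and \<open>g\<close> depend on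
   \<open>\<beta>\<close> alone, so the witness can be named before \<open>e\<close>,
   \<open>N\<close> and \<open>M\<close> are fixed.\<close>
 proof (intro exI[of _ "2 * ((2 + shishkin_mesh.stab \<beta>) * C * scheme.g \<beta>)"] allI impI)
  fix e N M y Y
  assume a: "0 < e \<and> e <= 1 \<and> compatible e f b gR \<phi> \<and> N > 0 \<and> 4 dvd N \<and> M > 0 \<and> even M \<and>
   solves_Y e f b gL gR \<phi> y \<and> solves_D e f b gL \<phi> \<beta> N M y Y"
  hence eps: "0 < e" "e <= 1" and comp: "compatible e f b gR \<phi>" and sY: "solves_Y e f b gL gR \<phi> y"
   and sD: "solves_D e f b gL \<phi> \<beta> N M y Y" by auto
  obtain n where n: "N = 4 * n" using a by (auto elim: dvdE)
  obtain m where m: "M = 2 * m" using a by (auto elim: evenE)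
  have nm: "0 < n" "0 < m" using a n m by auto
  have int: "x \<in> Icc" "t \<in> Icc" if "x \<in> Ioo" "t \<in> Ioc" for x t :: real using that by auto
  have yd: "t_differentiable y x t" "x_differentiable y x t" "x_differentiable (Dx y) x t" "L e b y x t = rhs e f b gL \<phi> x t"
   if "x \<in> Ioo" "t \<in> Ioc" for x t
   using sY that unfolding solves_Y_def Q_def by blast+
  have a0: "A0 gL \<phi> = a0" by (simp add: A0_def a0_def)
  have ew: "z0 e (b 0 0) x t = ew e t * hE x t" for x t by (simp add: z0_eq ew_def)
  have sol: "solution \<beta> \<delta> Kf Kb f b (%i. (D ^^ i) gL) (%i. (D ^^ i) gR) (%i. (D ^^ i) \<phi>) wd cd e y (Dx y) (Dx (Dx y)) (Dt y)"
  proof unfold_locales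
   show "0 < e" "e <= 1" by (fact eps)+
   show "continuous_on (Icc \<times> Icc) (%(x,t). y x t)" using sY by (simp add: solves_Y_def Qbar_def)
   show "heat_deriv 1 y (Dx y) (Dx (Dx y)) (Dt y)" unfolding heat_deriv_def
   proof (intro ballI conjI)
    fix x t :: real assume x: "x \<in> Ioo" and t: "t \<in> Ioc"
    have within: "at x within Icc = at x" using x by (simp add: at_within_Icc_at)
    show "DERIV (%s. y s t) x :> Dx y x t" "DERIV (%s. Dx y s t) x :> Dx (Dx y) x t"
     using differentiable_D[OF yd(2)[OF x t, unfolded x_differentiable_def]] differentiable_D[OF yd(3)[OF x t, unfolded x_differentiable_def]]
     unfolding within Dx_def by auto
    have "((%s. y x s) has_real_derivative Dt y x t) (at t within Icc)"
     using differentiable_D[OF yd(1)[OF x t, unfolded t_differentiable_def]] unfolding Dt_def .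
    thus "((%s. y x s) has_real_derivative Dt y x t) (at_left t)" by (rule left_deriv_within[OF _ t])
   qed
   show "e * (Dt y x t - Dx (Dx y) x t) + b x t * y x t = f x t - a0 * (b x t - b 0 0) * (ew e t * hE x t)"
    if "x \<in> Ioo" "t \<in> Ioc" for x t
    using yd(4)[OF that] unfolding L_def rhs_def a0 ew .
   show "y 0 t = (D ^^ 0) gL t - a0 * ew e t" if "t \<in> Icc" for t
    using sY that unfolding solves_Y_def a0 by (simp add: ew_def)
   show "y 1 t = (D ^^ 0) gR t - a0 * (ew e t * hE 1 t)" if "t \<in> Icc" for t
    using sY that unfolding solves_Y_def a0 ew by simp
   show "y x 0 = (D ^^ 0) \<phi> x" if "x \<in> Ioo" for x using sY that unfolding solves_Y_def by simp
   show "e * ((D ^^ Suc 0) gR 0 - (D ^^ 2) \<phi> 1) + b 1 0 * (D ^^ 0) gR 0 = f 1 0"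
    using comp by (simp add: compatible_def)
  qed
  have me: "mesh_estimates e \<beta> C y (Dx (Dx y)) (Dt y)" by (rule C(2)[OF sol])
  interpret sm: shishkin_mesh e \<beta> N M n m by unfold_locales (fact eps assms(7) n m nm)+
  have dis: "if (xmesh e \<beta> N i, tmesh e \<beta> M j) \<in> Q
    then discrete_L e b (xmesh e \<beta> N) (tmesh e \<beta> M) Y i j = rhs e f b gL \<phi> (xmesh e \<beta> N i) (tmesh e \<beta> M j)
    else Y i j = y (xmesh e \<beta> N i) (tmesh e \<beta> M j)" if "i <= N" "j <= M" for i j
   using sD that unfolding solves_D_def Let_def by blast
  have inQ: "(xmesh e \<beta> N i, tmesh e \<beta> M j) \<in> Q \<longleftrightarrow> 0 < i \<and> i < N \<and> 0 < j \<and> j <= M" for i j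
   using sm.p_less_iff[of 0 i] sm.p_less_iff[of i N] sm.q_less_iff[of 0 j] sm.q_le_iff[of j M] sm.p_values sm.q_values
   by (auto simp: Q_def)
  have "scheme e \<beta> C N M n m y (Dx (Dx y)) (Dt y) b (rhs e f b gL \<phi>) Y"
  proof (intro scheme.intro scheme_axioms.intro sm.shishkin_mesh_axioms me)
   show "1 <= C" by (fact C(1))
   show "\<beta> <= b x t" if "x \<in> Icc" "t \<in> Icc" for x t using b_gt[OF that] by simp
   show "e * (Dt y x t - Dx (Dx y) x t) + b x t * y x t = rhs e f b gL \<phi> x t" if "x \<in> Ioo" "t \<in> Ioc" for x t
    using yd(4)[OF that] unfolding L_def .
   show "discrete_L e b (xmesh e \<beta> N) (tmesh e \<beta> M) Y i j = rhs e f b gL \<phi> (xmesh e \<beta> N i) (tmesh e \<beta> M j)"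
    if "0 < i" "i < N" "0 < j" "j <= M" for i j
    using dis[of i j] inQ[of i j] that by simp
   show "Y i j = y (xmesh e \<beta> N i) (tmesh e \<beta> M j)" if "i <= N" "j <= M" "i = 0 \<or> i = N \<or> j = 0" for i j
    using dis[OF that(1,2)] inQ[of i j] that(3) by auto
  qed
  then interpret sc: scheme e \<beta> C N M n m y "Dx (Dx y)" "Dt y" b "rhs e f b gL \<phi>" Y .
  show "(SUP (x, t)\<in>Qbar. abs (y x t - bilinear_interpolant (xmesh e \<beta> N) N (tmesh e \<beta> M) M Y x t))
   <= 2 * ((2 + shishkin_mesh.stab \<beta>) * C * scheme.g \<beta>) * (max ((ln (real N))^2) (ln (real M)) / (real N)^2 + (ln (real M))^2 / real M)"
  proof (rule cSUP_least)
   show "Qbar ~= {}" by (auto simp: Qbar_def)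
   fix w assume "w \<in> Qbar"
   then obtain x t where w: "w = (x, t)" "x \<in> Icc" "t \<in> Icc" by (auto simp: Qbar_def)
   show "(case w of (x, t) => (abs (y x t - bilinear_interpolant (xmesh e \<beta> N) N (tmesh e \<beta> M) M Y x t)))
    <= 2 * ((2 + shishkin_mesh.stab \<beta>) * C * scheme.g \<beta>) * (max ((ln (real N))^2) (ln (real M)) / (real N)^2 + (ln (real M))^2 / real M)"
    using sc.interpolation_error_rate[OF w(2,3)] by (simp add: w(1))
  qed
 qed
qed

end
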